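(* If a pair $$(v,k)\in L_{\alpha+1,\mathrm{loc}}\bigl((0,\infty);W^3_{\alpha+1,B}(\Omega)\bigr)\times L_{\frac{\alpha+1}{\alpha},\mathrm{loc}}\bigl((0,\infty)\times\Omega\bigr)\quad\text{with}\quad\partial_tv\in L_{\frac{\alpha+1}{\alpha},\mathrm{loc}}\bigl((0,\infty);(W^1_{\alpha+1,B}(\Omega))'\bigr)$$ satisfies the continuity equation $$\begin{cases}\partial_tv+\partial_xk=0,&t>0,\ x\in\Omega,\\ \partial_xv=k=0,&t>0,\ x\in\partial\Omega,\end{cases}$$ in the sense that $$\int_0^\infty\langle\partial_tv,\phi\rangle_{W^1_{\alpha+1}}\,dt-\int_0^\infty\int_\Omega k\,\partial_x\phi\,dx\,dt=0$$ for all $\phi\in L_{\alpha+1}\bigl([0,\infty);W^1_{\alpha+1}(\Omega)\bigr)$ compactly supported in time, then $$E^\sigma[v](t)+\tfrac{\alpha}{\alpha+1}\int_s^t\int_\Omega\frac{|k|^{\frac{\alpha+1}{\alpha}}}{m(v)^{\frac1\alpha}}\,dx\,d\tau+\tfrac1{\alpha+1}\int_s^t\int_\Omega m(v)\bigl|\partial_x^3v-G_\sigma''(v)\partial_xv\bigr|^{\alpha+1}\,dx\,d\tau\ \ge\ E^\sigma[v](s)$$ holds for all $0\le s<t<\infty$. Moreover, provided that $E^\sigma[v_0]<\infty$, equality holds if and only if $v$ is a weak solution to the modified thin-film equation $$\begin{cases}\partial_tv+\partial_x\bigl(m(v)\Psi(\partial_x^3v-G_\sigma''(v)\partial_xv)\bigr)=0,&t>0,\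 x\in\Omega,\\ \partial_xv=\partial_x^3v-G_\sigma''(v)\partial_xv=0,&t>0,\ x\in\partial\Omega,\end{cases}$$ in the sense that $v$ satisfies $$\int_0^\infty\langle\partial_tv,\phi\rangle_{W^1_{\alpha+1}}\,dt-\int_0^\infty\int_\Omega m(v)\Psi\bigl(\partial_x^3v-G_\sigma''(v)\partial_xv\bigr)\partial_x\phi\,dx\,dt=0$$ for all $\phi\in L_{\alpha+1}\bigl([0,\infty);W^1_{\alpha+1}(\Omega)\bigr)$ with compact support in time.
   Context: $\Omega\subset\mathbb R$ is a bounded open interval, $\alpha>0$, $\Psi(s)=|s|^{\alpha-1}s$. The mobility $m:\mathbb R\to[0,\infty)$ is locally Lipschitz continuous with $m(s)=0$ for $s\le0$ and $m(s)>0$ for $s>0$. The potential $G:\mathbb R\to[0,\infty]$ satisfies $G\in C^2((0,\infty))$, $G$ convex on $(0,\infty)$, $G\ge0$, $G$ continuous at $0$. Fix $\sigma\in(0,1)$; the modified potential $G_\sigma:\mathbb R\to[0,\infty]$ satisfies $G_\sigma\in C^2((0,\infty))$, $G_\sigma$ convex on $\mathbb R_+$, $G_\sigma\ge0$, $G_\sigma(s)=+\infty$ for $s<0$, $G_\sigma(s)\ge c_0s^{-2}$ for $0\le s\le\sigma$ with some $c_0>0$ (with $0^{-2}=+\infty$), and $G_\sigma(s)=G(s)$ for $s\ge2\sigma$. The energy is $E^\sigma[u]=\int_\Omega\tfrac12|\partial_xu|^2+G_\sigma(u)\,dx$; $E^\sigma[v](t)$ denotes the energy of $v(t,\cdot)$,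 and $v_0=v(0,\cdot)$ is the initial value of $v$. $W^k_p(\Omega)$ are the usual Sobolev spaces; $W^3_{p,B}(\Omega)=\{w\in W^3_p(\Omega):w_x=0\text{ on }\partial\Omega\}$ and $W^1_{p,B}(\Omega)=W^1_p(\Omega)$; $\langle\cdot,\cdot\rangle_{W^1_{\alpha+1}}$ is the duality pairing of $(W^1_{\alpha+1}(\Omega))'$ and $W^1_{\alpha+1}(\Omega)$. The subscript $\mathrm{loc}$ means local integrability in time. *)

theory Defs
  imports "HOL-Analysis.Analysis"
begin

section \<open>Lebesgue and Sobolev spaces\<close>

text \<open>Elements of these spaces are represented by functions that are total on the ambient type;
  values outside the set \<open>S\<close> are irrelevant, and two functions that agree almost everywhere on
  \<open>S\<close> represent the same element. The norms are seminorms on representatives.\<close>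

definition Lp_space :: "real \<Rightarrow> 'a::euclidean_space set \<Rightarrow> ('a \<Rightarrow> real) set" where
  "Lp_space p S = {f. f \<in> borel_measurable (lebesgue_on S) \<and>
                      integrable (lebesgue_on S) (\<lambda>x. \<bar>f x\<bar> powr p)}"

definition Lp_norm :: "real \<Rightarrow> 'a::euclidean_space set \<Rightarrow> ('a \<Rightarrow> real) \<Rightarrow> real" where
  "Lp_norm p S f = (LINT x|lebesgue_on S. \<bar>f x\<bar> powr p) powr (1 / p)"

definition test_fun :: "real set \<Rightarrow> (real \<Rightarrow> real) \<Rightarrow> bool" where
  "test_fun S \<phi> \<longleftrightarrow> (\<forall>n x. (deriv ^^ n) \<phi> differentiable (at x)) \<and>
                   (\<exists>K. compact K \<and> K \<subseteq> S \<and> (\<forall>x. x \<notin> K \<longrightarrow> \<phi> x = 0))"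

definition locally_integrable :: "real set \<Rightarrow> (real \<Rightarrow> real) \<Rightarrow> bool" where
  "locally_integrable S f \<longleftrightarrow> (\<forall>K. compact K \<and> K \<subseteq> S \<longrightarrow> set_integrable lebesgue K f)"

definition has_weak_deriv :: "real set \<Rightarrow> nat \<Rightarrow> (real \<Rightarrow> real) \<Rightarrow> (real \<Rightarrow> real) \<Rightarrow> bool" where
  "has_weak_deriv S j f g \<longleftrightarrow> locally_integrable S f \<and> locally_integrable S g \<and>
     (\<forall>\<phi>. test_fun S \<phi> \<longrightarrow>
        (LINT x:S|lebesgue. f x * (deriv ^^ j) \<phi> x) = (-1) ^ j * (LINT x:S|lebesgue. g x * \<phi> x))"

text \<open>A representative of the weak derivative of order \<open>j\<close>, unique almost everywhere on an open
  set \<open>S\<close> whenever it exists, and arbitrary otherwise.\<close>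

definition wderiv :: "real set \<Rightarrow> nat \<Rightarrow> (real \<Rightarrow> real) \<Rightarrow> real \<Rightarrow> real" where
  "wderiv S j f = (SOME g. has_weak_deriv S j f g)"

definition sobolev :: "nat \<Rightarrow> real \<Rightarrow> real set \<Rightarrow> (real \<Rightarrow> real) set" where
  "sobolev k p S = {f \<in> Lp_space p S. \<forall>j\<le>k. \<exists>g \<in> Lp_space p S. has_weak_deriv S j f g}"

definition sobolev_norm :: "nat \<Rightarrow> real \<Rightarrow> real set \<Rightarrow> (real \<Rightarrow> real) \<Rightarrow> real" where
  "sobolev_norm k p S f = (\<Sum>j\<le>k. LINT x|lebesgue_on S. \<bar>wderiv S j f x\<bar> powr p) powr (1 / p)"

text \<open>Boundary values are those of the representative that is continuous up to the boundary.\<close>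

definition zero_on_boundary :: "real set \<Rightarrow> (real \<Rightarrow> real) \<Rightarrow> bool" where
  "zero_on_boundary S f \<longleftrightarrow>
     (\<exists>g. continuous_on (closure S) g \<and> (AE x in lebesgue_on S. g x = f x) \<and>
          (\<forall>x\<in>frontier S. g x = 0))"

definition sobolev3_B :: "real \<Rightarrow> real set \<Rightarrow> (real \<Rightarrow> real) set" where
  "sobolev3_B p S = {w \<in> sobolev 3 p S. zero_on_boundary S (wderiv S 1 w)}"

section \<open>Dual spaces and Bochner spaces\<close>

text \<open>A normed space of real-valued functions is given by a carrier \<open>X\<close> and a (semi)norm \<open>N\<close>.
  Functionals are functions on all representatives, only their values on \<open>X\<close> matter; the bound
  forces them to respect almost everywhere equality.\<close>

definition dual_space ::
  "('a \<Rightarrow> real) set \<Rightarrow> (('a \<Rightarrow> real) \<Rightarrow> real) \<Rightarrow> (('a \<Rightarrow> real) \<Rightarrow> real) set" where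
  "dual_space X N =
     {F. (\<forall>f\<in>X. \<forall>g\<in>X. \<forall>c d. F (\<lambda>x. c * f x + d * g x) = c * F f + d * F g) \<and>
         (\<exists>C. \<forall>f\<in>X. \<bar>F f\<bar> \<le> C * N f)}"

definition dual_norm ::
  "('a \<Rightarrow> real) set \<Rightarrow> (('a \<Rightarrow> real) \<Rightarrow> real) \<Rightarrow> (('a \<Rightarrow> real) \<Rightarrow> real) \<Rightarrow> real" where
  "dual_norm X N F = Sup {\<bar>F f\<bar> | f. f \<in> X \<and> N f \<le> 1}"

definition strongly_measurable ::
  "real set \<Rightarrow> ('a \<Rightarrow> real) set \<Rightarrow> (('a \<Rightarrow> real) \<Rightarrow> real) \<Rightarrow> (real \<Rightarrow> 'a \<Rightarrow> real) \<Rightarrow> bool" where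
  "strongly_measurable I X N u \<longleftrightarrow>
     (\<exists>s :: nat \<Rightarrow> real \<Rightarrow> 'a \<Rightarrow> real.
        (\<forall>n. simple_function (lebesgue_on I) (s n) \<and> s n ` I \<subseteq> X) \<and>
        (AE t in lebesgue_on I. u t \<in> X \<and> (\<lambda>n. N (\<lambda>x. u t x - s n t x)) \<longlonglongrightarrow> 0))"

definition bochner_Lp ::
  "real \<Rightarrow> real set \<Rightarrow> ('a \<Rightarrow> real) set \<Rightarrow> (('a \<Rightarrow> real) \<Rightarrow> real) \<Rightarrow> (real \<Rightarrow> 'a \<Rightarrow> real) set" where
  "bochner_Lp p I X N =
     {u. strongly_measurable I X N u \<and> integrable (lebesgue_on I) (\<lambda>t. N (u t) powr p)}"

text \<open>Local integrability in time is understood up to the initial time, that is, integrability on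
  \<open>(0,T)\<close> for every finite \<open>T\<close>; this is what gives meaning to the initial value and to the time
  integrals against test functions that do not vanish near \<open>t = 0\<close>.\<close>

definition bochner_Lp_loc ::
  "real \<Rightarrow> ('a \<Rightarrow> real) set \<Rightarrow> (('a \<Rightarrow> real) \<Rightarrow> real) \<Rightarrow> (real \<Rightarrow> 'a \<Rightarrow> real) set" where
  "bochner_Lp_loc p X N = {u. \<forall>T>0. u \<in> bochner_Lp p {0<..<T} X N}"

definition Lp_loc_time :: "real \<Rightarrow> real set \<Rightarrow> (real \<Rightarrow> real \<Rightarrow> real) set" where
  "Lp_loc_time p S = {k. \<forall>T>0. (\<lambda>(t, x). k t x) \<in> Lp_space p ({0<..<T} \<times> S)}"

text \<open>\<open>vt\<close> is the distributional time derivative of \<open>v\<close> with values in the dual of \<open>W\<^sup>1\<^sub>p(S)\<close>,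
  into which functions on \<open>S\<close> are embedded through the \<open>L\<^sub>2\<close> pairing.\<close>

definition has_weak_time_deriv ::
  "real \<Rightarrow> real set \<Rightarrow> (real \<Rightarrow> real \<Rightarrow> real) \<Rightarrow> (real \<Rightarrow> (real \<Rightarrow> real) \<Rightarrow> real) \<Rightarrow> bool" where
  "has_weak_time_deriv p S v vt \<longleftrightarrow>
     (\<forall>\<eta> \<psi>. test_fun {0<..} \<eta> \<and> \<psi> \<in> sobolev 1 p S \<longrightarrow>
        (LINT t:{0<..}|lebesgue. deriv \<eta> t * (LINT x:S|lebesgue. v t x * \<psi> x)) =
        - (LINT t:{0<..}|lebesgue. \<eta> t * vt t \<psi>))"

text \<open>Selects the representative of \<open>v\<close> in \<open>C([0,\<infinity>); L\<^sub>2(S))\<close>, so that \<open>v t\<close> is meaningful for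
  every \<open>t \<ge> 0\<close> rather than almost every \<open>t\<close>. For a bounded interval \<open>S\<close> and \<open>p > 1\<close> such a
  representative exists, by the evolution triple of \<open>W\<^sup>1\<^sub>p(S)\<close>, \<open>L\<^sub>2(S)\<close> and the dual of \<open>W\<^sup>1\<^sub>p(S)\<close>,
  whenever \<open>v\<close> is locally in \<open>L\<^sub>p\<close> with values in \<open>W\<^sup>1\<^sub>p(S)\<close> and its time derivative is locally in
  \<open>L\<^sub>q\<close>, \<open>1/p + 1/q = 1\<close>, with values in the dual.\<close>

definition L2_continuous :: "real set \<Rightarrow> (real \<Rightarrow> real \<Rightarrow> real) \<Rightarrow> bool" where
  "L2_continuous S v \<longleftrightarrow>
     (\<forall>t\<ge>0. v t \<in> Lp_space 2 S \<and>
        ((\<lambda>s. Lp_norm 2 S (\<lambda>x. v s x - v t x)) \<longlongrightarrow> 0) (at t within {0..}))"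

section \<open>Mobility, potentials and energy\<close>

definition Psi :: "real \<Rightarrow> real \<Rightarrow> real" where
  "Psi \<alpha> s = \<bar>s\<bar> powr (\<alpha> - 1) * s"

definition mobility :: "(real \<Rightarrow> real) \<Rightarrow> bool" where
  "mobility m \<longleftrightarrow>
     (\<forall>s. \<exists>r>0. \<exists>L. L-lipschitz_on (cball s r) m) \<and>
     (\<forall>s\<le>0. m s = 0) \<and> (\<forall>s>0. m s > 0)"

definition C2_on_pos :: "(real \<Rightarrow> ennreal) \<Rightarrow> bool" where
  "C2_on_pos H \<longleftrightarrow>
     (\<forall>s>0. H s < \<infinity>) \<and>
     (let h = (\<lambda>s. enn2real (H s)) in
        (\<forall>s>0. h differentiable (at s) \<and> deriv h differentiable (at s)) \<and>
        continuous_on {0<..} (deriv (deriv h)))"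

text \<open>For \<open>s > 0\<close>, the second derivative of a potential that is finite and \<open>C\<^sup>2\<close> there.
  Its values at \<open>s \<le> 0\<close> are meaningless and only ever occur multiplied by \<open>m s = 0\<close>.\<close>

definition dd :: "(real \<Rightarrow> ennreal) \<Rightarrow> real \<Rightarrow> real" where
  "dd H = deriv (deriv (\<lambda>s. enn2real (H s)))"

definition potential :: "(real \<Rightarrow> ennreal) \<Rightarrow> bool" where
  "potential G \<longleftrightarrow>
     C2_on_pos G \<and> convex_on {0<..} (\<lambda>s. enn2real (G s)) \<and> isCont G 0"

text \<open>In \<^typ>\<open>ennreal\<close>, division of a positive number by \<open>0\<close> is \<open>\<infinity>\<close>; so the lower bound
  includes \<open>G\<sigma> 0 = \<infinity>\<close>, and convexity on \<open>(0,\<infinity>)\<close> and on \<open>[0,\<infinity>)\<close> are the same.\<close>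

definition modified_potential :: "real \<Rightarrow> (real \<Rightarrow> ennreal) \<Rightarrow> (real \<Rightarrow> ennreal) \<Rightarrow> bool" where
  "modified_potential \<sigma> G G\<sigma> \<longleftrightarrow>
     C2_on_pos G\<sigma> \<and> convex_on {0<..} (\<lambda>s. enn2real (G\<sigma> s)) \<and>
     (\<forall>s<0. G\<sigma> s = \<infinity>) \<and>
     (\<exists>c0>0. \<forall>s. 0 \<le> s \<and> s \<le> \<sigma> \<longrightarrow> G\<sigma> s \<ge> ennreal c0 / (ennreal s)\<^sup>2) \<and>
     (\<forall>s\<ge>2 * \<sigma>. G\<sigma> s = G s)"

text \<open>The energy is \<open>\<infinity>\<close> at functions without a weak derivative.\<close>

definition energy :: "real set \<Rightarrow> (real \<Rightarrow> ennreal) \<Rightarrow> (real \<Rightarrow> real) \<Rightarrow> ennreal" where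
  "energy S H u =
     (if \<exists>g. has_weak_deriv S 1 u g
      then \<integral>\<^sup>+x\<in>S. (ennreal (1 / 2 * \<bar>wderiv S 1 u x\<bar>\<^sup>2) + H (u x)) \<partial>lebesgue
      else \<infinity>)"

text \<open>The quantity \<open>\<partial>\<^sub>x\<^sup>3 v - H''(v) \<partial>\<^sub>x v\<close>.\<close>

definition force ::
  "real set \<Rightarrow> (real \<Rightarrow> ennreal) \<Rightarrow> (real \<Rightarrow> real \<Rightarrow> real) \<Rightarrow> real \<Rightarrow> real \<Rightarrow> real" where
  "force S H v t x = wderiv S 3 (v t) x - dd H (v t x) * wderiv S 1 (v t) x"

text \<open>Quotients by \<open>m v = 0\<close> are taken in \<open>[0,\<infinity>]\<close>, with \<open>0 / 0 = 0\<close> and \<open>c / 0 = \<infinity>\<close> for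
  \<open>c > 0\<close>.\<close>

definition flux_dissipation ::
  "real set \<Rightarrow> real \<Rightarrow> (real \<Rightarrow> real) \<Rightarrow> (real \<Rightarrow> real \<Rightarrow> real) \<Rightarrow> (real \<Rightarrow> real \<Rightarrow> real) \<Rightarrow>
    real \<Rightarrow> real \<Rightarrow> ennreal" where
  "flux_dissipation S \<alpha> m v k s t =
     (\<integral>\<^sup>+\<tau>\<in>{s..t}. (\<integral>\<^sup>+x\<in>S.
        (ennreal (\<bar>k \<tau> x\<bar> powr ((\<alpha> + 1) / \<alpha>)) / ennreal (m (v \<tau> x) powr (1 / \<alpha>)))
        \<partial>lebesgue) \<partial>lebesgue)"

definition force_dissipation ::
  "real set \<Rightarrow> real \<Rightarrow> (real \<Rightarrow> real) \<Rightarrow> (real \<Rightarrow> ennreal) \<Rightarrow> (real \<Rightarrow> real \<Rightarrow> real) \<Rightarrow>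
    real \<Rightarrow> real \<Rightarrow> ennreal" where
  "force_dissipation S \<alpha> m H v s t =
     (\<integral>\<^sup>+\<tau>\<in>{s..t}. (\<integral>\<^sup>+x\<in>S.
        ennreal (m (v \<tau> x) * \<bar>force S H v \<tau> x\<bar> powr (\<alpha> + 1))
        \<partial>lebesgue) \<partial>lebesgue)"

section \<open>Weak formulations\<close>

definition time_test :: "real \<Rightarrow> real set \<Rightarrow> (real \<Rightarrow> real \<Rightarrow> real) set" where
  "time_test p S =
     {\<phi> \<in> bochner_Lp p {0..} (sobolev 1 p S) (sobolev_norm 1 p S).
        \<exists>T. AE t in lebesgue. t > T \<longrightarrow> (AE x in lebesgue_on S. \<phi> t x = 0)}"

text \<open>The weak form of \<open>\<partial>\<^sub>t v + \<partial>\<^sub>x J = 0\<close> with no flux through the boundary, where \<open>vt = \<partial>\<^sub>t v\<close>.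
  Since integrals of non-integrable functions are \<open>0\<close> by convention, the absolute convergence of
  the flux integral is stated explicitly; the iterated form is used because a representative of a
  Bochner function need not be jointly measurable in \<open>(t,x)\<close>. It is automatic
  when \<open>J\<close> is locally in \<open>L\<^sub>q\<close>, \<open>1/p + 1/q = 1\<close>, just as the pairing with \<open>vt\<close> is integrable
  when \<open>vt\<close> is locally in \<open>L\<^sub>q\<close> with values in the dual.\<close>

definition weak_continuity_eq ::
  "real \<Rightarrow> real set \<Rightarrow> (real \<Rightarrow> (real \<Rightarrow> real) \<Rightarrow> real) \<Rightarrow> (real \<Rightarrow> real \<Rightarrow> real) \<Rightarrow> bool" where
  "weak_continuity_eq p S vt J \<longleftrightarrow>
     (\<forall>\<phi> \<in> time_test p S.
        (AE t in lebesgue_on {0..}. set_integrable lebesgue S (\<lambda>x. J t x * wderiv S 1 (\<phi> t) x)) \<and>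
        set_integrable lebesgue {0..} (\<lambda>t. LINT x:S|lebesgue. \<bar>J t x * wderiv S 1 (\<phi> t) x\<bar>) \<and>
        (LINT t:{0..}|lebesgue. vt t (\<phi> t)) -
        (LINT t:{0..}|lebesgue. LINT x:S|lebesgue. J t x * wderiv S 1 (\<phi> t) x) = 0)"

text \<open>The boundary condition \<open>\<partial>\<^sub>x v = 0\<close> of the modified thin-film equation is part of the function
  space for \<open>v\<close>; the second one is contained in the weak form.\<close>

definition weak_solution_mtfe ::
  "real set \<Rightarrow> real \<Rightarrow> (real \<Rightarrow> real) \<Rightarrow> (real \<Rightarrow> ennreal) \<Rightarrow> (real \<Rightarrow> real \<Rightarrow> real) \<Rightarrow>
    (real \<Rightarrow> (real \<Rightarrow> real) \<Rightarrow> real) \<Rightarrow> bool" where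
  "weak_solution_mtfe S \<alpha> m H v vt \<longleftrightarrow>
     weak_continuity_eq (\<alpha> + 1) S vt (\<lambda>t x. m (v t x) * Psi \<alpha> (force S H v t x))"

end

theory Submission
  imports Defs "HOL-Computational_Algebra.Polynomial"
begin

text \<open>Let \<open>h\<close> be the finite part of \<open>G\<^sub>\<sigma>\<close>, and let \<open>f = \<partial>\<^sub>x\<^sup>3 v - h''(v) \<partial>\<^sub>x v\<close>. Testing the continuity
  equation with \<open>- \<partial>\<^sub>x\<^sup>2 v + h'(v)\<close> frozen at a time \<open>r\<close>, and using convexity of the energy \<open>E\<close>, gives
  \<open>E(t) - E(r) \<ge> - \<integral>\<^sub>r\<^sup>t b(r,s) ds\<close> on both sides of \<open>r\<close>, where \<open>b(r,s) = \<integral> f(r,x) k(s,x) dx\<close>. Summing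
  these inequalities over fine meshes and averaging over the origin of the mesh yields
  \<open>E(t) + \<integral>\<^sub>0\<^sup>t b(s,s) ds = const\<close> as long as \<open>v > 0\<close>, without regularising in time. Young's inequality
  for \<open>f k\<close>, with weights given by \<open>m(v)\<close>, turns this into the dissipation inequality, with equality
  exactly when \<open>k = m(v) \<Psi>(f)\<close> almost everywhere.

  A bound on the energy gives \<open>1/2\<close>-Hoelder continuity in \<open>x\<close>, and then \<open>G\<^sub>\<sigma> \<ge> c\<^sub>0 s\<^sup>-\<^sup>2\<close> keeps \<open>v\<close> away
  from \<open>0\<close> quantitatively. If the left-hand side of the inequality is finite, it bounds the energy
  at all earlier times up to which \<open>v\<close> is positive, so positivity propagates backwards. For a weak
  solution with finite initial energy the flux is determined by \<open>\<partial>\<^sub>t v\<close>, the energy does not increase,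
  and positivity propagates forwards.\<close>

section \<open>Smooth functions and bump functions\<close>

text \<open>The formal test function - v_xx + h'(v) is admissible only where v > 0, while the lower
  bound for v is itself drawn from the energy. The two halves of the energy are therefore treated
  apart. Besides the chain rule it yields, at every t and also at t = 0, where v is a priori only an
  L_2 limit, a gradient in L_2, and hence Hoelder bounds uniform in time and joint continuity of v,
  all before positivity is known. The potential half is added on closed rectangles where v > 0.

  Why the mesh is averaged: the force is only L_p in time, so its values at a given mesh mean
  nothing. On average, however, freezing over a cell of length h costs h times a modulus of
  continuity of translations; the number of cells is of order 1/h, and the modulus tends to 0.

  The Bochner spaces fix derivatives slice by slice, without joint measurability in (t, x). Fubini
  arguments therefore run on joint versions \<open>U1\<close>, \<open>U3\<close>, \<open>K\<close>,
  which agree with the slices for almost every t.\<close>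

definition smooth :: "(real \<Rightarrow> real) \<Rightarrow> bool" where
  "smooth f \<longleftrightarrow> (\<forall>n x. (deriv ^^ n) f differentiable (at x))"

text \<open>Coinduction: a set of functions closed under differentiation contains all iterated
  derivatives of its members.\<close>

lemma smoothI:
  assumes "f \<in> S" "\<And>g. g \<in> S \<Longrightarrow> \<exists>g'\<in>S. \<forall>x. (g has_real_derivative g' x) (at x)"
  shows "smooth f"
proof -
  have *: "(deriv ^^ n) f \<in> S" for n
  proof (induction n)
    case (Suc n)
    from assms(2)[OF this] obtain g' where g': "g' \<in> S"
      "\<forall>x. ((deriv ^^ n) f has_real_derivative g' x) (at x)" by blast
    then have "deriv ((deriv ^^ n) f) = g'" by (auto intro!: ext DERIV_imp_deriv)
    with g' show ?case by simp
  qed (use assms in auto)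
  show ?thesis unfolding smooth_def
  proof (intro allI)
    fix n x
    from assms(2)[OF *[of n]] obtain g' where "\<forall>x. ((deriv ^^ n) f has_real_derivative g' x) (at x)" by blast
    then show "(deriv ^^ n) f differentiable (at x)" using real_differentiable_def by blast
  qed
qed

lemma smooth_deriv: "smooth f \<Longrightarrow> smooth (deriv f)"
  unfolding smooth_def
proof (intro allI)
  fix n x assume a: "\<forall>n x. (deriv ^^ n) f differentiable (at x)"
  have "(deriv ^^ n) (deriv f) = (deriv ^^ Suc n) f" by (simp add: funpow_swap1)
  with a show "(deriv ^^ n) (deriv f) differentiable at x" by metis
qed

lemma smooth_DERIV: "smooth f \<Longrightarrow> (f has_real_derivative deriv f x) (at x)"
  unfolding smooth_def by (metis DERIV_deriv_iff_real_differentiable funpow_0)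

lemma smooth_continuous: "smooth f \<Longrightarrow> continuous_on A f"
  by (meson DERIV_isCont continuous_at_imp_continuous_on smooth_DERIV)

lemma smooth_primitive: assumes "smooth f" "\<And>x. (g has_real_derivative f x) (at x)" shows "smooth g"
proof -
  have d: "deriv g = f" using assms(2) by (auto intro!: ext DERIV_imp_deriv)
  show ?thesis unfolding smooth_def
  proof (intro allI)
    fix n x show "(deriv ^^ n) g differentiable at x"
    proof (cases n)
      case 0 then show ?thesis using assms(2) real_differentiable_def by auto
    next
      case (Suc m)
      have "(deriv ^^ n) g = (deriv ^^ m) f" by (simp add: Suc funpow_swap1 d)
      then show ?thesis using assms(1) by (simp add: smooth_def)
    qed
  qed
qed

text \<open>Sums of products are stable under differentiation by the product rule, so
  \<open>smoothI\<close> takes the place of a Leibniz formula for higher derivatives.\<close>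

inductive_set mult_closure :: "(real \<Rightarrow> real) set \<Rightarrow> (real \<Rightarrow> real) set \<Rightarrow> (real \<Rightarrow> real) set" for A B where
  prod: "f \<in> A \<Longrightarrow> g \<in> B \<Longrightarrow> (\<lambda>x. f x * g x) \<in> mult_closure A B"
| sum: "f \<in> mult_closure A B \<Longrightarrow> g \<in> mult_closure A B \<Longrightarrow> (\<lambda>x. f x + g x) \<in> mult_closure A B"

lemma smooth_mult:
  assumes "smooth f" "smooth g" shows "smooth (\<lambda>x. f x * g x)"
proof (rule smoothI)
  let ?S = "Collect smooth"
  show "(\<lambda>x. f x * g x) \<in> mult_closure ?S ?S" using assms by (auto intro: mult_closure.prod)
  fix h assume "h \<in> mult_closure ?S ?S"
  then show "\<exists>g'\<in>mult_closure ?S ?S. \<forall>x. (h has_real_derivative g' x) (at x)"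
  proof induction
    case (prod f g)
    then have "(\<lambda>x. deriv f x * g x + f x * deriv g x) \<in> mult_closure ?S ?S"
      by (auto intro!: mult_closure.intros smooth_deriv)
    moreover have "((\<lambda>x. f x * g x) has_real_derivative deriv f x * g x + f x * deriv g x) (at x)" for x
      using smooth_DERIV[of f x] smooth_DERIV[of g x] prod by (auto intro!: derivative_eq_intros)
    ultimately show ?case by (intro bexI[of _ "\<lambda>x. deriv f x * g x + f x * deriv g x"]) auto
  next
    case (sum f g)
    then obtain f' g' where "f' \<in> mult_closure ?S ?S" "g' \<in> mult_closure ?S ?S"
      "\<forall>x. (f has_real_derivative f' x) (at x)" "\<forall>x. (g has_real_derivative g' x) (at x)" by blast
    then show ?case by (intro bexI[of _ "\<lambda>x. f' x + g' x"]) (auto intro!: derivative_eq_intros mult_closure.sum)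
  qed
qed

lemma smooth_const: "smooth (\<lambda>x. c)"
  by (rule smoothI[of _ "{\<lambda>x. c, \<lambda>x. 0}"]) auto

lemma smooth_add:
  assumes "smooth f" "smooth g" shows "smooth (\<lambda>x. f x + g x)"
proof (rule smoothI)
  show "(\<lambda>x. f x + g x) \<in> {\<lambda>x. u x + w x |u w. smooth u \<and> smooth w}" using assms by blast
  fix h assume "h \<in> {\<lambda>x. u x + w x |u w. smooth u \<and> smooth w}"
  then obtain u w where h: "h = (\<lambda>x. u x + w x)" "smooth u" "smooth w" by blast
  show "\<exists>g'\<in>{\<lambda>x. u x + w x |u w. smooth u \<and> smooth w}. \<forall>x. (h has_real_derivative g' x) (at x)"
    by (rule bexI[of _ "\<lambda>x. deriv u x + deriv w x"])
       (use h smooth_DERIV smooth_deriv in \<open>auto intro!: derivative_eq_intros exI\<close>)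
qed

text \<open>Each differentiation only multiplies the scalar factor c by s, so the set of such
  multiples is closed under derivatives.\<close>

lemma smooth_affine:
  assumes "smooth f" shows "smooth (\<lambda>x. f (s * x + t))"
proof (rule smoothI)
  let ?S = "{\<lambda>x. c * u (s * x + t) |c u. smooth u}"
  show "(\<lambda>x. f (s * x + t)) \<in> ?S" using assms by (intro CollectI exI[of _ 1] exI[of _ f]) auto
  fix h assume "h \<in> ?S"
  then obtain c u where h: "h = (\<lambda>x. c * u (s * x + t))" "smooth u" by blast
  have "(h has_real_derivative (c * s) * deriv u (s * x + t)) (at x)" for x
    unfolding h by (rule derivative_eq_intros DERIV_chain2[OF smooth_DERIV[OF h(2)]] refl | simp)+
  then show "\<exists>g'\<in>?S. \<forall>x. (h has_real_derivative g' x) (at x)"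
    by (intro bexI[of _ "\<lambda>x. (c * s) * deriv u (s * x + t)"]) (use smooth_deriv[OF h(2)] in blast)+
qed

text \<open>Derivatives of \<open>exp (-1/x)\<close> are of the form \<open>p (1/x) exp (-1/x)\<close> with a polynomial \<open>p\<close>.\<close>

definition flat :: "real poly \<Rightarrow> real \<Rightarrow> real" where
  "flat p x = (if x > 0 then poly p (1/x) * exp (-1/x) else 0)"

lemma poly_exp_tendsto_0: "((\<lambda>y. poly p y * exp (- y)) \<longlongrightarrow> (0::real)) at_top"
proof -
  have "((\<lambda>y. (\<Sum>i\<le>degree p. coeff p i * (y ^ i / exp y))) \<longlongrightarrow> (\<Sum>i\<le>degree p. coeff p i * 0)) at_top"
    by (intro tendsto_sum tendsto_mult tendsto_const tendsto_power_div_exp_0)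
  moreover have "(\<Sum>i\<le>degree p. coeff p i * (y ^ i / exp y)) = poly p y * exp (- y)" for y
    by (simp add: poly_altdef sum_distrib_right exp_minus divide_inverse mult.assoc)
  ultimately show ?thesis by simp
qed

text \<open>With y = 1/x one has d/dx = - y^2 d/dy, which sends p exp(-y) to y^2 (p - p') exp(-y);
  the polynomial in the statement is the one obtained here.\<close>

lemma flat_DERIV: "(flat p has_real_derivative flat ([:0,0,1:] * (p - pderiv p)) x) (at x)"
proof -
  consider "x > 0" | "x < 0" | "x = 0" by linarith
  then show ?thesis
  proof cases
    case 1
    have "((\<lambda>x. poly p (1/x) * exp (-1/x)) has_real_derivative
       (poly (pderiv p) (1/x) * (- 1 / x^2)) * exp (-1/x) + poly p (1/x) * (exp (-1/x) * (1/x^2))) (at x)"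
      using 1 by (auto intro!: derivative_eq_intros DERIV_chain2[OF poly_DERIV] simp: power2_eq_square)
    moreover have "(poly (pderiv p) (1/x) * (- 1 / x^2)) * exp (-1/x) + poly p (1/x) * (exp (-1/x) * (1/x^2))
       = flat ([:0,0,1:] * (p - pderiv p)) x"
      using 1 by (simp add: flat_def power2_eq_square field_simps)
    ultimately have "((\<lambda>x. poly p (1/x) * exp (-1/x)) has_real_derivative flat ([:0,0,1:] * (p - pderiv p)) x) (at x)"
      by simp
    then show ?thesis
      by (rule DERIV_cong_ev[THEN iffD1, rotated -1])
         (use 1 in \<open>auto simp: flat_def eventually_at_filter intro!: eventually_mono[OF order_tendstoD(1)[OF tendsto_ident_at 1]] eventually_nhds_in_open[of "{0<..}" x, THEN eventually_mono]\<close>)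
  next
    case 2
    have "((\<lambda>x. 0) has_real_derivative flat ([:0,0,1:] * (p - pderiv p)) x) (at x)"
      using 2 by (simp add: flat_def)
    then show ?thesis
      by (rule DERIV_cong_ev[THEN iffD1, rotated -1])
         (use 2 in \<open>auto simp: flat_def intro!: eventually_nhds_in_open[of "{..<0}" x, THEN eventually_mono]\<close>)
  next
    case 3
    have "((\<lambda>h. flat p h / h) \<longlongrightarrow> 0) (at_right 0)"
    proof -
      \<comment> \<open>The difference quotient at 0 is y p(y) exp(-y) with y = 1/h, and y tends to
        infinity. This is where the decay of the exponential enters.\<close>
      have "((\<lambda>h. poly ([:0,1:] * p) (inverse h) * exp (- inverse h)) \<longlongrightarrow> 0) (at_right (0::real))"
        by (rule filterlim_compose[OF poly_exp_tendsto_0 filterlim_inverse_at_top_right])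
      then show ?thesis
        by (rule Lim_transform_eventually)
           (auto simp: flat_def eventually_at_filter divide_inverse mult_ac)
    qed
    moreover have "((\<lambda>h. flat p h / h) \<longlongrightarrow> 0) (at_left 0)"
      by (rule Lim_transform_eventually[OF tendsto_const[of 0]]) (auto simp: flat_def eventually_at_filter)
    ultimately have "((\<lambda>h. flat p h / h) \<longlongrightarrow> 0) (at 0)"
      using filterlim_at_split by blast
    then show ?thesis using 3 by (simp add: DERIV_def flat_def)
  qed
qed

lemma smooth_flat: "smooth (flat p)"
  by (rule smoothI[of _ "range flat"]) (use flat_DERIV in blast)+

text \<open>The factor \<open>Suc n\<close> steepens both flanks: on (c, d) each factor is exp
  (-1/((n+1) y)), with y the distance to an endpoint, and tends to 1. For c \<ge> d the function is
  0.\<close>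

definition bump :: "nat \<Rightarrow> real \<Rightarrow> real \<Rightarrow> real \<Rightarrow> real" where
  "bump n c d x = flat 1 (real (Suc n) * (x - c)) * flat 1 (real (Suc n) * (d - x))"

lemma smooth_bump: "smooth (bump n c d)"
proof -
  have "smooth (\<lambda>x. flat 1 (real (Suc n) * x + (- real (Suc n) * c)) * flat 1 ((- real (Suc n)) * x + real (Suc n) * d))"
    by (intro smooth_mult smooth_affine smooth_flat)
  moreover have "bump n c d = (\<lambda>x. flat 1 (real (Suc n) * x + (- real (Suc n) * c)) * flat 1 ((- real (Suc n)) * x + real (Suc n) * d))"
    by (auto simp: bump_def algebra_simps)
  ultimately show ?thesis by metis
qed

lemma bump_range: "0 \<le> bump n c d x" "bump n c d x \<le> 1"
  unfolding bump_def flat_def by (auto intro!: mult_le_one)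

lemma bump_outside: "x \<notin> {c<..<d} \<Longrightarrow> bump n c d x = 0"
  by (auto simp: bump_def flat_def zero_less_mult_iff)

lemma bump_pos: "x \<in> {c<..<d} \<Longrightarrow> bump n c d x > 0"
  by (auto simp: bump_def flat_def zero_less_mult_iff)

lemma bump_tendsto: "(\<lambda>n. bump n c d x) \<longlonglongrightarrow> indicator {c<..<d} x"
proof (cases "x \<in> {c<..<d}")
  case True
  have *: "(\<lambda>n. flat 1 (real (Suc n) * y)) \<longlonglongrightarrow> 1" if "y > 0" for y :: real
  proof -
    have "(\<lambda>n. - (1/y) * inverse (real (Suc n))) \<longlonglongrightarrow> - (1/y) * 0"
      by (intro tendsto_mult tendsto_const LIMSEQ_inverse_real_of_nat)
    then have "(\<lambda>n. exp (- (1/y) * inverse (real (Suc n)))) \<longlonglongrightarrow> 1"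
      using tendsto_exp by fastforce
    moreover have "flat 1 (real (Suc n) * y) = exp (- (1/y) * inverse (real (Suc n)))" for n
    proof -
      have "real (Suc n) * y > 0" using that by (simp add: zero_less_mult_iff)
      then show ?thesis by (simp only: flat_def if_True) (simp add: divide_inverse mult.commute)
    qed
    ultimately show ?thesis by simp
  qed
  have "(\<lambda>n. bump n c d x) \<longlonglongrightarrow> 1 * 1"
    unfolding bump_def by (intro tendsto_mult *) (use True in auto)
  then show ?thesis using True by simp
qed (simp add: bump_outside)

section \<open>Test functions with compact support\<close>

lemma test_fun_iff: "test_fun S \<phi> \<longleftrightarrow> smooth \<phi> \<and> (\<exists>K. compact K \<and> K \<subseteq> S \<and> (\<forall>x. x \<notin> K \<longrightarrow> \<phi> x = 0))"
  by (simp add: test_fun_def smooth_def)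

lemma test_fun_bump: "{c..d} \<subseteq> S \<Longrightarrow> test_fun S (bump n c d)"
  unfolding test_fun_iff using smooth_bump bump_outside[of _ c d]
  by (intro conjI exI[of _ "{c..d}"]) auto

lemma test_fun_deriv:
  assumes "test_fun S \<phi>" shows "test_fun S (deriv \<phi>)"
proof -
  obtain K where K: "compact K" "K \<subseteq> S" "\<And>x. x \<notin> K \<Longrightarrow> \<phi> x = 0" using assms unfolding test_fun_iff by blast
  have "deriv \<phi> x = 0" if "x \<notin> K" for x
  proof -
    have "open (- K)" using K(1) by (simp add: compact_imp_closed open_Compl)
    then have "\<forall>\<^sub>F y in nhds x. \<phi> y = 0"
      using that K(3) by (auto intro!: eventually_nhds_in_open[of "-K" x, THEN eventually_mono])
    then have "(\<phi> has_real_derivative 0) (at x)"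
      by (subst DERIV_cong_ev[OF refl _ refl, of _ "\<lambda>_. 0"]) auto
    then show ?thesis by (rule DERIV_imp_deriv)
  qed
  then show ?thesis using assms K smooth_deriv unfolding test_fun_iff by blast
qed

lemma test_fun_derivn: "test_fun S \<phi> \<Longrightarrow> test_fun S ((deriv ^^ n) \<phi>)"
  by (induction n) (auto intro: test_fun_deriv)

lemma test_fun_add: "test_fun S f \<Longrightarrow> test_fun S g \<Longrightarrow> test_fun S (\<lambda>x. f x + g x)"
  unfolding test_fun_iff
proof (elim conjE exE, intro conjI)
  fix K L assume "compact K" "compact L" "K \<subseteq> S" "L \<subseteq> S" "\<forall>x. x \<notin> K \<longrightarrow> f x = 0" "\<forall>x. x \<notin> L \<longrightarrow> g x = 0"
  then show "\<exists>K. compact K \<and> K \<subseteq> S \<and> (\<forall>x. x \<notin> K \<longrightarrow> f x + g x = 0)"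
    by (intro exI[of _ "K \<union> L"]) auto
qed (use smooth_add in auto)

lemma test_fun_cmult: "test_fun S f \<Longrightarrow> test_fun S (\<lambda>x. c * f x)"
  unfolding test_fun_iff by (auto intro: smooth_mult smooth_const)

lemma test_fun_continuous: "test_fun S f \<Longrightarrow> continuous_on A f"
  using smooth_continuous test_fun_iff by blast

lemma test_fun_DERIV: "test_fun S f \<Longrightarrow> (f has_real_derivative deriv f x) (at x)"
  using smooth_DERIV test_fun_iff by blast

lemma test_fun_bounded: assumes "test_fun S f" obtains B where "\<And>x. \<bar>f x\<bar> \<le> B" "B > 0"
proof -
  obtain K where K: "compact K" "\<And>x. x \<notin> K \<Longrightarrow> f x = 0" using assms unfolding test_fun_iff by blast
  have "bounded (f ` K)" using compact_continuous_image[OF test_fun_continuous[OF assms] K(1)] compact_imp_bounded by blast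
  then obtain B where "B > 0" "\<forall>y\<in>f ` K. norm y \<le> B" using bounded_pos by blast
  with K show thesis by (intro that[of B]) (metis abs_zero image_eqI less_eq_real_def real_norm_def)+
qed

lemma test_fun_measurable: "test_fun S f \<Longrightarrow> f \<in> borel_measurable lebesgue"
  by (rule measurable_completion) (simp add: borel_measurable_continuous_onI test_fun_continuous)

section \<open>Weak derivatives\<close>

text \<open>The densities max 0 h and max 0 (-h) give every ray the same finite mass, so they define
  the same measure and agree almost everywhere; hence h = 0. A Borel version of h is taken first,
  because the measures are compared on Borel sets.\<close>

lemma AE_zero_of_rays:
  fixes h :: "real \<Rightarrow> real"
  assumes h: "integrable lebesgue h" and z: "\<And>x. (LINT y|lebesgue. indicator {x<..} y * h y) = 0"
  shows "AE x in lebesgue. h x = 0"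
proof -
  obtain g where g: "g \<in> borel_measurable lborel" "AE x in lborel. h x = g x"
    using completion_ex_borel_measurable_real[of h lborel] h by blast
  have [measurable]: "g \<in> borel_measurable borel" using g(1) by simp
  have hg: "AE x in lebesgue. h x = g x" using g(2) by (rule AE_completion)
  have "integrable lebesgue g"
    using h hg g(1) by (subst integrable_cong_AE[of _ _ h]) (auto intro: measurable_completion elim: AE_mp)
  then have gi: "integrable lborel g" using integrable_completion[of g lborel] g(1) by simp
  have "(LINT y|lborel. indicator {x<..} y * g y) = 0" for x
  proof -
    have "(LINT y|lborel. indicator {x<..} y * g y) = (LINT y|lebesgue. indicator {x<..} y * g y)"
      by (subst integral_completion) auto
    also have "\<dots> = (LINT y|lebesgue. indicator {x<..} y * h y)"
    proof (rule integral_cong_AE)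
      show "(\<lambda>y. indicat_real {x<..} y * g y) \<in> borel_measurable lebesgue"
        by (rule measurable_completion) auto
      show "(\<lambda>y. indicat_real {x<..} y * h y) \<in> borel_measurable lebesgue"
        using h by (intro borel_measurable_times) (auto intro!: measurable_completion)
    qed (use hg in auto)
    finally show ?thesis using z by simp
  qed
  then have eq: "(LINT y|lborel. indicator {x<..} y * max 0 (g y)) = (LINT y|lborel. indicator {x<..} y * max 0 (- g y))" for x
  proof -
    have i: "integrable lborel (\<lambda>y. indicat_real {x<..} y * f y)" if "integrable lborel f" for f :: "real \<Rightarrow> real"
      using integrable_mult_indicator[of "{x<..}" lborel f] that by simp
    have "(LINT y|lborel. indicator {x<..} y * max 0 (g y)) - (LINT y|lborel. indicator {x<..} y * max 0 (- g y)) = (LINT y|lborel. indicator {x<..} y * g y)"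
      using gi by (subst Bochner_Integration.integral_diff[symmetric])
        (auto intro!: i integrable_max arg_cong[where f = "integral\<^sup>L lborel"] simp: fun_eq_iff split: split_indicator)
    then show ?thesis using \<open>\<And>x. (LINT y|lborel. indicator {x<..} y * g y) = 0\<close> by simp
  qed
  let ?p = "\<lambda>y. ennreal (max 0 (g y))" and ?m = "\<lambda>y. ennreal (max 0 (- g y))"
  have nn: "(\<integral>\<^sup>+y. ennreal (f y) * indicator {x<..} y \<partial>lborel) = ennreal (LINT y|lborel. indicator {x<..} y * f y)"
    if "integrable lborel f" "\<And>y. f y \<ge> 0" for f :: "real \<Rightarrow> real" and x
  proof -
    have "(\<integral>\<^sup>+y. ennreal (f y) * indicator {x<..} y \<partial>lborel) = (\<integral>\<^sup>+y. ennreal (indicator {x<..} y * f y) \<partial>lborel)"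
      by (intro nn_integral_cong) (auto split: split_indicator)
    also have "\<dots> = ennreal (LINT y|lborel. indicator {x<..} y * f y)"
    proof (rule nn_integral_eq_integral)
      show "integrable lborel (\<lambda>y. indicat_real {x<..} y * f y)"
        using integrable_mult_indicator[OF _ that(1), of "{x<..}"] by simp
    qed (use that(2) in auto)
    finally show ?thesis .
  qed
  have "density lborel ?p = density lborel ?m"
    by (rule measure_eqI_lessThan) (use nn gi eq in \<open>auto simp: emeasure_density less_top\<close>)
  then have "AE y in lborel. ?p y = ?m y"
    by (subst sigma_finite_measure.density_unique_iff[OF sigma_finite_lborel, symmetric]) auto
  then have "AE y in lborel. g y = 0"
    by (rule AE_mp) (auto intro!: AE_I2 simp: max_def split: if_splits)
  then have "AE y in lborel. h y = 0" using g(2) by eventually_elim simp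
  then show ?thesis by (rule AE_completion)
qed

lemma test_fun_mult_integrable:
  assumes S: "S \<in> sets lebesgue" and "locally_integrable S f" "test_fun S \<phi>"
  shows "set_integrable lebesgue S (\<lambda>x. f x * \<phi> x)"
proof -
  obtain K where K: "compact K" "K \<subseteq> S" "\<And>x. x \<notin> K \<Longrightarrow> \<phi> x = 0" using assms(3) unfolding test_fun_iff by blast
  obtain B where B: "\<And>x. \<bar>\<phi> x\<bar> \<le> B" "B > 0" using test_fun_bounded[OF assms(3)] by blast
  have i: "integrable lebesgue (\<lambda>x. indicator K x *\<^sub>R f x)"
    using assms(2) K unfolding locally_integrable_def set_integrable_def by blast
  have "integrable lebesgue (\<lambda>x. (indicator K x *\<^sub>R f x) * \<phi> x)"
  proof (rule Bochner_Integration.integrable_bound[OF integrable_mult_left[OF i, of B]])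
    show "(\<lambda>x. indicat_real K x *\<^sub>R f x * \<phi> x) \<in> borel_measurable lebesgue"
      using i test_fun_measurable[OF assms(3)] by (intro borel_measurable_times) auto
    show "AE x in lebesgue. norm (indicat_real K x *\<^sub>R f x * \<phi> x) \<le> norm (indicat_real K x *\<^sub>R f x * B)"
      using B by (intro AE_I2) (auto simp: abs_mult intro!: mult_left_mono)
  qed
  moreover have "(\<lambda>x. (indicator K x *\<^sub>R f x) * \<phi> x) = (\<lambda>x. indicator S x *\<^sub>R (f x * \<phi> x))"
    using K by (auto split: split_indicator simp: fun_eq_iff)
  ultimately show ?thesis by (simp add: set_integrable_def)
qed

lemma locally_integrableD: "locally_integrable S f \<Longrightarrow> compact K \<Longrightarrow> K \<subseteq> S \<Longrightarrow> integrable lebesgue (\<lambda>x. indicator K x * f x)"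
  by (simp add: locally_integrable_def set_integrable_def)

text \<open>The bumps are test functions and converge boundedly to the indicator of (c, d);
  integrability of h on the compact interval [c, d] supplies the majorant.\<close>

lemma fundamental_lemma_interval:
  fixes h :: "real \<Rightarrow> real"
  assumes li: "locally_integrable S h" and z: "\<And>\<phi>. test_fun S \<phi> \<Longrightarrow> (LINT x:S|lebesgue. h x * \<phi> x) = 0"
    and cd: "{c..d} \<subseteq> S"
  shows "(LINT x|lebesgue. indicator {c<..<d} x * h x) = 0"
proof -
  have i: "integrable lebesgue (\<lambda>x. indicator {c..d} x * h x)"
    using locally_integrableD[OF li] cd by simp
  have "(\<lambda>n. LINT x|lebesgue. (indicator {c..d} x * h x) * bump n c d x) \<longlonglongrightarrow> (LINT x|lebesgue. (indicator {c..d} x * h x) * indicator {c<..<d} x)"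
  proof (rule integral_dominated_convergence[where w = "\<lambda>x. norm (indicator {c..d} x * h x)"])
    show "AE x in lebesgue. (\<lambda>n. indicat_real {c..d} x * h x * bump n c d x) \<longlonglongrightarrow> indicat_real {c..d} x * h x * indicat_real {c<..<d} x"
      by (intro AE_I2 tendsto_mult tendsto_const bump_tendsto)
    show "AE x in lebesgue. norm (indicat_real {c..d} x * h x * bump n c d x) \<le> norm (indicat_real {c..d} x * h x)" for n
      using bump_range by (intro AE_I2) (auto simp: abs_mult mult_left_le)
    show "(\<lambda>x. indicat_real {c..d} x * h x * bump n c d x) \<in> borel_measurable lebesgue" for n
      by (rule borel_measurable_times[OF borel_measurable_integrable[OF i] test_fun_measurable[OF test_fun_bump[OF cd]]])
    show "(\<lambda>x. indicat_real {c..d} x * h x * indicat_real {c<..<d} x) \<in> borel_measurable lebesgue"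
      by (rule borel_measurable_times[OF borel_measurable_integrable[OF i]]) (auto intro!: measurable_completion)
  qed (use i in auto)
  moreover have "(LINT x|lebesgue. (indicator {c..d} x * h x) * bump n c d x) = 0" for n
  proof -
    have "(LINT x|lebesgue. (indicator {c..d} x * h x) * bump n c d x) = (LINT x:S|lebesgue. h x * bump n c d x)"
      unfolding set_lebesgue_integral_def using cd bump_outside[of _ c d n]
      by (intro Bochner_Integration.integral_cong) (auto split: split_indicator)
    then show ?thesis using z[OF test_fun_bump[OF cd]] by simp
  qed
  moreover have "(\<lambda>x. (indicator {c..d} x * h x) * indicator {c<..<d} x) = (\<lambda>x. indicator {c<..<d} x * h x)"
    by (auto split: split_indicator)
  ultimately show ?thesis by (simp add: LIMSEQ_const_iff)
qed

text \<open>A ray cuts an interval of this kind in another one, so h vanishes almost everywhere on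
  each of them. Those with rational endpoints are countable and cover the open set S.\<close>

lemma AE_zero_of_intervals:
  fixes h :: "real \<Rightarrow> real"
  assumes S: "open S" and li: "locally_integrable S h"
    and z: "\<And>c d. {c..d} \<subseteq> S \<Longrightarrow> (LINT x|lebesgue. indicator {c<..<d} x * h x) = 0"
  shows "AE x in lebesgue. x \<in> S \<longrightarrow> h x = 0"
proof -
  have *: "AE x in lebesgue. indicator {c<..<d} x * h x = 0" if cd: "{c..d} \<subseteq> S" for c d
  proof (rule AE_zero_of_rays)
    have "integrable lebesgue (\<lambda>x. indicator {c<..<d} x *\<^sub>R (indicator {c..d} x * h x))"
      using locally_integrableD[OF li, of "{c..d}"] cd by (intro integrable_mult_indicator) auto
    then show "integrable lebesgue (\<lambda>x. indicat_real {c<..<d} x * h x)"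
      by (rule Bochner_Integration.integrable_cong[THEN iffD1, rotated -1]) (auto split: split_indicator)
    fix x
    have "(\<lambda>y. indicat_real {x<..} y * (indicat_real {c<..<d} y * h y)) = (\<lambda>y. indicat_real {max x c<..<d} y * h y)"
      by (auto split: split_indicator)
    moreover have "{max x c..d} \<subseteq> S" using cd by auto
    ultimately show "(LINT y|lebesgue. indicat_real {x<..} y * (indicat_real {c<..<d} y * h y)) = 0"
      using z by simp
  qed
  let ?Q = "{(c, d). c \<in> \<rat> \<and> d \<in> \<rat> \<and> {c..d} \<subseteq> S}"
  have "countable ?Q"
    by (rule countable_subset[of _ "\<rat> \<times> \<rat>"]) (auto simp: countable_rat)
  moreover have "\<forall>q\<in>?Q. AE x in lebesgue. indicator {fst q<..<snd q} x * h x = 0" using * by auto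
  ultimately have "AE x in lebesgue. \<forall>q\<in>?Q. indicator {fst q<..<snd q} x * h x = 0"
    by (subst AE_ball_countable) auto
  then show ?thesis
  proof eventually_elim
    case (elim x)
    show ?case
    proof
      assume "x \<in> S"
      then obtain e where e: "e > 0" "cball x e \<subseteq> S" using S open_contains_cball by blast
      obtain c where c: "c \<in> \<rat>" "x - e < c" "c < x" using Rats_dense_in_real[of "x - e" x] e by auto
      obtain d where d: "d \<in> \<rat>" "x < d" "d < x + e" using Rats_dense_in_real[of x "x+e"] e by auto
      have "{c..d} \<subseteq> cball x e" using c d by (auto simp: dist_real_def)
      then have "(c, d) \<in> ?Q" using c d e by auto
      with elim c d show "h x = 0" by fastforce
    qed
  qed
qed

lemma fundamental_lemma:
  fixes h :: "real \<Rightarrow> real"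
  assumes "open S" "locally_integrable S h" "\<And>\<phi>. test_fun S \<phi> \<Longrightarrow> (LINT x:S|lebesgue. h x * \<phi> x) = 0"
  shows "AE x in lebesgue. x \<in> S \<longrightarrow> h x = 0"
  using AE_zero_of_intervals[OF assms(1,2)] fundamental_lemma_interval[OF assms(2,3)] by blast

lemma locally_integrable_lincomb:
  assumes "locally_integrable S f" "locally_integrable S g"
  shows "locally_integrable S (\<lambda>x. c * f x + d * g x)"
  using assms unfolding locally_integrable_def
  by (auto intro!: set_integral_add set_integrable_mult_right)

lemma has_weak_deriv_lincomb:
  assumes S: "open S" and "has_weak_deriv S j f f'" "has_weak_deriv S j g g'"
  shows "has_weak_deriv S j (\<lambda>x. c * f x + d * g x) (\<lambda>x. c * f' x + d * g' x)"
  unfolding has_weak_deriv_def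
proof (intro conjI allI impI)
  show "locally_integrable S (\<lambda>x. c * f x + d * g x)" "locally_integrable S (\<lambda>x. c * f' x + d * g' x)"
    using assms by (auto simp: has_weak_deriv_def intro!: locally_integrable_lincomb)
  fix \<phi> assume \<phi>: "test_fun S \<phi>"
  have Sm: "S \<in> sets lebesgue" using S by auto
  have *: "(LINT x:S|lebesgue. (c * u x + d * w x) * \<psi> x) = c * (LINT x:S|lebesgue. u x * \<psi> x) + d * (LINT x:S|lebesgue. w x * \<psi> x)"
    if "test_fun S \<psi>" "locally_integrable S u" "locally_integrable S w" for u w \<psi>
  proof -
    have i: "set_integrable lebesgue S (\<lambda>x. u x * \<psi> x)" "set_integrable lebesgue S (\<lambda>x. w x * \<psi> x)"
      using test_fun_mult_integrable[OF Sm] that by auto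
    have "(LINT x:S|lebesgue. (c * u x + d * w x) * \<psi> x) = (LINT x:S|lebesgue. c * (u x * \<psi> x) + d * (w x * \<psi> x))"
      by (simp add: algebra_simps)
    also have "\<dots> = c * (LINT x:S|lebesgue. u x * \<psi> x) + d * (LINT x:S|lebesgue. w x * \<psi> x)"
      using i by (subst set_integral_add) (auto intro!: set_integrable_mult_right)
    finally show ?thesis .
  qed
  show "(LINT x:S|lebesgue. (c * f x + d * g x) * (deriv ^^ j) \<phi> x) = (-1) ^ j * (LINT x:S|lebesgue. (c * f' x + d * g' x) * \<phi> x)"
    using assms \<phi> *[OF test_fun_derivn[OF \<phi>], of f g j] *[OF \<phi>, of f' g']
    by (simp add: has_weak_deriv_def distrib_left)
qed

lemma has_weak_deriv_unique:
  assumes S: "open S" and "has_weak_deriv S j f g" "has_weak_deriv S j f g'"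
  shows "AE x in lebesgue. x \<in> S \<longrightarrow> g x = g' x"
proof -
  have w: "has_weak_deriv S j (\<lambda>x. 1 * f x + (-1) * f x) (\<lambda>x. 1 * g x + (-1) * g' x)"
    by (rule has_weak_deriv_lincomb[OF assms])
  have "AE x in lebesgue. x \<in> S \<longrightarrow> 1 * g x + (-1) * g' x = 0"
  proof (rule fundamental_lemma[OF S])
    show "locally_integrable S (\<lambda>x. 1 * g x + - 1 * g' x)" using w unfolding has_weak_deriv_def by blast
    fix \<phi> assume "test_fun S \<phi>"
    with w have "(LINT x:S|lebesgue. (1 * f x + (-1) * f x) * (deriv ^^ j) \<phi> x) = (-1) ^ j * (LINT x:S|lebesgue. (1 * g x + (-1) * g' x) * \<phi> x)"
      unfolding has_weak_deriv_def by blast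
    then show "(LINT x:S|lebesgue. (1 * g x + (-1) * g' x) * \<phi> x) = 0" by simp
  qed
  then show ?thesis by eventually_elim simp
qed

lemma wderiv_has: "has_weak_deriv S j f g \<Longrightarrow> has_weak_deriv S j f (wderiv S j f)"
  unfolding wderiv_def by (rule someI[of "has_weak_deriv S j f"])

lemma wderiv_AE: "open S \<Longrightarrow> has_weak_deriv S j f g \<Longrightarrow> AE x in lebesgue. x \<in> S \<longrightarrow> wderiv S j f x = g x"
  by (rule has_weak_deriv_unique[OF _ wderiv_has])

section \<open>Absolutely continuous functions on an interval\<close>

abbreviation "MI a b \<equiv> lebesgue_on {a<..<b::real}"

lemma finite_MI: "finite_measure (MI a b)"
  by (rule finite_measure_lebesgue_on) (simp add: lmeasurable_interval)

lemma sigma_finite_MI: "sigma_finite_measure (MI a b)"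
  using finite_MI finite_measure_def by blast

lemma pair_MI: "pair_sigma_finite (MI a b) (MI a b)"
  by (intro pair_sigma_finite.intro sigma_finite_MI)

lemma Ioo_lebesgue: "{a<..<b::real} \<inter> space lebesgue \<in> sets lebesgue"
  by (simp add: space_completion)

lemma LINT_MI: "(LINT x:{a<..<b}|lebesgue. F x) = integral\<^sup>L (MI a b) (F :: real \<Rightarrow> real)"
  unfolding set_lebesgue_integral_def by (rule integral_restrict_space[OF Ioo_lebesgue, symmetric])

lemma set_integrable_MI: "set_integrable lebesgue {a<..<b} F \<longleftrightarrow> integrable (MI a b) (F :: real \<Rightarrow> real)"
  unfolding set_integrable_def by (simp add: integrable_restrict_space[OF Ioo_lebesgue])

lemma AE_MI: "(AE x in MI a b. P x) \<longleftrightarrow> (AE x in lebesgue. x \<in> {a<..<b} \<longrightarrow> P x)"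
  by (rule AE_restrict_space_iff[OF Ioo_lebesgue])

lemma nn_MI: "(\<integral>\<^sup>+x\<in>{a<..<b}. F x \<partial>lebesgue) = integral\<^sup>N (MI a b) F"
  by (simp add: nn_integral_restrict_space[OF Ioo_lebesgue])

lemma space_MI: "space (MI a b) = {a<..<b}"
  by (simp add: space_restrict_space)

lemma measurable_ident_MI: "(\<lambda>x. x) \<in> MI a b \<rightarrow>\<^sub>M borel"
  by (intro measurable_restrict_space1 measurable_completion) simp

lemma borel_measurable_MI: "f \<in> borel_measurable borel \<Longrightarrow> f \<in> borel_measurable (MI a b)"
  by (intro measurable_restrict_space1 measurable_completion) simp

lemma continuous_measurable_MI: "continuous_on {a<..<b} f \<Longrightarrow> (f :: real \<Rightarrow> real) \<in> borel_measurable (MI a b)"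
  by (rule continuous_imp_measurable_on_sets_lebesgue) auto

lemma continuous_integrable_MI:
  assumes "continuous_on {a..b} (f :: real \<Rightarrow> real)" shows "integrable (MI a b) f"
proof -
  interpret finite_measure "MI a b" by (rule finite_MI)
  have "bounded (f ` {a..b})" using compact_continuous_image[OF assms] compact_imp_bounded by blast
  then obtain B where "\<forall>y\<in>f ` {a..b}. norm y \<le> B" using bounded_iff by blast
  then have "AE x in MI a b. norm (f x) \<le> B" by (intro AE_I2) (auto simp: space_MI)
  moreover have "f \<in> borel_measurable (MI a b)"
    by (rule continuous_measurable_MI[OF continuous_on_subset[OF assms]]) auto
  ultimately show ?thesis by (rule integrable_const_bound)
qed

lemma integrable_MI_indicator:
  assumes "integrable (MI a b) (f :: real \<Rightarrow> real)" "A \<in> sets borel"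
  shows "integrable (MI a b) (\<lambda>x. indicator A x * f x)"
proof -
  have "(\<lambda>x. indicat_real A x) \<in> borel_measurable (MI a b)"
    using assms(2) by (intro borel_measurable_MI) auto
  then show ?thesis
    using assms(1) by (intro Bochner_Integration.integrable_bound[OF assms(1)]) (auto split: split_indicator)
qed

lemma locally_integrable_MI:
  assumes "integrable (MI a b) f" shows "locally_integrable {a<..<b} f"
  unfolding locally_integrable_def
proof (intro allI impI)
  fix K assume "compact K \<and> K \<subseteq> {a<..<b}"
  moreover have "set_integrable lebesgue {a<..<b} f" using assms by (simp add: set_integrable_MI)
  ultimately show "set_integrable lebesgue K f"
    by (elim set_integrable_subset) (auto simp: borel_compact)
qed

lemma MI_FTC:
  assumes "\<And>x. x \<in> {a..b} \<Longrightarrow> (\<phi> has_real_derivative \<phi>' x) (at x within {a..b})" "continuous_on {a..b} \<phi>'"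
    and yz: "a \<le> y" "y \<le> z" "z \<le> b"
  shows "(\<integral>x. indicator {y..z} x * \<phi>' x \<partial>MI a b) = \<phi> z - \<phi> y"
proof -
  have "(\<integral>x. indicator {y..z} x * \<phi>' x \<partial>MI a b) = (\<integral>x. indicator {a<..<b} x *\<^sub>R (indicator {y..z} x * \<phi>' x) \<partial>lebesgue)"
    by (rule integral_restrict_space[OF Ioo_lebesgue])
  also have "\<dots> = (\<integral>x. indicator {y..z} x *\<^sub>R \<phi>' x \<partial>lebesgue)"
  proof (rule integral_cong_AE)
    have c: "continuous_on {y..z} \<phi>'" by (rule continuous_on_subset[OF assms(2)]) (use yz in auto)
    show m: "(\<lambda>x. indicat_real {y..z} x *\<^sub>R \<phi>' x) \<in> borel_measurable lebesgue"
      by (intro measurable_completion) (use borel_measurable_continuous_on_indicator[OF _ c] in simp)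
    have "(\<lambda>x. indicat_real {a<..<b} x *\<^sub>R (indicat_real {y..z} x *\<^sub>R \<phi>' x)) \<in> borel_measurable lebesgue"
      by (rule borel_measurable_scaleR[OF _ m]) (auto intro!: measurable_completion)
    then show "(\<lambda>x. indicat_real {a<..<b} x *\<^sub>R (indicat_real {y..z} x * \<phi>' x)) \<in> borel_measurable lebesgue" by simp
    have "AE x in lebesgue. x \<noteq> a \<and> x \<noteq> b"
      using AE_completion[OF AE_lborel_singleton[of a]] AE_completion[OF AE_lborel_singleton[of b]]
      by eventually_elim simp
    then show "AE x in lebesgue. indicat_real {a<..<b} x *\<^sub>R (indicat_real {y..z} x * \<phi>' x) = indicat_real {y..z} x *\<^sub>R \<phi>' x"
      by eventually_elim (use yz in \<open>auto split: split_indicator\<close>)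
  qed
  also have "\<dots> = (\<integral>x. indicator {y..z} x *\<^sub>R \<phi>' x \<partial>lborel)"
  proof (rule integral_completion)
    have c: "continuous_on {y..z} \<phi>'" by (rule continuous_on_subset[OF assms(2)]) (use yz in auto)
    show "(\<lambda>x. indicat_real {y..z} x *\<^sub>R \<phi>' x) \<in> borel_measurable lborel"
      using borel_measurable_continuous_on_indicator[OF _ c] by simp
  qed
  also have "\<dots> = \<phi> z - \<phi> y"
  proof (rule integral_FTC_atLeastAtMost[OF yz(2)])
    show "continuous_on {y..z} \<phi>'" by (rule continuous_on_subset[OF assms(2)]) (use yz in auto)
    fix x assume "y \<le> x" "x \<le> z"
    then have "(\<phi> has_real_derivative \<phi>' x) (at x within {y..z})"
      using yz by (intro DERIV_subset[OF assms(1)[of x]]) auto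
    then show "(\<phi> has_vector_derivative \<phi>' x) (at x within {y..z})"
      by (rule has_real_derivative_iff_has_vector_derivative[THEN iffD1])
  qed
  finally show ?thesis .
qed

text \<open>Integrating over a ray makes the function total: it is 0 for x \<le> a and constant for
  x \<ge> b, hence continuous on the whole line.\<close>

definition prim :: "real \<Rightarrow> real \<Rightarrow> (real \<Rightarrow> real) \<Rightarrow> real \<Rightarrow> real" where
  "prim a b g x = (\<integral>y. indicator {..x} y * g y \<partial>MI a b)"

lemma prim_right: "prim a b g b = integral\<^sup>L (MI a b) g"
  unfolding prim_def by (rule Bochner_Integration.integral_cong) (auto simp: space_MI)

lemma prim_diff:
  assumes "integrable (MI a b) g" "x \<le> y"
  shows "prim a b g y - prim a b g x = (\<integral>z. indicator {x<..y} z * g z \<partial>MI a b)"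
  unfolding prim_def using assms
  by (subst Bochner_Integration.integral_diff[symmetric])
     (auto intro!: integrable_MI_indicator Bochner_Integration.integral_cong split: split_indicator)

text \<open>Fubini on the triangle y \<le> x: for fixed y the inner integral of \<phi>' over [y, b]
  is \<phi> b - \<phi> y.\<close>

lemma prim_by_parts:
  assumes ab: "a < b" and g: "integrable (MI a b) g"
    and \<phi>: "\<And>x. x \<in> {a..b} \<Longrightarrow> (\<phi> has_real_derivative \<phi>' x) (at x within {a..b})" "continuous_on {a..b} \<phi>'"
  shows "(\<integral>x. prim a b g x * \<phi>' x \<partial>MI a b) = integral\<^sup>L (MI a b) g * \<phi> b - (\<integral>x. g x * \<phi> x \<partial>MI a b)"
proof -
  let ?M = "MI a b"
  interpret M: finite_measure ?M by (rule finite_MI)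
  interpret P: pair_sigma_finite ?M ?M by (rule pair_MI)
  have \<phi>i: "integrable ?M \<phi>'" by (rule continuous_integrable_MI[OF \<phi>(2)])
  have \<phi>c: "continuous_on {a..b} \<phi>" using \<phi>(1) DERIV_continuous continuous_on_eq_continuous_within by blast
  have [measurable]: "g \<in> borel_measurable ?M" "\<phi>' \<in> borel_measurable ?M" using g \<phi>i by auto
  let ?F = "\<lambda>x y. indicator {..x} y * g y * \<phi>' x"
  note [measurable] = measurable_ident_MI
  have m: "(\<lambda>(x, y). ?F x y) \<in> borel_measurable (?M \<Otimes>\<^sub>M ?M)"
  proof -
    have "(\<lambda>p. indicat_real {p. snd p \<le> fst p} p * g (snd p) * \<phi>' (fst p)) \<in> borel_measurable (?M \<Otimes>\<^sub>M ?M)"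
      by measurable
    then show ?thesis by (rule measurable_cong[THEN iffD1, rotated]) (auto split: split_indicator)
  qed
  have gp: "integrable (?M \<Otimes>\<^sub>M ?M) (\<lambda>(x, y). \<phi>' x * g y)"
  proof (rule P.Fubini_integrable)
    show "(\<lambda>(x, y). \<phi>' x * g y) \<in> borel_measurable (?M \<Otimes>\<^sub>M ?M)" by measurable
    show "integrable ?M (\<lambda>x. \<integral>y. norm (case (x, y) of (x, y) \<Rightarrow> \<phi>' x * g y) \<partial>?M)"
      using \<phi>i by (simp add: abs_mult integrable_abs integrable_mult_left)
    show "AE x in ?M. integrable ?M (\<lambda>y. case (x, y) of (x, y) \<Rightarrow> \<phi>' x * g y)" using g by simp
  qed
  have i: "integrable (?M \<Otimes>\<^sub>M ?M) (\<lambda>(x, y). ?F x y)"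
    by (rule Bochner_Integration.integrable_bound[OF gp m]) (auto simp: abs_mult split: split_indicator)
  have "(\<integral>x. prim a b g x * \<phi>' x \<partial>?M) = (\<integral>x. (\<integral>y. ?F x y \<partial>?M) \<partial>?M)"
    unfolding prim_def by simp
  also have "\<dots> = (\<integral>y. (\<integral>x. ?F x y \<partial>?M) \<partial>?M)"
    using P.Fubini_integral[OF i] by simp
  also have "\<dots> = (\<integral>y. g y * (\<phi> b - \<phi> y) \<partial>?M)"
  proof (rule Bochner_Integration.integral_cong[OF refl])
    fix y assume "y \<in> space ?M" then have y: "a < y" "y < b" by (auto simp: space_MI)
    have "(\<integral>x. ?F x y \<partial>?M) = (\<integral>x. g y * (indicator {y..b} x * \<phi>' x) \<partial>?M)"
      by (rule Bochner_Integration.integral_cong) (auto simp: space_MI split: split_indicator)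
    also have "\<dots> = g y * (\<phi> b - \<phi> y)" using MI_FTC[OF \<phi>, of y b] y by simp
    finally show "(\<integral>x. ?F x y \<partial>?M) = g y * (\<phi> b - \<phi> y)" .
  qed
  also have "\<dots> = (\<integral>y. g y * \<phi> b - g y * \<phi> y \<partial>?M)" by (simp add: algebra_simps)
  also have "\<dots> = integral\<^sup>L ?M g * \<phi> b - (\<integral>y. g y * \<phi> y \<partial>?M)"
  proof (subst Bochner_Integration.integral_diff)
    have "bounded (\<phi> ` {a..b})" using compact_continuous_image[OF \<phi>c] compact_imp_bounded by blast
    then obtain B0 where B0: "\<forall>y\<in>\<phi> ` {a..b}. norm y \<le> B0" using bounded_iff by blast
    define B where "B = \<bar>B0\<bar>"
    have B: "\<bar>\<phi> x\<bar> \<le> \<bar>B\<bar>" if "a < x" "x < b" for x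
    proof -
      have "norm (\<phi> x) \<le> B0" using B0 that by auto
      then show ?thesis by (simp add: B_def)
    qed
    have "\<phi> \<in> borel_measurable ?M" using continuous_integrable_MI[OF \<phi>c] by auto
    then show "integrable ?M (\<lambda>x. g x * \<phi> x)"
      using B by (intro Bochner_Integration.integrable_bound[OF integrable_mult_left[OF g, of B]] borel_measurable_times AE_I2)
        (auto simp: space_MI abs_mult intro!: mult_left_mono)
  qed (use g in auto)
  finally show ?thesis .
qed

text \<open>Absolute continuity on the closed interval in integrated form. Here g enters only up to
  null sets, whereas f is fixed at every point of [a, b] up to the choice of one constant, so that
  boundary values make sense.\<close>

definition ac_rep :: "real \<Rightarrow> real \<Rightarrow> (real \<Rightarrow> real) \<Rightarrow> (real \<Rightarrow> real) \<Rightarrow> bool" where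
  "ac_rep a b f g \<longleftrightarrow> integrable (MI a b) g \<and> (\<exists>c. \<forall>x\<in>{a..b}. f x = c + prim a b g x)"

text \<open>As X n tends to x, the indicators of {..X n} converge to that of {..x} except possibly
  at the point x, a null set.\<close>

lemma prim_continuous:
  assumes g: "integrable (MI a b) g" shows "continuous_on A (prim a b g)"
proof -
  have "prim a b g \<midarrow>x\<rightarrow> prim a b g x" for x
    unfolding prim_def
  proof (rule tendsto_at_iff_sequentially[THEN iffD2], intro allI impI)
    fix X :: "nat \<Rightarrow> real" assume X: "X \<longlonglongrightarrow> x"
    show "((\<lambda>x. \<integral>y. indicat_real {..x} y * g y \<partial>MI a b) \<circ> X) \<longlonglongrightarrow> (\<integral>y. indicat_real {..x} y * g y \<partial>MI a b)"
      unfolding comp_def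
    proof (rule integral_dominated_convergence[where w = "\<lambda>y. norm (g y)"])
      have "AE y in lebesgue. y \<noteq> x" by (intro AE_completion AE_lborel_singleton)
      then have "AE y in MI a b. y \<noteq> x" unfolding AE_MI by eventually_elim simp
      then show "AE y in MI a b. (\<lambda>i. indicat_real {..X i} y * g y) \<longlonglongrightarrow> indicat_real {..x} y * g y"
      proof eventually_elim
        case (elim y)
        have "\<forall>\<^sub>F i in sequentially. indicat_real {..x} y * g y = indicat_real {..X i} y * g y"
        proof (cases "y < x")
          case True
          have "\<forall>\<^sub>F i in sequentially. y < X i" using order_tendstoD(1)[OF X True] .
          then show ?thesis by (rule eventually_mono) (use True in auto)
        next
          case False
          then have "\<forall>\<^sub>F i in sequentially. X i < y" using order_tendstoD(2)[OF X, of y] elim by auto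
          then show ?thesis by (rule eventually_mono) (use False elim in auto)
        qed
        then show ?case by (rule Lim_transform_eventually[OF tendsto_const])
      qed
      show "(\<lambda>y. indicat_real {..x} y * g y) \<in> borel_measurable (MI a b)" for x
        by (rule borel_measurable_integrable[OF integrable_MI_indicator[OF g]]) simp
      then show "(\<lambda>y. indicat_real {..X i} y * g y) \<in> borel_measurable (MI a b)" for i .
      show "integrable (MI a b) (\<lambda>y. norm (g y))" using g by simp
      show "AE y in MI a b. norm (indicat_real {..X i} y * g y) \<le> norm (g y)" for i
        by (intro AE_I2) (auto split: split_indicator)
    qed
  qed
  then show ?thesis by (simp add: continuous_at_imp_continuous_on isCont_def)
qed

lemma ac_repE:
  assumes "ac_rep a b f g"
  obtains c where "\<And>x. x \<in> {a..b} \<Longrightarrow> f x = c + prim a b g x" "integrable (MI a b) g"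
  using assms unfolding ac_rep_def by blast

lemma ac_rep_continuous: assumes "ac_rep a b f g" shows "continuous_on {a..b} f"
proof -
  obtain c where c: "\<And>x. x \<in> {a..b} \<Longrightarrow> f x = c + prim a b g x" "integrable (MI a b) g"
    using ac_repE[OF assms] by blast
  have "continuous_on {a..b} (\<lambda>x. c + prim a b g x)" by (intro continuous_intros prim_continuous c)
  then show ?thesis by (rule continuous_on_cong[THEN iffD1, rotated -1]) (auto simp: c)
qed

lemma ac_rep_diff:
  assumes "ac_rep a b f g" "x \<in> {a..b}" "y \<in> {a..b}" "x \<le> y"
  shows "f y - f x = (\<integral>z. indicator {x<..y} z * g z \<partial>MI a b)"
proof -
  obtain c where c: "\<And>x. x \<in> {a..b} \<Longrightarrow> f x = c + prim a b g x" "integrable (MI a b) g"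
    using ac_repE[OF assms(1)] by blast
  show ?thesis using prim_diff[OF c(2) assms(4)] assms(2,3) by (simp add: c)
qed

lemma ac_rep_by_parts:
  assumes ab: "a < b" and f: "ac_rep a b f g"
    and \<phi>: "\<And>x. x \<in> {a..b} \<Longrightarrow> (\<phi> has_real_derivative \<phi>' x) (at x within {a..b})" "continuous_on {a..b} \<phi>'"
    and "\<phi> a = 0" "\<phi> b = 0"
  shows "(\<integral>x. f x * \<phi>' x \<partial>MI a b) = - (\<integral>x. g x * \<phi> x \<partial>MI a b)"
proof -
  obtain d where d: "\<And>x. x \<in> {a..b} \<Longrightarrow> f x = d + prim a b g x" and g: "integrable (MI a b) g"
    using ac_repE[OF f] by blast
  have c: "continuous_on {a..b} (\<lambda>x. prim a b g x * \<phi>' x)" by (intro continuous_intros \<phi> prim_continuous g)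
  have "(\<integral>x. f x * \<phi>' x \<partial>MI a b) = (\<integral>x. d * \<phi>' x + prim a b g x * \<phi>' x \<partial>MI a b)"
    by (intro Bochner_Integration.integral_cong) (auto simp: d space_MI algebra_simps)
  also have "\<dots> = d * (\<integral>x. \<phi>' x \<partial>MI a b) + (\<integral>x. prim a b g x * \<phi>' x \<partial>MI a b)"
    using continuous_integrable_MI[OF c] continuous_integrable_MI[OF \<phi>(2)] by simp
  also have "(\<integral>x. \<phi>' x \<partial>MI a b) = (\<integral>x. indicator {a..b} x * \<phi>' x \<partial>MI a b)"
    by (rule Bochner_Integration.integral_cong) (auto simp: space_MI)
  also have "\<dots> = 0" using MI_FTC[OF \<phi>, of a b] assms by simp
  finally show ?thesis using prim_by_parts[OF ab g \<phi>] assms by simp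
qed

section \<open>From weak derivatives to absolutely continuous representatives\<close>

lemma test_fun_boundary: "test_fun {a<..<b} \<phi> \<Longrightarrow> \<phi> a = 0 \<and> \<phi> b = 0"
  unfolding test_fun_iff by auto

lemma ac_rep_has_weak_deriv:
  assumes ab: "a < b" and f: "ac_rep a b f g" shows "has_weak_deriv {a<..<b} 1 f g"
  unfolding has_weak_deriv_def
proof (intro conjI allI impI)
  show "locally_integrable {a<..<b} f" "locally_integrable {a<..<b} g"
    using f continuous_integrable_MI[OF ac_rep_continuous[OF f]]
    by (auto intro!: locally_integrable_MI simp: ac_rep_def)
  fix \<phi> assume t: "test_fun {a<..<b} \<phi>"
  have "(\<integral>x. f x * deriv \<phi> x \<partial>MI a b) = - (\<integral>x. g x * \<phi> x \<partial>MI a b)"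
    by (rule ac_rep_by_parts[OF ab f])
       (use test_fun_boundary[OF t] test_fun_DERIV[OF t] test_fun_continuous[OF test_fun_deriv[OF t]]
         in \<open>auto intro: has_field_derivative_at_within\<close>)
  then show "(LINT x:{a<..<b}|lebesgue. f x * (deriv ^^ 1) \<phi> x) = (- 1) ^ 1 * (LINT x:{a<..<b}|lebesgue. g x * \<phi> x)"
    unfolding LINT_MI by simp
qed

text \<open>The primitive is 0 to the left of the support and constant to the right of it; the zero
  mean makes that constant 0. The support is enclosed in some (lo, hi) with [lo, hi] inside (a, b),
  also when it is empty.\<close>

lemma test_fun_antideriv:
  assumes t: "test_fun {a<..<b} \<psi>" and z: "integral\<^sup>L (MI a b) \<psi> = 0" and ab: "a < b"
  obtains \<Phi> where "test_fun {a<..<b} \<Phi>" "deriv \<Phi> = \<psi>"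
proof -
  obtain K where K: "compact K" "K \<subseteq> {a<..<b}" "\<And>x. x \<notin> K \<Longrightarrow> \<psi> x = 0" using t unfolding test_fun_iff by blast
  obtain lo hi where lh: "a < lo" "lo < hi" "hi < b" "K \<subseteq> {lo<..<hi}"
  proof (cases "K = {}")
    case True
    define d where "d = (b - a) / 3"
    then have "a < a + d" "a + d < b - d" "b - d < b" using ab by (auto simp: field_simps)
    with True show thesis by (intro that[of "a + d" "b - d"]) auto
  next
    case False
    obtain l where l: "l \<in> K" "\<forall>x\<in>K. l \<le> x" using compact_attains_inf[OF K(1) False] by blast
    obtain h where h: "h \<in> K" "\<forall>x\<in>K. x \<le> h" using compact_attains_sup[OF K(1) False] by blast
    have "a < l" "h < b" "l \<le> h" using l h K(2) by auto
    then obtain l' h' where "a < l'" "l' < l" "h < h'" "h' < b" using dense[of a l] dense[of h b] by blast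
    note lh' = this
    have "K \<subseteq> {l'<..<h'}"
    proof
      fix x assume "x \<in> K"
      with l(2) h(2) have "l \<le> x" "x \<le> h" by blast+
      with lh' show "x \<in> {l'<..<h'}" by simp
    qed
    moreover have "l' < h'" using lh' \<open>l \<le> h\<close> by linarith
    ultimately show thesis using lh' by (intro that[of l' h'])
  qed
  have \<psi>c: "continuous_on A \<psi>" for A by (rule test_fun_continuous[OF t])
  define \<Phi> where "\<Phi> x = integral {a..x} \<psi>" for x
  have D1: "(\<Phi> has_real_derivative \<psi> x) (at x within {a..c})" if "x \<in> {a..c}" for x c
    unfolding \<Phi>_def by (rule integral_has_real_derivative[OF \<psi>c that])
  have lo0: "\<Phi> x = 0" if "x \<le> lo" for x
  proof -
    have "\<Phi> x = integral {a..x} (\<lambda>_. 0)" unfolding \<Phi>_def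
      by (rule Henstock_Kurzweil_Integration.integral_cong) (use that lh in \<open>auto intro!: K(3)\<close>)
    then show ?thesis by simp
  qed
  have D: "(\<Phi> has_real_derivative \<psi> x) (at x)" for x
  proof (cases "x > a")
    case True
    then show ?thesis using D1[of x "x + 1"] at_within_interior[of x "{a..x+1}"] by force
  next
    case False
    then have "\<psi> x = 0" using K(2) by (intro K(3)) auto
    moreover have "(\<Phi> has_real_derivative 0) (at x)"
      using False lh lo0 by (subst DERIV_cong_ev[OF refl _ refl, of _ "\<lambda>_. 0"])
        (auto intro!: eventually_nhds_in_open[of "{..<lo}" x, THEN eventually_mono])
    ultimately show ?thesis by simp
  qed
  have \<Phi>0: "\<Phi> a = 0" by (simp add: \<Phi>_def)
  have "(\<integral>x. indicator {a..b} x * \<psi> x \<partial>MI a b) = \<Phi> b - \<Phi> a"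
    by (rule MI_FTC[OF D1 \<psi>c]) (use ab in auto)
  moreover have "(\<integral>x. indicator {a..b} x * \<psi> x \<partial>MI a b) = integral\<^sup>L (MI a b) \<psi>"
    by (rule Bochner_Integration.integral_cong) (auto simp: space_MI)
  ultimately have "\<Phi> b = 0" using z \<Phi>0 by simp
  have hi0: "\<Phi> x = 0" if "x \<ge> hi" for x
  proof -
    have *: "\<Phi> u = \<Phi> w" if "hi \<le> u" and uw: "u < w" for u w
    proof -
      obtain \<xi> where "u < \<xi>" "\<Phi> w - \<Phi> u = (w - u) * \<psi> \<xi>" using MVT2[OF uw D] by blast
      moreover have "\<psi> \<xi> = 0" using \<open>u < \<xi>\<close> that lh by (intro K(3)) auto
      ultimately show ?thesis by simp
    qed
    have "hi \<le> b" using lh by simp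
    have "\<Phi> x = \<Phi> b"
    proof (cases x b rule: linorder_cases)
      case less then show ?thesis by (rule *[OF that])
    next
      case greater then show ?thesis using *[OF \<open>hi \<le> b\<close>] by metis
    qed simp
    then show ?thesis using \<open>\<Phi> b = 0\<close> by simp
  qed
  have "test_fun {a<..<b} \<Phi>"
    unfolding test_fun_iff
  proof (intro conjI exI[of _ "{lo..hi}"])
    show "smooth \<Phi>" using smooth_primitive[OF _ D] t by (simp add: test_fun_iff)
    show "\<forall>x. x \<notin> {lo..hi} \<longrightarrow> \<Phi> x = 0" using lo0 hi0 by force
  qed (use lh in auto)
  moreover have "deriv \<Phi> = \<psi>" using D by (auto intro!: ext DERIV_imp_deriv)
  ultimately show thesis by (rule that)
qed

lemma test_fun_mono: "test_fun S \<phi> \<Longrightarrow> S \<subseteq> T \<Longrightarrow> test_fun T \<phi>"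
  unfolding test_fun_iff by blast

lemma test_fun_mult_integrable_MI:
  "integrable (MI a b) f \<Longrightarrow> test_fun {a<..<b} \<phi> \<Longrightarrow> integrable (MI a b) (\<lambda>x. f x * \<phi> x)"
  using test_fun_mult_integrable[of "{a<..<b}" f \<phi>] locally_integrable_MI[of a b f]
  by (simp add: set_integrable_MI)

text \<open>The difference h = f - prim g annihilates all derivatives of test functions. A test
  function becomes such a derivative after subtracting the multiple of a fixed bump \<beta> that
  removes its mean. So h acts on test functions like the constant c given by its pairing with
  \<beta>.\<close>

lemma du_Bois_Reymond:
  assumes ab: "a < b" and f: "integrable (MI a b) f" and g: "integrable (MI a b) g"
    and w: "\<And>\<phi>. test_fun {a<..<b} \<phi> \<Longrightarrow> (\<integral>x. f x * deriv \<phi> x \<partial>MI a b) = - (\<integral>x. g x * \<phi> x \<partial>MI a b)"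
  shows "\<exists>c. AE x in MI a b. f x = c + prim a b g x"
proof -
  let ?M = "MI a b"
  define h where "h x = f x - prim a b g x" for x
  have pi: "integrable ?M (prim a b g)" by (rule continuous_integrable_MI[OF prim_continuous[OF g]])
  have hi: "integrable ?M h" unfolding h_def using f pi by simp
  have prim_ac: "ac_rep a b (prim a b g) g"
    unfolding ac_rep_def using g by (intro conjI exI[of _ 0]) auto
  have hz: "(\<integral>x. h x * deriv \<phi> x \<partial>?M) = 0" if t: "test_fun {a<..<b} \<phi>" for \<phi>
  proof -
    have "(\<integral>x. h x * deriv \<phi> x \<partial>?M) = (\<integral>x. f x * deriv \<phi> x \<partial>?M) - (\<integral>x. prim a b g x * deriv \<phi> x \<partial>?M)"
      using test_fun_mult_integrable_MI[OF f test_fun_deriv[OF t]] test_fun_mult_integrable_MI[OF pi test_fun_deriv[OF t]]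
      by (simp add: h_def left_diff_distrib)
    moreover have "(\<integral>x. prim a b g x * deriv \<phi> x \<partial>?M) = - (\<integral>x. g x * \<phi> x \<partial>?M)"
      by (rule ac_rep_by_parts[OF ab prim_ac])
         (use test_fun_boundary[OF t] test_fun_DERIV[OF t] test_fun_continuous[OF test_fun_deriv[OF t]]
         in \<open>auto intro: has_field_derivative_at_within\<close>)
    ultimately show ?thesis using w[OF t] by simp
  qed
  define d where "d = (b - a) / 3"
  define \<beta> where "\<beta> = bump 0 (a + d) (b - d)"
  have d: "a < a + d" "a + d < b - d" "b - d < b" using ab by (auto simp: d_def field_simps)
  have \<beta>t: "test_fun {a<..<b} \<beta>" unfolding \<beta>_def using d by (intro test_fun_bump) auto
  have \<beta>i: "integrable ?M \<beta>" by (rule continuous_integrable_MI[OF test_fun_continuous[OF \<beta>t]])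
  have I: "integral\<^sup>L ?M \<beta> \<noteq> 0"
  proof
    assume "integral\<^sup>L ?M \<beta> = 0"
    then have "AE x in ?M. \<beta> x = 0"
      using integral_nonneg_eq_0_iff_AE[OF \<beta>i] bump_range(1) by (simp add: \<beta>_def)
    then have "AE x in ?M. x \<notin> {a+d<..<b-d}"
    proof eventually_elim
      case (elim x)
      then show ?case using bump_pos[of x "a + d" "b - d" 0] unfolding \<beta>_def by (metis less_irrefl)
    qed
    then have "AE x in lebesgue. x \<notin> {a+d<..<b-d}"
      unfolding AE_MI by eventually_elim (use d in auto)
    then have "{a+d<..<b-d} \<in> null_sets lebesgue" by (subst AE_iff_null_sets) auto
    then have "emeasure lebesgue {a+d<..<b-d} = 0" by auto
    then show False using d by simp
  qed
  define c where "c = (\<integral>x. h x * \<beta> x \<partial>?M) / integral\<^sup>L ?M \<beta>"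
  have "AE x in lebesgue. x \<in> {a<..<b} \<longrightarrow> h x - c = 0"
  proof (rule fundamental_lemma)
    show "locally_integrable {a<..<b} (\<lambda>x. h x - c)"
      using hi finite_MI[of a b] by (intro locally_integrable_MI Bochner_Integration.integrable_diff)
        (auto simp: finite_measure.integrable_const)
    fix \<psi> assume t: "test_fun {a<..<b} \<psi>"
    let ?I = "integral\<^sup>L ?M \<psi> / integral\<^sup>L ?M \<beta>"
    have \<psi>i: "integrable ?M \<psi>" by (rule continuous_integrable_MI[OF test_fun_continuous[OF t]])
    have t': "test_fun {a<..<b} (\<lambda>x. \<psi> x + (- ?I) * \<beta> x)"
      by (intro test_fun_add test_fun_cmult t \<beta>t)
    have "integral\<^sup>L ?M (\<lambda>x. \<psi> x + (- ?I) * \<beta> x) = 0" using \<psi>i \<beta>i I by simp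
    then obtain \<Phi> where \<Phi>: "test_fun {a<..<b} \<Phi>" "deriv \<Phi> = (\<lambda>x. \<psi> x + (- ?I) * \<beta> x)"
      using test_fun_antideriv[OF t' _ ab] by blast
    have i: "integrable ?M (\<lambda>x. h x * \<psi> x)" "integrable ?M (\<lambda>x. h x * \<beta> x)"
      using test_fun_mult_integrable_MI hi t \<beta>t by auto
    have "0 = (\<integral>x. h x * (\<psi> x + (- ?I) * \<beta> x) \<partial>?M)" using hz[OF \<Phi>(1)] \<Phi>(2) by simp
    also have "\<dots> = (\<integral>x. h x * \<psi> x + (- ?I) * (h x * \<beta> x) \<partial>?M)" by (simp add: algebra_simps)
    also have "\<dots> = (\<integral>x. h x * \<psi> x \<partial>?M) - ?I * (\<integral>x. h x * \<beta> x \<partial>?M)"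
      using i by simp
    also have "\<dots> = (\<integral>x. h x * \<psi> x \<partial>?M) - c * integral\<^sup>L ?M \<psi>"
      by (simp add: c_def)
    also have "\<dots> = (\<integral>x. (h x - c) * \<psi> x \<partial>?M)"
      using i \<psi>i by (simp add: left_diff_distrib)
    finally show "(LINT x:{a<..<b}|lebesgue. (h x - c) * \<psi> x) = 0" by (simp add: LINT_MI)
  qed auto
  then have "AE x in ?M. f x = c + prim a b g x"
    unfolding AE_MI h_def by eventually_elim auto
  then show ?thesis by blast
qed

text \<open>The set where f = g is closed and has full measure in (a, b); it therefore contains (a,
  b) and its closure.\<close>

lemma continuous_eq_of_AE:
  assumes ab: "a < b" and "continuous_on {a..b} f" "continuous_on {a..b} (g :: real \<Rightarrow> real)" "AE x in MI a b. f x = g x"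
    and x: "x \<in> {a..b}"
  shows "f x = g x"
proof -
  let ?C = "{x \<in> {a..b}. f x = g x}"
  have "closed {x \<in> {a..b}. f x - g x = 0}"
    by (intro continuous_closed_preimage_constant continuous_on_diff assms closed_atLeastAtMost)
  then have cl: "closed ?C" by simp
  have "{a<..<b} \<subseteq> ?C"
  proof
    fix y assume y: "y \<in> {a<..<b}"
    have "AE x\<in>{a<..<b} in lebesgue. x \<in> ?C" using assms(4) unfolding AE_MI by eventually_elim auto
    then show "y \<in> ?C" using mem_closed_if_AE_lebesgue_open[OF _ cl _ y] by auto
  qed
  then have "closure {a<..<b} \<subseteq> ?C" using cl closure_minimal by blast
  then show ?thesis using x ab by auto
qed

lemma weak_deriv_ac_rep:
  assumes ab: "a < b" and w: "has_weak_deriv {a<..<b} 1 f g" and f: "integrable (MI a b) f" and g: "integrable (MI a b) g"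
  obtains u where "ac_rep a b u g" "AE x in MI a b. f x = u x"
proof -
  have "(\<integral>x. f x * deriv \<phi> x \<partial>MI a b) = - (\<integral>x. g x * \<phi> x \<partial>MI a b)" if "test_fun {a<..<b} \<phi>" for \<phi>
    using w that unfolding has_weak_deriv_def LINT_MI by simp
  from du_Bois_Reymond[OF ab f g this] obtain c where "AE x in MI a b. f x = c + prim a b g x" by auto
  moreover have "ac_rep a b (\<lambda>x. c + prim a b g x) g" using g unfolding ac_rep_def by blast
  ultimately show thesis by (intro that[of "\<lambda>x. c + prim a b g x"])
qed

text \<open>The weak equation determines y on (0, T) up to a constant and a null set. Continuity up
  to 0 turns this into an identity at every pair of times, the initial time included.\<close>

lemma time_primitive:
  assumes y: "continuous_on {0..} y" and z: "\<And>T. T > 0 \<Longrightarrow> integrable (MI 0 T) z"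
    and w: "\<And>\<eta>. test_fun {0<..} \<eta> \<Longrightarrow> (LINT t:{0<..}|lebesgue. deriv \<eta> t * y t) = - (LINT t:{0<..}|lebesgue. \<eta> t * z t)"
    and st: "0 \<le> s" "s \<le> t" "t \<le> T" "0 < T"
  shows "y t - y s = (\<integral>\<tau>. indicator {s<..t} \<tau> * z \<tau> \<partial>MI 0 T)"
proof -
  have yc: "continuous_on {0..T} y" using y by (rule continuous_on_subset) auto
  have zi: "integrable (MI 0 T) z" using z st by simp
  have yi: "integrable (MI 0 T) y" by (rule continuous_integrable_MI[OF yc])
  have red: "(LINT t:{0<..}|lebesgue. \<phi> t * u t) = (\<integral>x. u x * \<phi> x \<partial>MI 0 T)"
    if "\<And>x. x \<notin> {0<..<T} \<Longrightarrow> \<phi> x = 0" for \<phi> u :: "real \<Rightarrow> real"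
    unfolding LINT_MI[symmetric] set_lebesgue_integral_def
    by (rule Bochner_Integration.integral_cong) (use that in \<open>auto split: split_indicator\<close>)
  have "\<exists>c. AE x in MI 0 T. y x = c + prim 0 T z x"
  proof (rule du_Bois_Reymond[OF st(4) yi zi])
    fix \<phi> assume t: "test_fun {0<..<T} \<phi>"
    have o: "\<psi> x = 0" if "test_fun {0<..<T} \<psi>" "x \<notin> {0<..<T}" for \<psi> x
      using that unfolding test_fun_iff by blast
    have "test_fun {0<..} \<phi>" using t by (rule test_fun_mono) auto
    from w[OF this] show "(\<integral>x. y x * deriv \<phi> x \<partial>MI 0 T) = - (\<integral>x. z x * \<phi> x \<partial>MI 0 T)"
      using red[of "deriv \<phi>" y] red[of \<phi> z] o[OF t] o[OF test_fun_deriv[OF t]] by simp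
  qed
  then obtain c where c: "AE x in MI 0 T. y x = c + prim 0 T z x" by blast
  have eq: "y x = c + prim 0 T z x" if "x \<in> {0..T}" for x
    by (rule continuous_eq_of_AE[OF st(4) yc _ c that]) (intro continuous_intros prim_continuous zi)
  show ?thesis using prim_diff[OF zi st(2)] eq[of t] eq[of s] st by simp
qed

text \<open>Insert \<phi>' as test function into the relation of order j and compare with the
  relation of order j + 1 tested with \<phi>.\<close>

lemma has_weak_deriv_step:
  assumes "has_weak_deriv S (Suc j) f h" "has_weak_deriv S j f g"
  shows "has_weak_deriv S 1 g h"
  unfolding has_weak_deriv_def
proof (intro conjI allI impI)
  show "locally_integrable S g" "locally_integrable S h" using assms by (auto simp: has_weak_deriv_def)
  fix \<phi> assume t: "test_fun S \<phi>"
  have "(LINT x:S|lebesgue. f x * (deriv ^^ Suc j) \<phi> x) = (-1) ^ Suc j * (LINT x:S|lebesgue. h x * \<phi> x)"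
    using assms(1) t unfolding has_weak_deriv_def by blast
  moreover have "(LINT x:S|lebesgue. f x * (deriv ^^ j) (deriv \<phi>) x) = (-1) ^ j * (LINT x:S|lebesgue. g x * deriv \<phi> x)"
    using assms(2) test_fun_deriv[OF t] unfolding has_weak_deriv_def by blast
  moreover have "(deriv ^^ j) (deriv \<phi>) = (deriv ^^ Suc j) \<phi>" by (simp add: funpow_swap1)
  ultimately have "(-1) ^ j * (LINT x:S|lebesgue. g x * deriv \<phi> x) = (-1) ^ j * (- (LINT x:S|lebesgue. h x * \<phi> x))" by simp
  then have "(LINT x:S|lebesgue. g x * deriv \<phi> x) = - (LINT x:S|lebesgue. h x * \<phi> x)"
    by (rule mult_left_cancel[THEN iffD1, rotated]) simp
  then show "(LINT x:S|lebesgue. g x * (deriv ^^ 1) \<phi> x) = (- 1) ^ 1 * (LINT x:S|lebesgue. h x * \<phi> x)" by simp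
qed

text \<open>The function is the pointwise limit of its restrictions to compact intervals exhausting
  (a, b). This supplies measurability of \<open>wderiv\<close>, a chosen function of which the
  definition grants local integrability only.\<close>

lemma locally_integrable_measurable:
  assumes "locally_integrable {a<..<b} f" shows "f \<in> borel_measurable (MI a b)"
proof (rule borel_measurable_LIMSEQ_metric[where f = "\<lambda>n x. indicator {a + 1 / real (Suc n)..b - 1 / real (Suc n)} x * f x"])
  fix n :: nat
  have "a < a + 1 / real (Suc n)" "b - 1 / real (Suc n) < b" by auto
  then have "{a + 1 / real (Suc n)..b - 1 / real (Suc n)} \<subseteq> {a<..<b}"
    by (meson atLeastAtMost_iff greaterThanLessThan_iff le_less_trans less_le_trans subsetI)
  from locally_integrableD[OF assms _ this]
  show "(\<lambda>x. indicator {a + 1 / real (Suc n)..b - 1 / real (Suc n)} x * f x) \<in> borel_measurable (MI a b)"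
    by (intro measurable_restrict_space1) auto
next
  fix x assume "x \<in> space (MI a b)"
  then have x: "a < x" "x < b" by (auto simp: space_MI)
  have l: "(\<lambda>n. 1 / real (Suc n)) \<longlonglongrightarrow> 0" by (rule LIMSEQ_Suc[OF lim_1_over_n])
  have "\<forall>\<^sub>F n in sequentially. 1 / real (Suc n) < x - a" "\<forall>\<^sub>F n in sequentially. 1 / real (Suc n) < b - x"
    using order_tendstoD(2)[OF l] x by auto
  then have "\<forall>\<^sub>F n in sequentially. f x = indicator {a + 1 / real (Suc n)..b - 1 / real (Suc n)} x * f x"
  proof eventually_elim
    case (elim n)
    then have "x \<in> {a + 1 / real (Suc n)..b - 1 / real (Suc n)}" unfolding atLeastAtMost_iff by linarith
    then show ?case by simp
  qed
  then show "(\<lambda>n. indicator {a + 1 / real (Suc n)..b - 1 / real (Suc n)} x * f x) \<longlonglongrightarrow> f x"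
    by (rule Lim_transform_eventually[OF tendsto_const])
qed

section \<open>Sobolev functions and their chosen weak derivatives\<close>

lemma abs_le_1_plus_powr: "1 \<le> p \<Longrightarrow> \<bar>x::real\<bar> \<le> 1 + \<bar>x\<bar> powr p"
proof (cases "\<bar>x\<bar> \<le> 1")
  case True then show ?thesis by (simp add: add_increasing2)
next
  case False assume "1 \<le> p"
  then have "\<bar>x\<bar> powr 1 \<le> \<bar>x\<bar> powr p" using False by (intro powr_mono) auto
  then show ?thesis using False by simp
qed

lemma (in finite_measure) integrable_of_powr:
  fixes f :: "'a \<Rightarrow> real"
  assumes "1 \<le> p" "f \<in> borel_measurable M" "integrable M (\<lambda>x. \<bar>f x\<bar> powr p)"
  shows "integrable M f"
proof (rule Bochner_Integration.integrable_bound)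
  show "integrable M (\<lambda>x. 1 + \<bar>f x\<bar> powr p)" using assms by (simp add: integrable_const)
  have "norm (f x) \<le> norm (1 + \<bar>f x\<bar> powr p)" for x
    using abs_le_1_plus_powr[OF assms(1), of "f x"] by simp
  then show "AE x in M. norm (f x) \<le> norm (1 + \<bar>f x\<bar> powr p)" by (intro AE_I2)
qed (rule assms)

text \<open>Membership in the Sobolev space speaks of some derivative in L_p; uniqueness almost
  everywhere transfers its integrability to the choice \<open>wderiv\<close>.\<close>

lemma sobolev_wderiv:
  assumes f: "f \<in> sobolev k p {a<..<b}" and j: "j \<le> k"
  shows "has_weak_deriv {a<..<b} j f (wderiv {a<..<b} j f)"
    "wderiv {a<..<b} j f \<in> borel_measurable (MI a b)"
    "integrable (MI a b) (\<lambda>x. \<bar>wderiv {a<..<b} j f x\<bar> powr p)"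
proof -
  obtain g where g: "g \<in> Lp_space p {a<..<b}" "has_weak_deriv {a<..<b} j f g"
    using f j unfolding sobolev_def by blast
  show w: "has_weak_deriv {a<..<b} j f (wderiv {a<..<b} j f)" by (rule wderiv_has[OF g(2)])
  then show m: "wderiv {a<..<b} j f \<in> borel_measurable (MI a b)"
    by (auto intro!: locally_integrable_measurable simp: has_weak_deriv_def)
  have "AE x in MI a b. wderiv {a<..<b} j f x = g x"
    unfolding AE_MI using wderiv_AE[OF _ g(2)] by auto
  then have "AE x in MI a b. \<bar>g x\<bar> powr p = \<bar>wderiv {a<..<b} j f x\<bar> powr p" by eventually_elim simp
  then show "integrable (MI a b) (\<lambda>x. \<bar>wderiv {a<..<b} j f x\<bar> powr p)"
  proof (rule integrable_cong_AE_imp[rotated 2])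
    show "integrable (MI a b) (\<lambda>x. \<bar>g x\<bar> powr p)" using g(1) by (simp add: Lp_space_def)
    show "(\<lambda>x. \<bar>wderiv {a<..<b} j f x\<bar> powr p) \<in> borel_measurable (MI a b)" using m by measurable
  qed
qed

lemma sobolev_wderiv_integrable:
  assumes "f \<in> sobolev k p {a<..<b}" "j \<le> k" "1 \<le> p"
  shows "integrable (MI a b) (wderiv {a<..<b} j f)"
  using sobolev_wderiv[OF assms(1,2)] finite_measure.integrable_of_powr[OF finite_MI assms(3)] by blast

lemma wderiv_0: "f \<in> sobolev k p {a<..<b} \<Longrightarrow> AE x in MI a b. wderiv {a<..<b} 0 f x = f x"
proof -
  assume f: "f \<in> sobolev k p {a<..<b}"
  then obtain g where "has_weak_deriv {a<..<b} 0 f g" unfolding sobolev_def by blast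
  then have "locally_integrable {a<..<b} f" by (simp add: has_weak_deriv_def)
  then have "has_weak_deriv {a<..<b} 0 f f" by (simp add: has_weak_deriv_def)
  then show ?thesis unfolding AE_MI by (intro wderiv_AE) auto
qed

lemma sobolevI:
  assumes "f \<in> borel_measurable (MI a b)" "integrable (MI a b) (\<lambda>x. \<bar>f x\<bar> powr p)"
    "g \<in> borel_measurable (MI a b)" "integrable (MI a b) (\<lambda>x. \<bar>g x\<bar> powr p)" "has_weak_deriv {a<..<b} 1 f g"
  shows "f \<in> sobolev 1 p {a<..<b}"
proof -
  have "has_weak_deriv {a<..<b} 0 f f" using assms(5) by (simp add: has_weak_deriv_def)
  moreover have "j = 0 \<or> j = 1" if "j \<le> 1" for j :: nat using that by auto
  ultimately show ?thesis using assms unfolding sobolev_def Lp_space_def by blast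
qed

lemma sobolev_wderiv_step:
  assumes "f \<in> sobolev k p {a<..<b}" "Suc j \<le> k"
  shows "has_weak_deriv {a<..<b} 1 (wderiv {a<..<b} j f) (wderiv {a<..<b} (Suc j) f)"
  using has_weak_deriv_step[OF sobolev_wderiv(1)[OF assms] sobolev_wderiv(1)[OF assms(1)]] assms(2) by simp

text \<open>The du Bois-Reymond lemma is applied to w, w_x and w_xx in turn. The continuous function
  that witnesses the boundary condition agrees with u1 almost everywhere, hence also at the
  endpoints.\<close>

lemma sobolev3_B_ac_rep:
  assumes ab: "a < b" and p: "1 \<le> p" and w: "w \<in> sobolev3_B p {a<..<b}"
  obtains u u1 u2 where
    "ac_rep a b u (wderiv {a<..<b} 1 w)" "AE x in MI a b. w x = u x"
    "ac_rep a b u1 (wderiv {a<..<b} 2 w)" "AE x in MI a b. wderiv {a<..<b} 1 w x = u1 x"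
    "ac_rep a b u2 (wderiv {a<..<b} 3 w)" "AE x in MI a b. wderiv {a<..<b} 2 w x = u2 x"
    "u1 a = 0" "u1 b = 0"
proof -
  have s: "w \<in> sobolev 3 p {a<..<b}" and zb: "zero_on_boundary {a<..<b} (wderiv {a<..<b} 1 w)"
    using w by (auto simp: sobolev3_B_def)
  note i = sobolev_wderiv_integrable[OF s _ p]
  obtain u where u: "ac_rep a b u (wderiv {a<..<b} 1 w)" "AE x in MI a b. wderiv {a<..<b} 0 w x = u x"
    using weak_deriv_ac_rep[OF ab sobolev_wderiv_step[OF s, of 0] i i] by auto
  have u': "AE x in MI a b. w x = u x" using u(2) wderiv_0[OF s] by eventually_elim simp
  obtain u1 where u1: "ac_rep a b u1 (wderiv {a<..<b} 2 w)" "AE x in MI a b. wderiv {a<..<b} 1 w x = u1 x"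
    using weak_deriv_ac_rep[OF ab sobolev_wderiv_step[OF s, of 1] i i] by (auto simp: numeral_2_eq_2)
  obtain u2 where u2: "ac_rep a b u2 (wderiv {a<..<b} 3 w)" "AE x in MI a b. wderiv {a<..<b} 2 w x = u2 x"
    using weak_deriv_ac_rep[OF ab sobolev_wderiv_step[OF s, of 2] i i] by (auto simp: numeral_2_eq_2 numeral_3_eq_3)
  obtain g where g: "continuous_on (closure {a<..<b}) g" "AE x in MI a b. g x = wderiv {a<..<b} 1 w x" "\<forall>x\<in>frontier {a<..<b}. g x = 0"
    using zb unfolding zero_on_boundary_def by blast
  have gc: "continuous_on {a..b} g" using g(1) ab by simp
  have "AE x in MI a b. u1 x = g x" using g(2) u1(2) by eventually_elim simp
  from continuous_eq_of_AE[OF ab ac_rep_continuous[OF u1(1)] gc this]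
  have "u1 a = g a" "u1 b = g b" using ab by auto
  moreover have "frontier {a<..<b} = {a, b}" using ab by (auto simp: frontier_def)
  ultimately have "u1 a = 0" "u1 b = 0" using g(3) by auto
  with u u' u1 u2 show thesis by (intro that[of u u1 u2])
qed

section \<open>A chain rule by averaging over time shifts\<close>

lemma AE_lborel_shift:
  fixes P :: "real \<Rightarrow> bool"
  assumes "AE t in lborel. P t" shows "AE t in lborel. P (t + c :: real)"
proof -
  have "AE t in distr lborel borel ((+) c). P t" using assms by (subst lborel_distr_plus)
  then have "AE t in lborel. P (c + t)" by (rule AE_distrD[rotated]) simp
  then show ?thesis by (simp add: add.commute)
qed

lemma integral_lborel_shift: "(\<integral>t. f (t + c) \<partial>lborel) = (\<integral>t. f t \<partial>lborel)" for f :: "real \<Rightarrow> real" and c :: real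
  using lborel_integral_real_affine[of 1 f c] by (simp add: add.commute)

lemma integrable_lborel_shift: "integrable lborel f \<Longrightarrow> integrable lborel (\<lambda>t. f (t + c))" for f :: "real \<Rightarrow> real" and c :: real
  using lborel_integrable_real_affine[of f 1 c] by (simp add: add.commute)

definition transl_cont :: "(real \<Rightarrow> real) \<Rightarrow> bool" where
  "transl_cont g \<longleftrightarrow> (\<forall>\<theta>. \<theta> \<longlonglongrightarrow> 0 \<longrightarrow> (\<lambda>n. \<integral>t. \<bar>g (t + \<theta> n) - g t\<bar> \<partial>lborel) \<longlonglongrightarrow> 0)"

text \<open>Three-term estimate: by translation invariance the approximation error and its shifted
  copy have the same integral, below r/4 each.\<close>

lemma transl_cont_approx:
  assumes g: "integrable lborel g"
    and a: "\<And>\<epsilon>. \<epsilon> > 0 \<Longrightarrow> \<exists>h. integrable lborel h \<and> transl_cont h \<and> (\<integral>t. \<bar>g t - h t\<bar> \<partial>lborel) < \<epsilon>"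
  shows "transl_cont g"
  unfolding transl_cont_def
proof (intro allI impI)
  fix \<theta> :: "nat \<Rightarrow> real" assume \<theta>: "\<theta> \<longlonglongrightarrow> 0"
  show "(\<lambda>n. \<integral>t. \<bar>g (t + \<theta> n) - g t\<bar> \<partial>lborel) \<longlonglongrightarrow> 0"
  proof (rule LIMSEQ_I)
    fix r :: real assume r: "r > 0"
    obtain h where h: "integrable lborel h" "transl_cont h" "(\<integral>t. \<bar>g t - h t\<bar> \<partial>lborel) < r / 4" using a[of "r/4"] r by auto
    have "(\<lambda>n. \<integral>t. \<bar>h (t + \<theta> n) - h t\<bar> \<partial>lborel) \<longlonglongrightarrow> 0" using h(2) \<theta> unfolding transl_cont_def by blast
    then obtain N where N: "\<And>n. n \<ge> N \<Longrightarrow> norm ((\<integral>t. \<bar>h (t + \<theta> n) - h t\<bar> \<partial>lborel) - 0) < r / 4"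
      using LIMSEQ_D[of _ 0 "r/4"] r by fastforce
    show "\<exists>no. \<forall>n\<ge>no. norm ((\<integral>t. \<bar>g (t + \<theta> n) - g t\<bar> \<partial>lborel) - 0) < r"
    proof (intro exI[of _ N] allI impI)
      fix n assume n: "n \<ge> N"
      have i: "integrable lborel (\<lambda>t. \<bar>g t - h t\<bar>)" using g h(1) by (intro integrable_abs Bochner_Integration.integrable_diff)
      have i2: "integrable lborel (\<lambda>t. \<bar>h (t + \<theta> n) - h t\<bar>)"
        by (intro integrable_abs Bochner_Integration.integrable_diff integrable_lborel_shift[OF h(1)] h(1))
      have i3: "integrable lborel (\<lambda>t. \<bar>g (t + \<theta> n) - g t\<bar>)"
        by (intro integrable_abs Bochner_Integration.integrable_diff integrable_lborel_shift[OF g] g)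
      note ish = integrable_lborel_shift[OF i, of "\<theta> n"]
      have "(\<integral>t. \<bar>g (t + \<theta> n) - g t\<bar> \<partial>lborel) \<le> (\<integral>t. \<bar>g (t + \<theta> n) - h (t + \<theta> n)\<bar> + (\<bar>h (t + \<theta> n) - h t\<bar> + \<bar>g t - h t\<bar>) \<partial>lborel)"
        by (intro integral_mono i3 Bochner_Integration.integrable_add i i2 ish) auto
      also have "\<dots> = (\<integral>t. \<bar>g (t + \<theta> n) - h (t + \<theta> n)\<bar> \<partial>lborel) + ((\<integral>t. \<bar>h (t + \<theta> n) - h t\<bar> \<partial>lborel) + (\<integral>t. \<bar>g t - h t\<bar> \<partial>lborel))"
        using i i2 ish by simp
      also have "(\<integral>t. \<bar>g (t + \<theta> n) - h (t + \<theta> n)\<bar> \<partial>lborel) = (\<integral>t. \<bar>g t - h t\<bar> \<partial>lborel)"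
        using integral_lborel_shift[of "\<lambda>t. \<bar>g t - h t\<bar>" "\<theta> n"] by simp
      finally show "norm ((\<integral>t. \<bar>g (t + \<theta> n) - g t\<bar> \<partial>lborel) - 0) < r"
        using N[OF n] h(3) r by (simp add: integral_nonneg_AE)
    qed
  qed
qed

text \<open>A point of U stays in U under small shifts, so the positive part of g(t) - g(t +
  \<theta>) tends to 0, dominated by g. Since shifts preserve the integral, the positive and the
  negative part of the difference have equal integrals, and the whole is twice the first.\<close>

lemma transl_cont_open:
  assumes U: "open U" and fin: "emeasure lborel U < \<infinity>"
  shows "transl_cont (indicator U)"
  unfolding transl_cont_def
proof (intro allI impI)
  fix \<theta> :: "nat \<Rightarrow> real" assume \<theta>: "\<theta> \<longlonglongrightarrow> 0"
  let ?g = "indicat_real U"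
  have g: "integrable lborel ?g" using U fin by (intro integrable_real_indicator) auto
  let ?m = "\<lambda>n t. max 0 (?g t - ?g (t + \<theta> n))"
  have mi: "integrable lborel (?m n)" for n
    using Bochner_Integration.integrable_diff[OF g integrable_lborel_shift[OF g]] by (intro integrable_max) auto
  have "(\<lambda>n. \<integral>t. ?m n t \<partial>lborel) \<longlonglongrightarrow> (\<integral>t. 0 \<partial>(lborel::real measure))"
  proof (rule integral_dominated_convergence[where w = ?g])
    show "AE t in lborel. (\<lambda>n. ?m n t) \<longlonglongrightarrow> 0"
    proof (rule AE_I2)
      fix t
      show "(\<lambda>n. ?m n t) \<longlonglongrightarrow> 0"
      proof (cases "t \<in> U")
        case True
        have "(\<lambda>n. t + \<theta> n) \<longlonglongrightarrow> t" using tendsto_add[OF tendsto_const \<theta>, of t] by simp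
        then have "\<forall>\<^sub>F n in sequentially. t + \<theta> n \<in> U" using U True topological_tendstoD by blast
        then have "\<forall>\<^sub>F n in sequentially. 0 = ?m n t" by eventually_elim (use True in simp)
        then show ?thesis by (rule Lim_transform_eventually[OF tendsto_const])
      next
        case False
        then have "?m n t = 0" for n by (auto split: split_indicator)
        then show ?thesis by simp
      qed
    qed
    show "AE t in lborel. norm (?m n t) \<le> ?g t" for n
      by (intro AE_I2) (auto split: split_indicator)
  qed (use g mi in \<open>auto dest: borel_measurable_integrable\<close>)
  then have "(\<lambda>n. 2 * (\<integral>t. ?m n t \<partial>lborel)) \<longlonglongrightarrow> 2 * 0" by (intro tendsto_mult tendsto_const) simp
  moreover have "2 * (\<integral>t. ?m n t \<partial>lborel) = (\<integral>t. \<bar>?g (t + \<theta> n) - ?g t\<bar> \<partial>lborel)" for n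
  proof -
    have "(\<integral>t. \<bar>?g (t + \<theta> n) - ?g t\<bar> \<partial>lborel) = (\<integral>t. 2 * ?m n t + (?g (t + \<theta> n) - ?g t) \<partial>lborel)"
      by (intro Bochner_Integration.integral_cong) (auto split: split_indicator)
    also have "\<dots> = 2 * (\<integral>t. ?m n t \<partial>lborel) + ((\<integral>t. ?g (t + \<theta> n) \<partial>lborel) - (\<integral>t. ?g t \<partial>lborel))"
      using mi g integrable_lborel_shift[OF g] by simp
    finally show ?thesis using integral_lborel_shift[of ?g] by simp
  qed
  ultimately show "(\<lambda>n. \<integral>t. \<bar>?g (t + \<theta> n) - ?g t\<bar> \<partial>lborel) \<longlonglongrightarrow> 0" by simp
qed

lemma transl_cont_cmult: assumes "transl_cont g" shows "transl_cont (\<lambda>t. c * g t)"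
  unfolding transl_cont_def
proof (intro allI impI)
  fix \<theta> :: "nat \<Rightarrow> real" assume "\<theta> \<longlonglongrightarrow> 0"
  then have "(\<lambda>n. \<bar>c\<bar> * (\<integral>t. \<bar>g (t + \<theta> n) - g t\<bar> \<partial>lborel)) \<longlonglongrightarrow> \<bar>c\<bar> * 0"
    using assms unfolding transl_cont_def by (intro tendsto_mult tendsto_const) blast
  moreover have "\<bar>c\<bar> * (\<integral>t. \<bar>g (t + \<theta> n) - g t\<bar> \<partial>lborel) = (\<integral>t. \<bar>c * g (t + \<theta> n) - c * g t\<bar> \<partial>lborel)" for n
    by (simp add: abs_mult flip: right_diff_distrib)
  ultimately show "(\<lambda>n. \<integral>t. \<bar>c * g (t + \<theta> n) - c * g t\<bar> \<partial>lborel) \<longlonglongrightarrow> 0" by simp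
qed

text \<open>Measurable sets are reached from open ones by outer regularity, limits of simple
  functions by the approximation lemma.\<close>

lemma transl_cont_integrable: "integrable lborel g \<Longrightarrow> transl_cont (g :: real \<Rightarrow> real)"
proof (induction rule: integrable_induct)
  case (base A c)
  have iA: "integrable lborel (indicat_real A)" using base by (intro integrable_real_indicator) auto
  have "transl_cont (indicat_real A)"
  proof (rule transl_cont_approx[OF iA])
    fix \<epsilon> :: real assume e: "\<epsilon> > 0"
    have "A \<in> sets lebesgue" using base by auto
    then obtain U where U: "open U" "A \<subseteq> U" "(U - A) \<in> lmeasurable" "emeasure lebesgue (U - A) < ennreal \<epsilon>"
      using sets_lebesgue_outer_open[of A \<epsilon>] e by auto
    have UA: "emeasure lborel (U - A) < ennreal \<epsilon>" using U base by (simp add: emeasure_completion)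
    have "emeasure lborel U = emeasure lborel (A \<union> (U - A))" using U(2) by (simp add: Un_absorb1)
    also have "\<dots> \<le> emeasure lborel A + emeasure lborel (U - A)"
      using base U(1) by (intro emeasure_subadditive) auto
    also have "\<dots> < \<infinity>" using base order.strict_trans[OF UA ennreal_less_top] by auto
    finally have fU: "emeasure lborel U < \<infinity>" .
    have "(\<integral>t. \<bar>indicat_real A t - indicat_real U t\<bar> \<partial>lborel) = (\<integral>t. indicat_real (U - A) t \<partial>lborel)"
      using U(2) by (intro Bochner_Integration.integral_cong) (auto split: split_indicator)
    also have "\<dots> = measure lborel (U - A)" using U(1) base by simp
    also have "\<dots> < \<epsilon>"
    proof -
      have "emeasure lborel (U - A) = ennreal (measure lborel (U - A))"
        using UA by (intro emeasure_eq_ennreal_measure) auto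
      then show ?thesis using UA by (simp add: ennreal_less_iff)
    qed
    finally show "\<exists>h. integrable lborel h \<and> transl_cont h \<and> (\<integral>t. \<bar>indicat_real A t - h t\<bar> \<partial>lborel) < \<epsilon>"
      using transl_cont_open[OF U(1) fU] U(1) fU by (intro exI[of _ "indicat_real U"] conjI integrable_real_indicator) auto
  qed
  from transl_cont_cmult[OF this, of c] show ?case by (simp add: mult.commute)
next
  case (add f g)
  show ?case unfolding transl_cont_def
  proof (intro allI impI)
    fix \<theta> :: "nat \<Rightarrow> real" assume "\<theta> \<longlonglongrightarrow> 0"
    then have l: "(\<lambda>n. (\<integral>t. \<bar>f (t + \<theta> n) - f t\<bar> \<partial>lborel) + (\<integral>t. \<bar>g (t + \<theta> n) - g t\<bar> \<partial>lborel)) \<longlonglongrightarrow> 0"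
      using add.IH tendsto_add[of _ 0 sequentially _ 0] unfolding transl_cont_def by fastforce
    have i: "integrable lborel (\<lambda>t. \<bar>u (t + \<theta> n) - u t\<bar>)" if "integrable lborel u" for u :: "real \<Rightarrow> real" and n
      by (intro integrable_abs Bochner_Integration.integrable_diff integrable_lborel_shift[OF that] that)
    show "(\<lambda>n. \<integral>t. \<bar>(f (t + \<theta> n) + g (t + \<theta> n)) - (f t + g t)\<bar> \<partial>lborel) \<longlonglongrightarrow> 0"
    proof (rule tendsto_sandwich[OF _ _ tendsto_const l])
      show "\<forall>\<^sub>F n in sequentially. 0 \<le> (\<integral>t. \<bar>(f (t + \<theta> n) + g (t + \<theta> n)) - (f t + g t)\<bar> \<partial>lborel)"
        by (intro always_eventually allI integral_nonneg_AE) auto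
      show "\<forall>\<^sub>F n in sequentially. (\<integral>t. \<bar>(f (t + \<theta> n) + g (t + \<theta> n)) - (f t + g t)\<bar> \<partial>lborel) \<le> (\<integral>t. \<bar>f (t + \<theta> n) - f t\<bar> \<partial>lborel) + (\<integral>t. \<bar>g (t + \<theta> n) - g t\<bar> \<partial>lborel)"
      proof (intro always_eventually allI)
        fix n
        have "(\<integral>t. \<bar>(f (t + \<theta> n) + g (t + \<theta> n)) - (f t + g t)\<bar> \<partial>lborel) \<le> (\<integral>t. \<bar>f (t + \<theta> n) - f t\<bar> + \<bar>g (t + \<theta> n) - g t\<bar> \<partial>lborel)"
          by (intro integral_mono i[of "\<lambda>t. f t + g t"] Bochner_Integration.integrable_add i add.hyps) auto
        then show "(\<integral>t. \<bar>(f (t + \<theta> n) + g (t + \<theta> n)) - (f t + g t)\<bar> \<partial>lborel) \<le> (\<integral>t. \<bar>f (t + \<theta> n) - f t\<bar> \<partial>lborel) + (\<integral>t. \<bar>g (t + \<theta> n) - g t\<bar> \<partial>lborel)"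
          using i[OF add.hyps(1)] i[OF add.hyps(2)] by simp
      qed
    qed
  qed
next
  case (lim f s)
  show ?case
  proof (rule transl_cont_approx[OF lim.hyps(4)])
    fix \<epsilon> :: real assume e: "\<epsilon> > 0"
    have "(\<lambda>n. \<integral>t. norm (f t - s n t) \<partial>lborel) \<longlonglongrightarrow> (\<integral>t. norm (f t - f t) \<partial>lborel)"
    proof (rule integral_dominated_convergence[where w = "\<lambda>t. 3 * norm (f t)"])
      show "AE t in lborel. (\<lambda>n. norm (f t - s n t)) \<longlonglongrightarrow> norm (f t - f t)"
        using lim.hyps(2) by (intro AE_I2 tendsto_intros) auto
      show "AE t in lborel. norm (norm (f t - s n t)) \<le> 3 * norm (f t)" for n
      proof (intro AE_I2)
        fix t have "norm (s n t) \<le> 2 * norm (f t)" using lim.hyps(3) by simp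
        then show "norm (norm (f t - s n t)) \<le> 3 * norm (f t)" using norm_triangle_ineq4[of "f t" "s n t"] by simp
      qed
    qed (use lim.hyps(1,4) in \<open>auto dest: borel_measurable_integrable\<close>)
    then have "(\<lambda>n. \<integral>t. norm (f t - s n t) \<partial>lborel) \<longlonglongrightarrow> 0" by simp
    then obtain n where "(\<integral>t. norm (f t - s n t) \<partial>lborel) < \<epsilon>"
      using order_tendstoD(2)[of _ 0 sequentially \<epsilon>] e eventually_happens'[OF sequentially_bot] by blast
    then show "\<exists>h. integrable lborel h \<and> transl_cont h \<and> (\<integral>t. \<bar>f t - h t\<bar> \<partial>lborel) < \<epsilon>"
      using lim.IH lim.hyps(1) by (intro exI[of _ "s n"]) auto
  qed
qed

section \<open>Shifts of the time variable on a product space\<close>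

lemma pair_lborel: "sigma_finite_measure M \<Longrightarrow> pair_sigma_finite lborel M"
  by (intro pair_sigma_finite.intro sigma_finite_lborel)

lemma shift_fst_measurable:
  "(\<lambda>z. (fst z + c, snd z)) \<in> lborel \<Otimes>\<^sub>M M \<rightarrow>\<^sub>M lborel \<Otimes>\<^sub>M M" for c :: real
  by measurable

lemma nn_integral_pair_shift:
  fixes c :: real
  assumes M: "sigma_finite_measure M" and f: "f \<in> borel_measurable (lborel \<Otimes>\<^sub>M M)"
  shows "(\<integral>\<^sup>+z. f (fst z + c, snd z) \<partial>(lborel \<Otimes>\<^sub>M M)) = (\<integral>\<^sup>+z. f z \<partial>(lborel \<Otimes>\<^sub>M M))"
proof -
  interpret M: sigma_finite_measure M by (rule M)
  interpret P: pair_sigma_finite lborel M by (rule pair_lborel[OF M])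
  have fs: "(\<lambda>z. f (fst z + c, snd z)) \<in> borel_measurable (lborel \<Otimes>\<^sub>M M)"
    by (rule measurable_compose[OF shift_fst_measurable f])
  have "(\<integral>\<^sup>+z. f (fst z + c, snd z) \<partial>(lborel \<Otimes>\<^sub>M M)) = (\<integral>\<^sup>+t. (\<integral>\<^sup>+x. f (t + c, x) \<partial>M) \<partial>lborel)"
    using M.nn_integral_fst[OF fs] by simp
  also have "\<dots> = (\<integral>\<^sup>+t. (\<integral>\<^sup>+x. f (t, x) \<partial>M) \<partial>lborel)"
    using nn_integral_real_affine[of "\<lambda>t. \<integral>\<^sup>+x. f (t, x) \<partial>M" 1 c] M.borel_measurable_nn_integral_fst[OF f]
    by (simp add: add.commute)
  also have "\<dots> = (\<integral>\<^sup>+z. f z \<partial>(lborel \<Otimes>\<^sub>M M))" by (rule M.nn_integral_fst[OF f])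
  finally show ?thesis .
qed

lemma integrable_pair_shift:
  fixes c :: real and f :: "real \<times> 'b \<Rightarrow> real"
  assumes M: "sigma_finite_measure M" and f: "integrable (lborel \<Otimes>\<^sub>M M) f"
  shows "integrable (lborel \<Otimes>\<^sub>M M) (\<lambda>z. f (fst z + c, snd z))"
proof -
  have m: "(\<lambda>z. ennreal (norm (f z))) \<in> borel_measurable (lborel \<Otimes>\<^sub>M M)" using f by simp
  show ?thesis
  using f nn_integral_pair_shift[OF M, of "\<lambda>z. ennreal (norm (f z))" c, OF m]
    measurable_compose[OF shift_fst_measurable borel_measurable_integrable[OF f]]
  by (simp add: integrable_iff_bounded)
qed

lemma integral_pair_shift:
  fixes c :: real and f :: "real \<times> 'b \<Rightarrow> real"
  assumes M: "sigma_finite_measure M" and f: "integrable (lborel \<Otimes>\<^sub>M M) f"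
  shows "(\<integral>z. f (fst z + c, snd z) \<partial>(lborel \<Otimes>\<^sub>M M)) = (\<integral>z. f z \<partial>(lborel \<Otimes>\<^sub>M M))"
proof -
  interpret P: pair_sigma_finite lborel M by (rule pair_lborel[OF M])
  have "(\<integral>z. f (fst z + c, snd z) \<partial>(lborel \<Otimes>\<^sub>M M)) = (\<integral>t. (\<integral>x. f (t + c, x) \<partial>M) \<partial>lborel)"
    using P.integral_fst'[OF integrable_pair_shift[OF M f, of c]] by simp
  also have "\<dots> = (\<integral>t. (\<integral>x. f (t, x) \<partial>M) \<partial>lborel)"
    by (rule integral_lborel_shift[of "\<lambda>t. \<integral>x. f (t, x) \<partial>M"])
  also have "\<dots> = (\<integral>z. f z \<partial>(lborel \<Otimes>\<^sub>M M))" by (rule P.integral_fst'[OF f])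
  finally show ?thesis .
qed

text \<open>Translations are continuous on almost every section with x fixed. The section integrals
  are bounded by twice the L_1 norm of the section, which is integrable in x, so dominated
  convergence applies.\<close>

lemma transl_L1_pair:
  fixes f :: "real \<times> 'b \<Rightarrow> real"
  assumes M: "sigma_finite_measure M" and f: "integrable (lborel \<Otimes>\<^sub>M M) f" and \<theta>: "\<theta> \<longlonglongrightarrow> 0"
  shows "(\<lambda>n. \<integral>z. \<bar>f (fst z + \<theta> n, snd z) - f z\<bar> \<partial>(lborel \<Otimes>\<^sub>M M)) \<longlonglongrightarrow> 0"
proof -
  interpret P: pair_sigma_finite lborel M by (rule pair_lborel[OF M])
  let ?P = "lborel \<Otimes>\<^sub>M M"
  have i: "integrable ?P (\<lambda>z. \<bar>f (fst z + \<theta> n, snd z) - f z\<bar>)" for n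
    using integrable_pair_shift[OF M f] f by (intro integrable_abs Bochner_Integration.integrable_diff)
  have fa: "integrable ?P (\<lambda>z. \<bar>f z\<bar>)" using f by simp
  have sec: "AE x in M. integrable lborel (\<lambda>t. f (t, x))"
    using P.AE_integrable_snd[of "\<lambda>t x. f (t, x)"] f by simp
  let ?\<Psi> = "\<lambda>n x. \<integral>t. \<bar>f (t + \<theta> n, x) - f (t, x)\<bar> \<partial>lborel"
  have \<Psi>: "(\<integral>z. \<bar>f (fst z + \<theta> n, snd z) - f z\<bar> \<partial>?P) = (\<integral>x. ?\<Psi> n x \<partial>M)" "integrable M (?\<Psi> n)" for n
    using P.integral_snd[of "\<lambda>t x. \<bar>f (t + \<theta> n, x) - f (t, x)\<bar>"] P.integrable_snd[of "\<lambda>t x. \<bar>f (t + \<theta> n, x) - f (t, x)\<bar>"] i[of n]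
    by (simp_all add: case_prod_unfold)
  have w: "integrable M (\<lambda>x. \<integral>t. \<bar>f (t, x)\<bar> \<partial>lborel)"
    using P.integrable_snd[of "\<lambda>t x. \<bar>f (t, x)\<bar>"] fa by (simp add: case_prod_unfold)
  have "(\<lambda>n. \<integral>x. ?\<Psi> n x \<partial>M) \<longlonglongrightarrow> (\<integral>x. 0 \<partial>M)"
  proof (rule integral_dominated_convergence[where w = "\<lambda>x. 2 * (\<integral>t. \<bar>f (t, x)\<bar> \<partial>lborel)"])
    show "?\<Psi> n \<in> borel_measurable M" for n using \<Psi>(2) by (rule borel_measurable_integrable)
    show "integrable M (\<lambda>x. 2 * (\<integral>t. \<bar>f (t, x)\<bar> \<partial>lborel))" using w by simp
    show "AE x in M. (\<lambda>n. ?\<Psi> n x) \<longlonglongrightarrow> 0"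
      using sec
    proof eventually_elim
      case (elim x)
      from transl_cont_integrable[OF elim] \<theta> show ?case unfolding transl_cont_def by blast
    qed
    show "AE x in M. norm (?\<Psi> n x) \<le> 2 * (\<integral>t. \<bar>f (t, x)\<bar> \<partial>lborel)" for n
      using sec
    proof eventually_elim
      case (elim x)
      note s = integrable_lborel_shift[OF elim, of "\<theta> n"]
      have "?\<Psi> n x \<le> (\<integral>t. \<bar>f (t + \<theta> n, x)\<bar> + \<bar>f (t, x)\<bar> \<partial>lborel)"
        by (intro integral_mono integrable_abs Bochner_Integration.integrable_diff Bochner_Integration.integrable_add elim s) auto
      also have "\<dots> = (\<integral>t. \<bar>f (t + \<theta> n, x)\<bar> \<partial>lborel) + (\<integral>t. \<bar>f (t, x)\<bar> \<partial>lborel)"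
        using elim s by simp
      also have "(\<integral>t. \<bar>f (t + \<theta> n, x)\<bar> \<partial>lborel) = (\<integral>t. \<bar>f (t, x)\<bar> \<partial>lborel)"
        by (rule integral_lborel_shift[of "\<lambda>t. \<bar>f (t, x)\<bar>"])
      finally show ?case by (simp add: integral_nonneg_AE)
    qed
  qed simp
  then show ?thesis using \<Psi>(1) by simp
qed

text \<open>Young's inequality for (e u) (v / e) with e the p-th root of \<epsilon>; the divisors p
  and q, both above 1, are then dropped.\<close>

lemma Young_eps:
  fixes p q u v \<epsilon> :: real
  assumes "p > 1" "q > 1" "1/p + 1/q = 1" "\<epsilon> > 0" "u \<ge> 0" "v \<ge> 0"
  shows "u * v \<le> \<epsilon> * u powr p + \<epsilon> powr (- q / p) * v powr q"
proof -
  define e where "e = \<epsilon> powr (1 / p)"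
  have e: "e > 0" using assms by (simp add: e_def)
  have "u * v = (e * u) * (v / e)" using e by simp
  also have "\<dots> \<le> (e * u) powr p / p + (v / e) powr q / q"
    using assms e by (intro Youngs_inequality) auto
  also have "\<dots> \<le> (e * u) powr p + (v / e) powr q"
  proof -
    have *: "x / r \<le> x" if "x \<ge> 0" "r > 1" for x r :: real
      using that divide_left_mono[of 1 r x] by simp
    show ?thesis using assms by (intro add_mono *) auto
  qed
  also have "\<dots> = \<epsilon> * u powr p + \<epsilon> powr (- q / p) * v powr q"
    using assms e by (simp add: e_def powr_mult powr_divide powr_powr powr_minus field_simps)
  finally show ?thesis .
qed

text \<open>The crude factor 2^p comes from bounding |x - y| by twice the larger of the two
  moduli.\<close>

lemma powr_add_le: 
  fixes p :: real assumes "p \<ge> 0"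
  shows "\<bar>x - y\<bar> powr p \<le> 2 powr p * (\<bar>x\<bar> powr p + \<bar>y\<bar> powr p)"
proof -
  have "\<bar>x - y\<bar> powr p \<le> (2 * max \<bar>x\<bar> \<bar>y\<bar>) powr p" using assms by (intro powr_mono2) auto
  also have "\<dots> = 2 powr p * (max \<bar>x\<bar> \<bar>y\<bar>) powr p" by (simp add: powr_mult)
  also have "(max \<bar>x\<bar> \<bar>y\<bar>) powr p \<le> \<bar>x\<bar> powr p + \<bar>y\<bar> powr p" by (simp add: max_def)
  finally show ?thesis by (simp add: mult_left_mono)
qed

text \<open>Abstract force F and flux k with dual exponents. Both are extended by 0 outside a
  bounded time interval, so that shifts in time act on the whole line and preserve all
  integrals.\<close>

locale Lpq = finite_measure M for M :: "'b measure" +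
  fixes p q :: real and F k :: "real \<times> 'b \<Rightarrow> real" and A B :: real
  assumes pq: "p > 1" "q > 1" "1 / p + 1 / q = 1"
    and F: "F \<in> borel_measurable (lborel \<Otimes>\<^sub>M M)" "integrable (lborel \<Otimes>\<^sub>M M) (\<lambda>z. \<bar>F z\<bar> powr p)"
    and k: "k \<in> borel_measurable (lborel \<Otimes>\<^sub>M M)" "integrable (lborel \<Otimes>\<^sub>M M) (\<lambda>z. \<bar>k z\<bar> powr q)"
    and supp: "\<And>t x. t \<notin> {A<..<B} \<Longrightarrow> F (t, x) = 0" "\<And>t x. t \<notin> {A<..<B} \<Longrightarrow> k (t, x) = 0"
begin

abbreviation "P \<equiv> (lborel :: real measure) \<Otimes>\<^sub>M M"

lemma sfM: "sigma_finite_measure M" ..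

sublocale P: pair_sigma_finite lborel M by (rule pair_lborel[OF sfM])

lemma strip_integrable: "integrable P (\<lambda>z. indicator {A<..<B} (fst z) :: real)"
proof (rule P.Fubini_integrable)
  show "(\<lambda>z. indicat_real {A<..<B} (fst z)) \<in> borel_measurable P" by measurable
  have "integrable lborel (indicat_real {A<..<B})"
    by (cases "A \<le> B") (auto intro!: integrable_real_indicator)
  then show "integrable lborel (\<lambda>x. LINT y|M. norm (indicat_real {A<..<B} (fst (x, y))))"
    by simp
qed (auto simp: integrable_const)

text \<open>The strip (A, B) times the finite measure space has finite measure, so L_r embeds into
  L_1 there.\<close>

lemma integrable_supp:
  assumes "f \<in> borel_measurable P" "integrable P (\<lambda>z. \<bar>f z\<bar> powr r)" "r \<ge> 1" "\<And>t x. t \<notin> {A<..<B} \<Longrightarrow> f (t, x) = (0::real)"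
  shows "integrable P f"
proof (rule Bochner_Integration.integrable_bound[OF Bochner_Integration.integrable_add[OF strip_integrable assms(2)] assms(1)])
  show "AE z in P. norm (f z) \<le> norm (indicator {A<..<B} (fst z) + \<bar>f z\<bar> powr r)"
  proof (rule AE_I2)
    fix z :: "real \<times> 'b"
    show "norm (f z) \<le> norm (indicator {A<..<B} (fst z) + \<bar>f z\<bar> powr r)"
      using abs_le_1_plus_powr[OF assms(3), of "f z"] assms(4)[of "fst z" "snd z"]
      by (cases "fst z \<in> {A<..<B}") auto
  qed
qed

lemma F_integrable: "integrable P F"
  using integrable_supp[OF F _ supp(1)] pq by simp

lemma Fs: "(\<lambda>z. F (fst z + c, snd z)) \<in> borel_measurable P"
  by (rule measurable_compose[OF shift_fst_measurable F(1)])

lemma Fs_integrable: "integrable P (\<lambda>z. \<bar>F (fst z + c, snd z)\<bar> powr p)"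
  using integrable_pair_shift[OF sfM F(2)] by simp

lemma mult_bound: "\<bar>(F (fst z + c, snd z) - F z) * k z\<bar> \<le> 2 powr p * (\<bar>F (fst z + c, snd z)\<bar> powr p + \<bar>F z\<bar> powr p) + \<bar>k z\<bar> powr q"
proof -
  have "\<bar>(F (fst z + c, snd z) - F z) * k z\<bar> \<le> \<bar>F (fst z + c, snd z) - F z\<bar> powr p + \<bar>k z\<bar> powr q"
    using Young_eps[OF pq, of 1 "\<bar>F (fst z + c, snd z) - F z\<bar>" "\<bar>k z\<bar>"] by (simp add: abs_mult)
  also have "\<bar>F (fst z + c, snd z) - F z\<bar> powr p \<le> 2 powr p * (\<bar>F (fst z + c, snd z)\<bar> powr p + \<bar>F z\<bar> powr p)"
    using pq by (intro powr_add_le) auto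
  finally show ?thesis by simp
qed

lemma osc_integrable: "integrable P (\<lambda>z. \<bar>(F (fst z + c, snd z) - F z) * k z\<bar>)"
proof (rule Bochner_Integration.integrable_bound)
  show "integrable P (\<lambda>z. 2 powr p * (\<bar>F (fst z + c, snd z)\<bar> powr p + \<bar>F z\<bar> powr p) + \<bar>k z\<bar> powr q)"
    using Fs_integrable F(2) k(2) by simp
  show "(\<lambda>z. \<bar>(F (fst z + c, snd z) - F z) * k z\<bar>) \<in> borel_measurable P"
    using Fs F(1) k(1) by measurable
qed (use mult_bound in \<open>auto intro!: AE_I2\<close>)

text \<open>Split according to the size of k. Where |k| \<le> N, the L_1 continuity of translations
  suffices, with the factor N. Elsewhere Young's inequality puts the small weight \<epsilon> on the
  difference of F, whose L_p norm is bounded independently of the shift, and the large weight C on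
  the tail of |k|^q, which is small for large N. So N is fixed before the shift.\<close>

lemma transl_dual:
  assumes \<theta>: "\<theta> \<longlonglongrightarrow> 0"
  shows "(\<lambda>n. \<integral>z. \<bar>(F (fst z + \<theta> n, snd z) - F z) * k z\<bar> \<partial>P) \<longlonglongrightarrow> 0"
proof (rule LIMSEQ_I)
  fix r :: real assume r: "r > 0"
  define AF where "AF = (\<integral>z. \<bar>F z\<bar> powr p \<partial>P)"
  have AF: "AF \<ge> 0" unfolding AF_def by (intro integral_nonneg_AE) auto
  \<comment> \<open>Makes the Young term at most r/4, since F and its shift contribute
    \<open>AF\<close> each. The added 1 keeps the denominator positive when AF = 0.\<close>
  define \<epsilon> where "\<epsilon> = r / (4 * 2 powr p * (2 * AF + 1))"
  have den: "2 powr p * (2 * AF + 1) > 0" using AF by (intro mult_pos_pos) auto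
  have \<epsilon>: "\<epsilon> > 0" unfolding \<epsilon>_def using r den by (simp add: zero_less_divide_iff mult.assoc)
  have \<epsilon>b: "\<epsilon> * (2 powr p * (2 * AF)) \<le> r / 4"
  proof -
    have "\<epsilon> * (2 powr p * (2 * AF)) \<le> \<epsilon> * (2 powr p * (2 * AF + 1))" using \<epsilon> by (intro mult_left_mono) auto
    also have "\<dots> = r / 4" unfolding \<epsilon>_def using den AF by (simp add: field_simps)
    finally show ?thesis .
  qed
  define C where "C = \<epsilon> powr (- q / p)"
  have C: "C > 0" using \<epsilon> by (simp add: C_def)
  \<comment> \<open>The tail of |k|^q above the level N; its integral tends to 0 by dominated
    convergence.\<close>
  let ?K = "\<lambda>N z. if \<bar>k z\<bar> > real N then \<bar>k z\<bar> powr q else 0"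
  have Km: "?K N \<in> borel_measurable P" for N using k(1) by measurable
  have Ki: "integrable P (?K N)" for N
    by (rule Bochner_Integration.integrable_bound[OF k(2) Km]) auto
  have "(\<lambda>N. \<integral>z. ?K N z \<partial>P) \<longlonglongrightarrow> (\<integral>z. (0::real) \<partial>P)"
  proof (rule Bochner_Integration.integral_dominated_convergence[where w = "\<lambda>z. \<bar>k z\<bar> powr q" and s = ?K])
    show "AE z in P. (\<lambda>N. ?K N z) \<longlonglongrightarrow> 0"
    proof (rule AE_I2)
      fix z
      obtain N0 :: nat where "\<bar>k z\<bar> \<le> real N0" using real_arch_simple by blast
      then have "\<forall>\<^sub>F N in sequentially. 0 = ?K N z"
        unfolding eventually_sequentially by (intro exI[of _ N0]) (auto simp: not_less intro: order_trans)
      then show "(\<lambda>N. ?K N z) \<longlonglongrightarrow> 0" by (rule Lim_transform_eventually[OF tendsto_const])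
    qed
  qed (use k(2) Km in auto)
  then have "(\<lambda>N. \<integral>z. ?K N z \<partial>P) \<longlonglongrightarrow> 0" by simp
  then obtain N where N: "(\<integral>z. ?K N z \<partial>P) < r / (4 * C)"
    using order_tendstoD(2)[of _ 0 sequentially "r / (4 * C)"] r C eventually_happens'[OF sequentially_bot]
    by (metis (no_types, lifting) divide_pos_pos mult_pos_pos zero_less_numeral)
  let ?D = "\<lambda>n z. \<bar>F (fst z + \<theta> n, snd z) - F z\<bar>"
  have Di: "integrable P (?D n)" for n
    using integrable_pair_shift[OF sfM F_integrable] F_integrable by (intro integrable_abs Bochner_Integration.integrable_diff)
  have "(\<lambda>n. real N * (\<integral>z. ?D n z \<partial>P)) \<longlonglongrightarrow> real N * 0"
    by (intro tendsto_mult tendsto_const transl_L1_pair[OF sfM F_integrable \<theta>])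
  then have "\<forall>\<^sub>F n in sequentially. real N * (\<integral>z. ?D n z \<partial>P) < r / 4"
    using order_tendstoD(2)[of _ 0 sequentially "r/4"] r by simp
  then obtain n0 where n0: "\<And>n. n \<ge> n0 \<Longrightarrow> real N * (\<integral>z. ?D n z \<partial>P) < r / 4"
    unfolding eventually_sequentially by blast
  show "\<exists>no. \<forall>n\<ge>no. norm ((\<integral>z. \<bar>(F (fst z + \<theta> n, snd z) - F z) * k z\<bar> \<partial>P) - 0) < r"
  proof (intro exI[of _ n0] allI impI)
    fix n assume n: "n \<ge> n0"
    let ?R = "\<lambda>z. real N * ?D n z + (\<epsilon> * (2 powr p * (\<bar>F (fst z + \<theta> n, snd z)\<bar> powr p + \<bar>F z\<bar> powr p)) + C * ?K N z)"
    have Ri: "integrable P ?R"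
      using Di[of n] Fs_integrable[of "\<theta> n"] F(2) Ki[of N] by (intro Bochner_Integration.integrable_add integrable_mult_right) auto
    have "(\<integral>z. \<bar>(F (fst z + \<theta> n, snd z) - F z) * k z\<bar> \<partial>P) \<le> (\<integral>z. ?R z \<partial>P)"
    proof (rule integral_mono[OF osc_integrable Ri])
      fix z
      show "\<bar>(F (fst z + \<theta> n, snd z) - F z) * k z\<bar> \<le> ?R z"
      proof (cases "\<bar>k z\<bar> > real N")
        case True
        have "\<bar>(F (fst z + \<theta> n, snd z) - F z) * k z\<bar> \<le> \<epsilon> * ?D n z powr p + C * \<bar>k z\<bar> powr q"
          using Young_eps[OF pq \<epsilon>, of "?D n z" "\<bar>k z\<bar>"] by (simp add: abs_mult C_def)
        also have "\<dots> \<le> \<epsilon> * (2 powr p * (\<bar>F (fst z + \<theta> n, snd z)\<bar> powr p + \<bar>F z\<bar> powr p)) + C * \<bar>k z\<bar> powr q"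
          using pq \<epsilon> by (intro add_right_mono mult_left_mono powr_add_le) auto
        also have "\<dots> \<le> ?R z" using True by simp
        finally show ?thesis .
      next
        case False
        then have "\<bar>(F (fst z + \<theta> n, snd z) - F z) * k z\<bar> \<le> real N * ?D n z"
          by (simp add: abs_mult mult.commute mult_right_mono)
        moreover have "0 \<le> \<epsilon> * (2 powr p * (\<bar>F (fst z + \<theta> n, snd z)\<bar> powr p + \<bar>F z\<bar> powr p))" using \<epsilon> by simp
        ultimately show ?thesis using False by simp
      qed
    qed
    also have "(\<integral>z. ?R z \<partial>P) = real N * (\<integral>z. ?D n z \<partial>P) + (\<epsilon> * (2 powr p * ((\<integral>z. \<bar>F (fst z + \<theta> n, snd z)\<bar> powr p \<partial>P) + AF)) + C * (\<integral>z. ?K N z \<partial>P))"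
      using Di[of n] Fs_integrable[of "\<theta> n"] F(2) Ki[of N] unfolding AF_def
      by (simp add: Bochner_Integration.integral_add Bochner_Integration.integrable_add)
    also have "(\<integral>z. \<bar>F (fst z + \<theta> n, snd z)\<bar> powr p \<partial>P) = AF"
      unfolding AF_def using integral_pair_shift[OF sfM F(2), of "\<theta> n"] by simp
    also have "real N * (\<integral>z. ?D n z \<partial>P) + (\<epsilon> * (2 powr p * (AF + AF)) + C * (\<integral>z. ?K N z \<partial>P)) < r / 4 + (r / 4 + r / 4)"
    proof -
      have "C * (\<integral>z. ?K N z \<partial>P) < r / 4" using N C by (simp add: field_simps)
      then show ?thesis using n0[OF n] \<epsilon>b by (intro add_strict_mono add_le_less_mono) auto
    qed
    also have "\<dots> < r" using r by simp
    finally show "norm ((\<integral>z. \<bar>(F (fst z + \<theta> n, snd z) - F z) * k z\<bar> \<partial>P) - 0) < r"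
      by (simp add: integral_nonneg_AE)
  qed
qed

lemma transl_dual_eps:
  assumes "\<epsilon> > 0"
  obtains \<delta> where "\<delta> > 0" "\<And>c. \<bar>c\<bar> < \<delta> \<Longrightarrow> (\<integral>z. \<bar>(F (fst z + c, snd z) - F z) * k z\<bar> \<partial>P) < \<epsilon>"
proof -
  have "((\<lambda>c. \<integral>z. \<bar>(F (fst z + c, snd z) - F z) * k z\<bar> \<partial>P) \<longlongrightarrow> 0) (at 0)"
    unfolding tendsto_at_iff_sequentially comp_def using transl_dual by auto
  then have "\<forall>\<^sub>F c in at 0. (\<integral>z. \<bar>(F (fst z + c, snd z) - F z) * k z\<bar> \<partial>P) < \<epsilon>"
    using assms by (rule order_tendstoD)
  then obtain \<delta> where "\<delta> > 0" "\<And>c. c \<noteq> 0 \<Longrightarrow> dist c 0 < \<delta> \<Longrightarrow> (\<integral>z. \<bar>(F (fst z + c, snd z) - F z) * k z\<bar> \<partial>P) < \<epsilon>"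
    unfolding eventually_at by blast
  note \<delta> = this
  show thesis
  proof (rule that[OF \<delta>(1)])
    fix c :: real assume c: "\<bar>c\<bar> < \<delta>"
    show "(\<integral>z. \<bar>(F (fst z + c, snd z) - F z) * k z\<bar> \<partial>P) < \<epsilon>"
    proof (cases "c = 0")
      case True
      then show ?thesis using assms by simp
    next
      case False
      then show ?thesis using \<delta>(2)[of c] c by simp
    qed
  qed
qed

end

section \<open>Summation of frozen inequalities over meshes in time\<close>

context Lpq begin

definition b :: "real \<Rightarrow> real \<Rightarrow> real" where "b r \<sigma> = (\<integral>x. F (r, x) * k (\<sigma>, x) \<partial>M)"

text \<open>Density of the error made at time \<sigma> by using the force of time \<tau>. With
  values in [0, \<infinity>] it is jointly measurable in both times before any integrability is
  known.\<close>

definition D :: "real \<Rightarrow> real \<Rightarrow> ennreal" where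
  "D \<tau> \<sigma> = (\<integral>\<^sup>+x. ennreal \<bar>(F (\<tau>, x) - F (\<sigma>, x)) * k (\<sigma>, x)\<bar> \<partial>M)"

lemma D_measurable: "(\<lambda>z. D (fst z) (snd z)) \<in> borel_measurable (lborel \<Otimes>\<^sub>M lborel)"
proof -
  note [measurable] = F(1) k(1)
  have "(\<lambda>z. \<integral>\<^sup>+x. ennreal \<bar>(F (fst z, x) - F (snd z, x)) * k (snd z, x)\<bar> \<partial>M) \<in> borel_measurable (lborel \<Otimes>\<^sub>M lborel)"
    by measurable
  then show ?thesis by (simp add: D_def)
qed

lemma D_measurable': 
  assumes [measurable]: "f \<in> borel_measurable N" "g \<in> borel_measurable N"
  shows "(\<lambda>z. D (f z) (g z)) \<in> borel_measurable N"
proof -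
  have "(\<lambda>z. (f z, g z)) \<in> N \<rightarrow>\<^sub>M lborel \<Otimes>\<^sub>M lborel" by measurable
  from measurable_compose[OF this D_measurable] show ?thesis by simp
qed

text \<open>Shifting the integration variable by \<theta> turns the error at lag \<theta> into the
  quantity that \<open>transl_dual\<close> sends to 0.\<close>

lemma D_integral: "(\<integral>\<^sup>+\<tau>. D \<tau> (\<tau> + \<theta>) \<partial>lborel) = ennreal (\<integral>z. \<bar>(F (fst z + (- \<theta>), snd z) - F z) * k z\<bar> \<partial>P)"
proof -
  note [measurable] = F(1) k(1)
  have "(\<integral>\<^sup>+\<tau>. D \<tau> (\<tau> + \<theta>) \<partial>lborel) = (\<integral>\<^sup>+\<tau>. D (\<tau> - \<theta>) \<tau> \<partial>lborel)"
  proof -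
    have "(\<lambda>\<tau>. D (\<tau> - \<theta>) \<tau>) \<in> borel_measurable borel" by (rule D_measurable') simp_all
    from nn_integral_real_affine[OF this, of 1 \<theta>] show ?thesis by (simp add: add.commute[of \<theta>])
  qed
  also have "\<dots> = (\<integral>\<^sup>+z. ennreal \<bar>(F (fst z + (- \<theta>), snd z) - F z) * k z\<bar> \<partial>P)"
  proof -
    have "(\<lambda>z. ennreal \<bar>(F (fst z + (- \<theta>), snd z) - F z) * k z\<bar>) \<in> borel_measurable P"
      by (rule measurable_compose[OF borel_measurable_integrable[OF osc_integrable] measurable_ennreal])
    from nn_integral_fst[OF this] show ?thesis by (simp add: D_def)
  qed
  also have "\<dots> = ennreal (\<integral>z. \<bar>(F (fst z + (- \<theta>), snd z) - F z) * k z\<bar> \<partial>P)"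
    by (rule nn_integral_eq_integral[OF osc_integrable]) auto
  finally show ?thesis .
qed

text \<open>At such times the force slice lies in L_p, and \<open>b r\<close> is an integrable
  function of its second argument.\<close>

definition good :: "real \<Rightarrow> bool" where
  "good r \<longleftrightarrow> integrable M (\<lambda>x. \<bar>F (r, x)\<bar> powr p)"

lemma AE_good: "AE r in lborel. good r"
  using P.AE_integrable_fst[of "\<lambda>t x. \<bar>F (t, x)\<bar> powr p"] F(2) by (simp add: good_def case_prod_unfold)

lemma good_product:
  assumes "good r" shows "integrable P (\<lambda>z. F (r, snd z) * k z)"
proof (rule Bochner_Integration.integrable_bound)
  note [measurable] = F(1) k(1)
  have m: "(\<lambda>z. \<bar>F (r, snd z)\<bar> powr p) \<in> borel_measurable P" by measurable
  have "integrable P (\<lambda>z. indicator {A<..<B} (fst z) * \<bar>F (r, snd z)\<bar> powr p)"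
  proof (rule P.Fubini_integrable)
    have "integrable lborel (\<lambda>t. indicat_real {A<..<B} t)"
      by (cases "A \<le> B") (auto intro!: integrable_real_indicator)
    then show "integrable lborel (\<lambda>t. \<integral>x. norm (indicat_real {A<..<B} (fst (t, x)) * \<bar>F (r, snd (t, x))\<bar> powr p) \<partial>M)"
      by (simp add: abs_mult)
    show "AE t in lborel. integrable M (\<lambda>x. indicat_real {A<..<B} (fst (t, x)) * \<bar>F (r, snd (t, x))\<bar> powr p)"
      using assms by (intro AE_I2) (simp add: good_def)
  qed measurable
  then show "integrable P (\<lambda>z. indicator {A<..<B} (fst z) * \<bar>F (r, snd z)\<bar> powr p + \<bar>k z\<bar> powr q)"
    using k(2) by simp
  show "(\<lambda>z. F (r, snd z) * k z) \<in> borel_measurable P" by measurable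
  show "AE z in P. norm (F (r, snd z) * k z) \<le> norm (indicator {A<..<B} (fst z) * \<bar>F (r, snd z)\<bar> powr p + \<bar>k z\<bar> powr q)"
  proof (rule AE_I2)
    fix z :: "real \<times> 'b"
    show "norm (F (r, snd z) * k z) \<le> norm (indicator {A<..<B} (fst z) * \<bar>F (r, snd z)\<bar> powr p + \<bar>k z\<bar> powr q)"
      using Young_eps[OF pq, of 1 "\<bar>F (r, snd z)\<bar>" "\<bar>k z\<bar>"] supp(2)[of "fst z" "snd z"]
      by (cases "fst z \<in> {A<..<B}") (auto simp: abs_mult)
  qed
qed

lemma diag_product: "integrable P (\<lambda>z. F z * k z)"
proof (rule Bochner_Integration.integrable_bound)
  note [measurable] = F(1) k(1)
  show "integrable P (\<lambda>z. \<bar>F z\<bar> powr p + \<bar>k z\<bar> powr q)" using F(2) k(2) by simp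
  show "(\<lambda>z. F z * k z) \<in> borel_measurable P" by measurable
  show "AE z in P. norm (F z * k z) \<le> norm (\<bar>F z\<bar> powr p + \<bar>k z\<bar> powr q)"
    using Young_eps[OF pq, of 1 "\<bar>F z\<bar>" "\<bar>k z\<bar>" for z] by (intro AE_I2) (simp add: abs_mult)
qed

lemma b_integrable: "good r \<Longrightarrow> integrable lborel (b r)"
  using P.integrable_fst'[OF good_product[of r]] by (simp add: b_def[abs_def])

lemma diag_integrable: "integrable lborel (\<lambda>\<sigma>. b \<sigma> \<sigma>)"
  using P.integrable_fst'[OF diag_product] by (simp add: b_def)

lemma b_diff_le:
  assumes "good r" shows "AE \<sigma> in lborel. ennreal \<bar>b r \<sigma> - b \<sigma> \<sigma>\<bar> \<le> D r \<sigma>"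
proof -
  have "AE \<sigma> in lborel. integrable M (\<lambda>x. F (r, x) * k (\<sigma>, x))"
    using P.AE_integrable_fst'[OF good_product[OF assms]] by simp
  moreover have "AE \<sigma> in lborel. integrable M (\<lambda>x. F (\<sigma>, x) * k (\<sigma>, x))"
    using P.AE_integrable_fst'[OF diag_product] by simp
  ultimately show ?thesis
  proof eventually_elim
    case (elim \<sigma>)
    have i: "integrable M (\<lambda>x. (F (r, x) - F (\<sigma>, x)) * k (\<sigma>, x))"
      using Bochner_Integration.integrable_diff[OF elim] by (simp add: left_diff_distrib)
    have "\<bar>b r \<sigma> - b \<sigma> \<sigma>\<bar> = \<bar>\<integral>x. (F (r, x) - F (\<sigma>, x)) * k (\<sigma>, x) \<partial>M\<bar>"
      using elim by (simp add: b_def left_diff_distrib)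
    also have "\<dots> \<le> (\<integral>x. \<bar>(F (r, x) - F (\<sigma>, x)) * k (\<sigma>, x)\<bar> \<partial>M)" by (rule integral_abs_bound)
    finally have "ennreal \<bar>b r \<sigma> - b \<sigma> \<sigma>\<bar> \<le> ennreal (\<integral>x. \<bar>(F (r, x) - F (\<sigma>, x)) * k (\<sigma>, x)\<bar> \<partial>M)"
      by (rule ennreal_leI)
    also have "\<dots> = D r \<sigma>" unfolding D_def
      using i by (intro nn_integral_eq_integral[symmetric]) auto
    finally show ?case .
  qed
qed

text \<open>Total freezing error over one mesh cell (r, r + h].\<close>

definition W :: "real \<Rightarrow> real \<Rightarrow> ennreal" where
  "W h r = (\<integral>\<^sup>+\<theta>. indicator {0<..h} \<theta> * D r (r + \<theta>) \<partial>lborel)"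

lemma W_measurable: "W h \<in> borel_measurable lborel"
proof -
  have [measurable]: "(\<lambda>z. D (fst z) (fst z + snd z)) \<in> borel_measurable (lborel \<Otimes>\<^sub>M lborel)"
    by (rule D_measurable') measurable
  have "(\<lambda>z. indicator {0<..h} (snd z) * D (fst z) (fst z + snd z)) \<in> borel_measurable (lborel \<Otimes>\<^sub>M lborel)" by measurable
  from lborel.borel_measurable_nn_integral_fst[OF this] show ?thesis by (simp add: W_def[abs_def])
qed

text \<open>By Tonelli, integration over the left endpoint r costs the cell length h times the
  modulus of continuity \<epsilon>. The factor h is decisive: the d / h cells of a mesh then cost
  only d \<epsilon> together.\<close>

lemma W_integral:
  assumes "h \<ge> 0" "\<And>c. \<bar>c\<bar> \<le> h \<Longrightarrow> (\<integral>z. \<bar>(F (fst z + c, snd z) - F z) * k z\<bar> \<partial>P) \<le> \<epsilon>" "\<epsilon> \<ge> 0"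
  shows "(\<integral>\<^sup>+r. W h r \<partial>lborel) \<le> ennreal (h * \<epsilon>)"
proof -
  have [measurable]: "(\<lambda>z. D (fst z) (fst z + snd z)) \<in> borel_measurable (lborel \<Otimes>\<^sub>M lborel)"
    by (rule D_measurable') measurable
  have m: "(\<lambda>z. indicator {0<..h} (snd z) * D (fst z) (fst z + snd z)) \<in> borel_measurable (lborel \<Otimes>\<^sub>M lborel)" by measurable
  have "(\<integral>\<^sup>+r. W h r \<partial>lborel) = (\<integral>\<^sup>+\<theta>. (\<integral>\<^sup>+r. indicator {0<..h} \<theta> * D r (r + \<theta>) \<partial>lborel) \<partial>lborel)"
    unfolding W_def using lborel_pair.Fubini[OF m] by simp
  also have "\<dots> = (\<integral>\<^sup>+\<theta>. indicator {0<..h} \<theta> * (\<integral>\<^sup>+r. D r (r + \<theta>) \<partial>lborel) \<partial>lborel)"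
    by (intro nn_integral_cong nn_integral_cmult D_measurable') auto
  also have "\<dots> \<le> (\<integral>\<^sup>+\<theta>. ennreal \<epsilon> * indicator {0<..h} \<theta> \<partial>lborel)"
  proof (rule nn_integral_mono)
    fix \<theta> :: real
    show "indicator {0<..h} \<theta> * (\<integral>\<^sup>+r. D r (r + \<theta>) \<partial>lborel) \<le> ennreal \<epsilon> * indicator {0<..h} \<theta>"
    proof (cases "\<theta> \<in> {0<..h}")
      case True
      then have "(\<integral>z. \<bar>(F (fst z + (- \<theta>), snd z) - F z) * k z\<bar> \<partial>P) \<le> \<epsilon>" by (intro assms(2)) auto
      then show ?thesis unfolding D_integral using True by (simp add: ennreal_leI)
    qed simp
  qed
  also have "\<dots> = ennreal (h * \<epsilon>)"
    using assms by (subst nn_integral_cmult_indicator) (auto simp: ennreal_mult mult.commute)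
  finally show ?thesis .
qed

lemma W_bound:
  assumes "good r" "h \<ge> 0"
  shows "ennreal \<bar>(\<integral>\<sigma>. indicator {r<..r+h} \<sigma> * b r \<sigma> \<partial>lborel) - (\<integral>\<sigma>. indicator {r<..r+h} \<sigma> * b \<sigma> \<sigma> \<partial>lborel)\<bar> \<le> W h r"
proof -
  have i: "integrable lborel (\<lambda>\<sigma>. indicator {r<..r+h} \<sigma> * f \<sigma>)" if "integrable lborel f" for f :: "real \<Rightarrow> real"
    using integrable_mult_indicator[of "{r<..r+h}" lborel f] that by simp
  note ii = i[OF b_integrable[OF assms(1)]] i[OF diag_integrable]
  note id = Bochner_Integration.integrable_diff[OF ii]
  have m: "(\<lambda>\<theta>. indicator {r<..r+h} \<theta> * D r \<theta>) \<in> borel_measurable borel"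
    using D_measurable'[of "\<lambda>_. r" borel "\<lambda>x. x"] by measurable
  have "\<bar>(\<integral>\<sigma>. indicator {r<..r+h} \<sigma> * b r \<sigma> \<partial>lborel) - (\<integral>\<sigma>. indicator {r<..r+h} \<sigma> * b \<sigma> \<sigma> \<partial>lborel)\<bar>
     \<le> (\<integral>\<sigma>. \<bar>indicator {r<..r+h} \<sigma> * b r \<sigma> - indicator {r<..r+h} \<sigma> * b \<sigma> \<sigma>\<bar> \<partial>lborel)"
    unfolding Bochner_Integration.integral_diff[OF ii, symmetric] by (rule integral_abs_bound)
  then have "ennreal \<bar>(\<integral>\<sigma>. indicator {r<..r+h} \<sigma> * b r \<sigma> \<partial>lborel) - (\<integral>\<sigma>. indicator {r<..r+h} \<sigma> * b \<sigma> \<sigma> \<partial>lborel)\<bar>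
    \<le> ennreal (\<integral>\<sigma>. \<bar>indicator {r<..r+h} \<sigma> * b r \<sigma> - indicator {r<..r+h} \<sigma> * b \<sigma> \<sigma>\<bar> \<partial>lborel)"
    by (rule ennreal_leI)
  also have "\<dots> = (\<integral>\<^sup>+\<sigma>. ennreal \<bar>indicator {r<..r+h} \<sigma> * b r \<sigma> - indicator {r<..r+h} \<sigma> * b \<sigma> \<sigma>\<bar> \<partial>lborel)"
    using id by (intro nn_integral_eq_integral[symmetric]) auto
  also have "\<dots> \<le> (\<integral>\<^sup>+\<sigma>. indicator {r<..r+h} \<sigma> * D r \<sigma> \<partial>lborel)"
  proof (rule nn_integral_mono_AE)
    show "AE \<sigma> in lborel. ennreal \<bar>indicator {r<..r+h} \<sigma> * b r \<sigma> - indicator {r<..r+h} \<sigma> * b \<sigma> \<sigma>\<bar> \<le> indicator {r<..r+h} \<sigma> * D r \<sigma>"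
      using b_diff_le[OF assms(1)] by eventually_elim (auto split: split_indicator)
  qed
  also have "\<dots> = (\<integral>\<^sup>+\<theta>. indicator {r<..r+h} (r + \<theta>) * D r (r + \<theta>) \<partial>lborel)"
    using nn_integral_real_affine[OF m, of 1 r] by simp
  also have "\<dots> = W h r" unfolding W_def
    by (intro nn_integral_cong) (auto split: split_indicator)
  finally show ?thesis .
qed

lemma indicator_split_integral:
  assumes "integrable lborel (f :: real \<Rightarrow> real)" "r \<le> s" "s \<le> t"
  shows "(\<integral>\<sigma>. indicator {r<..t} \<sigma> * f \<sigma> \<partial>lborel) = (\<integral>\<sigma>. indicator {r<..s} \<sigma> * f \<sigma> \<partial>lborel) + (\<integral>\<sigma>. indicator {s<..t} \<sigma> * f \<sigma> \<partial>lborel)"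
proof -
  have i: "integrable lborel (\<lambda>\<sigma>. indicator {r<..t} \<sigma> * f \<sigma>)" for r t
    using integrable_mult_indicator[of "{r<..t}" lborel f] assms(1) by simp
  have "(\<lambda>\<sigma>. indicator {r<..t} \<sigma> * f \<sigma>) = (\<lambda>\<sigma>. indicator {r<..s} \<sigma> * f \<sigma> + indicator {s<..t} \<sigma> * f \<sigma>)"
    using assms(2,3) by (auto simp: fun_eq_iff split: split_indicator)
  then show ?thesis using i by simp
qed

text \<open>The estimates are summed over a mesh of width \<open>d / n\<close> starting at \<open>\<tau>\<close>. Freezing the first
  argument of \<open>b\<close> at the mesh points causes an error that tends to \<open>0\<close> only after averaging over
  \<open>\<tau>\<close>, by continuity of translations in \<open>L\<^sub>p\<close>; a subsequence gives almost every \<open>\<tau>\<close>.\<close>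

lemma chain_mono:
  assumes R: "AE r in lborel. r \<in> {A<..<B} \<longrightarrow> R r"
    and e: "\<And>r t. R r \<Longrightarrow> R t \<Longrightarrow> r \<in> {A<..<B} \<Longrightarrow> t \<in> {A<..<B} \<Longrightarrow> r < t \<Longrightarrow> e t - e r \<ge> - (\<integral>\<sigma>. indicator {r<..t} \<sigma> * b r \<sigma> \<partial>lborel)"
    and d: "d > 0"
  shows "AE \<tau> in lborel. A < \<tau> \<and> \<tau> + d < B \<longrightarrow> e (\<tau> + d) - e \<tau> \<ge> - (\<integral>\<sigma>. indicator {\<tau><..\<tau>+d} \<sigma> * b \<sigma> \<sigma> \<partial>lborel)"
proof -
  define h where "h n = d / real (Suc n)" for n
  have h: "h n > 0" "real (Suc n) * h n = d" for n using d by (auto simp: h_def)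
  define Err where "Err n \<tau> = (\<Sum>i<Suc n. W (h n) (\<tau> + real i * h n))" for n \<tau>
  have Wm: "(\<lambda>\<tau>. W (h n) (\<tau> + c)) \<in> borel_measurable lborel" for n c
    using measurable_compose[OF _ W_measurable, of "\<lambda>\<tau>. \<tau> + c" borel "h n"] by simp
  have Em: "Err n \<in> borel_measurable lborel" for n
    unfolding Err_def[abs_def] by (intro borel_measurable_sum Wm)
  have Ei: "(\<integral>\<^sup>+\<tau>. Err n \<tau> \<partial>lborel) = of_nat (Suc n) * (\<integral>\<^sup>+\<tau>. W (h n) \<tau> \<partial>lborel)" for n
  proof -
    have "(\<integral>\<^sup>+\<tau>. Err n \<tau> \<partial>lborel) = (\<Sum>i<Suc n. \<integral>\<^sup>+\<tau>. W (h n) (\<tau> + real i * h n) \<partial>lborel)"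
      unfolding Err_def by (intro nn_integral_sum Wm)
    also have "\<dots> = (\<Sum>i<Suc n. \<integral>\<^sup>+\<tau>. W (h n) \<tau> \<partial>lborel)"
      using nn_integral_real_affine[of "W (h n)" 1 "real i * h n" for i] W_measurable[of "h n"]
      by (intro sum.cong) (auto simp: add.commute)
    finally show ?thesis by simp
  qed
  have "(\<lambda>n. \<integral>\<^sup>+\<tau>. Err n \<tau> \<partial>lborel) \<longlonglongrightarrow> 0"
  proof (rule order_tendstoI)
    fix x :: ennreal assume "0 < x"
    then obtain y where y: "0 < y" "y < x" using dense by blast
    then obtain \<epsilon>' where e': "\<epsilon>' > 0" "ennreal \<epsilon>' < x"
      by (cases y rule: ennreal_cases) auto
    \<comment> \<open>The \<open>Suc n\<close> cells of length \<open>h n\<close> add up to d, so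
      the total error is at most d \<epsilon> = \<epsilon>'.\<close>
    define \<epsilon> where "\<epsilon> = \<epsilon>' / d"
    have ep: "\<epsilon> > 0" using e' d by (simp add: \<epsilon>_def)
    obtain \<delta> where \<delta>: "\<delta> > 0" "\<And>c. \<bar>c\<bar> < \<delta> \<Longrightarrow> (\<integral>z. \<bar>(F (fst z + c, snd z) - F z) * k z\<bar> \<partial>P) < \<epsilon>"
      using transl_dual_eps[OF ep] by blast
    have "(\<lambda>n. d * (1 / real (Suc n))) \<longlonglongrightarrow> d * 0" by (intro tendsto_mult tendsto_const LIMSEQ_Suc[OF lim_1_over_n])
    then have "\<forall>\<^sub>F n in sequentially. d * (1 / real (Suc n)) < \<delta>" using \<delta>(1) by (intro order_tendstoD(2)) auto
    then show "\<forall>\<^sub>F n in sequentially. (\<integral>\<^sup>+\<tau>. Err n \<tau> \<partial>lborel) < x"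
    proof eventually_elim
      case (elim n)
      have "(\<integral>\<^sup>+\<tau>. W (h n) \<tau> \<partial>lborel) \<le> ennreal (h n * \<epsilon>)"
      proof (rule W_integral)
        fix c assume "\<bar>c\<bar> \<le> h n"
        then have "\<bar>c\<bar> < \<delta>" using elim by (simp add: h_def)
        then show "(\<integral>z. \<bar>(F (fst z + c, snd z) - F z) * k z\<bar> \<partial>P) \<le> \<epsilon>" using \<delta>(2) by (intro less_imp_le)
      qed (use h ep less_imp_le in auto)
      then have "(\<integral>\<^sup>+\<tau>. Err n \<tau> \<partial>lborel) \<le> ennreal (real (Suc n)) * ennreal (h n * \<epsilon>)"
        unfolding Ei ennreal_of_nat_eq_real_of_nat by (intro mult_left_mono) auto
      also have "\<dots> = ennreal (real (Suc n) * (h n * \<epsilon>))"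
        using h ep by (intro ennreal_mult[symmetric]) (auto intro!: mult_nonneg_nonneg less_imp_le)
      also have "real (Suc n) * (h n * \<epsilon>) = \<epsilon>'"
        using h(2)[of n] d by (simp add: \<epsilon>_def mult.assoc[symmetric])
      finally show ?case by (rule order.strict_trans1[OF _ e'(2)])
    qed
  qed simp
  \<comment> \<open>Fatou's lemma makes the lower limit of the errors vanish for almost every origin
    \<tau>. The quantity c estimated below does not depend on n, so the lower limit is
    enough.\<close>
  then have "liminf (\<lambda>n. \<integral>\<^sup>+\<tau>. Err n \<tau> \<partial>lborel) = 0" by (intro lim_imp_Liminf) auto
  moreover have "(\<integral>\<^sup>+\<tau>. liminf (\<lambda>n. Err n \<tau>) \<partial>lborel) \<le> liminf (\<lambda>n. \<integral>\<^sup>+\<tau>. Err n \<tau> \<partial>lborel)"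
    by (rule nn_integral_liminf[OF Em])
  ultimately have "(\<integral>\<^sup>+\<tau>. liminf (\<lambda>n. Err n \<tau>) \<partial>lborel) = 0" by simp
  moreover have "(\<lambda>\<tau>. liminf (\<lambda>n. Err n \<tau>)) \<in> borel_measurable lborel" using Em by measurable
  ultimately have lim0: "AE \<tau> in lborel. liminf (\<lambda>n. Err n \<tau>) = 0"
    by (simp add: nn_integral_0_iff_AE)
  \<comment> \<open>The points of all meshes with origin \<tau> are countably many shifts of \<tau>,
    so for almost every \<tau> none of them is exceptional.\<close>
  have "AE r in lborel. (r \<in> {A<..<B} \<longrightarrow> R r) \<and> good r" using R AE_good by eventually_elim simp
  then have "AE \<tau> in lborel. (\<tau> + c \<in> {A<..<B} \<longrightarrow> R (\<tau> + c)) \<and> good (\<tau> + c)" for c by (rule AE_lborel_shift)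
  then have Rall: "AE \<tau> in lborel. \<forall>n i. (\<tau> + real i * h n \<in> {A<..<B} \<longrightarrow> R (\<tau> + real i * h n)) \<and> good (\<tau> + real i * h n)"
    by (simp add: AE_all_countable)
  show ?thesis using lim0 Rall
  proof eventually_elim
    case (elim \<tau>)
    show ?case
    proof (intro impI)
      assume AB: "A < \<tau> \<and> \<tau> + d < B"
      define c where "c = e (\<tau> + d) - e \<tau> + (\<integral>\<sigma>. indicator {\<tau><..\<tau>+d} \<sigma> * b \<sigma> \<sigma> \<partial>lborel)"
      have "ennreal (- c) \<le> Err n \<tau>" for n
      proof -
        define t where "t i = \<tau> + real i * h n" for i
        have tS: "t (Suc i) = t i + h n" for i by (simp add: t_def algebra_simps)
        have tin: "t i \<in> {A<..<B}" if "i \<le> Suc n" for i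
        proof -
          have "real i * h n \<le> real (Suc n) * h n" using that h(1)[of n] by (intro mult_right_mono) auto
          then have "real i * h n \<le> d" using h(2) by simp
          moreover have "0 \<le> real i * h n" using h(1)[of n] by simp
          ultimately show ?thesis using AB by (simp add: t_def)
        qed
        have el: "R (t i) \<and> good (t i)" if "i \<le> Suc n" for i
          using elim(2) tin[OF that] unfolding t_def by blast
        have "ennreal (- (e (t i) - e \<tau> + (\<integral>\<sigma>. indicator {\<tau><..t i} \<sigma> * b \<sigma> \<sigma> \<partial>lborel))) \<le> (\<Sum>j<i. W (h n) (t j))"
          if "i \<le> Suc n" for i using that
        proof (induction i)
          case 0 then show ?case by (simp add: t_def)
        next
          case (Suc i)
          let ?x = "e (t i) - e \<tau> + (\<integral>\<sigma>. indicator {\<tau><..t i} \<sigma> * b \<sigma> \<sigma> \<partial>lborel)"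
          let ?X = "(\<integral>\<sigma>. indicator {t i<..t i + h n} \<sigma> * b (t i) \<sigma> \<partial>lborel)"
          let ?Y = "(\<integral>\<sigma>. indicator {t i<..t i + h n} \<sigma> * b \<sigma> \<sigma> \<partial>lborel)"
          have ti: "R (t i)" "R (t (Suc i))" "good (t i)"
            using el[of i] el[of "Suc i"] Suc.prems by auto
          have "e (t (Suc i)) - e (t i) \<ge> - ?X"
            using e[OF ti(1,2)] tin[of i] tin[of "Suc i"] Suc.prems h(1)[of n] by (simp add: tS)
          moreover have "(\<integral>\<sigma>. indicator {\<tau><..t (Suc i)} \<sigma> * b \<sigma> \<sigma> \<partial>lborel) = (\<integral>\<sigma>. indicator {\<tau><..t i} \<sigma> * b \<sigma> \<sigma> \<partial>lborel) + ?Y"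
            unfolding tS using h(1)[of n] by (intro indicator_split_integral diag_integrable) (auto simp: t_def)
          ultimately have "- (e (t (Suc i)) - e \<tau> + (\<integral>\<sigma>. indicator {\<tau><..t (Suc i)} \<sigma> * b \<sigma> \<sigma> \<partial>lborel)) \<le> - ?x + \<bar>?X - ?Y\<bar>"
            by linarith
          \<comment> \<open>\<open>ennreal\<close> truncates negative numbers to 0. Taking the
            maximum with 0 leaves a sum of two nonnegative terms, which can be split.\<close>
          then have "ennreal (- (e (t (Suc i)) - e \<tau> + (\<integral>\<sigma>. indicator {\<tau><..t (Suc i)} \<sigma> * b \<sigma> \<sigma> \<partial>lborel))) \<le> ennreal (max 0 (- ?x) + \<bar>?X - ?Y\<bar>)"
            by (intro ennreal_leI) simp
          also have "\<dots> = ennreal (- ?x) + ennreal \<bar>?X - ?Y\<bar>"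
            by (subst ennreal_plus) (auto simp: max_def ennreal_neg)
          also have "\<dots> \<le> (\<Sum>j<i. W (h n) (t j)) + W (h n) (t i)"
            using Suc W_bound[OF ti(3), of "h n"] h(1)[of n] by (intro add_mono) auto
          finally show ?case by simp
        qed
        from this[of "Suc n"] show ?thesis
          using h(2)[of n] by (simp add: t_def c_def Err_def)
      qed
      then have "ennreal (- c) \<le> liminf (\<lambda>n. Err n \<tau>)"
        by (intro Liminf_bounded always_eventually allI)
      then have "ennreal (- c) = 0" using elim(1) by simp
      then have "c \<ge> 0" by (simp add: ennreal_eq_0_iff)
      then show "e (\<tau> + d) - e \<tau> \<ge> - (\<integral>\<sigma>. indicator {\<tau><..\<tau>+d} \<sigma> * b \<sigma> \<sigma> \<partial>lborel)"
        by (simp add: c_def)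
    qed
  qed
qed

end

section \<open>Time reversal and the identity from both directions\<close>

lemma AE_lborel_uminus:
  fixes P :: "real \<Rightarrow> bool"
  assumes "AE t in lborel. P t" shows "AE t in lborel. P (- t)"
proof -
  have "AE t in distr lborel borel uminus. P t" using assms by (subst lborel_distr_uminus)
  then show ?thesis by (rule AE_distrD[rotated]) simp
qed

lemma integral_reflect_Ioc:
  fixes f :: "real \<Rightarrow> real"
  assumes [measurable]: "f \<in> borel_measurable borel"
  shows "(\<integral>\<sigma>. indicator {r<..t} \<sigma> * f (- \<sigma>) \<partial>lborel) = (\<integral>s. indicator {-t<..-r} s * f s \<partial>lborel)"
proof -
  have "(\<integral>s. indicator {-t<..-r} s * f s \<partial>lborel) = (\<integral>\<sigma>. indicator {-t<..-r} (- \<sigma>) * f (- \<sigma>) \<partial>lborel)"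
    using lborel_integral_real_affine[of "-1" "\<lambda>s. indicator {-t<..-r} s * f s" 0] by simp
  also have "\<dots> = (\<integral>\<sigma>. indicator {r<..t} \<sigma> * f (- \<sigma>) \<partial>lborel)"
  proof (rule integral_cong_AE)
    show "AE \<sigma> in lborel. indicat_real {- t<..- r} (- \<sigma>) * f (- \<sigma>) = indicat_real {r<..t} \<sigma> * f (- \<sigma>)"
      using AE_lborel_singleton[of r] AE_lborel_singleton[of t]
      by eventually_elim (auto split: split_indicator)
  qed measurable
  finally show ?thesis ..
qed

lemma reflect_fst_measurable:
  "(\<lambda>z. (- fst z, snd z)) \<in> (lborel :: real measure) \<Otimes>\<^sub>M M \<rightarrow>\<^sub>M lborel \<Otimes>\<^sub>M M"
  by measurable

lemma nn_integral_pair_reflect: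
  assumes M: "sigma_finite_measure M" and f: "f \<in> borel_measurable ((lborel :: real measure) \<Otimes>\<^sub>M M)"
  shows "(\<integral>\<^sup>+z. f (- fst z, snd z) \<partial>(lborel \<Otimes>\<^sub>M M)) = (\<integral>\<^sup>+z. f z \<partial>(lborel \<Otimes>\<^sub>M M))"
proof -
  interpret M: sigma_finite_measure M by (rule M)
  have fs: "(\<lambda>z. f (- fst z, snd z)) \<in> borel_measurable (lborel \<Otimes>\<^sub>M M)"
    by (rule measurable_compose[OF reflect_fst_measurable f])
  have "(\<integral>\<^sup>+z. f (- fst z, snd z) \<partial>(lborel \<Otimes>\<^sub>M M)) = (\<integral>\<^sup>+t. (\<integral>\<^sup>+x. f (- t, x) \<partial>M) \<partial>lborel)"
    using M.nn_integral_fst[OF fs] by simp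
  also have "\<dots> = (\<integral>\<^sup>+t. (\<integral>\<^sup>+x. f (t, x) \<partial>M) \<partial>lborel)"
    using nn_integral_real_affine[of "\<lambda>t. \<integral>\<^sup>+x. f (t, x) \<partial>M" "-1" 0] M.borel_measurable_nn_integral_fst[OF f]
    by simp
  also have "\<dots> = (\<integral>\<^sup>+z. f z \<partial>(lborel \<Otimes>\<^sub>M M))" by (rule M.nn_integral_fst[OF f])
  finally show ?thesis .
qed

lemma integrable_pair_reflect:
  fixes f :: "real \<times> 'b \<Rightarrow> real"
  assumes M: "sigma_finite_measure M" and f: "integrable (lborel \<Otimes>\<^sub>M M) f"
  shows "integrable (lborel \<Otimes>\<^sub>M M) (\<lambda>z. f (- fst z, snd z))"
proof -
  have m: "(\<lambda>z. ennreal (norm (f z))) \<in> borel_measurable (lborel \<Otimes>\<^sub>M M)" using f by simp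
  show ?thesis
  using f nn_integral_pair_reflect[OF M, of "\<lambda>z. ennreal (norm (f z))", OF m]
    measurable_compose[OF reflect_fst_measurable borel_measurable_integrable[OF f]]
  by (simp add: integrable_iff_bounded)
qed

text \<open>The exceptional set of \<tau> depends on the shift d. Fubini exchanges the two: for
  almost every \<tau>, the value I \<tau> is taken at almost every later time. Two such \<tau> are
  then compared at a common later time.\<close>

lemma AE_const_of_shifts:
  fixes I :: "real \<Rightarrow> real"
  assumes I[measurable]: "I \<in> borel_measurable borel"
    and sh: "\<And>d. d > 0 \<Longrightarrow> AE \<tau> in lborel. A < \<tau> \<and> \<tau> + d < B \<longrightarrow> I (\<tau> + d) = I \<tau>"
  shows "\<exists>c. AE \<tau> in lborel. \<tau> \<in> {A<..<B} \<longrightarrow> I \<tau> = c"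
proof (cases "A < B")
  case False
  then show ?thesis by auto
next
  case True
  let ?Q = "\<lambda>d \<tau>. 0 < d \<and> A < \<tau> \<and> \<tau> + d < B \<longrightarrow> I (\<tau> + d) = I \<tau>"
  have m: "{z \<in> space (lborel \<Otimes>\<^sub>M lborel). ?Q (fst z) (snd z)} \<in> sets (lborel \<Otimes>\<^sub>M lborel)" by measurable
  have "AE d in lborel. AE \<tau> in lborel. ?Q d \<tau>"
  proof (rule AE_I2)
    fix d show "AE \<tau> in lborel. ?Q d \<tau>"
    proof (cases "d > 0")
      case True
      from sh[OF this] show ?thesis by eventually_elim simp
    qed simp
  qed
  then have sw: "AE \<tau> in lborel. AE d in lborel. ?Q d \<tau>"
    by (rule lborel_pair.AE_commute[where P = ?Q, OF m, THEN iffD1])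
  have sw': "AE \<tau> in lborel. AE t in lborel. A < \<tau> \<and> \<tau> < t \<and> t < B \<longrightarrow> I t = I \<tau>"
    using sw
  proof eventually_elim
    case (elim \<tau>)
    from AE_lborel_shift[OF elim, of "- \<tau>"] show ?case by eventually_elim auto
  qed
  have ex: "\<exists>x. x \<in> {l<..<u} \<and> P x" if "AE x in lborel. P x" "l < u" for P :: "real \<Rightarrow> bool" and l u
  proof (rule ccontr)
    assume "\<not> ?thesis"
    then have "AE x in lborel. x \<notin> {l<..<u}" using that(1) by (auto elim!: AE_mp)
    then have "{l<..<u} \<in> null_sets lborel" by (subst AE_iff_null_sets) auto
    then have "emeasure lborel {l<..<u} = 0" by auto
    then show False using that(2) by simp
  qed
  obtain \<tau>1 where t1: "\<tau>1 \<in> {A<..<B}" "AE t in lborel. A < \<tau>1 \<and> \<tau>1 < t \<and> t < B \<longrightarrow> I t = I \<tau>1"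
    using ex[OF sw' True] by blast
  have "AE \<tau> in lborel. \<tau> \<in> {A<..<B} \<longrightarrow> I \<tau> = I \<tau>1"
    using sw'
  proof eventually_elim
    case (elim \<tau>)
    show ?case
    proof
      assume \<tau>: "\<tau> \<in> {A<..<B}"
      have "AE t in lborel. (A < \<tau>1 \<and> \<tau>1 < t \<and> t < B \<longrightarrow> I t = I \<tau>1) \<and> (A < \<tau> \<and> \<tau> < t \<and> t < B \<longrightarrow> I t = I \<tau>)"
        using t1(2) elim by eventually_elim simp
      from ex[OF this, of "max \<tau> \<tau>1" B] obtain t where
        "t \<in> {max \<tau> \<tau>1<..<B}" "I t = I \<tau>1" "I t = I \<tau>" using t1(1) \<tau> by auto
      then show "I \<tau> = I \<tau>1" by simp
    qed
  qed
  then show ?thesis by blast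
qed

context Lpq begin

text \<open>Reversal of time exchanges the endpoints of a cell and the sign of the increment of e;
  the sign of F compensates the latter, so that an inequality frozen at the right endpoint becomes
  one frozen at the left endpoint.\<close>

lemma reflected: "Lpq M p q (\<lambda>z. - F (- fst z, snd z)) (\<lambda>z. k (- fst z, snd z)) (- B) (- A)"
proof (unfold_locales, goal_cases)
  case 4
  from measurable_compose[OF reflect_fst_measurable F(1)] show ?case by simp
next
  case 5
  from integrable_pair_reflect[OF sfM F(2)] show ?case by simp
next
  case 6
  from measurable_compose[OF reflect_fst_measurable k(1)] show ?case by simp
next
  case 7
  from integrable_pair_reflect[OF sfM k(2)] show ?case by simp
qed (use pq supp in auto)

text \<open>Forward meshes use the inequality frozen at the left endpoint, reflected meshes the one
  frozen at the right endpoint. Both errors vanish in the limit, so for each fixed shift and almost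
  every time two opposite inequalities meet in an equality.\<close>

lemma chain_const:
  assumes R: "AE r in lborel. r \<in> {A<..<B} \<longrightarrow> R r"
    and e1: "\<And>r t. R r \<Longrightarrow> R t \<Longrightarrow> r \<in> {A<..<B} \<Longrightarrow> t \<in> {A<..<B} \<Longrightarrow> r < t \<Longrightarrow> e t - e r \<ge> - (\<integral>\<sigma>. indicator {r<..t} \<sigma> * b r \<sigma> \<partial>lborel)"
    and e2: "\<And>r t. R r \<Longrightarrow> R t \<Longrightarrow> r \<in> {A<..<B} \<Longrightarrow> t \<in> {A<..<B} \<Longrightarrow> t < r \<Longrightarrow> e t - e r \<ge> (\<integral>\<sigma>. indicator {t<..r} \<sigma> * b r \<sigma> \<partial>lborel)"
    and e[measurable]: "e \<in> borel_measurable borel"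
  shows "\<exists>c. AE \<tau> in lborel. \<tau> \<in> {A<..<B} \<longrightarrow> e \<tau> + (\<integral>\<sigma>. indicator {A<..\<tau>} \<sigma> * b \<sigma> \<sigma> \<partial>lborel) = c"
proof (rule AE_const_of_shifts)
  interpret R: Lpq M p q "\<lambda>z. - F (- fst z, snd z)" "\<lambda>z. k (- fst z, snd z)" "- B" "- A"
    by (rule reflected)
  have Rb: "R.b r \<sigma> = - b (- r) (- \<sigma>)" for r \<sigma> by (simp add: R.b_def b_def)
  note [measurable] = F(1) k(1)
  have bm[measurable]: "b r \<in> borel_measurable borel" for r unfolding b_def[abs_def] by measurable
  have dm[measurable]: "(\<lambda>\<sigma>. b \<sigma> \<sigma>) \<in> borel_measurable borel" using diag_integrable by auto
  have "(\<lambda>z. indicat_real {z. A < snd z \<and> snd z \<le> fst z} z * b (snd z) (snd z)) \<in> borel_measurable (lborel \<Otimes>\<^sub>M lborel)"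
    by measurable
  then have "(\<lambda>\<tau>. \<integral>\<sigma>. indicat_real {z. A < snd z \<and> snd z \<le> fst z} (\<tau>, \<sigma>) * b \<sigma> \<sigma> \<partial>lborel) \<in> borel_measurable lborel"
    by (intro lborel.borel_measurable_lebesgue_integral) (simp add: case_prod_unfold)
  moreover have "(\<lambda>\<tau>. \<integral>\<sigma>. indicat_real {z. A < snd z \<and> snd z \<le> fst z} (\<tau>, \<sigma>) * b \<sigma> \<sigma> \<partial>lborel) = (\<lambda>\<tau>. \<integral>\<sigma>. indicator {A<..\<tau>} \<sigma> * b \<sigma> \<sigma> \<partial>lborel)"
    by (intro ext Bochner_Integration.integral_cong) (auto split: split_indicator)
  ultimately show "(\<lambda>\<tau>. e \<tau> + (\<integral>\<sigma>. indicator {A<..\<tau>} \<sigma> * b \<sigma> \<sigma> \<partial>lborel)) \<in> borel_measurable borel" by simp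
  fix d :: real assume d: "d > 0"
  have lo: "AE \<tau> in lborel. A < \<tau> \<and> \<tau> + d < B \<longrightarrow> e (\<tau> + d) - e \<tau> \<ge> - (\<integral>\<sigma>. indicator {\<tau><..\<tau>+d} \<sigma> * b \<sigma> \<sigma> \<partial>lborel)"
    by (rule chain_mono[OF R e1 d])
  have "AE \<tau> in lborel. - B < \<tau> \<and> \<tau> + d < - A \<longrightarrow> e (- (\<tau> + d)) - e (- \<tau>) \<ge> - (\<integral>\<sigma>. indicator {\<tau><..\<tau>+d} \<sigma> * R.b \<sigma> \<sigma> \<partial>lborel)"
  proof (rule R.chain_mono[where R = "\<lambda>r. R (- r)" and e = "\<lambda>t. e (- t)", OF _ _ d])
    show "AE r in lborel. r \<in> {- B<..<- A} \<longrightarrow> R (- r)"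
      using AE_lborel_uminus[OF R] by eventually_elim auto
    fix r t assume a: "R (- r)" "R (- t)" "r \<in> {- B<..<- A}" "t \<in> {- B<..<- A}" "r < t"
    have "(\<integral>\<sigma>. indicator {r<..t} \<sigma> * R.b r \<sigma> \<partial>lborel) = - (\<integral>\<sigma>. indicator {r<..t} \<sigma> * b (- r) (- \<sigma>) \<partial>lborel)"
      unfolding Rb by simp
    also have "(\<integral>\<sigma>. indicator {r<..t} \<sigma> * b (- r) (- \<sigma>) \<partial>lborel) = (\<integral>s. indicator {-t<..-r} s * b (- r) s \<partial>lborel)"
      by (rule integral_reflect_Ioc) measurable
    finally show "- (\<integral>\<sigma>. indicator {r<..t} \<sigma> * R.b r \<sigma> \<partial>lborel) \<le> e (- t) - e (- r)"
      using e2[of "- r" "- t"] a by auto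
  qed
  \<comment> \<open>Undoes the reflection: the reflected cell that starts at - (\<tau> + d) is the
    original cell from \<tau> to \<tau> + d.\<close>
  from AE_lborel_shift[OF AE_lborel_uminus[OF this], of d]
  have "AE \<tau> in lborel. A < \<tau> \<and> \<tau> + d < B \<longrightarrow> e \<tau> - e (\<tau> + d) \<ge> - (\<integral>\<sigma>. indicator {- \<tau> - d<..- \<tau>} \<sigma> * R.b \<sigma> \<sigma> \<partial>lborel)"
    by eventually_elim (auto simp: add.commute)
  then show "AE \<tau> in lborel. A < \<tau> \<and> \<tau> + d < B \<longrightarrow> e (\<tau> + d) + (\<integral>\<sigma>. indicator {A<..\<tau> + d} \<sigma> * b \<sigma> \<sigma> \<partial>lborel) = e \<tau> + (\<integral>\<sigma>. indicator {A<..\<tau>} \<sigma> * b \<sigma> \<sigma> \<partial>lborel)"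
    using lo
  proof eventually_elim
    case (elim \<tau>)
    show ?case
    proof
      assume AB: "A < \<tau> \<and> \<tau> + d < B"
      have "(\<integral>\<sigma>. indicator {- \<tau> - d<..- \<tau>} \<sigma> * R.b \<sigma> \<sigma> \<partial>lborel) = - (\<integral>\<sigma>. indicator {- \<tau> - d<..- \<tau>} \<sigma> * b (- \<sigma>) (- \<sigma>) \<partial>lborel)"
        unfolding Rb by simp
      also have "(\<integral>\<sigma>. indicator {- \<tau> - d<..- \<tau>} \<sigma> * b (- \<sigma>) (- \<sigma>) \<partial>lborel) = (\<integral>s. indicator {\<tau><..\<tau>+d} s * b s s \<partial>lborel)"
        using integral_reflect_Ioc[OF dm, of "- \<tau> - d" "- \<tau>"] by (simp add: add.commute)
      finally have "e (\<tau> + d) - e \<tau> = - (\<integral>s. indicator {\<tau><..\<tau>+d} s * b s s \<partial>lborel)"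
        using elim AB by linarith
      moreover have "(\<integral>\<sigma>. indicator {A<..\<tau> + d} \<sigma> * b \<sigma> \<sigma> \<partial>lborel) = (\<integral>\<sigma>. indicator {A<..\<tau>} \<sigma> * b \<sigma> \<sigma> \<partial>lborel) + (\<integral>\<sigma>. indicator {\<tau><..\<tau>+d} \<sigma> * b \<sigma> \<sigma> \<partial>lborel)"
        using AB d by (intro indicator_split_integral diag_integrable) auto
      ultimately show "e (\<tau> + d) + (\<integral>\<sigma>. indicator {A<..\<tau> + d} \<sigma> * b \<sigma> \<sigma> \<partial>lborel) = e \<tau> + (\<integral>\<sigma>. indicator {A<..\<tau>} \<sigma> * b \<sigma> \<sigma> \<partial>lborel)"
        by simp
    qed
  qed
qed

end

section \<open>Joint measurability of weak derivatives\<close>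

lemma AE_lborel_MI: "(AE x in MI a b. P x) \<longleftrightarrow> (AE x in lborel. x \<in> {a<..<b} \<longrightarrow> P x)"
  unfolding AE_MI AE_completion_iff by simp

lemma nn_integral_MI_lborel: "integral\<^sup>N (MI a b) f = (\<integral>\<^sup>+x. indicator {a<..<b} x * f x \<partial>lborel)"
  by (simp add: nn_MI[symmetric] nn_integral_completion mult.commute)

text \<open>No convergence rate is uniform in \<open>t\<close>, so the index of the approximation is chosen
  measurably depending on \<open>t\<close>.\<close>

lemma joint_measurable_limit:
  fixes g :: "nat \<Rightarrow> real \<times> 'b \<Rightarrow> real" and u :: "real \<Rightarrow> 'b \<Rightarrow> real"
  assumes M: "sigma_finite_measure M" and g[measurable]: "\<And>n. g n \<in> borel_measurable (lborel \<Otimes>\<^sub>M M)"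
    and u: "AE t in lborel. t \<in> I \<longrightarrow> u t \<in> borel_measurable M \<and> (\<lambda>n. \<integral>\<^sup>+x. ennreal \<bar>g n (t, x) - u t x\<bar> \<partial>M) \<longlonglongrightarrow> 0"
  obtains U where "U \<in> borel_measurable (lborel \<Otimes>\<^sub>M M)" "AE t in lborel. t \<in> I \<longrightarrow> (AE x in M. U (t, x) = u t x)"
proof -
  interpret M: sigma_finite_measure M by (rule M)
  define d where "d n m t = (\<integral>\<^sup>+x. ennreal \<bar>g n (t, x) - g m (t, x)\<bar> \<partial>M)" for n m t
  have dm[measurable]: "d n m \<in> borel_measurable lborel" for n m
  proof -
    have "(\<lambda>z. ennreal \<bar>g n z - g m z\<bar>) \<in> borel_measurable (lborel \<Otimes>\<^sub>M M)" by measurable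
    from M.borel_measurable_nn_integral_fst[OF this] show ?thesis by (simp add: d_def[abs_def])
  qed
  \<comment> \<open>A summable rate, so that L_1 distances below c j force convergence almost
    everywhere.\<close>
  define c :: "nat \<Rightarrow> ennreal" where "c j = ennreal ((1/2) ^ j)" for j
  \<comment> \<open>The index is read off the mutual distances of the approximants, which are
    measurable in t. The distances to u are not known to be, since u comes without joint
    measurability.\<close>
  define N where "N j t = (LEAST n. \<forall>m. m \<ge> n \<longrightarrow> d n m t \<le> c j)" for j t
  have Nm[measurable]: "N j \<in> lborel \<rightarrow>\<^sub>M count_space UNIV" for j
    unfolding N_def[abs_def] by measurable
  define G where "G j z = g (N j (fst z)) z" for j z
  have Gm[measurable]: "G j \<in> borel_measurable (lborel \<Otimes>\<^sub>M M)" for j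
    unfolding G_def[abs_def]
    by (rule measurable_compose_countable[where f = "\<lambda>i z. g i z" and g = "\<lambda>z. N j (fst z)"]) measurable
  define U where "U z = lim (\<lambda>j. G j z)" for z
  have Um: "U \<in> borel_measurable (lborel \<Otimes>\<^sub>M M)"
    unfolding U_def[abs_def] by (rule borel_measurable_lim_metric) (rule Gm)
  have "AE t in lborel. t \<in> I \<longrightarrow> (AE x in M. U (t, x) = u t x)"
    using u
  proof eventually_elim
    case (elim t)
    show ?case
    proof
      assume "t \<in> I"
      with elim have um[measurable]: "u t \<in> borel_measurable M"
        and l: "(\<lambda>n. \<integral>\<^sup>+x. ennreal \<bar>g n (t, x) - u t x\<bar> \<partial>M) \<longlonglongrightarrow> 0" by auto
      have gt[measurable]: "(\<lambda>x. g n (t, x)) \<in> borel_measurable M" for n by measurable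
      have tri: "(\<integral>\<^sup>+x. ennreal \<bar>f x - h x\<bar> \<partial>M) \<le> (\<integral>\<^sup>+x. ennreal \<bar>f x - w x\<bar> \<partial>M) + (\<integral>\<^sup>+x. ennreal \<bar>h x - w x\<bar> \<partial>M)"
        if [measurable]: "f \<in> borel_measurable M" "h \<in> borel_measurable M" "w \<in> borel_measurable M" for f h w :: "'b \<Rightarrow> real"
      proof -
        have "(\<integral>\<^sup>+x. ennreal \<bar>f x - h x\<bar> \<partial>M) \<le> (\<integral>\<^sup>+x. ennreal \<bar>f x - w x\<bar> + ennreal \<bar>h x - w x\<bar> \<partial>M)"
          by (intro nn_integral_mono) (simp flip: ennreal_plus)
        also have "\<dots> = (\<integral>\<^sup>+x. ennreal \<bar>f x - w x\<bar> \<partial>M) + (\<integral>\<^sup>+x. ennreal \<bar>h x - w x\<bar> \<partial>M)"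
          by (rule nn_integral_add) measurable
        finally show ?thesis .
      qed
      have cpos: "0 < c j" for j by (simp add: c_def)
      have ex: "\<exists>n. \<forall>m. m \<ge> n \<longrightarrow> d n m t \<le> c j" for j
      proof -
        have "0 < ennreal ((1/2) ^ j / 2)" by simp
        from order_tendstoD(2)[OF l this] obtain n where
          n: "\<And>m. m \<ge> n \<Longrightarrow> (\<integral>\<^sup>+x. ennreal \<bar>g m (t, x) - u t x\<bar> \<partial>M) < ennreal ((1/2) ^ j / 2)"
          unfolding eventually_sequentially by blast
        have "d n m t \<le> c j" if "m \<ge> n" for m
        proof -
          have "d n m t \<le> ennreal ((1/2) ^ j / 2) + ennreal ((1/2) ^ j / 2)"
            unfolding d_def using tri[OF gt gt um, of n m] n[of n] n[OF that]
            by (meson add_mono less_imp_le order_refl order_trans)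
          also have "\<dots> = c j" by (simp add: c_def flip: ennreal_plus)
          finally show ?thesis .
        qed
        then show ?thesis by blast
      qed
      have dN: "d (N j t) m t \<le> c j" if "m \<ge> N j t" for j m
        using LeastI_ex[OF ex[of j]] that unfolding N_def by blast
      have GU: "(\<integral>\<^sup>+x. ennreal \<bar>G j (t, x) - u t x\<bar> \<partial>M) \<le> c j" for j
      proof -
        have "(\<lambda>m. c j + (\<integral>\<^sup>+x. ennreal \<bar>g m (t, x) - u t x\<bar> \<partial>M)) \<longlonglongrightarrow> c j + 0"
          by (intro tendsto_add tendsto_const l)
        then have "(\<lambda>m. c j + (\<integral>\<^sup>+x. ennreal \<bar>g m (t, x) - u t x\<bar> \<partial>M)) \<longlonglongrightarrow> c j" by simp
        then show ?thesis
        proof (rule tendsto_lowerbound)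
          show "\<forall>\<^sub>F m in sequentially. (\<integral>\<^sup>+x. ennreal \<bar>G j (t, x) - u t x\<bar> \<partial>M) \<le> c j + (\<integral>\<^sup>+x. ennreal \<bar>g m (t, x) - u t x\<bar> \<partial>M)"
            unfolding eventually_sequentially
          proof (intro exI[of _ "N j t"] allI impI)
            fix m assume m: "m \<ge> N j t"
            have "(\<integral>\<^sup>+x. ennreal \<bar>G j (t, x) - u t x\<bar> \<partial>M) \<le> d (N j t) m t + (\<integral>\<^sup>+x. ennreal \<bar>u t x - g m (t, x)\<bar> \<partial>M)"
              unfolding G_def d_def by (simp add: tri)
            also have "\<dots> \<le> c j + (\<integral>\<^sup>+x. ennreal \<bar>g m (t, x) - u t x\<bar> \<partial>M)"
              using dN[OF m] by (simp add: abs_minus_commute add_mono)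
            finally show "(\<integral>\<^sup>+x. ennreal \<bar>G j (t, x) - u t x\<bar> \<partial>M) \<le> c j + (\<integral>\<^sup>+x. ennreal \<bar>g m (t, x) - u t x\<bar> \<partial>M)" .
          qed
        qed simp
      qed
      have [measurable]: "(\<lambda>x. G j (t, x)) \<in> borel_measurable M" for j by (simp add: G_def gt)
      have "(\<integral>\<^sup>+x. (\<Sum>j. ennreal \<bar>G j (t, x) - u t x\<bar>) \<partial>M) = (\<Sum>j. \<integral>\<^sup>+x. ennreal \<bar>G j (t, x) - u t x\<bar> \<partial>M)"
        by (rule nn_integral_suminf) measurable
      also have "\<dots> \<le> (\<Sum>j. c j)" by (intro suminf_le GU) auto
      also have "\<dots> < \<infinity>"
        unfolding c_def by (subst suminf_ennreal2) (auto simp: summable_geometric)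
      finally have "(\<integral>\<^sup>+x. (\<Sum>j. ennreal \<bar>G j (t, x) - u t x\<bar>) \<partial>M) \<noteq> \<infinity>" by simp
      then have "AE x in M. (\<Sum>j. ennreal \<bar>G j (t, x) - u t x\<bar>) \<noteq> \<infinity>"
        by (intro nn_integral_PInf_AE) measurable
      then show "AE x in M. U (t, x) = u t x"
      proof eventually_elim
        case (elim x)
        then have "summable (\<lambda>j. \<bar>G j (t, x) - u t x\<bar>)" by (intro summable_suminf_not_top) auto
        then have "(\<lambda>j. G j (t, x) - u t x) \<longlonglongrightarrow> 0" using summable_LIMSEQ_zero tendsto_rabs_zero_iff by blast
        then have "(\<lambda>j. G j (t, x)) \<longlonglongrightarrow> u t x" by (simp add: LIM_zero_iff)
        then show ?case unfolding U_def by (rule limI)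
      qed
    qed
  qed
  with Um show thesis by (rule that)
qed

text \<open>Pointwise |y| \<le> e + e^(1-p) |y|^p, by comparing |y| with e. The number e is chosen
  small against the total mass, and only then n is taken large.\<close>

lemma Lp_to_L1:
  fixes f :: "nat \<Rightarrow> 'b \<Rightarrow> real"
  assumes fin: "finite_measure M" and p: "p \<ge> 1" and f: "\<And>n. f n \<in> borel_measurable M" "\<And>n. integrable M (\<lambda>x. \<bar>f n x\<bar> powr p)"
    and l: "(\<lambda>n. \<integral>x. \<bar>f n x\<bar> powr p \<partial>M) \<longlonglongrightarrow> 0"
  shows "(\<lambda>n. \<integral>x. \<bar>f n x\<bar> \<partial>M) \<longlonglongrightarrow> 0"
proof (rule LIMSEQ_I)
  interpret finite_measure M by (rule fin)
  have i: "integrable M (f n)" for n using integrable_of_powr[OF p f] .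
  fix r :: real assume r: "r > 0"
  define m where "m = measure M (space M)"
  have m: "m \<ge> 0" by (simp add: m_def)
  define e where "e = r / (2 * (m + 1))"
  have e: "e > 0" using r m by (simp add: e_def)
  have em: "e * m < r / 2 + r / 4" 
  proof -
    have "e * m \<le> e * (m + 1)" using e by simp
    also have "\<dots> = r / 2" using m by (simp add: e_def field_simps)
    finally show ?thesis using r by simp
  qed
  have "(\<lambda>n. e powr (1 - p) * (\<integral>x. \<bar>f n x\<bar> powr p \<partial>M)) \<longlonglongrightarrow> e powr (1 - p) * 0"
    by (intro tendsto_mult tendsto_const l)
  then have "\<forall>\<^sub>F n in sequentially. e powr (1 - p) * (\<integral>x. \<bar>f n x\<bar> powr p \<partial>M) < r / 4"
    using order_tendstoD(2)[of _ 0 sequentially "r/4"] r by simp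
  then obtain N where N: "\<And>n. n \<ge> N \<Longrightarrow> e powr (1 - p) * (\<integral>x. \<bar>f n x\<bar> powr p \<partial>M) < r / 4"
    unfolding eventually_sequentially by blast
  show "\<exists>no. \<forall>n\<ge>no. norm ((\<integral>x. \<bar>f n x\<bar> \<partial>M) - 0) < r"
  proof (intro exI[of _ N] allI impI)
    fix n assume n: "n \<ge> N"
    have pt: "\<bar>y\<bar> \<le> e + e powr (1 - p) * \<bar>y\<bar> powr p" for y :: real
    proof (cases "\<bar>y\<bar> \<le> e")
      case True
      have "0 \<le> e powr (1 - p) * \<bar>y\<bar> powr p" by simp
      with True show ?thesis by linarith
    next
      case False
      then have "\<bar>y\<bar> = \<bar>y\<bar> powr (1 - p) * \<bar>y\<bar> powr p" using e by (simp add: powr_add[symmetric])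
      also have "\<dots> \<le> e powr (1 - p) * \<bar>y\<bar> powr p"
        using False e p by (intro mult_right_mono powr_mono2') auto
      finally show ?thesis using e by linarith
    qed
    have "(\<integral>x. \<bar>f n x\<bar> \<partial>M) \<le> (\<integral>x. e + e powr (1 - p) * \<bar>f n x\<bar> powr p \<partial>M)"
      using i f(2) pt by (intro integral_mono integrable_abs Bochner_Integration.integrable_add integrable_const integrable_mult_right) auto
    also have "\<dots> = e * m + e powr (1 - p) * (\<integral>x. \<bar>f n x\<bar> powr p \<partial>M)"
      using f(2) by (simp add: m_def)
    also have "\<dots> < r" using N[OF n] em by linarith
    finally show "norm ((\<integral>x. \<bar>f n x\<bar> \<partial>M) - 0) < r" by (simp add: integral_nonneg_AE)
  qed
qed

lemma sobolev_norm_powr: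
  assumes "p > 0"
  shows "sobolev_norm k p {a<..<b} f powr p = (\<Sum>j\<le>k. \<integral>x. \<bar>wderiv {a<..<b} j f x\<bar> powr p \<partial>MI a b)"
proof -
  have "0 \<le> (\<Sum>j\<le>k. \<integral>x. \<bar>wderiv {a<..<b} j f x\<bar> powr p \<partial>MI a b)"
    by (intro sum_nonneg integral_nonneg_AE) auto
  then show ?thesis using assms by (simp add: sobolev_norm_def powr_powr)
qed

lemma sobolev_norm_wderiv_le:
  assumes "p > 0" "j \<le> k"
  shows "(\<integral>x. \<bar>wderiv {a<..<b} j f x\<bar> powr p \<partial>MI a b) \<le> sobolev_norm k p {a<..<b} f powr p"
  unfolding sobolev_norm_powr[OF assms(1)]
  using member_le_sum[of j "{..k}" "\<lambda>j. \<integral>x. \<bar>wderiv {a<..<b} j f x\<bar> powr p \<partial>MI a b"] assms(2)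
  by (auto intro!: integral_nonneg_AE)

lemma wderiv_diff:
  assumes "f \<in> sobolev k p {a<..<b}" "g \<in> sobolev k p {a<..<b}" "j \<le> k"
  shows "AE x in MI a b. wderiv {a<..<b} j (\<lambda>x. f x - g x) x = wderiv {a<..<b} j f x - wderiv {a<..<b} j g x"
proof -
  have "has_weak_deriv {a<..<b} j (\<lambda>x. 1 * f x + (-1) * g x) (\<lambda>x. 1 * wderiv {a<..<b} j f x + (-1) * wderiv {a<..<b} j g x)"
    by (rule has_weak_deriv_lincomb[OF _ sobolev_wderiv(1)[OF assms(1,3)] sobolev_wderiv(1)[OF assms(2,3)]]) simp
  then have "has_weak_deriv {a<..<b} j (\<lambda>x. f x - g x) (\<lambda>x. wderiv {a<..<b} j f x - wderiv {a<..<b} j g x)"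
    by simp
  from wderiv_AE[OF _ this] show ?thesis unfolding AE_MI by simp
qed

text \<open>A simple function into the Sobolev space has finitely many values w, so its derivative
  in x is a finite sum of products of an indicator in t and a function of x. The indicators belong
  to Lebesgue sets; Borel functions c n w replace them for almost every t. Convergence in the
  Sobolev norm gives L_1 convergence of the derivatives at almost every t, as
  \<open>joint_measurable_limit\<close> requires.\<close>

lemma joint_wderiv_measurable:
  assumes p: "p \<ge> 1" and X: "X \<subseteq> sobolev k p {a<..<b}" and j: "j \<le> k"
    and sm: "strongly_measurable {0<..<T} X (sobolev_norm k p {a<..<b}) v"
  obtains U where "U \<in> borel_measurable (lborel \<Otimes>\<^sub>M MI a b)"
    "AE t in lborel. t \<in> {0<..<T} \<longrightarrow> (AE x in MI a b. U (t, x) = wderiv {a<..<b} j (v t) x)"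
proof -
  let ?M = "MI a b" and ?W = "wderiv {a<..<b} j" and ?N = "sobolev_norm k p {a<..<b}"
  obtain s :: "nat \<Rightarrow> real \<Rightarrow> real \<Rightarrow> real" where
    s: "\<And>n. simple_function (MI 0 T) (s n)" "\<And>n. s n ` {0<..<T} \<subseteq> X"
    and lim: "AE t in MI 0 T. v t \<in> X \<and> (\<lambda>n. ?N (\<lambda>x. v t x - s n t x)) \<longlonglongrightarrow> 0"
    using sm unfolding strongly_measurable_def by blast
  have "\<exists>c. c \<in> borel_measurable lborel \<and> (AE t in lborel. (if t \<in> {0<..<T} \<and> s n t = w then 1 else 0 :: real) = c t)" for n w
  proof -
    have "s n -` {w} \<inter> space (MI 0 T) \<in> sets (MI 0 T)" by (rule simple_functionD(2)[OF s(1)])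
    then have S: "{t. t \<in> {0<..<T} \<and> s n t = w} \<in> sets lebesgue"
    proof (subst (asm) sets_restrict_space_iff)
      assume "s n -` {w} \<inter> space (MI 0 T) \<subseteq> {0<..<T} \<and> s n -` {w} \<inter> space (MI 0 T) \<in> sets lebesgue"
      moreover have "{t. t \<in> {0<..<T} \<and> s n t = w} = s n -` {w} \<inter> space (MI 0 T)"
        by (auto simp: space_MI)
      ultimately show ?thesis by simp
    qed simp
    have "(\<lambda>t. if t \<in> {0<..<T} \<and> s n t = w then 1 else 0 :: real) = indicator {t. t \<in> {0<..<T} \<and> s n t = w}"
      by (auto simp: indicator_def)
    then have "(\<lambda>t. if t \<in> {0<..<T} \<and> s n t = w then 1 else 0 :: real) \<in> borel_measurable lebesgue"
      using S by simp
    from completion_ex_borel_measurable_real[OF this] show ?thesis by blast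
  qed
  note ex = this
  define c where "c n w = (SOME c. c \<in> borel_measurable lborel \<and> (AE t in lborel. (if t \<in> {0<..<T} \<and> s n t = w then 1 else 0 :: real) = c t))" for n w
  have c: "c n w \<in> borel_measurable lborel" "AE t in lborel. (if t \<in> {0<..<T} \<and> s n t = w then 1 else 0 :: real) = c n w t" for n w
    using someI_ex[OF ex[of n w]] unfolding c_def by blast+
  define R where "R n = s n ` {0<..<T}" for n
  have finR: "finite (R n)" for n
    using simple_functionD(1)[OF s(1)[of n]] by (simp add: R_def space_MI)
  have Rs: "w \<in> sobolev k p {a<..<b}" if "w \<in> R n" for n w using that s(2) X by (auto simp: R_def)
  define g where "g n z = (\<Sum>w\<in>R n. c n w (fst z) * ?W w (snd z))" for n z
  have gm: "g n \<in> borel_measurable (lborel \<Otimes>\<^sub>M ?M)" for n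
    unfolding g_def[abs_def]
  proof (intro borel_measurable_sum)
    fix w assume "w \<in> R n"
    note [measurable] = sobolev_wderiv(2)[OF Rs[OF this] j] c(1)
    show "(\<lambda>z. c n w (fst z) * ?W w (snd z)) \<in> borel_measurable (lborel \<Otimes>\<^sub>M ?M)" by measurable
  qed
  have "AE t in lborel. \<forall>n. \<forall>w\<in>R n. (if t \<in> {0<..<T} \<and> s n t = w then 1 else 0 :: real) = c n w t"
    using c(2) finR by (simp add: AE_all_countable AE_ball_countable countable_finite)
  moreover have "AE t in lborel. t \<in> {0<..<T} \<longrightarrow> v t \<in> X \<and> (\<lambda>n. ?N (\<lambda>x. v t x - s n t x)) \<longlonglongrightarrow> 0"
    using lim unfolding AE_lborel_MI .
  ultimately have "AE t in lborel. t \<in> {0<..<T} \<longrightarrow> ?W (v t) \<in> borel_measurable ?M \<and> (\<lambda>n. \<integral>\<^sup>+x. ennreal \<bar>g n (t, x) - ?W (v t) x\<bar> \<partial>?M) \<longlonglongrightarrow> 0"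
  proof eventually_elim
    case (elim t)
    show ?case
    proof (intro impI conjI)
      assume t: "t \<in> {0<..<T}"
      have gs: "g n (t, x) = ?W (s n t) x" for n x
      proof -
        have "g n (t, x) = (\<Sum>w\<in>R n. (if s n t = w then ?W w x else 0))"
          unfolding g_def using elim(1) t by (intro sum.cong) (auto simp flip: bspec[OF spec[OF elim(1)]])
        also have "\<dots> = ?W (s n t) x" using finR t by (simp add: R_def)
        finally show ?thesis .
      qed
      have st: "s n t \<in> sobolev k p {a<..<b}" for n using t s(2) X by blast
      have vt: "v t \<in> sobolev k p {a<..<b}" using elim(2) t X by blast
      show m: "?W (v t) \<in> borel_measurable ?M" by (rule sobolev_wderiv(2)[OF vt j])
      let ?d = "\<lambda>n x. ?W (s n t) x - ?W (v t) x"
      have dm: "?d n \<in> borel_measurable ?M" for n using sobolev_wderiv(2)[OF st j] m by measurable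
      have di: "integrable ?M (\<lambda>x. \<bar>?d n x\<bar> powr p)" for n
      proof (rule Bochner_Integration.integrable_bound)
        show "integrable ?M (\<lambda>x. 2 powr p * (\<bar>?W (s n t) x\<bar> powr p + \<bar>?W (v t) x\<bar> powr p))"
          using sobolev_wderiv(3)[OF st j] sobolev_wderiv(3)[OF vt j] by simp
        show "(\<lambda>x. \<bar>?d n x\<bar> powr p) \<in> borel_measurable ?M" using dm[of n] by measurable
        show "AE x in ?M. norm (\<bar>?d n x\<bar> powr p) \<le> norm (2 powr p * (\<bar>?W (s n t) x\<bar> powr p + \<bar>?W (v t) x\<bar> powr p))"
          using powr_add_le[of p "?W (s n t) x" "?W (v t) x" for x] p by (intro AE_I2) simp
      qed
      have le: "(\<integral>x. \<bar>?d n x\<bar> powr p \<partial>?M) \<le> ?N (\<lambda>x. v t x - s n t x) powr p" for n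
      proof -
        have "AE x in ?M. \<bar>?d n x\<bar> powr p = \<bar>?W (\<lambda>x. v t x - s n t x) x\<bar> powr p"
          using wderiv_diff[OF vt st j, of n] by eventually_elim (simp add: abs_minus_commute)
        then have "AE x in ?M. \<bar>?W (\<lambda>x. v t x - s n t x) x\<bar> powr p = \<bar>?d n x\<bar> powr p" by eventually_elim simp
        moreover have "(\<lambda>x. \<bar>?W (\<lambda>x. v t x - s n t x) x\<bar> powr p) \<in> borel_measurable ?M"
        proof -
          have "has_weak_deriv {a<..<b} j (\<lambda>x. 1 * v t x + (-1) * s n t x) (\<lambda>x. 1 * ?W (v t) x + (-1) * ?W (s n t) x)"
            by (intro has_weak_deriv_lincomb sobolev_wderiv(1)[OF vt j] sobolev_wderiv(1)[OF st j]) auto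
          then have "has_weak_deriv {a<..<b} j (\<lambda>x. v t x - s n t x) (?W (\<lambda>x. v t x - s n t x))"
            by (intro wderiv_has) simp
          then have "?W (\<lambda>x. v t x - s n t x) \<in> borel_measurable ?M"
            by (auto intro!: locally_integrable_measurable simp: has_weak_deriv_def)
          then show ?thesis by measurable
        qed
        ultimately have "(\<integral>x. \<bar>?d n x\<bar> powr p \<partial>?M) = (\<integral>x. \<bar>?W (\<lambda>x. v t x - s n t x) x\<bar> powr p \<partial>?M)"
          using di[of n] by (intro integral_cong_AE) auto
        also have "\<dots> \<le> ?N (\<lambda>x. v t x - s n t x) powr p"
          using p j by (intro sobolev_norm_wderiv_le) auto
        finally show ?thesis .
      qed
      have N0: "(\<lambda>n. ?N (\<lambda>x. v t x - s n t x)) \<longlonglongrightarrow> 0" using elim(2) t by blast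
      have "(\<lambda>n. ?N (\<lambda>x. v t x - s n t x) powr p) \<longlonglongrightarrow> 0 powr p"
        using p by (intro tendsto_powr' N0 tendsto_const) (auto simp: sobolev_norm_def)
      then have Np: "(\<lambda>n. ?N (\<lambda>x. v t x - s n t x) powr p) \<longlonglongrightarrow> 0" by simp
      have "(\<lambda>n. \<integral>x. \<bar>?d n x\<bar> powr p \<partial>?M) \<longlonglongrightarrow> 0"
        by (rule tendsto_sandwich[OF _ _ tendsto_const Np]) (use le in \<open>auto intro!: always_eventually integral_nonneg_AE\<close>)
      then have L1: "(\<lambda>n. \<integral>x. \<bar>?d n x\<bar> \<partial>?M) \<longlonglongrightarrow> 0" by (rule Lp_to_L1[OF finite_MI p dm di])
      have "(\<integral>\<^sup>+x. ennreal \<bar>g n (t, x) - ?W (v t) x\<bar> \<partial>?M) = ennreal (\<integral>x. \<bar>?d n x\<bar> \<partial>?M)" for n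
        unfolding gs using finite_measure.integrable_of_powr[OF finite_MI p dm di]
        by (intro nn_integral_eq_integral) auto
      then show "(\<lambda>n. \<integral>\<^sup>+x. ennreal \<bar>g n (t, x) - ?W (v t) x\<bar> \<partial>?M) \<longlonglongrightarrow> 0"
        using tendsto_ennrealI[OF L1] by simp
    qed
  qed
  from joint_measurable_limit[OF sigma_finite_MI gm this] that show thesis by blast
qed

section \<open>Weak formulations of the continuity equation\<close>

text \<open>Completeness of Lebesgue measure. It serves where slices of the flux and of test
  functions, whose measurability is not assumed, are compared with better representatives.\<close>

lemma borel_measurable_lebesgue_cong_AE:
  fixes f g :: "'a::euclidean_space \<Rightarrow> real"
  assumes f: "f \<in> borel_measurable lebesgue" and ae: "AE x in lebesgue. f x = g x"
  shows "g \<in> borel_measurable lebesgue"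
proof -
  obtain f' where f': "f' \<in> borel_measurable lborel" "AE x in lborel. f x = f' x"
    using completion_ex_borel_measurable_real[OF f] by blast
  have "AE x in lborel. f x = g x" using ae by (simp add: AE_completion_iff)
  with f'(2) have "AE x in lborel. f' x = g x" by eventually_elim simp
  then obtain N where N: "N \<in> null_sets lborel" "{x. f' x \<noteq> g x} \<subseteq> N"
    unfolding eventually_ae_filter by auto
  show ?thesis
  proof (rule borel_measurableI)
    fix S :: "real set" assume S: "open S"
    have 1: "f' -` S \<inter> space lebesgue \<in> sets lebesgue"
      using measurable_sets[OF measurable_completion[OF f'(1)], of S] S by auto
    have 2: "(g -` S \<inter> N) \<in> null_sets lebesgue"
      by (rule completion.complete2[OF _ null_sets_completionI[OF N(1)]]) auto
    have 3: "N \<in> sets lebesgue" using N(1) null_sets_completionI by blast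
    have "g -` S \<inter> space lebesgue = (f' -` S \<inter> space lebesgue - N) \<union> (g -` S \<inter> N)"
    proof -
      have "f' x = g x" if "x \<notin> N" for x using N(2) that by blast
      then show ?thesis by auto
    qed
    then show "g -` S \<inter> space lebesgue \<in> sets lebesgue" using sets.Un[OF sets.Diff[OF 1 3] null_setsD2[OF 2]] by simp
  qed
qed

text \<open>Measurability is not assumed: if one function fails to be measurable, so does the other,
  and both integrals are 0 by convention.\<close>

lemma integral_lebesgue_cong_AE:
  fixes f g :: "'a::euclidean_space \<Rightarrow> real"
  assumes ae: "AE x in lebesgue. f x = g x"
  shows "integral\<^sup>L lebesgue f = integral\<^sup>L lebesgue g"
proof (cases "f \<in> borel_measurable lebesgue")
  case True
  then show ?thesis using borel_measurable_lebesgue_cong_AE[OF True ae] ae by (intro integral_cong_AE)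
next
  case False
  have "AE x in lebesgue. g x = f x" using ae by eventually_elim simp
  then have "g \<notin> borel_measurable lebesgue" using borel_measurable_lebesgue_cong_AE False by blast
  then show ?thesis using False by (simp add: not_integrable_integral_eq borel_measurable_integrable integrable_iff_bounded)
qed

lemma set_integral_lebesgue_cong_AE:
  fixes f g :: "'a::euclidean_space \<Rightarrow> real"
  assumes "AE x in lebesgue. x \<in> S \<longrightarrow> f x = g x"
  shows "(LINT x:S|lebesgue. f x) = (LINT x:S|lebesgue. g x)"
proof -
  have "AE x in lebesgue. indicat_real S x *\<^sub>R f x = indicat_real S x *\<^sub>R g x"
    using assms by eventually_elim (auto split: split_indicator)
  then show ?thesis unfolding set_lebesgue_integral_def by (rule integral_lebesgue_cong_AE)
qed

lemma LINT_atLeast_greaterThan: "(LINT t:{0..}|lebesgue. f t) = (LINT t:{0<..}|lebesgue. f t)" for f :: "real \<Rightarrow> real"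
proof -
  have "AE t in lebesgue. t \<noteq> (0::real)" by (intro AE_completion AE_lborel_singleton)
  then have "AE t in lebesgue. indicat_real {0..} t *\<^sub>R f t = indicat_real {0<..} t *\<^sub>R f t"
    by eventually_elim (auto split: split_indicator)
  then show ?thesis unfolding set_lebesgue_integral_def by (rule integral_lebesgue_cong_AE)
qed

section \<open>Products of a time and a space function as tests\<close>

lemma has_weak_deriv_cmult:
  assumes "has_weak_deriv {a<..<b} j f g" shows "has_weak_deriv {a<..<b} j (\<lambda>x. c * f x) (\<lambda>x. c * g x)"
  using has_weak_deriv_lincomb[OF _ assms assms, of c 0] by simp

lemma sobolev_cmult:
  assumes "f \<in> sobolev k p {a<..<b}" shows "(\<lambda>x. c * f x) \<in> sobolev k p {a<..<b}"
proof -
  have Lp: "(\<lambda>x. c * g x) \<in> Lp_space p {a<..<b}" if g: "g \<in> Lp_space p {a<..<b}" for g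
  proof -
    have [measurable]: "g \<in> borel_measurable (MI a b)" and i: "integrable (MI a b) (\<lambda>x. \<bar>g x\<bar> powr p)"
      using g by (auto simp: Lp_space_def)
    have "(\<lambda>x. c * g x) \<in> borel_measurable (MI a b)" by measurable
    then show ?thesis using integrable_mult_right[of "\<bar>c\<bar> powr p", OF i] by (simp add: Lp_space_def abs_mult powr_mult)
  qed
  then show ?thesis using assms has_weak_deriv_cmult[of a b] unfolding sobolev_def by blast
qed

lemma wderiv_cmult:
  assumes "f \<in> sobolev k p {a<..<b}" "j \<le> k"
  shows "AE x in MI a b. wderiv {a<..<b} j (\<lambda>x. c * f x) x = c * wderiv {a<..<b} j f x"
  unfolding AE_MI using wderiv_AE[OF _ has_weak_deriv_cmult[OF sobolev_wderiv(1)[OF assms]]] by simp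

lemma sobolev_norm_cmult:
  assumes f: "f \<in> sobolev k p {a<..<b}" and p: "p > 0"
  shows "sobolev_norm k p {a<..<b} (\<lambda>x. c * f x) = \<bar>c\<bar> * sobolev_norm k p {a<..<b} f"
proof -
  have "(\<integral>x. \<bar>wderiv {a<..<b} j (\<lambda>x. c * f x) x\<bar> powr p \<partial>MI a b) = \<bar>c\<bar> powr p * (\<integral>x. \<bar>wderiv {a<..<b} j f x\<bar> powr p \<partial>MI a b)"
    if "j \<le> k" for j
  proof -
    note [measurable] = sobolev_wderiv(2)[OF f that] sobolev_wderiv(2)[OF sobolev_cmult[OF f] that]
    have "(\<integral>x. \<bar>wderiv {a<..<b} j (\<lambda>x. c * f x) x\<bar> powr p \<partial>MI a b) = (\<integral>x. \<bar>c\<bar> powr p * \<bar>wderiv {a<..<b} j f x\<bar> powr p \<partial>MI a b)"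
    proof (rule integral_cong_AE)
      show "AE x in MI a b. \<bar>wderiv {a<..<b} j (\<lambda>x. c * f x) x\<bar> powr p = \<bar>c\<bar> powr p * \<bar>wderiv {a<..<b} j f x\<bar> powr p"
        using wderiv_cmult[OF f that, where c = c] by eventually_elim (simp add: abs_mult powr_mult)
    qed measurable
    then show ?thesis by simp
  qed
  then have "sobolev_norm k p {a<..<b} (\<lambda>x. c * f x) = (\<bar>c\<bar> powr p * (\<Sum>j\<le>k. \<integral>x. \<bar>wderiv {a<..<b} j f x\<bar> powr p \<partial>MI a b)) powr (1 / p)"
    unfolding sobolev_norm_def by (simp add: sum_distrib_left)
  also have "\<dots> = \<bar>c\<bar> * sobolev_norm k p {a<..<b} f"
    unfolding sobolev_norm_def using p
    by (subst powr_mult) (auto simp: powr_powr intro!: sum_nonneg integral_nonneg_AE)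
  finally show ?thesis .
qed

text \<open>Approximating the scalar \<eta> by simple functions F n makes F n(t) \<psi> simple with
  values in the Sobolev space; the distance to the limit is |\<eta> t - F n t| times the norm of
  \<psi>.\<close>

lemma product_time_test:
  assumes p: "p > 0" and \<eta>: "test_fun {0<..} \<eta>" and \<psi>: "\<psi> \<in> sobolev 1 p {a<..<b}"
  shows "(\<lambda>t x. \<eta> t * \<psi> x) \<in> time_test p {a<..<b}"
proof -
  let ?I = "lebesgue_on {0::real..}" and ?X = "sobolev 1 p {a<..<b}" and ?N = "sobolev_norm 1 p {a<..<b}"
  obtain K where K: "compact K" "K \<subseteq> {0<..}" "\<And>x. x \<notin> K \<Longrightarrow> \<eta> x = 0" using \<eta> unfolding test_fun_iff by blast
  obtain B where B: "\<And>x. \<bar>\<eta> x\<bar> \<le> B" "B > 0" using test_fun_bounded[OF \<eta>] by blast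
  have I: "{0::real..} \<inter> space lebesgue \<in> sets lebesgue" by simp
  have \<eta>m: "\<eta> \<in> borel_measurable ?I" by (intro measurable_restrict_space1 test_fun_measurable[OF \<eta>])
  obtain F where F: "\<And>i. simple_function ?I (F i)" "\<And>t. t \<in> space ?I \<Longrightarrow> (\<lambda>i. F i t) \<longlonglongrightarrow> \<eta> t"
    using borel_measurable_implies_sequence_metric[OF \<eta>m, of 0] by blast
  have sm: "strongly_measurable {0..} ?X ?N (\<lambda>t x. \<eta> t * \<psi> x)"
    unfolding strongly_measurable_def
  proof (intro exI[of _ "\<lambda>n t x. F n t * \<psi> x"] conjI allI)
    fix n
    have "simple_function ?I ((\<lambda>c x. c * \<psi> x) \<circ> F n)" by (rule simple_function_compose[OF F(1)])
    then show "simple_function ?I (\<lambda>t x. F n t * \<psi> x)" by (simp add: comp_def)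
    show "(\<lambda>t x. F n t * \<psi> x) ` {0..} \<subseteq> ?X" using sobolev_cmult[OF \<psi>] by auto
  next
    show "AE t in ?I. (\<lambda>x. \<eta> t * \<psi> x) \<in> ?X \<and> (\<lambda>n. ?N (\<lambda>x. \<eta> t * \<psi> x - F n t * \<psi> x)) \<longlonglongrightarrow> 0"
    proof (rule AE_I2)
      fix t :: real assume t: "t \<in> space ?I"
      have "(\<lambda>n. \<bar>\<eta> t - F n t\<bar> * ?N \<psi>) \<longlonglongrightarrow> \<bar>\<eta> t - \<eta> t\<bar> * ?N \<psi>"
        by (intro tendsto_mult tendsto_rabs tendsto_diff tendsto_const F(2)[OF t])
      moreover have "?N (\<lambda>x. \<eta> t * \<psi> x - F n t * \<psi> x) = \<bar>\<eta> t - F n t\<bar> * ?N \<psi>" for n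
        using sobolev_norm_cmult[OF \<psi> p, of "\<eta> t - F n t"] by (simp add: left_diff_distrib)
      ultimately show "(\<lambda>x. \<eta> t * \<psi> x) \<in> ?X \<and> (\<lambda>n. ?N (\<lambda>x. \<eta> t * \<psi> x - F n t * \<psi> x)) \<longlonglongrightarrow> 0"
        using sobolev_cmult[OF \<psi>] by simp
    qed
  qed
  have "integrable ?I (\<lambda>t. \<bar>\<eta> t\<bar> powr p)"
  proof (rule Bochner_Integration.integrable_bound)
    have "integrable lebesgue (indicat_real K)"
      using K(1) emeasure_bounded_finite[OF compact_imp_bounded[OF K(1)]]
      by (intro integrable_real_indicator) (auto simp: borel_compact emeasure_completion)
    then show "integrable ?I (\<lambda>t. B powr p * indicat_real K t)"
      unfolding integrable_restrict_space[OF I]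
      by (intro integrable_mult_indicator integrable_mult_right) auto
    show "(\<lambda>t. \<bar>\<eta> t\<bar> powr p) \<in> borel_measurable ?I" using \<eta>m by measurable
    show "AE t in ?I. norm (\<bar>\<eta> t\<bar> powr p) \<le> norm (B powr p * indicat_real K t)"
    proof (rule AE_I2)
      fix t
      show "norm (\<bar>\<eta> t\<bar> powr p) \<le> norm (B powr p * indicat_real K t)"
        using K(3)[of t] B(1)[of t] p by (cases "t \<in> K") (auto intro!: powr_mono2)
    qed
  qed
  note \<eta>i = this
  have int: "integrable ?I (\<lambda>t. ?N (\<lambda>x. \<eta> t * \<psi> x) powr p)"
  proof -
    have "?N (\<lambda>x. \<eta> t * \<psi> x) powr p = \<bar>\<eta> t\<bar> powr p * ?N \<psi> powr p" for t
      unfolding sobolev_norm_cmult[OF \<psi> p] by (rule powr_mult)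
    then show ?thesis using \<eta>i by simp
  qed
  obtain T where T: "\<And>t. t \<in> K \<Longrightarrow> t \<le> T" using K(1) bounded_imp_bdd_above[OF compact_imp_bounded[OF K(1)]]
    by (auto simp: bdd_above_def)
  have "AE t in lebesgue. t > T \<longrightarrow> (AE x in MI a b. \<eta> t * \<psi> x = 0)"
    using T K(3) by (intro AE_I2) force
  with sm int show ?thesis unfolding time_test_def bochner_Lp_def by blast
qed

lemma AE_pos_of_AE_Ioo:
  assumes "\<And>T. T > 0 \<Longrightarrow> AE t in MI 0 T. P t"
  shows "AE t in lebesgue. t > 0 \<longrightarrow> P t"
proof -
  have "AE t in lebesgue. \<forall>n. t \<in> {0<..<real (Suc n)} \<longrightarrow> P t"
    unfolding AE_all_countable using assms unfolding AE_MI by auto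
  then show ?thesis
  proof eventually_elim
    case (elim t)
    obtain n where "t < real n" using reals_Archimedean2 by blast
    then have "t < real (Suc n)" by simp
    with elim show ?case by auto
  qed
qed

text \<open>Linearity of vt t at almost every time pulls \<eta> t out of the pairing. The second
  conclusion extracts integrability of the flux slice against the derivative of \<psi> wherever
  \<eta> does not vanish.\<close>

lemma weak_eq_product:
  assumes p: "p > 0" and vt: "\<And>T. T > 0 \<Longrightarrow> AE t in MI 0 T. vt t \<in> dual_space (sobolev 1 p {a<..<b}) N"
    and J: "weak_continuity_eq p {a<..<b} vt J" and \<psi>: "\<psi> \<in> sobolev 1 p {a<..<b}" and \<eta>: "test_fun {0<..} \<eta>"
  shows "(LINT t:{0<..}|lebesgue. \<eta> t * vt t \<psi>) = (LINT t:{0<..}|lebesgue. \<eta> t * (\<integral>x. J t x * wderiv {a<..<b} 1 \<psi> x \<partial>MI a b))"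
    and "AE t in lebesgue. t > 0 \<longrightarrow> \<eta> t \<noteq> 0 \<longrightarrow> integrable (MI a b) (\<lambda>x. J t x * wderiv {a<..<b} 1 \<psi> x)"
proof -
  let ?\<phi> = "\<lambda>t x. \<eta> t * \<psi> x"
  have w: "AE x in MI a b. wderiv {a<..<b} 1 (?\<phi> t) x = \<eta> t * wderiv {a<..<b} 1 \<psi> x" for t
    by (rule wderiv_cmult[OF \<psi>]) simp
  have in_eq: "(LINT x:{a<..<b}|lebesgue. J t x * wderiv {a<..<b} 1 (?\<phi> t) x) = \<eta> t * (\<integral>x. J t x * wderiv {a<..<b} 1 \<psi> x \<partial>MI a b)" for t
  proof -
    have "(LINT x:{a<..<b}|lebesgue. J t x * wderiv {a<..<b} 1 (?\<phi> t) x) = (LINT x:{a<..<b}|lebesgue. \<eta> t * (J t x * wderiv {a<..<b} 1 \<psi> x))"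
    proof (rule set_integral_lebesgue_cong_AE)
      show "AE x in lebesgue. x \<in> {a<..<b} \<longrightarrow> J t x * wderiv {a<..<b} 1 (?\<phi> t) x = \<eta> t * (J t x * wderiv {a<..<b} 1 \<psi> x)"
        using w[of t] unfolding AE_MI by eventually_elim simp
    qed
    then show ?thesis by (simp add: LINT_MI)
  qed
  have tt: "?\<phi> \<in> time_test p {a<..<b}" by (rule product_time_test[OF p \<eta> \<psi>])
  have "(LINT t:{0..}|lebesgue. vt t (?\<phi> t)) - (LINT t:{0..}|lebesgue. LINT x:{a<..<b}|lebesgue. J t x * wderiv {a<..<b} 1 (?\<phi> t) x) = 0"
    using bspec[OF J[unfolded weak_continuity_eq_def] tt] by (elim conjE)
  then have e: "(LINT t:{0..}|lebesgue. vt t (?\<phi> t)) = (LINT t:{0..}|lebesgue. \<eta> t * (\<integral>x. J t x * wderiv {a<..<b} 1 \<psi> x \<partial>MI a b))"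
    unfolding in_eq by simp
  have "AE t in lebesgue. t > 0 \<longrightarrow> vt t \<in> dual_space (sobolev 1 p {a<..<b}) N"
    by (rule AE_pos_of_AE_Ioo[OF vt])
  then have "AE t in lebesgue. t \<in> {0<..} \<longrightarrow> \<eta> t * vt t \<psi> = vt t (?\<phi> t)"
  proof eventually_elim
    case (elim t)
    show ?case
    proof
      assume "t \<in> {0<..}"
      with elim have "vt t (\<lambda>x. \<eta> t * \<psi> x + 0 * \<psi> x) = \<eta> t * vt t \<psi> + 0 * vt t \<psi>"
        using \<psi> unfolding dual_space_def by blast
      then show "\<eta> t * vt t \<psi> = vt t (?\<phi> t)" by simp
    qed
  qed
  then have "(LINT t:{0<..}|lebesgue. \<eta> t * vt t \<psi>) = (LINT t:{0<..}|lebesgue. vt t (?\<phi> t))"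
    by (rule set_integral_lebesgue_cong_AE)
  with e show "(LINT t:{0<..}|lebesgue. \<eta> t * vt t \<psi>) = (LINT t:{0<..}|lebesgue. \<eta> t * (\<integral>x. J t x * wderiv {a<..<b} 1 \<psi> x \<partial>MI a b))"
    by (simp add: LINT_atLeast_greaterThan)
  have "AE t in lebesgue_on {0..}. set_integrable lebesgue {a<..<b} (\<lambda>x. J t x * wderiv {a<..<b} 1 (?\<phi> t) x)"
    using bspec[OF J[unfolded weak_continuity_eq_def] tt] by (elim conjE)
  then have "AE t in lebesgue. t \<in> {0..} \<longrightarrow> set_integrable lebesgue {a<..<b} (\<lambda>x. J t x * wderiv {a<..<b} 1 (?\<phi> t) x)"
    by (subst (asm) AE_restrict_space_iff) auto
  then show "AE t in lebesgue. t > 0 \<longrightarrow> \<eta> t \<noteq> 0 \<longrightarrow> integrable (MI a b) (\<lambda>x. J t x * wderiv {a<..<b} 1 \<psi> x)"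
  proof eventually_elim
    case (elim t)
    show ?case
    proof (intro impI)
      assume t: "t > 0" "\<eta> t \<noteq> 0"
      then have "integrable lebesgue (\<lambda>x. indicator {a<..<b} x * (J t x * wderiv {a<..<b} 1 (?\<phi> t) x))"
        using elim by (simp add: set_integrable_def)
      moreover have ae: "AE x in lebesgue. indicator {a<..<b} x * (J t x * wderiv {a<..<b} 1 (?\<phi> t) x) = indicator {a<..<b} x * (\<eta> t * (J t x * wderiv {a<..<b} 1 \<psi> x))"
        using w[of t] unfolding AE_MI by eventually_elim (auto split: split_indicator)
      ultimately have "integrable lebesgue (\<lambda>x. indicator {a<..<b} x * (\<eta> t * (J t x * wderiv {a<..<b} 1 \<psi> x)))"
        using borel_measurable_lebesgue_cong_AE[OF _ ae] by (intro integrable_cong_AE_imp[OF _ _ ae]) auto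
      then have "integrable (MI a b) (\<lambda>x. \<eta> t * (J t x * wderiv {a<..<b} 1 \<psi> x))"
        unfolding integrable_restrict_space[OF Ioo_lebesgue] real_scaleR_def .
      then show "integrable (MI a b) (\<lambda>x. J t x * wderiv {a<..<b} 1 \<psi> x)"
        using integrable_mult_right[of "1 / \<eta> t" "MI a b" "\<lambda>x. \<eta> t * (J t x * wderiv {a<..<b} 1 \<psi> x)"] t(2) by simp
    qed
  qed
qed

lemma id_lborel_MI_measurable: "(\<lambda>z. z) \<in> lborel \<Otimes>\<^sub>M MI a b \<rightarrow>\<^sub>M (borel :: (real \<times> real) measure)"
proof -
  have "snd \<in> lborel \<Otimes>\<^sub>M MI a b \<rightarrow>\<^sub>M borel"
    using measurable_compose[OF measurable_snd measurable_ident_MI, of lborel a b] by simp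
  moreover have "fst \<in> lborel \<Otimes>\<^sub>M MI a b \<rightarrow>\<^sub>M borel"
    using measurable_fst[of "lborel :: real measure" "MI a b"] by (simp add: measurable_lborel1)
  ultimately have "(\<lambda>z. (fst z, snd z)) \<in> lborel \<Otimes>\<^sub>M MI a b \<rightarrow>\<^sub>M borel \<Otimes>\<^sub>M borel" by (rule measurable_Pair[rotated])
  then show ?thesis by (simp add: borel_prod)
qed

text \<open>A Lebesgue measurable function of the plane need not be measurable for the product
  measure. A Borel version, extended by 0, is; by Fubini it agrees with k on almost every time
  slice.\<close>

lemma Lp_loc_time_joint:
  assumes k: "k \<in> Lp_loc_time q {a<..<b}" and T: "T > 0"
  obtains K where "K \<in> borel_measurable (lborel \<Otimes>\<^sub>M MI a b)" "integrable (lborel \<Otimes>\<^sub>M MI a b) (\<lambda>z. \<bar>K z\<bar> powr q)"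
    "AE t in lborel. t \<in> {0<..<T} \<longrightarrow> (AE x in MI a b. K (t, x) = k t x)" "\<And>t x. t \<notin> {0<..<T} \<Longrightarrow> K (t, x) = 0"
proof -
  let ?S = "{0<..<T} \<times> {a<..<b}"
  have op: "open ?S" by (intro open_Times) auto
  have S: "?S \<inter> space lebesgue \<in> sets lebesgue" using op by auto
  have km: "(\<lambda>z. indicator ?S z *\<^sub>R (case z of (t, x) \<Rightarrow> k t x)) \<in> borel_measurable lebesgue"
    and ki: "integrable lebesgue (\<lambda>z. indicator ?S z *\<^sub>R \<bar>case z of (t, x) \<Rightarrow> k t x\<bar> powr q)"
    using k T unfolding Lp_loc_time_def Lp_space_def
    by (auto simp: borel_measurable_restrict_space_iff[OF S] integrable_restrict_space[OF S])
  obtain K0 where K0: "K0 \<in> borel_measurable lborel" "AE z in lborel. indicator ?S z *\<^sub>R (case z of (t, x) \<Rightarrow> k t x) = K0 z"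
    using completion_ex_borel_measurable_real[OF km] by blast
  define K where "K z = indicator ?S z * K0 z" for z
  have Kb: "K \<in> borel_measurable borel"
    unfolding K_def[abs_def] using K0(1) op by (intro borel_measurable_times) auto
  have KS: "AE z in lborel. K z = indicator ?S z *\<^sub>R (case z of (t, x) \<Rightarrow> k t x)"
    using K0(2)
  proof eventually_elim
    case (elim z)
    show ?case unfolding K_def elim[symmetric] by (simp split: split_indicator)
  qed
  have Km: "K \<in> borel_measurable (lborel \<Otimes>\<^sub>M MI a b)"
    using measurable_compose[OF id_lborel_MI_measurable Kb] by simp
  show thesis
  proof (rule that[OF Km])
    have "AE z in lborel \<Otimes>\<^sub>M lborel. K z = indicator ?S z *\<^sub>R (case z of (t, x) \<Rightarrow> k t x)"
      using KS unfolding lborel_prod .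
    then have "AE t in lborel. AE x in lborel. K (t, x) = indicator ?S (t, x) *\<^sub>R k t x"
      using lborel_pair.AE_pair[of "\<lambda>z. K z = indicator ?S z *\<^sub>R (case z of (t, x) \<Rightarrow> k t x)"] by simp
    then show "AE t in lborel. t \<in> {0<..<T} \<longrightarrow> (AE x in MI a b. K (t, x) = k t x)"
      unfolding AE_lborel_MI
    proof eventually_elim
      case (elim t)
      show ?case
      proof
        assume "t \<in> {0<..<T}"
        from elim show "AE x in lborel. x \<in> {a<..<b} \<longrightarrow> K (t, x) = k t x"
          by eventually_elim (use \<open>t \<in> {0<..<T}\<close> in \<open>auto simp: indicator_def\<close>)
      qed
    qed
    show "K (t, x) = 0" if "t \<notin> {0<..<T}" for t x using that by (auto simp: K_def indicator_def)
    have Kq: "(\<lambda>z. ennreal (\<bar>K z\<bar> powr q)) \<in> borel_measurable borel" using Kb by measurable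
    have Kq': "(\<lambda>z. \<bar>K z\<bar> powr q) \<in> borel_measurable (lborel \<Otimes>\<^sub>M MI a b)" using Km by measurable
    interpret sigma_finite_measure "MI a b" by (rule sigma_finite_MI)
    have "(\<integral>\<^sup>+z. ennreal (\<bar>K z\<bar> powr q) \<partial>(lborel \<Otimes>\<^sub>M MI a b)) = (\<integral>\<^sup>+t. \<integral>\<^sup>+x. ennreal (\<bar>K (t, x)\<bar> powr q) \<partial>MI a b \<partial>lborel)"
      using Kq' by (subst nn_integral_fst[symmetric]) auto
    also have "\<dots> = (\<integral>\<^sup>+t. \<integral>\<^sup>+x. ennreal (\<bar>K (t, x)\<bar> powr q) \<partial>lborel \<partial>lborel)"
      unfolding nn_integral_MI_lborel by (intro nn_integral_cong) (auto simp: K_def split: split_indicator)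
    also have "\<dots> = (\<integral>\<^sup>+z. ennreal (\<bar>K z\<bar> powr q) \<partial>lborel)"
      using Kq by (subst lborel.nn_integral_fst) (auto simp: lborel_prod)
    also have "\<dots> = (\<integral>\<^sup>+z. ennreal (indicator ?S z *\<^sub>R \<bar>case z of (t, x) \<Rightarrow> k t x\<bar> powr q) \<partial>lborel)"
    proof (rule nn_integral_cong_AE)
      show "AE z in lborel. ennreal (\<bar>K z\<bar> powr q) = ennreal (indicator ?S z *\<^sub>R \<bar>case z of (t, x) \<Rightarrow> k t x\<bar> powr q)"
        using KS
      proof eventually_elim
        case (elim z)
        show ?case unfolding elim by (simp split: split_indicator)
      qed
    qed
    also have "\<dots> = (\<integral>\<^sup>+z. ennreal (indicator ?S z *\<^sub>R \<bar>case z of (t, x) \<Rightarrow> k t x\<bar> powr q) \<partial>lebesgue)"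
      by (simp add: nn_integral_completion)
    also have "\<dots> < \<infinity>"
    proof -
      have "(\<integral>\<^sup>+z. ennreal (norm (indicator ?S z *\<^sub>R \<bar>case z of (t, x) \<Rightarrow> k t x\<bar> powr q)) \<partial>lebesgue) < \<infinity>"
        using ki unfolding integrable_iff_bounded by blast
      then show ?thesis by simp
    qed
    finally show "integrable (lborel \<Otimes>\<^sub>M MI a b) (\<lambda>z. \<bar>K z\<bar> powr q)"
      using Kq' by (simp add: integrable_iff_bounded)
  qed
qed

text \<open>On a finite measure space a Cauchy sequence in L_2 is Cauchy in L_1, which gives a
  subsequence converging almost everywhere. Fatou's lemma along it bounds the L_2 distance of the
  whole sequence to the limit.\<close>

lemma L2_complete:
  fixes f :: "nat \<Rightarrow> 'b \<Rightarrow> real"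
  assumes fin: "finite_measure M" and f: "\<And>n. f n \<in> borel_measurable M" "\<And>n. integrable M (\<lambda>x. (f n x)\<^sup>2)"
    and C: "\<And>e. e > 0 \<Longrightarrow> \<exists>N. \<forall>i\<ge>N. \<forall>j\<ge>N. (\<integral>x. (f i x - f j x)\<^sup>2 \<partial>M) < e"
  obtains g where "g \<in> borel_measurable M" "integrable M (\<lambda>x. (g x)\<^sup>2)" "(\<lambda>n. \<integral>x. (f n x - g x)\<^sup>2 \<partial>M) \<longlonglongrightarrow> 0"
proof -
  interpret finite_measure M by (rule fin)
  note [measurable] = f(1)
  have d2: "integrable M (\<lambda>x. (f i x - f j x)\<^sup>2)" for i j
  proof (rule Bochner_Integration.integrable_bound)
    show "integrable M (\<lambda>x. 2 * (f i x)\<^sup>2 + 2 * (f j x)\<^sup>2)" using f(2) by simp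
    have "(u - w)\<^sup>2 \<le> 2 * u\<^sup>2 + 2 * w\<^sup>2" for u w :: real
      using zero_le_power2[of "u + w"] by (simp add: power2_eq_square algebra_simps)
    then show "AE x in M. norm ((f i x - f j x)\<^sup>2) \<le> norm (2 * (f i x)\<^sup>2 + 2 * (f j x)\<^sup>2)" by (intro AE_I2) simp
  qed measurable
  have sq1: "\<bar>u\<bar> \<le> e + u\<^sup>2 / e" if "e > 0" for u e :: real
  proof (cases "\<bar>u\<bar> \<le> e")
    case True
    then show ?thesis using that by (simp add: add_increasing2)
  next
    case False
    then have "\<bar>u\<bar> * e \<le> \<bar>u\<bar> * \<bar>u\<bar>" by (intro mult_left_mono) auto
    then have "\<bar>u\<bar> \<le> u\<^sup>2 / e" using that by (simp add: pos_le_divide_eq power2_eq_square)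
    then show ?thesis using that by linarith
  qed
  have fi: "integrable M (f n)" for n
  proof (rule Bochner_Integration.integrable_bound)
    show "integrable M (\<lambda>x. 1 + (f n x)\<^sup>2)" using f(2) by simp
    show "AE x in M. norm (f n x) \<le> norm (1 + (f n x)\<^sup>2)" using sq1[of 1] by (intro AE_I2) simp
  qed measurable
  define m where "m = measure M (space M)"
  have m0: "m \<ge> 0" by (simp add: m_def)
  have L1: "\<exists>N. \<forall>i\<ge>N. \<forall>j\<ge>N. (LINT x|M. norm (f i x - f j x)) < e" if e: "e > 0" for e
  proof -
    define d where "d = e / (2 * (m + 1))"
    have d: "d > 0" using e m0 by (simp add: d_def)
    have dm: "d * m < e / 2 + e / 8"
    proof -
      have "d * m \<le> d * (m + 1)" using d by simp
      also have "\<dots> = e / 2" using m0 by (simp add: d_def field_simps)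
      finally show ?thesis using e by simp
    qed
    obtain N where N: "\<And>i j. i \<ge> N \<Longrightarrow> j \<ge> N \<Longrightarrow> (\<integral>x. (f i x - f j x)\<^sup>2 \<partial>M) < d * e / 8" using C[of "d * e / 8"] d e by auto
    have "(LINT x|M. norm (f i x - f j x)) < e" if ij: "i \<ge> N" "j \<ge> N" for i j
    proof -
      have "(LINT x|M. norm (f i x - f j x)) \<le> (\<integral>x. d + (f i x - f j x)\<^sup>2 / d \<partial>M)"
        using fi d2 sq1[OF d] by (intro integral_mono integrable_norm Bochner_Integration.integrable_diff Bochner_Integration.integrable_add) auto
      also have "\<dots> = d * m + (\<integral>x. (f i x - f j x)\<^sup>2 \<partial>M) / d" using d2 by (simp add: m_def)
      also have "(\<integral>x. (f i x - f j x)\<^sup>2 \<partial>M) / d \<le> e / 8" using N[OF ij] d by (simp add: pos_divide_le_eq field_simps)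
      finally show ?thesis using dm e by linarith
    qed
    then show ?thesis by blast
  qed
  from cauchy_L1_AE_cauchy_subseq[OF fi L1] obtain r where r: "strict_mono r" "AE x in M. Cauchy (\<lambda>i. f (r i) x)" by blast
  define g where "g x = lim (\<lambda>i. f (r i) x)" for x
  have gm[measurable]: "g \<in> borel_measurable M" unfolding g_def[abs_def] by (rule borel_measurable_lim_metric) measurable
  have conv: "AE x in M. (\<lambda>i. f (r i) x) \<longlonglongrightarrow> g x"
    using r(2) unfolding g_def by eventually_elim (simp add: Cauchy_convergent_iff convergent_LIMSEQ_iff)
  have Fatou: "(\<integral>\<^sup>+x. ennreal ((f n x - g x)\<^sup>2) \<partial>M) \<le> ennreal e"
    if N: "\<And>i j. i \<ge> N \<Longrightarrow> j \<ge> N \<Longrightarrow> (\<integral>x. (f i x - f j x)\<^sup>2 \<partial>M) < e" and n: "n \<ge> N" for n N e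
  proof -
    have "(\<integral>\<^sup>+x. ennreal ((f n x - g x)\<^sup>2) \<partial>M) = (\<integral>\<^sup>+x. liminf (\<lambda>i. ennreal ((f n x - f (r i) x)\<^sup>2)) \<partial>M)"
    proof (rule nn_integral_cong_AE)
      show "AE x in M. ennreal ((f n x - g x)\<^sup>2) = liminf (\<lambda>i. ennreal ((f n x - f (r i) x)\<^sup>2))"
        using conv
      proof eventually_elim
        case (elim x)
        have "(\<lambda>i. ennreal ((f n x - f (r i) x)\<^sup>2)) \<longlonglongrightarrow> ennreal ((f n x - g x)\<^sup>2)"
          by (intro tendsto_ennrealI tendsto_power tendsto_diff tendsto_const elim)
        then show ?case by (intro lim_imp_Liminf[symmetric]) auto
      qed
    qed
    also have "\<dots> \<le> liminf (\<lambda>i. \<integral>\<^sup>+x. ennreal ((f n x - f (r i) x)\<^sup>2) \<partial>M)"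
      by (rule nn_integral_liminf) measurable
    also have "\<dots> \<le> ennreal e"
    proof (rule Liminf_le)
      show "\<forall>\<^sub>F i in sequentially. (\<integral>\<^sup>+x. ennreal ((f n x - f (r i) x)\<^sup>2) \<partial>M) \<le> ennreal e"
        unfolding eventually_sequentially
      proof (intro exI[of _ N] allI impI)
        fix i assume "N \<le> i"
        then have ri: "r i \<ge> N" using seq_suble[OF r(1), of i] by simp
        have "(\<integral>\<^sup>+x. ennreal ((f n x - f (r i) x)\<^sup>2) \<partial>M) = ennreal (\<integral>x. (f n x - f (r i) x)\<^sup>2 \<partial>M)"
          by (rule nn_integral_eq_integral[OF d2]) auto
        also have "\<dots> \<le> ennreal e" using N[OF n ri] by (intro ennreal_leI) simp
        finally show "(\<integral>\<^sup>+x. ennreal ((f n x - f (r i) x)\<^sup>2) \<partial>M) \<le> ennreal e" .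
      qed
    qed simp
    finally show ?thesis .
  qed
  have gi0: "\<exists>N. \<forall>n\<ge>N. integrable M (\<lambda>x. (f n x - g x)\<^sup>2) \<and> (\<integral>x. (f n x - g x)\<^sup>2 \<partial>M) \<le> e" if e: "e > 0" for e
  proof -
    obtain N where N: "\<And>i j. i \<ge> N \<Longrightarrow> j \<ge> N \<Longrightarrow> (\<integral>x. (f i x - f j x)\<^sup>2 \<partial>M) < e" using C[OF e] by blast
    have "integrable M (\<lambda>x. (f n x - g x)\<^sup>2) \<and> (\<integral>x. (f n x - g x)\<^sup>2 \<partial>M) \<le> e" if n: "n \<ge> N" for n
    proof -
      have b: "(\<integral>\<^sup>+x. ennreal ((f n x - g x)\<^sup>2) \<partial>M) \<le> ennreal e" by (rule Fatou[OF N n])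
      then have "(\<integral>\<^sup>+x. ennreal ((f n x - g x)\<^sup>2) \<partial>M) < \<infinity>" using ennreal_less_top le_less_trans by fastforce
      then have i: "integrable M (\<lambda>x. (f n x - g x)\<^sup>2)" by (intro integrableI_bounded) auto
      have "ennreal (\<integral>x. (f n x - g x)\<^sup>2 \<partial>M) \<le> ennreal e"
        using b nn_integral_eq_integral[OF i] by simp
      then show ?thesis using i e by simp
    qed
    then show ?thesis by blast
  qed
  obtain N1 where N1: "integrable M (\<lambda>x. (f N1 x - g x)\<^sup>2)" using gi0[of 1] by auto
  have gi: "integrable M (\<lambda>x. (g x)\<^sup>2)"
  proof (rule Bochner_Integration.integrable_bound)
    show "integrable M (\<lambda>x. 2 * (f N1 x)\<^sup>2 + 2 * (f N1 x - g x)\<^sup>2)" using f(2) N1 by simp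
    have "w\<^sup>2 \<le> 2 * u\<^sup>2 + 2 * (u - w)\<^sup>2" for u w :: real
      using zero_le_power2[of "2 * u - w"] by (simp add: power2_eq_square algebra_simps)
    then show "AE x in M. norm ((g x)\<^sup>2) \<le> norm (2 * (f N1 x)\<^sup>2 + 2 * (f N1 x - g x)\<^sup>2)" by (intro AE_I2) simp
  qed measurable
  have "(\<lambda>n. \<integral>x. (f n x - g x)\<^sup>2 \<partial>M) \<longlonglongrightarrow> 0"
  proof (rule LIMSEQ_I)
    fix e :: real assume "e > 0"
    then obtain N where "\<forall>n\<ge>N. (\<integral>x. (f n x - g x)\<^sup>2 \<partial>M) \<le> e / 2" using gi0[of "e/2"] by auto
    moreover have "0 \<le> (\<integral>x. (f n x - g x)\<^sup>2 \<partial>M)" for n by (intro integral_nonneg_AE) auto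
    ultimately show "\<exists>no. \<forall>n\<ge>no. norm ((\<integral>x. (f n x - g x)\<^sup>2 \<partial>M) - 0) < e" using \<open>e > 0\<close>
      by (intro exI[of _ N]) (auto intro: le_less_trans[of _ "e/2"])
  qed
  with gm gi show thesis by (rule that)
qed

lemma ac_rep_deriv:
  assumes u: "ac_rep a b u g" and g: "AE x in MI a b. g x = h x" and h: "continuous_on {a..b} h" and x: "x \<in> {a..b}"
  shows "(u has_real_derivative h x) (at x within {a..b})"
proof -
  obtain c where c: "\<And>x. x \<in> {a..b} \<Longrightarrow> u x = c + prim a b g x" "integrable (MI a b) g" using ac_repE[OF u] by blast
  define H where "H y = integral {a..y} h" for y
  have H: "(H has_real_derivative h y) (at y within {a..b})" if "y \<in> {a..b}" for y
    unfolding H_def by (rule integral_has_real_derivative[OF h that])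
  have hi: "integrable (MI a b) h" by (rule continuous_integrable_MI[OF h])
  have "prim a b g y = H y" if y: "y \<in> {a..b}" for y
  proof -
    have "prim a b g y = (\<integral>z. indicator {..y} z * h z \<partial>MI a b)" unfolding prim_def
    proof (rule integral_cong_AE)
      show "(\<lambda>z. indicat_real {..y} z * g z) \<in> borel_measurable (MI a b)" "(\<lambda>z. indicat_real {..y} z * h z) \<in> borel_measurable (MI a b)"
        by (rule borel_measurable_integrable[OF integrable_MI_indicator], use c(2) hi in auto)+
      show "AE z in MI a b. indicat_real {..y} z * g z = indicat_real {..y} z * h z" using g by eventually_elim simp
    qed
    also have "\<dots> = (\<integral>z. indicator {a..y} z * h z \<partial>MI a b)"
      by (rule Bochner_Integration.integral_cong) (auto simp: space_MI split: split_indicator)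
    also have "\<dots> = H y - H a" by (rule MI_FTC[OF H h]) (use y in auto)
    finally show ?thesis by (simp add: H_def)
  qed
  then have eq: "u y = c + H y" if "y \<in> {a..b}" for y using c(1) that by simp
  have "((\<lambda>y. c + H y) has_real_derivative h x) (at x within {a..b})"
    using H[OF x] by (auto intro!: derivative_eq_intros)
  then show ?thesis by (rule has_field_derivative_transform_within[of _ _ _ _ 1]) (use eq x in auto)
qed

text \<open>The absolutely continuous representative is bounded on the compact interval. Bounded
  weights are what the pairing with the L_2 continuous function v needs below.\<close>

lemma sobolev1_bounded:
  assumes ab: "a < b" and p: "1 \<le> p" and f: "f \<in> sobolev 1 p {a<..<b}"
  obtains B where "B > 0" "AE x in MI a b. \<bar>f x\<bar> \<le> B" "f \<in> borel_measurable (MI a b)"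
proof -
  have fm: "f \<in> borel_measurable (MI a b)" and "integrable (MI a b) (\<lambda>x. \<bar>f x\<bar> powr p)"
    using f by (auto simp: sobolev_def Lp_space_def)
  then have fi: "integrable (MI a b) f" using finite_measure.integrable_of_powr[OF finite_MI p] by blast
  obtain u where u: "ac_rep a b u (wderiv {a<..<b} 1 f)" "AE x in MI a b. f x = u x"
    using weak_deriv_ac_rep[OF ab sobolev_wderiv(1)[OF f] fi sobolev_wderiv_integrable[OF f _ p]] by auto
  have "bounded (u ` {a..b})" using compact_continuous_image[OF ac_rep_continuous[OF u(1)]] compact_imp_bounded by blast
  then obtain B where B: "B > 0" "\<And>x. x \<in> {a..b} \<Longrightarrow> norm (u x) \<le> B" using bounded_pos by (metis imageI)
  have "AE x in MI a b. x \<in> {a<..<b}" by (intro AE_I2) (simp add: space_MI)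
  with u(2) have "AE x in MI a b. \<bar>f x\<bar> \<le> B" by eventually_elim (use B in auto)
  with B fm show thesis by (intro that)
qed

section \<open>The continuity equation integrated in time\<close>

lemma L2_continuous_pairing:
  assumes v: "L2_continuous {a<..<b} v" and \<psi>: "B > 0" "AE x in MI a b. \<bar>\<psi> x\<bar> \<le> B" "\<psi> \<in> borel_measurable (MI a b)"
    and X: "X \<longlonglongrightarrow> t" "\<And>n. X n \<ge> 0" "t \<ge> 0"
  shows "(\<lambda>n. \<integral>x. v (X n) x * \<psi> x \<partial>MI a b) \<longlonglongrightarrow> (\<integral>x. v t x * \<psi> x \<partial>MI a b)"
    "(\<lambda>n. \<integral>x. \<bar>v (X n) x - v t x\<bar> \<partial>MI a b) \<longlonglongrightarrow> 0"
proof -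
  interpret finite_measure "MI a b" by (rule finite_MI)
  have L2: "v s \<in> borel_measurable (MI a b)" "integrable (MI a b) (\<lambda>x. \<bar>v s x\<bar> powr 2)" if "s \<ge> 0" for s
    using v that by (auto simp: L2_continuous_def Lp_space_def)
  have vi: "integrable (MI a b) (v s)" if "s \<ge> 0" for s using integrable_of_powr[OF _ L2[OF that]] by simp
  let ?d = "\<lambda>n x. v (X n) x - v t x"
  have dm: "?d n \<in> borel_measurable (MI a b)" for n using L2(1)[OF X(2)] L2(1)[OF X(3)] by measurable
  have di: "integrable (MI a b) (\<lambda>x. \<bar>?d n x\<bar> powr 2)" for n
  proof (rule Bochner_Integration.integrable_bound)
    show "integrable (MI a b) (\<lambda>x. 2 powr 2 * (\<bar>v (X n) x\<bar> powr 2 + \<bar>v t x\<bar> powr 2))"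
      using L2(2)[OF X(2)] L2(2)[OF X(3)] by simp
    show "(\<lambda>x. \<bar>?d n x\<bar> powr 2) \<in> borel_measurable (MI a b)" using dm[of n] by measurable
    show "AE x in MI a b. norm (\<bar>?d n x\<bar> powr 2) \<le> norm (2 powr 2 * (\<bar>v (X n) x\<bar> powr 2 + \<bar>v t x\<bar> powr 2))"
      using powr_add_le[of 2 "v (X n) x" "v t x" for x] by (intro AE_I2) simp
  qed
  have "((\<lambda>s. Lp_norm 2 {a<..<b} (\<lambda>x. v s x - v t x)) \<longlongrightarrow> 0) (at t within {0..})"
    using v X(3) by (simp add: L2_continuous_def)
  moreover have "Lp_norm 2 {a<..<b} (\<lambda>x. v t x - v t x) = 0" by (simp add: Lp_norm_def)
  ultimately have "((\<lambda>s. Lp_norm 2 {a<..<b} (\<lambda>x. v s x - v t x)) \<longlongrightarrow> Lp_norm 2 {a<..<b} (\<lambda>x. v t x - v t x)) (at t within {0..})"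
    by (simp only:)
  then have "continuous (at t within {0..}) (\<lambda>s. Lp_norm 2 {a<..<b} (\<lambda>x. v s x - v t x))"
    by (simp only: continuous_within)
  then have "((\<lambda>s. Lp_norm 2 {a<..<b} (\<lambda>x. v s x - v t x)) \<circ> X) \<longlonglongrightarrow> Lp_norm 2 {a<..<b} (\<lambda>x. v t x - v t x)"
    unfolding continuous_within_sequentially using X by simp
  then have "(\<lambda>n. Lp_norm 2 {a<..<b} (?d n)) \<longlonglongrightarrow> 0" by (simp add: comp_def Lp_norm_def)
  then have "(\<lambda>n. Lp_norm 2 {a<..<b} (?d n) powr 2) \<longlonglongrightarrow> 0 powr 2"
    by (intro tendsto_powr' tendsto_const) (auto simp: Lp_norm_def)
  moreover have "Lp_norm 2 {a<..<b} (?d n) powr 2 = (\<integral>x. \<bar>?d n x\<bar> powr 2 \<partial>MI a b)" for n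
  proof -
    have "0 \<le> (\<integral>x. \<bar>?d n x\<bar> powr 2 \<partial>MI a b)" by (intro integral_nonneg_AE) auto
    then show ?thesis unfolding Lp_norm_def by (simp add: powr_powr)
  qed
  ultimately have "(\<lambda>n. \<integral>x. \<bar>?d n x\<bar> powr 2 \<partial>MI a b) \<longlonglongrightarrow> 0" by simp
  then show L1: "(\<lambda>n. \<integral>x. \<bar>?d n x\<bar> \<partial>MI a b) \<longlonglongrightarrow> 0"
    by (rule Lp_to_L1[OF finite_MI _ dm di, rotated]) simp
  have v\<psi>: "integrable (MI a b) (\<lambda>x. f x * \<psi> x)" if "integrable (MI a b) f" for f :: "real \<Rightarrow> real"
  proof (rule Bochner_Integration.integrable_bound[OF integrable_mult_left[OF that, of B]])
    show "(\<lambda>x. f x * \<psi> x) \<in> borel_measurable (MI a b)" using that \<psi>(3) by measurable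
    show "AE x in MI a b. norm (f x * \<psi> x) \<le> norm (f x * B)"
      using \<psi>(2) by eventually_elim (use \<psi>(1) in \<open>auto simp: abs_mult intro!: mult_left_mono\<close>)
  qed
  have "(\<lambda>n. B * (\<integral>x. \<bar>?d n x\<bar> \<partial>MI a b)) \<longlonglongrightarrow> B * 0" by (intro tendsto_mult tendsto_const L1)
  then have BL: "(\<lambda>n. B * (\<integral>x. \<bar>?d n x\<bar> \<partial>MI a b)) \<longlonglongrightarrow> 0" by simp
  have "(\<lambda>n. (\<integral>x. v (X n) x * \<psi> x \<partial>MI a b) - (\<integral>x. v t x * \<psi> x \<partial>MI a b)) \<longlonglongrightarrow> 0"
  proof (rule Lim_null_comparison[OF _ BL], intro always_eventually allI)
    fix n
    have dvi: "integrable (MI a b) (?d n)" using vi[OF X(2)] vi[OF X(3)] by (rule Bochner_Integration.integrable_diff)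
    have "(\<integral>x. v (X n) x * \<psi> x \<partial>MI a b) - (\<integral>x. v t x * \<psi> x \<partial>MI a b) = (\<integral>x. ?d n x * \<psi> x \<partial>MI a b)"
      using v\<psi>[OF vi[OF X(2)]] v\<psi>[OF vi[OF X(3)]] by (simp add: left_diff_distrib)
    also have "norm \<dots> \<le> (\<integral>x. \<bar>?d n x * \<psi> x\<bar> \<partial>MI a b)" using integral_abs_bound by simp
    also have "\<dots> \<le> (\<integral>x. B * \<bar>?d n x\<bar> \<partial>MI a b)"
    proof (rule integral_mono_AE)
      show "integrable (MI a b) (\<lambda>x. \<bar>?d n x * \<psi> x\<bar>)" using v\<psi>[OF dvi] by simp
      show "integrable (MI a b) (\<lambda>x. B * \<bar>?d n x\<bar>)" using dvi by simp
      show "AE x in MI a b. \<bar>?d n x * \<psi> x\<bar> \<le> B * \<bar>?d n x\<bar>"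
        using \<psi>(2) by eventually_elim (simp add: abs_mult mult.commute mult_right_mono)
    qed
    finally show "norm ((\<integral>x. v (X n) x * \<psi> x \<partial>MI a b) - (\<integral>x. v t x * \<psi> x \<partial>MI a b)) \<le> B * (\<integral>x. \<bar>?d n x\<bar> \<partial>MI a b)"
      by simp
  qed
  then show "(\<lambda>n. \<integral>x. v (X n) x * \<psi> x \<partial>MI a b) \<longlonglongrightarrow> (\<integral>x. v t x * \<psi> x \<partial>MI a b)"
    by (rule LIM_zero_cancel)
qed

lemma joint_pairing:
  fixes p q :: real and K :: "real \<times> real \<Rightarrow> real"
  assumes q: "1 < p" "1 < q" "1 / p + 1 / q = 1"
    and K: "K \<in> borel_measurable (lborel \<Otimes>\<^sub>M MI a b)" "integrable (lborel \<Otimes>\<^sub>M MI a b) (\<lambda>z. \<bar>K z\<bar> powr q)"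
    "\<And>t x. t \<notin> {0<..<T} \<Longrightarrow> K (t, x) = 0"
    and f: "f \<in> borel_measurable (MI a b)" "integrable (MI a b) (\<lambda>x. \<bar>f x\<bar> powr p)"
  shows "integrable lborel (\<lambda>t. \<integral>x. K (t, x) * f x \<partial>MI a b)"
    "integrable (lborel \<Otimes>\<^sub>M MI a b) (\<lambda>z. K z * f (snd z))"
proof -
  have "Lpq (MI a b) p q (\<lambda>z. 0) K 0 T"
    by (intro Lpq.intro Lpq_axioms.intro finite_MI) (use q K in auto)
  then interpret L: Lpq "MI a b" p q "\<lambda>z. 0" K 0 T .
  note [measurable] = K(1) f(1)
  have i: "integrable L.P (\<lambda>z. indicator {0<..<T} (fst z) * \<bar>f (snd z)\<bar> powr p)"
  proof (rule L.P.Fubini_integrable)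
    have "integrable lborel (\<lambda>t. indicat_real {0<..<T} t)"
      by (cases "0 \<le> T") (auto intro!: integrable_real_indicator)
    then show "integrable lborel (\<lambda>t. \<integral>x. norm (indicat_real {0<..<T} (fst (t, x)) * \<bar>f (snd (t, x))\<bar> powr p) \<partial>MI a b)"
      by (simp add: abs_mult)
    show "AE t in lborel. integrable (MI a b) (\<lambda>x. indicat_real {0<..<T} (fst (t, x)) * \<bar>f (snd (t, x))\<bar> powr p)"
      using f(2) by (intro AE_I2) simp
  qed measurable
  show "integrable L.P (\<lambda>z. K z * f (snd z))"
  proof (rule Bochner_Integration.integrable_bound)
    show "integrable L.P (\<lambda>z. indicator {0<..<T} (fst z) * \<bar>f (snd z)\<bar> powr p + \<bar>K z\<bar> powr q)" using i K(2) by simp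
    show "AE z in L.P. norm (K z * f (snd z)) \<le> norm (indicator {0<..<T} (fst z) * \<bar>f (snd z)\<bar> powr p + \<bar>K z\<bar> powr q)"
    proof (rule AE_I2)
      fix z :: "real \<times> real"
      show "norm (K z * f (snd z)) \<le> norm (indicator {0<..<T} (fst z) * \<bar>f (snd z)\<bar> powr p + \<bar>K z\<bar> powr q)"
        using Young_eps[OF q, of 1 "\<bar>f (snd z)\<bar>" "\<bar>K z\<bar>"] K(3)[of "fst z" "snd z"]
        by (cases "fst z \<in> {0<..<T}") (auto simp: abs_mult mult.commute)
    qed
  qed measurable
  from L.P.integrable_fst'[OF this] show "integrable lborel (\<lambda>t. \<integral>x. K (t, x) * f x \<partial>MI a b)" by simp
qed

text \<open>Here vt is eliminated: the weak time derivative and the tested continuity equation both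
  evaluate its pairing with \<psi>. Since v is continuous into L_2, \<open>time_primitive\<close>
  gives the identity for all s and t.\<close>

lemma continuity_eq_integrated:
  fixes p q :: real and K :: "real \<times> real \<Rightarrow> real"
  assumes ab: "a < b" and pq: "1 < p" "1 < q" "1 / p + 1 / q = 1" and k: "k \<in> Lp_loc_time q {a<..<b}"
    and vt: "\<And>T. T > 0 \<Longrightarrow> AE t in MI 0 T. vt t \<in> dual_space (sobolev 1 p {a<..<b}) N"
    and wt: "has_weak_time_deriv p {a<..<b} v vt" and L2: "L2_continuous {a<..<b} v"
    and ce: "weak_continuity_eq p {a<..<b} vt k"
    and K: "K \<in> borel_measurable (lborel \<Otimes>\<^sub>M MI a b)" "integrable (lborel \<Otimes>\<^sub>M MI a b) (\<lambda>z. \<bar>K z\<bar> powr q)"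
    "AE t in lborel. t \<in> {0<..<T} \<longrightarrow> (AE x in MI a b. K (t, x) = k t x)" "\<And>t x. t \<notin> {0<..<T} \<Longrightarrow> K (t, x) = 0"
    and \<psi>: "\<psi> \<in> sobolev 1 p {a<..<b}" and st: "0 \<le> s" "s \<le> t" "t \<le> T" "0 < T"
  shows "(\<integral>x. v t x * \<psi> x \<partial>MI a b) - (\<integral>x. v s x * \<psi> x \<partial>MI a b)
    = (\<integral>\<tau>. indicator {s<..t} \<tau> * (\<integral>x. K (\<tau>, x) * wderiv {a<..<b} 1 \<psi> x \<partial>MI a b) \<partial>lborel)"
proof -
  let ?w = "wderiv {a<..<b} 1 \<psi>"
  let ?z = "\<lambda>t. \<integral>x. k t x * ?w x \<partial>MI a b"
  let ?y = "\<lambda>t. \<integral>x. v t x * \<psi> x \<partial>MI a b"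
  have w: "?w \<in> borel_measurable (MI a b)" "integrable (MI a b) (\<lambda>x. \<bar>?w x\<bar> powr p)"
    using sobolev_wderiv[OF \<psi>, of 1] by auto
  \<comment> \<open>Outside (0, T') both sides are 0, so one identity serves on the whole
    line.\<close>
  have zK: "AE t in lebesgue. indicator {0<..<T'} t * ?z t = (\<integral>x. K' (t, x) * ?w x \<partial>MI a b)"
    if "AE t in lborel. t \<in> {0<..<T'} \<longrightarrow> (AE x in MI a b. K' (t, x) = k t x)" "\<And>t x. t \<notin> {0<..<T'} \<Longrightarrow> K' (t, x) = 0" for T' K'
    using AE_completion[OF that(1)]
  proof eventually_elim
    case (elim t)
    show ?case
    proof (cases "t \<in> {0<..<T'}")
      case True
      have "(LINT x:{a<..<b}|lebesgue. k t x * ?w x) = (LINT x:{a<..<b}|lebesgue. K' (t, x) * ?w x)"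
      proof (rule set_integral_lebesgue_cong_AE)
        have "AE x in MI a b. K' (t, x) = k t x" using elim True by blast
        then show "AE x in lebesgue. x \<in> {a<..<b} \<longrightarrow> k t x * ?w x = K' (t, x) * ?w x"
          unfolding AE_MI by eventually_elim simp
      qed
      then show ?thesis using True by (simp add: LINT_MI)
    qed (use that(2) in auto)
  qed
  \<comment> \<open>\<open>time_primitive\<close> asks for integrability on every (0, T'), so a
    representative K' is taken for each T' besides the given K on (0, T).\<close>
  have z: "integrable (MI 0 T') ?z" if T': "T' > 0" for T'
  proof -
    obtain K' where K': "K' \<in> borel_measurable (lborel \<Otimes>\<^sub>M MI a b)" "integrable (lborel \<Otimes>\<^sub>M MI a b) (\<lambda>z. \<bar>K' z\<bar> powr q)"
      "AE t in lborel. t \<in> {0<..<T'} \<longrightarrow> (AE x in MI a b. K' (t, x) = k t x)" "\<And>t x. t \<notin> {0<..<T'} \<Longrightarrow> K' (t, x) = 0"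
      using Lp_loc_time_joint[OF k T'] by blast
    have il: "integrable lborel (\<lambda>t. \<integral>x. K' (t, x) * ?w x \<partial>MI a b)" by (rule joint_pairing(1)[OF pq K'(1,2,4) w])
    then have i: "integrable lebesgue (\<lambda>t. \<integral>x. K' (t, x) * ?w x \<partial>MI a b)"
      by (subst integrable_completion) auto
    have ae: "AE t in lebesgue. (\<integral>x. K' (t, x) * ?w x \<partial>MI a b) = indicator {0<..<T'} t * ?z t"
    proof -
      have "AE t in lebesgue. indicator {0<..<T'} t * ?z t = (\<integral>x. K' (t, x) * ?w x \<partial>MI a b)"
        by (rule zK[OF K'(3)]) (rule K'(4))
      then show ?thesis by eventually_elim simp
    qed
    have "integrable lebesgue (\<lambda>t. indicator {0<..<T'} t * ?z t)"
      by (rule integrable_cong_AE_imp[OF i borel_measurable_lebesgue_cong_AE[OF borel_measurable_integrable[OF i] ae] ae])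
    then show ?thesis by (simp add: integrable_restrict_space[OF Ioo_lebesgue])
  qed
  obtain B where B: "B > 0" "AE x in MI a b. \<bar>\<psi> x\<bar> \<le> B" "\<psi> \<in> borel_measurable (MI a b)"
    using sobolev1_bounded[OF ab _ \<psi>] pq by auto
  have y: "continuous_on {0..} ?y"
    unfolding continuous_on_sequentially comp_def using L2_continuous_pairing(1)[OF L2 B] by auto
  have "?y t - ?y s = (\<integral>\<tau>. indicator {s<..t} \<tau> * ?z \<tau> \<partial>MI 0 T)"
  proof (rule time_primitive[OF y z _ st])
    fix \<eta> assume \<eta>: "test_fun {0<..} \<eta>"
    have "(LINT t:{0<..}|lebesgue. deriv \<eta> t * ?y t) = - (LINT t:{0<..}|lebesgue. \<eta> t * vt t \<psi>)"
      using wt \<eta> \<psi> unfolding has_weak_time_deriv_def LINT_MI by blast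
    also have "\<dots> = - (LINT t:{0<..}|lebesgue. \<eta> t * ?z t)"
      using weak_eq_product(1)[OF _ vt ce \<psi> \<eta>] pq by simp
    finally show "(LINT t:{0<..}|lebesgue. deriv \<eta> t * ?y t) = - (LINT t:{0<..}|lebesgue. \<eta> t * ?z t)" .
  qed
  also have "\<dots> = (\<integral>\<tau>. indicator {0<..<T} \<tau> *\<^sub>R (indicator {s<..t} \<tau> * ?z \<tau>) \<partial>lebesgue)"
    by (rule integral_restrict_space[OF Ioo_lebesgue])
  also have "\<dots> = (\<integral>\<tau>. indicator {s<..t} \<tau> * (\<integral>x. K (\<tau>, x) * ?w x \<partial>MI a b) \<partial>lebesgue)"
  proof (rule integral_lebesgue_cong_AE)
    show "AE \<tau> in lebesgue. indicat_real {0<..<T} \<tau> *\<^sub>R (indicat_real {s<..t} \<tau> * ?z \<tau>) = indicat_real {s<..t} \<tau> * (\<integral>x. K (\<tau>, x) * ?w x \<partial>MI a b)"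
    proof -
      have "AE t in lebesgue. indicator {0<..<T} t * ?z t = (\<integral>x. K (t, x) * ?w x \<partial>MI a b)"
        by (rule zK[OF K(3)]) (rule K(4))
      then show ?thesis
      proof eventually_elim
        case (elim \<tau>)
        show ?case unfolding elim[symmetric] by (simp add: mult_ac)
      qed
    qed
  qed
  also have "\<dots> = (\<integral>\<tau>. indicator {s<..t} \<tau> * (\<integral>x. K (\<tau>, x) * ?w x \<partial>MI a b) \<partial>lborel)"
    using borel_measurable_integrable[OF joint_pairing(1)[OF pq K(1,2,4) w]]
    by (intro integral_completion borel_measurable_times) auto
  finally show ?thesis .
qed

section \<open>Continuity in time of the gradient\<close>

text \<open>Rests on |u^2 - w^2| \<le> e w^2 + (1 + 1/e) (u - w)^2; e is chosen small against the
  norm of the limit before n grows.\<close>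

lemma L2_norm_conv:
  fixes f :: "nat \<Rightarrow> 'b \<Rightarrow> real"
  assumes f: "\<And>n. f n \<in> borel_measurable M" "\<And>n. integrable M (\<lambda>x. (f n x)\<^sup>2)"
    and g: "g \<in> borel_measurable M" "integrable M (\<lambda>x. (g x)\<^sup>2)" and l: "(\<lambda>n. \<integral>x. (f n x - g x)\<^sup>2 \<partial>M) \<longlonglongrightarrow> 0"
  shows "(\<lambda>n. \<integral>x. (f n x)\<^sup>2 \<partial>M) \<longlonglongrightarrow> (\<integral>x. (g x)\<^sup>2 \<partial>M)"
proof (rule LIM_zero_cancel, rule LIMSEQ_I)
  note [measurable] = f(1) g(1)
  fix r :: real assume r: "r > 0"
  define G where "G = (\<integral>x. (g x)\<^sup>2 \<partial>M)"
  have G: "G \<ge> 0" unfolding G_def by (intro integral_nonneg_AE) auto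
  define e where "e = r / (2 * (G + 1))"
  have e: "e > 0" using r G by (simp add: e_def)
  have eG: "e * G \<le> r / 2"
  proof -
    have "e * G \<le> e * (G + 1)" using e by simp
    also have "\<dots> = r / 2" using G by (simp add: e_def field_simps)
    finally show ?thesis .
  qed
  have d: "integrable M (\<lambda>x. (f n x - g x)\<^sup>2)" for n
  proof (rule Bochner_Integration.integrable_bound)
    show "integrable M (\<lambda>x. 2 * (f n x)\<^sup>2 + 2 * (g x)\<^sup>2)" using f(2) g(2) by simp
    have "(u - w)\<^sup>2 \<le> 2 * u\<^sup>2 + 2 * w\<^sup>2" for u w :: real
      using zero_le_power2[of "u + w"] by (simp add: power2_eq_square algebra_simps)
    then show "AE x in M. norm ((f n x - g x)\<^sup>2) \<le> norm (2 * (f n x)\<^sup>2 + 2 * (g x)\<^sup>2)" by (intro AE_I2) simp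
  qed measurable
  have pt: "\<bar>u\<^sup>2 - w\<^sup>2\<bar> \<le> e * w\<^sup>2 + (1 + 1 / e) * (u - w)\<^sup>2" for u w :: real
  proof -
    have sq: "2 * (x * y) \<le> e * x\<^sup>2 + y\<^sup>2 / e" for x y :: real
    proof -
      have "0 \<le> (e * x - y)\<^sup>2" by simp
      then have "2 * (x * y) * e \<le> e * x\<^sup>2 * e + y\<^sup>2"
        by (simp add: power2_eq_square algebra_simps)
      then have "2 * (x * y) \<le> (e * x\<^sup>2 * e + y\<^sup>2) / e" using e by (simp only: pos_le_divide_eq)
      then show ?thesis using e by (simp add: add_divide_distrib)
    qed
    define d where "d = u - w"
    have 1: "u\<^sup>2 - w\<^sup>2 = 2 * (w * d) + d\<^sup>2" by (simp add: d_def power2_eq_square algebra_simps)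
    have 2: "(1 + 1 / e) * d\<^sup>2 = d\<^sup>2 + d\<^sup>2 / e" by (simp add: distrib_right)
    have "2 * (w * d) \<le> e * w\<^sup>2 + d\<^sup>2 / e" "- (2 * (w * d)) \<le> e * w\<^sup>2 + d\<^sup>2 / e" "0 \<le> d\<^sup>2"
      using sq[of w d] sq[of w "- d"] by simp_all
    then have "2 * (w * d) + d\<^sup>2 \<le> e * w\<^sup>2 + (d\<^sup>2 + d\<^sup>2 / e)" "- (2 * (w * d) + d\<^sup>2) \<le> e * w\<^sup>2 + (d\<^sup>2 + d\<^sup>2 / e)"
      by linarith+
    then show ?thesis unfolding d_def[symmetric] 1 2 by (rule abs_leI)
  qed
  have "(\<lambda>n. (1 + 1 / e) * (\<integral>x. (f n x - g x)\<^sup>2 \<partial>M)) \<longlonglongrightarrow> (1 + 1 / e) * 0"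
    by (intro tendsto_mult tendsto_const l)
  then have "\<forall>\<^sub>F n in sequentially. (1 + 1 / e) * (\<integral>x. (f n x - g x)\<^sup>2 \<partial>M) < r / 2"
    using r by (intro order_tendstoD(2)) auto
  then obtain N where N: "\<And>n. n \<ge> N \<Longrightarrow> (1 + 1 / e) * (\<integral>x. (f n x - g x)\<^sup>2 \<partial>M) < r / 2"
    unfolding eventually_sequentially by blast
  show "\<exists>no. \<forall>n\<ge>no. norm ((\<integral>x. (f n x)\<^sup>2 \<partial>M) - (\<integral>x. (g x)\<^sup>2 \<partial>M) - 0) < r"
  proof (intro exI[of _ N] allI impI)
    fix n assume n: "n \<ge> N"
    have "norm ((\<integral>x. (f n x)\<^sup>2 \<partial>M) - (\<integral>x. (g x)\<^sup>2 \<partial>M) - 0) = \<bar>\<integral>x. (f n x)\<^sup>2 - (g x)\<^sup>2 \<partial>M\<bar>"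
      using f(2) g(2) by simp
    also have "\<dots> \<le> (\<integral>x. \<bar>(f n x)\<^sup>2 - (g x)\<^sup>2\<bar> \<partial>M)" by (rule integral_abs_bound)
    also have "\<dots> \<le> (\<integral>x. e * (g x)\<^sup>2 + (1 + 1 / e) * (f n x - g x)\<^sup>2 \<partial>M)"
      using f(2) g(2) d pt by (intro integral_mono integrable_abs Bochner_Integration.integrable_diff Bochner_Integration.integrable_add integrable_mult_right) auto
    also have "\<dots> = e * G + (1 + 1 / e) * (\<integral>x. (f n x - g x)\<^sup>2 \<partial>M)" using g(2) d unfolding G_def
      by (subst Bochner_Integration.integral_add) auto
    also have "\<dots> < r" using N[OF n] eG by linarith
    finally show "norm ((\<integral>x. (f n x)\<^sup>2 \<partial>M) - (\<integral>x. (g x)\<^sup>2 \<partial>M) - 0) < r" .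
  qed
qed

lemma lborel_primitive_continuous:
  fixes f :: "real \<Rightarrow> real"
  assumes f: "integrable lborel f" and X: "X \<longlonglongrightarrow> t"
  shows "(\<lambda>n. \<integral>\<sigma>. indicator {s<..X n} \<sigma> * f \<sigma> \<partial>lborel) \<longlonglongrightarrow> (\<integral>\<sigma>. indicator {s<..t} \<sigma> * f \<sigma> \<partial>lborel)"
proof (rule integral_dominated_convergence[where w = "\<lambda>\<sigma>. norm (f \<sigma>)"])
  show "AE \<sigma> in lborel. (\<lambda>n. indicat_real {s<..X n} \<sigma> * f \<sigma>) \<longlonglongrightarrow> indicat_real {s<..t} \<sigma> * f \<sigma>"
    using AE_lborel_singleton[of t]
  proof eventually_elim
    case (elim \<sigma>)
    have "\<forall>\<^sub>F n in sequentially. indicat_real {s<..t} \<sigma> * f \<sigma> = indicat_real {s<..X n} \<sigma> * f \<sigma>"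
    proof (cases "\<sigma> < t")
      case True
      have "\<forall>\<^sub>F i in sequentially. \<sigma> < X i" using order_tendstoD(1)[OF X True] .
      then show ?thesis by (rule eventually_mono) (use True in \<open>auto split: split_indicator\<close>)
    next
      case False
      then have "\<forall>\<^sub>F i in sequentially. X i < \<sigma>" using order_tendstoD(2)[OF X, of \<sigma>] elim by auto
      then show ?thesis by (rule eventually_mono) (use False elim in \<open>auto split: split_indicator\<close>)
    qed
    then show ?case by (rule Lim_transform_eventually[OF tendsto_const])
  qed
  show "AE \<sigma> in lborel. norm (indicat_real {s<..X n} \<sigma> * f \<sigma>) \<le> norm (f \<sigma>)" for n
    by (intro AE_I2) (auto split: split_indicator)
qed (use f in \<open>auto intro!: borel_measurable_times dest: borel_measurable_integrable\<close>)

lemma indicator_integrable_lborel: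
  "integrable lborel (f :: real \<Rightarrow> real) \<Longrightarrow> integrable lborel (\<lambda>\<sigma>. indicator {s<..t::real} \<sigma> * f \<sigma>)"
  using integrable_mult_indicator[of "{s<..t}" lborel f] by simp

text \<open>Since 1 / (r - t) is not integrable near t, (r - t) \<Phi> r cannot stay above \<eta>
  for almost all r close to t. Quantitatively, the right half of the window (t, t + h] would
  contribute \<eta>/2 to the integral of \<Phi>, while h is chosen so that the whole window
  contributes less.\<close>

lemma vanishing_times:
  fixes \<Phi> :: "real \<Rightarrow> real"
  assumes \<Phi>: "integrable lborel \<Phi>" "\<And>r. \<Phi> r \<ge> 0" and P: "AE r in lborel. r \<in> {0<..<T} \<longrightarrow> P r"
    and t: "0 \<le> t" "t < T" and \<eta>: "\<eta> > 0" "h0 > 0"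
  obtains r where "t < r" "r < T" "r < t + h0" "P r" "(r - t) * \<Phi> r < \<eta>"
proof -
  have "(\<lambda>n. \<integral>\<sigma>. indicator {t<..t + 1 / real (Suc n)} \<sigma> * \<Phi> \<sigma> \<partial>lborel) \<longlonglongrightarrow> (\<integral>\<sigma>. indicator {t<..t+0} \<sigma> * \<Phi> \<sigma> \<partial>lborel)"
    by (intro lborel_primitive_continuous[OF \<Phi>(1)] tendsto_add tendsto_const LIMSEQ_Suc[OF lim_1_over_n])
  then have "(\<lambda>n. \<integral>\<sigma>. indicator {t<..t + 1 / real (Suc n)} \<sigma> * \<Phi> \<sigma> \<partial>lborel) \<longlonglongrightarrow> 0" by simp
  then have "\<forall>\<^sub>F n in sequentially. (\<integral>\<sigma>. indicator {t<..t + 1 / real (Suc n)} \<sigma> * \<Phi> \<sigma> \<partial>lborel) < \<eta> / 2"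
    using \<eta> by (intro order_tendstoD(2)) auto
  moreover have "\<forall>\<^sub>F n in sequentially. 1 / real (Suc n) < min h0 (T - t)"
    using \<eta>(2) t by (intro order_tendstoD(2)[OF LIMSEQ_Suc[OF lim_1_over_n]]) auto
  ultimately have "\<forall>\<^sub>F n in sequentially. (\<integral>\<sigma>. indicator {t<..t + 1 / real (Suc n)} \<sigma> * \<Phi> \<sigma> \<partial>lborel) < \<eta> / 2 \<and> 1 / real (Suc n) < min h0 (T - t)"
    by eventually_elim simp
  then obtain n :: nat where n: "(\<integral>\<sigma>. indicator {t<..t + 1 / real (Suc n)} \<sigma> * \<Phi> \<sigma> \<partial>lborel) < \<eta> / 2" "1 / real (Suc n) < min h0 (T - t)"
    using eventually_happens'[OF sequentially_bot] by blast
  define h where "h = 1 / real (Suc n)"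
  have h: "h > 0" "h < h0" "t + h < T" using n(2) by (auto simp: h_def)
  have "\<exists>r. t < r \<and> r < t + h \<and> P r \<and> (r - t) * \<Phi> r < \<eta>"
  proof (rule ccontr)
    assume no: "\<not> ?thesis"
    have "AE r in lborel. indicator {t + h/2<..t+h} r * (\<eta> / h) \<le> indicator {t<..t+h} r * \<Phi> r"
      using P AE_lborel_singleton[of "t + h"]
    proof eventually_elim
      case (elim r)
      show ?case
      proof (cases "r \<in> {t + h/2<..t+h}")
        case True
        then have r: "t < r" "r < t + h" using elim h by auto
        then have "P r" using elim t h by auto
        then have "(r - t) * \<Phi> r \<ge> \<eta>" using no r by (meson not_less)
        moreover have "(r - t) * \<Phi> r \<le> h * \<Phi> r" using r \<Phi>(2)[of r] by (intro mult_right_mono) auto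
        ultimately have "\<eta> / h \<le> \<Phi> r" using h by (simp add: pos_divide_le_eq mult.commute)
        then show ?thesis using True r by simp
      next
        case False
        then show ?thesis using \<Phi>(2)[of r] by simp
      qed
    qed
    then have "(\<integral>r. indicator {t + h/2<..t+h} r * (\<eta> / h) \<partial>lborel) \<le> (\<integral>r. indicator {t<..t+h} r * \<Phi> r \<partial>lborel)"
      using h by (intro integral_mono_AE indicator_integrable_lborel \<Phi>(1) integrable_mult_left integrable_real_indicator) auto
    moreover have "(\<integral>r. indicator {t + h/2<..t+h} r * (\<eta> / h) \<partial>lborel) = \<eta> / 2" using h by (simp add: field_simps)
    ultimately show False using n(1)[folded h_def] by linarith
  qed
  then show thesis using h that by force
qed

lemma ac_rep_minus:
  assumes "ac_rep a b f g" "ac_rep a b f' g'" shows "ac_rep a b (\<lambda>x. f x - f' x) (\<lambda>x. g x - g' x)"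
proof -
  obtain c where c: "\<And>x. x \<in> {a..b} \<Longrightarrow> f x = c + prim a b g x" "integrable (MI a b) g" using ac_repE[OF assms(1)] by blast
  obtain d where d: "\<And>x. x \<in> {a..b} \<Longrightarrow> f' x = d + prim a b g' x" "integrable (MI a b) g'" using ac_repE[OF assms(2)] by blast
  have "prim a b (\<lambda>x. g x - g' x) x = prim a b g x - prim a b g' x" for x
    unfolding prim_def right_diff_distrib
    using integrable_MI_indicator[OF c(2), of "{..x}"] integrable_MI_indicator[OF d(2), of "{..x}"] by simp
  then have "\<forall>x\<in>{a..b}. f x - f' x = (c - d) + prim a b (\<lambda>x. g x - g' x) x" using c(1) d(1) by simp
  then show ?thesis unfolding ac_rep_def using c(2) d(2) by blast
qed

lemma continuous_bounded_Icc:
  assumes "continuous_on {a..b} (f :: real \<Rightarrow> real)"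
  obtains B where "B > 0" "\<And>x. x \<in> {a..b} \<Longrightarrow> \<bar>f x\<bar> \<le> B"
proof -
  have "bounded (f ` {a..b})" using compact_continuous_image[OF assms] compact_imp_bounded by blast
  then obtain B where B: "B > 0" "\<forall>y\<in>f ` {a..b}. norm y \<le> B" unfolding bounded_pos by blast
  have "\<bar>f x\<bar> \<le> B" if "x \<in> {a..b}" for x using B(2) that by (metis imageI real_norm_def)
  with B(1) show thesis by (rule that)
qed

lemma AE_bounded_mult_integrable:
  fixes f g :: "'b \<Rightarrow> real"
  assumes "integrable M f" "g \<in> borel_measurable M" "AE x in M. \<bar>g x\<bar> \<le> B" "B > 0"
  shows "integrable M (\<lambda>x. f x * g x)"
proof (rule Bochner_Integration.integrable_bound[OF integrable_mult_left[OF assms(1), of B]])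
  show "(\<lambda>x. f x * g x) \<in> borel_measurable M" using assms(1,2) by measurable
  show "AE x in M. norm (f x * g x) \<le> norm (f x * B)"
    using assms(3) by eventually_elim (use assms(4) in \<open>auto simp: abs_mult intro!: mult_left_mono\<close>)
qed

text \<open>\<open>U1\<close>, \<open>U3\<close> and \<open>K\<close> are jointly measurable
  versions of v_x, v_xxx and the flux on (0, T), extended by 0 in time. The continuity equation
  appears in its integrated form only, which holds for all times in [0, T].\<close>

locale flow =
  fixes a b p q T :: real and v :: "real \<Rightarrow> real \<Rightarrow> real" and U1 U3 K :: "real \<times> real \<Rightarrow> real"
  assumes ab: "a < b" and T: "T > 0" and pq: "1 < p" "1 < q" "1 / p + 1 / q = 1"
    and L2: "L2_continuous {a<..<b} v"
    and U1: "U1 \<in> borel_measurable (lborel \<Otimes>\<^sub>M MI a b)" "integrable (lborel \<Otimes>\<^sub>M MI a b) (\<lambda>z. \<bar>U1 z\<bar> powr p)" "\<And>t x. t \<notin> {0<..<T} \<Longrightarrow> U1 (t, x) = 0"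
    and U3: "U3 \<in> borel_measurable (lborel \<Otimes>\<^sub>M MI a b)" "integrable (lborel \<Otimes>\<^sub>M MI a b) (\<lambda>z. \<bar>U3 z\<bar> powr p)" "\<And>t x. t \<notin> {0<..<T} \<Longrightarrow> U3 (t, x) = 0"
    and K: "K \<in> borel_measurable (lborel \<Otimes>\<^sub>M MI a b)" "integrable (lborel \<Otimes>\<^sub>M MI a b) (\<lambda>z. \<bar>K z\<bar> powr q)" "\<And>t x. t \<notin> {0<..<T} \<Longrightarrow> K (t, x) = 0"
    and vB: "AE t in lborel. t \<in> {0<..<T} \<longrightarrow> v t \<in> sobolev3_B p {a<..<b} \<and>
      (AE x in MI a b. U1 (t, x) = wderiv {a<..<b} 1 (v t) x) \<and> (AE x in MI a b. U3 (t, x) = wderiv {a<..<b} 3 (v t) x)"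
    and ce: "\<And>\<psi> s t. \<psi> \<in> sobolev 1 p {a<..<b} \<Longrightarrow> 0 \<le> s \<Longrightarrow> s \<le> t \<Longrightarrow> t \<le> T \<Longrightarrow>
      (\<integral>x. v t x * \<psi> x \<partial>MI a b) - (\<integral>x. v s x * \<psi> x \<partial>MI a b)
      = (\<integral>\<tau>. indicator {s<..t} \<tau> * (\<integral>x. K (\<tau>, x) * wderiv {a<..<b} 1 \<psi> x \<partial>MI a b) \<partial>lborel)"
begin

abbreviation "M \<equiv> MI a b"

text \<open>The flux is cut to the strip of the force, since \<open>Lpq\<close> requires one common
  time interval.\<close>

lemma Lpq_of: 
  assumes "F \<in> borel_measurable (lborel \<Otimes>\<^sub>M M)" "integrable (lborel \<Otimes>\<^sub>M M) (\<lambda>z. \<bar>F z\<bar> powr p)" "\<And>t x. t \<notin> {A<..<B} \<Longrightarrow> F (t, x) = 0"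
    "{A<..<B} \<subseteq> {0<..<T}"
  shows "Lpq M p q F (\<lambda>z. indicator {A<..<B} (fst z) * K z) A B"
proof (intro Lpq.intro Lpq_axioms.intro finite_MI)
  note [measurable] = K(1)
  show m: "(\<lambda>z. indicat_real {A<..<B} (fst z) * K z) \<in> borel_measurable (lborel \<Otimes>\<^sub>M M)" by measurable
  show "integrable (lborel \<Otimes>\<^sub>M M) (\<lambda>z. \<bar>indicat_real {A<..<B} (fst z) * K z\<bar> powr q)"
  proof (rule Bochner_Integration.integrable_bound[OF K(2)])
    show "(\<lambda>z. \<bar>indicat_real {A<..<B} (fst z) * K z\<bar> powr q) \<in> borel_measurable (lborel \<Otimes>\<^sub>M M)" using m by measurable
    show "AE z in lborel \<Otimes>\<^sub>M M. norm (\<bar>indicat_real {A<..<B} (fst z) * K z\<bar> powr q) \<le> norm (\<bar>K z\<bar> powr q)"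
      by (intro AE_I2) (auto split: split_indicator)
  qed
qed (use pq assms in auto)

sublocale L: Lpq "MI a b" p q U3 K 0 T
  by (intro Lpq.intro Lpq_axioms.intro finite_MI) (use pq U3 K in auto)

definition good :: "real \<Rightarrow> bool" where
  "good r \<longleftrightarrow> r \<in> {0<..<T} \<and> v r \<in> sobolev3_B p {a<..<b} \<and>
      (AE x in M. U1 (r, x) = wderiv {a<..<b} 1 (v r) x) \<and> (AE x in M. U3 (r, x) = wderiv {a<..<b} 3 (v r) x)"

lemma AE_good: "AE r in lborel. r \<in> {0<..<T} \<longrightarrow> good r"
  using vB by eventually_elim (auto simp: good_def)

lemma U1_sec: "(\<lambda>x. U1 (t, x)) \<in> borel_measurable M"
  using U1(1) by measurable

text \<open>The regularity available at a good time: v r has a twice continuously differentiable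
  representative whose slope vanishes at both ends, and its second derivative lies in W^1_p, so it
  may be inserted into the continuity equation.\<close>

lemma goodE:
  assumes "good r"
  obtains u u1 u2 where
    "ac_rep a b u (\<lambda>x. U1 (r, x))" "AE x in M. v r x = u x"
    "AE x in M. U1 (r, x) = u1 x"
    "\<And>x. x \<in> {a..b} \<Longrightarrow> (u has_real_derivative u1 x) (at x within {a..b})" "continuous_on {a..b} u1"
    "\<And>x. x \<in> {a..b} \<Longrightarrow> (u1 has_real_derivative u2 x) (at x within {a..b})" "continuous_on {a..b} u2"
    "u1 a = 0" "u1 b = 0" "AE x in M. wderiv {a<..<b} 2 (v r) x = u2 x"
    "wderiv {a<..<b} 2 (v r) \<in> sobolev 1 p {a<..<b}"
    "AE x in M. wderiv {a<..<b} 1 (wderiv {a<..<b} 2 (v r)) x = U3 (r, x)"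
proof -
  have vr: "v r \<in> sobolev3_B p {a<..<b}" and w1: "AE x in M. U1 (r, x) = wderiv {a<..<b} 1 (v r) x"
    and w3: "AE x in M. U3 (r, x) = wderiv {a<..<b} 3 (v r) x" using assms by (auto simp: good_def)
  have s: "v r \<in> sobolev 3 p {a<..<b}" using vr by (simp add: sobolev3_B_def)
  have p1: "1 \<le> p" using pq by simp
  obtain u u1 u2 where u:
    "ac_rep a b u (wderiv {a<..<b} 1 (v r))" "AE x in M. v r x = u x"
    "ac_rep a b u1 (wderiv {a<..<b} 2 (v r))" "AE x in M. wderiv {a<..<b} 1 (v r) x = u1 x"
    "ac_rep a b u2 (wderiv {a<..<b} 3 (v r))" "AE x in M. wderiv {a<..<b} 2 (v r) x = u2 x"
    "u1 a = 0" "u1 b = 0" by (rule sobolev3_B_ac_rep[OF ab p1 vr, OF that])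
  have c1: "continuous_on {a..b} u1" and c2: "continuous_on {a..b} u2" using u ac_rep_continuous by blast+
  have cong: "ac_rep a b u (\<lambda>x. U1 (r, x))"
  proof -
    have i: "integrable M (wderiv {a<..<b} 1 (v r))" using u(1) by (simp add: ac_rep_def)
    have ae: "AE x in M. wderiv {a<..<b} 1 (v r) x = U1 (r, x)" using w1 by eventually_elim simp
    have i': "integrable M (\<lambda>x. U1 (r, x))" by (rule integrable_cong_AE_imp[OF i U1_sec ae])
    have "prim a b (wderiv {a<..<b} 1 (v r)) x = prim a b (\<lambda>x. U1 (r, x)) x" for x
      unfolding prim_def
    proof (rule integral_cong_AE)
      show "AE y in M. indicat_real {..x} y * wderiv {a<..<b} 1 (v r) y = indicat_real {..x} y * U1 (r, y)"
        using ae by eventually_elim simp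
    qed (use integrable_MI_indicator[OF i] integrable_MI_indicator[OF i'] in \<open>auto intro!: borel_measurable_integrable\<close>)
    then have "prim a b (wderiv {a<..<b} 1 (v r)) = prim a b (\<lambda>x. U1 (r, x))" by auto
    then show ?thesis using u(1) i' by (simp add: ac_rep_def)
  qed
  have hw: "has_weak_deriv {a<..<b} 1 (wderiv {a<..<b} 2 (v r)) (wderiv {a<..<b} 3 (v r))"
    using sobolev_wderiv_step[OF s, of 2] by (simp add: numeral_3_eq_3 numeral_2_eq_2)
  have s2: "wderiv {a<..<b} 2 (v r) \<in> sobolev 1 p {a<..<b}"
    by (rule sobolevI[OF _ _ _ _ hw]) (use sobolev_wderiv[OF s] in auto)
  have "AE x in M. wderiv {a<..<b} 1 (wderiv {a<..<b} 2 (v r)) x = wderiv {a<..<b} 3 (v r) x"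
    unfolding AE_MI using wderiv_AE[OF _ hw] by simp
  then have s3: "AE x in M. wderiv {a<..<b} 1 (wderiv {a<..<b} 2 (v r)) x = U3 (r, x)"
    using w3 by eventually_elim simp
  have d1: "(u has_real_derivative u1 x) (at x within {a..b})" if "x \<in> {a..b}" for x
    by (rule ac_rep_deriv[OF u(1,4) c1 that])
  have d2: "(u1 has_real_derivative u2 x) (at x within {a..b})" if "x \<in> {a..b}" for x
    by (rule ac_rep_deriv[OF u(3,6) c2 that])
  have U1u: "AE x in M. U1 (r, x) = u1 x" using w1 u(4) by eventually_elim simp
  show thesis by (rule that[OF cong u(2) U1u d1 c1 d2 c2 u(7,8,6) s2 s3])
qed

lemma good_U1_bounded:
  assumes "good r" obtains B where "B > 0" "AE x in M. \<bar>U1 (r, x)\<bar> \<le> B"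
proof -
  obtain u u1 u2 where u:
    "ac_rep a b u (\<lambda>x. U1 (r, x))" "AE x in M. v r x = u x"
    "AE x in M. U1 (r, x) = u1 x"
    "\<And>x. x \<in> {a..b} \<Longrightarrow> (u has_real_derivative u1 x) (at x within {a..b})" "continuous_on {a..b} u1"
    "\<And>x. x \<in> {a..b} \<Longrightarrow> (u1 has_real_derivative u2 x) (at x within {a..b})" "continuous_on {a..b} u2"
    "u1 a = 0" "u1 b = 0" "AE x in M. wderiv {a<..<b} 2 (v r) x = u2 x"
    "wderiv {a<..<b} 2 (v r) \<in> sobolev 1 p {a<..<b}"
    "AE x in M. wderiv {a<..<b} 1 (wderiv {a<..<b} 2 (v r)) x = U3 (r, x)"
    by (rule goodE[OF assms, OF that])
  note u1 = u(3,5)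
  obtain B where B: "B > 0" "\<And>x. x \<in> {a..b} \<Longrightarrow> \<bar>u1 x\<bar> \<le> B" using continuous_bounded_Icc[OF u1(2)] by blast
  have "AE x in M. x \<in> {a<..<b}" by (intro AE_I2) (simp add: space_MI)
  with u1(1) have "AE x in M. \<bar>U1 (r, x)\<bar> \<le> B" by eventually_elim (use B(2) in auto)
  with B(1) show thesis by (rule that)
qed

lemma good_U1_integrable:
  assumes "good r" shows "integrable M (\<lambda>x. U1 (r, x))" "integrable M (\<lambda>x. (U1 (r, x))\<^sup>2)"
proof -
  obtain u u1 u2 where u:
    "ac_rep a b u (\<lambda>x. U1 (r, x))" "AE x in M. v r x = u x"
    "AE x in M. U1 (r, x) = u1 x"
    "\<And>x. x \<in> {a..b} \<Longrightarrow> (u has_real_derivative u1 x) (at x within {a..b})" "continuous_on {a..b} u1"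
    "\<And>x. x \<in> {a..b} \<Longrightarrow> (u1 has_real_derivative u2 x) (at x within {a..b})" "continuous_on {a..b} u2"
    "u1 a = 0" "u1 b = 0" "AE x in M. wderiv {a<..<b} 2 (v r) x = u2 x"
    "wderiv {a<..<b} 2 (v r) \<in> sobolev 1 p {a<..<b}"
    "AE x in M. wderiv {a<..<b} 1 (wderiv {a<..<b} 2 (v r)) x = U3 (r, x)"
    by (rule goodE[OF assms, OF that])
  show i: "integrable M (\<lambda>x. U1 (r, x))" using u(1) by (simp add: ac_rep_def)
  obtain B where "B > 0" "AE x in M. \<bar>U1 (r, x)\<bar> \<le> B" using good_U1_bounded[OF assms] by blast
  from AE_bounded_mult_integrable[OF i U1_sec this(2,1)] show "integrable M (\<lambda>x. (U1 (r, x))\<^sup>2)"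
    by (simp add: power2_eq_square)
qed

lemma v_L2:
  assumes t: "t \<ge> 0"
  shows "v t \<in> borel_measurable M" "integrable M (v t)"
proof -
  have "v t \<in> Lp_space 2 {a<..<b}" using L2 t unfolding L2_continuous_def by blast
  then have m: "v t \<in> borel_measurable M" and i: "integrable M (\<lambda>x. \<bar>v t x\<bar> powr 2)"
    unfolding Lp_space_def by blast+
  show "v t \<in> borel_measurable M" by (rule m)
  show "integrable M (v t)" by (rule finite_measure.integrable_of_powr[OF finite_MI _ m i]) simp
qed

text \<open>Signed integral of \<open>L.b r\<close> from r to t. By \<open>good_ce\<close> it is the
  pairing of v(t) - v(r) with v_xx(r).\<close>

definition osc :: "real \<Rightarrow> real \<Rightarrow> real" where
  "osc r t = (if r \<le> t then (\<integral>\<sigma>. indicator {r<..t} \<sigma> * L.b r \<sigma> \<partial>lborel) else - (\<integral>\<sigma>. indicator {t<..r} \<sigma> * L.b r \<sigma> \<partial>lborel))"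

lemma good_ce:
  assumes r: "good r" and st: "0 \<le> s" "s \<le> t" "t \<le> T"
  shows "(\<integral>x. v t x * wderiv {a<..<b} 2 (v r) x \<partial>M) - (\<integral>x. v s x * wderiv {a<..<b} 2 (v r) x \<partial>M) = (\<integral>\<sigma>. indicator {s<..t} \<sigma> * L.b r \<sigma> \<partial>lborel)"
proof -
  obtain u u1 u2 where u:
    "ac_rep a b u (\<lambda>x. U1 (r, x))" "AE x in M. v r x = u x"
    "AE x in M. U1 (r, x) = u1 x"
    "\<And>x. x \<in> {a..b} \<Longrightarrow> (u has_real_derivative u1 x) (at x within {a..b})" "continuous_on {a..b} u1"
    "\<And>x. x \<in> {a..b} \<Longrightarrow> (u1 has_real_derivative u2 x) (at x within {a..b})" "continuous_on {a..b} u2"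
    "u1 a = 0" "u1 b = 0" "AE x in M. wderiv {a<..<b} 2 (v r) x = u2 x"
    "wderiv {a<..<b} 2 (v r) \<in> sobolev 1 p {a<..<b}"
    "AE x in M. wderiv {a<..<b} 1 (wderiv {a<..<b} 2 (v r)) x = U3 (r, x)"
    by (rule goodE[OF r, OF that])
  note w = u(11,12)
  have "(\<integral>x. K (\<tau>, x) * wderiv {a<..<b} 1 (wderiv {a<..<b} 2 (v r)) x \<partial>M) = L.b r \<tau>" for \<tau>
  proof -
    have "(LINT x:{a<..<b}|lebesgue. K (\<tau>, x) * wderiv {a<..<b} 1 (wderiv {a<..<b} 2 (v r)) x) = (LINT x:{a<..<b}|lebesgue. U3 (r, x) * K (\<tau>, x))"
      using w(2) unfolding AE_MI by (intro set_integral_lebesgue_cong_AE) (auto elim!: eventually_mono simp: mult.commute)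
    then show ?thesis by (simp add: LINT_MI L.b_def)
  qed
  then show ?thesis using ce[OF w(1) st] by simp
qed

text \<open>Integration by parts moves the derivative off v(t) - v(r), without boundary terms
  because v_x(r) vanishes at the ends. The continuity equation tested with v_xx(r) evaluates the
  result.\<close>

lemma cross:
  assumes r: "good r" and t: "0 \<le> t" "t \<le> T" and f: "ac_rep a b f g" "AE x in M. v t x = f x"
  shows "(\<integral>x. (g x - U1 (r, x)) * U1 (r, x) \<partial>M) = - osc r t"
proof -
  obtain u u1 u2 where uu:
    "ac_rep a b u (\<lambda>x. U1 (r, x))" "AE x in M. v r x = u x"
    "AE x in M. U1 (r, x) = u1 x"
    "\<And>x. x \<in> {a..b} \<Longrightarrow> (u has_real_derivative u1 x) (at x within {a..b})" "continuous_on {a..b} u1"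
    "\<And>x. x \<in> {a..b} \<Longrightarrow> (u1 has_real_derivative u2 x) (at x within {a..b})" "continuous_on {a..b} u2"
    "u1 a = 0" "u1 b = 0" "AE x in M. wderiv {a<..<b} 2 (v r) x = u2 x"
    "wderiv {a<..<b} 2 (v r) \<in> sobolev 1 p {a<..<b}"
    "AE x in M. wderiv {a<..<b} 1 (wderiv {a<..<b} 2 (v r)) x = U3 (r, x)"
    by (rule goodE[OF r, OF that])
  note u = uu(1,2,3,5,6,7,8,9,10,11)
  have r0: "0 \<le> r" "r \<le> T" using r by (auto simp: good_def)
  have w2m: "wderiv {a<..<b} 2 (v r) \<in> borel_measurable M" using u(10) by (simp add: sobolev_def Lp_space_def)
  have u2m: "u2 \<in> borel_measurable M" using continuous_integrable_MI[OF u(6)] by auto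
  have u1m: "u1 \<in> borel_measurable M" using continuous_integrable_MI[OF u(4)] by auto
  have gi: "integrable M g" using f(1) by (simp add: ac_rep_def)
  have gm: "g \<in> borel_measurable M" using gi by auto
  have fm: "f \<in> borel_measurable M" "u \<in> borel_measurable M"
    using continuous_integrable_MI[OF ac_rep_continuous[OF f(1)]] continuous_integrable_MI[OF ac_rep_continuous[OF u(1)]] by auto
  have fu: "integrable M (\<lambda>x. f x * u2 x)" "integrable M (\<lambda>x. u x * u2 x)"
    using continuous_integrable_MI[OF continuous_on_mult[OF ac_rep_continuous[OF f(1)] u(6)]]
      continuous_integrable_MI[OF continuous_on_mult[OF ac_rep_continuous[OF u(1)] u(6)]] by auto
  have "(\<integral>x. (f x - u x) * u2 x \<partial>M) = - (\<integral>x. (g x - U1 (r, x)) * u1 x \<partial>M)"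
    by (rule ac_rep_by_parts[OF ab ac_rep_minus[OF f(1) u(1)] u(5,6,7,8)])
  also have "(\<integral>x. (g x - U1 (r, x)) * u1 x \<partial>M) = (\<integral>x. (g x - U1 (r, x)) * U1 (r, x) \<partial>M)"
  proof (rule integral_cong_AE)
    show "AE x in M. (g x - U1 (r, x)) * u1 x = (g x - U1 (r, x)) * U1 (r, x)" using u(3) by eventually_elim simp
  qed (use gm u1m U1_sec in measurable)
  finally have 1: "(\<integral>x. (g x - U1 (r, x)) * U1 (r, x) \<partial>M) = - ((\<integral>x. f x * u2 x \<partial>M) - (\<integral>x. u x * u2 x \<partial>M))"
    using fu by (simp add: left_diff_distrib)
  have 2: "(\<integral>x. f x * u2 x \<partial>M) = (\<integral>x. v t x * wderiv {a<..<b} 2 (v r) x \<partial>M)"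
  proof (rule integral_cong_AE)
    show "AE x in M. f x * u2 x = v t x * wderiv {a<..<b} 2 (v r) x" using f(2) u(9) by eventually_elim simp
    show "(\<lambda>x. v t x * wderiv {a<..<b} 2 (v r) x) \<in> borel_measurable M" using v_L2(1)[OF t(1)] w2m by measurable
  qed (use fm u2m in measurable)
  have 3: "(\<integral>x. u x * u2 x \<partial>M) = (\<integral>x. v r x * wderiv {a<..<b} 2 (v r) x \<partial>M)"
  proof (rule integral_cong_AE)
    show "AE x in M. u x * u2 x = v r x * wderiv {a<..<b} 2 (v r) x" using u(2,9) by eventually_elim simp
    show "(\<lambda>x. v r x * wderiv {a<..<b} 2 (v r) x) \<in> borel_measurable M" using v_L2(1)[OF r0(1)] w2m by measurable
  qed (use fm u2m in measurable)
  show ?thesis unfolding 1 2 3 osc_def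
    using good_ce[OF r r0(1) _ t(2)] good_ce[OF r t(1) _ r0(2)] by auto
qed

section \<open>Chain rule for the Dirichlet energy\<close>

definition e :: "real \<Rightarrow> real" where "e t = 1 / 2 * (\<integral>x. (U1 (t, x))\<^sup>2 \<partial>M)"

text \<open>The square is expanded around the gradient at time r, with the remainder kept. Dropping
  the remainder gives the convexity inequality \<open>e_ge\<close>; keeping it gives the Cauchy
  property of gradients in \<open>H1_all\<close>.\<close>

lemma energy_expansion:
  assumes r: "good r" and t: "0 \<le> t" "t \<le> T" and f: "ac_rep a b f g" "AE x in M. v t x = f x" and g2: "integrable M (\<lambda>x. (g x)\<^sup>2)"
  shows "1 / 2 * (\<integral>x. (g x)\<^sup>2 \<partial>M) = e r - osc r t + 1 / 2 * (\<integral>x. (g x - U1 (r, x))\<^sup>2 \<partial>M)"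
    "integrable M (\<lambda>x. (g x - U1 (r, x))\<^sup>2)"
proof -
  have gi: "integrable M g" using f(1) by (simp add: ac_rep_def)
  note U = good_U1_integrable[OF r]
  obtain B where B: "B > 0" "AE x in M. \<bar>U1 (r, x)\<bar> \<le> B" using good_U1_bounded[OF r] by blast
  have c: "integrable M (\<lambda>x. (g x - U1 (r, x)) * U1 (r, x))"
    by (rule AE_bounded_mult_integrable[OF Bochner_Integration.integrable_diff[OF gi U(1)] U1_sec B(2,1)])
  have "(g x - U1 (r, x))\<^sup>2 = (g x)\<^sup>2 - (U1 (r, x))\<^sup>2 - 2 * ((g x - U1 (r, x)) * U1 (r, x))" for x
    by (simp add: power2_eq_square algebra_simps)
  then have eq: "(\<lambda>x. (g x - U1 (r, x))\<^sup>2) = (\<lambda>x. (g x)\<^sup>2 - (U1 (r, x))\<^sup>2 - 2 * ((g x - U1 (r, x)) * U1 (r, x)))" by auto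
  show "integrable M (\<lambda>x. (g x - U1 (r, x))\<^sup>2)" unfolding eq using g2 U c by simp
  have "(\<integral>x. (g x - U1 (r, x))\<^sup>2 \<partial>M) = (\<integral>x. (g x)\<^sup>2 \<partial>M) - (\<integral>x. (U1 (r, x))\<^sup>2 \<partial>M) - 2 * (- osc r t)"
    unfolding eq using g2 U c cross[OF r t f] by simp
  then have "(\<integral>x. (g x - U1 (r, x))\<^sup>2 \<partial>M) = (\<integral>x. (g x)\<^sup>2 \<partial>M) - 2 * e r + 2 * osc r t" by (simp add: e_def)
  then show "1 / 2 * (\<integral>x. (g x)\<^sup>2 \<partial>M) = e r - osc r t + 1 / 2 * (\<integral>x. (g x - U1 (r, x))\<^sup>2 \<partial>M)"
    by linarith
qed

lemma good_ac:
  assumes "good t" obtains u where "ac_rep a b u (\<lambda>x. U1 (t, x))" "AE x in M. v t x = u x"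
proof -
  obtain u u1 u2 where u:
    "ac_rep a b u (\<lambda>x. U1 (t, x))" "AE x in M. v t x = u x"
    "AE x in M. U1 (t, x) = u1 x"
    "\<And>x. x \<in> {a..b} \<Longrightarrow> (u has_real_derivative u1 x) (at x within {a..b})" "continuous_on {a..b} u1"
    "\<And>x. x \<in> {a..b} \<Longrightarrow> (u1 has_real_derivative u2 x) (at x within {a..b})" "continuous_on {a..b} u2"
    "u1 a = 0" "u1 b = 0" "AE x in M. wderiv {a<..<b} 2 (v t) x = u2 x"
    "wderiv {a<..<b} 2 (v t) \<in> sobolev 1 p {a<..<b}"
    "AE x in M. wderiv {a<..<b} 1 (wderiv {a<..<b} 2 (v t)) x = U3 (t, x)"
    by (rule goodE[OF assms, OF that])
  then show thesis by (intro that)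
qed

lemma e_expansion:
  assumes "good r" "good t"
  shows "e t = e r - osc r t + 1 / 2 * (\<integral>x. (U1 (t, x) - U1 (r, x))\<^sup>2 \<partial>M)"
proof -
  obtain u where "ac_rep a b u (\<lambda>x. U1 (t, x))" "AE x in M. v t x = u x" using good_ac[OF assms(2)] by blast
  from energy_expansion(1)[OF assms(1) _ _ this good_U1_integrable(2)[OF assms(2)]] assms(2)
  show ?thesis by (simp add: good_def e_def)
qed

lemma e_ge: "good r \<Longrightarrow> good t \<Longrightarrow> e t \<ge> e r - osc r t"
  using e_expansion[of r t] by (simp add: integral_nonneg_AE)

definition \<beta> :: "real \<Rightarrow> real" where "\<beta> t = (\<integral>\<sigma>. indicator {0<..t} \<sigma> * L.b \<sigma> \<sigma> \<partial>lborel)"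

lemma e_measurable: "e \<in> borel_measurable borel"
proof -
  note [measurable] = U1(1)
  interpret sigma_finite_measure M by (rule sigma_finite_MI)
  have "(\<lambda>t. \<integral>x. (U1 (t, x))\<^sup>2 \<partial>M) \<in> borel_measurable lborel" by measurable
  then show ?thesis unfolding e_def[abs_def] by simp
qed

lemma e_const: "\<exists>c. AE \<tau> in lborel. \<tau> \<in> {0<..<T} \<longrightarrow> e \<tau> + \<beta> \<tau> = c"
  unfolding \<beta>_def
proof (rule L.chain_const[OF AE_good _ _ e_measurable])
  fix r t assume "good r" "good t"
  then show "r < t \<Longrightarrow> - (\<integral>\<sigma>. indicator {r<..t} \<sigma> * L.b r \<sigma> \<partial>lborel) \<le> e t - e r"
    "t < r \<Longrightarrow> (\<integral>\<sigma>. indicator {t<..r} \<sigma> * L.b r \<sigma> \<partial>lborel) \<le> e t - e r"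
    using e_ge[of r t] by (auto simp: osc_def)
qed

text \<open>This is the Dirichlet energy at the initial time: at t = 0 the last part of
  \<open>W_props\<close> has c0 - \<beta> 0 on the right, and \<beta> 0 = 0.\<close>

definition c0 :: real where "c0 = (SOME c. AE \<tau> in lborel. \<tau> \<in> {0<..<T} \<longrightarrow> e \<tau> + \<beta> \<tau> = c)"

lemma c0: "AE \<tau> in lborel. \<tau> \<in> {0<..<T} \<longrightarrow> e \<tau> + \<beta> \<tau> = c0"
  unfolding c0_def by (rule someI_ex[OF e_const])

definition \<Phi> :: "real \<Rightarrow> real" where "\<Phi> r = (\<integral>x. \<bar>U3 (r, x)\<bar> powr p \<partial>M)"
definition \<kappa> :: "real \<Rightarrow> real" where "\<kappa> s = (\<integral>x. \<bar>K (s, x)\<bar> powr q \<partial>M)"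

lemma \<Phi>_integrable: "integrable lborel \<Phi>" and \<kappa>_integrable: "integrable lborel \<kappa>"
  using L.P.integrable_fst'[OF U3(2)] L.P.integrable_fst'[OF K(2)] by (simp_all add: \<Phi>_def[abs_def] \<kappa>_def[abs_def])

lemma \<Phi>_nonneg: "\<Phi> r \<ge> 0" and \<kappa>_nonneg: "\<kappa> r \<ge> 0"
  unfolding \<Phi>_def \<kappa>_def by (auto intro!: integral_nonneg_AE)

text \<open>Young's inequality separates the two times. The term with \<Phi> r is tamed by the
  choice of r in \<open>vanishing_times\<close>; the integral of \<kappa> tends to 0 with the length
  of the interval.\<close>

lemma b_bound:
  assumes "L.good r" "s \<le> t"
  shows "\<bar>\<integral>\<sigma>. indicator {s<..t} \<sigma> * L.b r \<sigma> \<partial>lborel\<bar> \<le> (t - s) * \<Phi> r + (\<integral>\<sigma>. indicator {s<..t} \<sigma> * \<kappa> \<sigma> \<partial>lborel)"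
proof -
  have Fr: "integrable M (\<lambda>x. \<bar>U3 (r, x)\<bar> powr p)" using assms(1) by (simp add: L.good_def)
  have pt: "AE \<sigma> in lborel. \<bar>L.b r \<sigma>\<bar> \<le> \<Phi> r + \<kappa> \<sigma>"
    using L.P.AE_integrable_fst'[OF K(2)] L.P.AE_integrable_fst'[OF L.good_product[OF assms(1)]]
  proof eventually_elim
    case (elim \<sigma>)
    have "\<bar>L.b r \<sigma>\<bar> \<le> (\<integral>x. \<bar>U3 (r, x) * K (\<sigma>, x)\<bar> \<partial>M)" unfolding L.b_def by (rule integral_abs_bound)
    also have "\<dots> \<le> (\<integral>x. \<bar>U3 (r, x)\<bar> powr p + \<bar>K (\<sigma>, x)\<bar> powr q \<partial>M)"
    proof (rule integral_mono)
      show "\<bar>U3 (r, x) * K (\<sigma>, x)\<bar> \<le> \<bar>U3 (r, x)\<bar> powr p + \<bar>K (\<sigma>, x)\<bar> powr q" for x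
        using Young_eps[OF pq, of 1 "\<bar>U3 (r, x)\<bar>" "\<bar>K (\<sigma>, x)\<bar>"] by (simp add: abs_mult)
    qed (use elim Fr in auto)
    also have "\<dots> = \<Phi> r + \<kappa> \<sigma>" using elim Fr by (simp add: \<Phi>_def \<kappa>_def)
    finally show ?case .
  qed
  have bi: "integrable lborel (L.b r)" by (rule L.b_integrable[OF assms(1)])
  have ci: "integrable lborel (\<lambda>\<sigma>. indicator {s<..t} \<sigma> * \<Phi> r)"
    using assms(2) by (intro integrable_mult_left integrable_real_indicator) auto
  have "\<bar>\<integral>\<sigma>. indicator {s<..t} \<sigma> * L.b r \<sigma> \<partial>lborel\<bar> \<le> (\<integral>\<sigma>. \<bar>indicator {s<..t} \<sigma> * L.b r \<sigma>\<bar> \<partial>lborel)"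
    by (rule integral_abs_bound)
  also have "\<dots> \<le> (\<integral>\<sigma>. indicator {s<..t} \<sigma> * \<Phi> r + indicator {s<..t} \<sigma> * \<kappa> \<sigma> \<partial>lborel)"
  proof (rule integral_mono_AE)
    show "integrable lborel (\<lambda>\<sigma>. \<bar>indicator {s<..t} \<sigma> * L.b r \<sigma>\<bar>)" using indicator_integrable_lborel[OF bi] by (rule integrable_abs)
    show "integrable lborel (\<lambda>\<sigma>. indicator {s<..t} \<sigma> * \<Phi> r + indicator {s<..t} \<sigma> * \<kappa> \<sigma>)"
      using ci indicator_integrable_lborel[OF \<kappa>_integrable] by (rule Bochner_Integration.integrable_add)
    show "AE \<sigma> in lborel. \<bar>indicator {s<..t} \<sigma> * L.b r \<sigma>\<bar> \<le> indicator {s<..t} \<sigma> * \<Phi> r + indicator {s<..t} \<sigma> * \<kappa> \<sigma>"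
      using pt by eventually_elim (auto split: split_indicator)
  qed
  also have "\<dots> = (t - s) * \<Phi> r + (\<integral>\<sigma>. indicator {s<..t} \<sigma> * \<kappa> \<sigma> \<partial>lborel)"
    using ci indicator_integrable_lborel[OF \<kappa>_integrable] assms(2) by simp
  finally show ?thesis .
qed

end

text \<open>The continuous representative of v t. It is determined at every point of [a, b] and
  arbitrary outside.\<close>

definition vrep :: "real \<Rightarrow> real \<Rightarrow> (real \<Rightarrow> real \<Rightarrow> real) \<Rightarrow> real \<Rightarrow> real \<Rightarrow> real" where
  "vrep a b v t = (SOME u. ac_rep a b u (wderiv {a<..<b} 1 (v t)) \<and> (AE x in MI a b. v t x = u x))"

text \<open>Arithmetic of the Cauchy estimate in \<open>H1_all\<close>: A and B are Dirichlet
  energies at two times, C is the term \<open>osc\<close>, X the squared distance of the gradients;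
  bi, bj and bt are values of \<beta>.\<close>

lemma Cauchy_arith:
  fixes X :: real
  assumes "A = B - C + 1 / 2 * X" "B + bi = k" "A + bj = k" "C \<le> p" "0 \<le> s"
  shows "X \<le> 2 * (p + \<bar>bi - bt\<bar> + (s + \<bar>bj - bt\<bar>))"
proof -
  have "X = 2 * (A - B + C)" using assms(1) by simp
  also have "A - B = bi - bj" using assms(2,3) by simp
  finally have "X = 2 * ((bi - bt) - (bj - bt) + C)" by simp
  moreover have "(bi - bt) - (bj - bt) + C \<le> p + \<bar>bi - bt\<bar> + (s + \<bar>bj - bt\<bar>)"
    using assms(4,5) by simp
  ultimately show ?thesis by simp
qed

section \<open>Gradient and continuous representative at every time\<close>

context flow begin

abbreviation "W t \<equiv> wderiv {a<..<b} 1 (v t)"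
abbreviation "vc \<equiv> vrep a b v"

lemma osc_bound:
  assumes r: "L.good r" and t: "0 \<le> t" "t \<le> s" "s \<le> r"
  shows "\<bar>osc r s\<bar> \<le> (r - t) * \<Phi> r + (\<integral>\<sigma>. indicator {t<..r} \<sigma> * \<kappa> \<sigma> \<partial>lborel)"
proof -
  have "\<bar>osc r s\<bar> = \<bar>\<integral>\<sigma>. indicator {s<..r} \<sigma> * L.b r \<sigma> \<partial>lborel\<bar>"
    using t by (auto simp: osc_def)
  also have "\<dots> \<le> (r - s) * \<Phi> r + (\<integral>\<sigma>. indicator {s<..r} \<sigma> * \<kappa> \<sigma> \<partial>lborel)" by (rule b_bound[OF r t(3)])
  also have "\<dots> \<le> (r - t) * \<Phi> r + (\<integral>\<sigma>. indicator {t<..r} \<sigma> * \<kappa> \<sigma> \<partial>lborel)"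
  proof (rule add_mono)
    show "(r - s) * \<Phi> r \<le> (r - t) * \<Phi> r" using t \<Phi>_nonneg[of r] by (intro mult_right_mono) auto
    show "(\<integral>\<sigma>. indicator {s<..r} \<sigma> * \<kappa> \<sigma> \<partial>lborel) \<le> (\<integral>\<sigma>. indicator {t<..r} \<sigma> * \<kappa> \<sigma> \<partial>lborel)"
      using t(2) \<kappa>_nonneg by (intro integral_mono indicator_integrable_lborel \<kappa>_integrable) (auto split: split_indicator)
  qed
  finally show ?thesis .
qed

text \<open>The time t itself need not be good, so it is approached from the right by good times at
  which (r - t) \<Phi> r tends to 0. The quadratic remainder in \<open>e_expansion\<close> is then
  small for any two of them, the gradients converge in L_2, and L_2 continuity of v identifies the
  limit as the weak derivative of v t. Strong convergence carries the balance e + \<beta> = c0 over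
  to t.\<close>

lemma H1_all:
  assumes t: "0 \<le> t" "t < T"
  obtains g where "g \<in> borel_measurable M" "integrable M (\<lambda>x. (g x)\<^sup>2)" "has_weak_deriv {a<..<b} 1 (v t) g"
    "1 / 2 * (\<integral>x. (g x)\<^sup>2 \<partial>M) = c0 - \<beta> t"
proof -
  let ?P = "\<lambda>r. good r \<and> L.good r \<and> e r + \<beta> r = c0"
  have AP: "AE r in lborel. r \<in> {0<..<T} \<longrightarrow> ?P r"
    using AE_good c0 L.AE_good by eventually_elim auto
  have "\<exists>r. t < r \<and> r < T \<and> r < t + 1 / real (Suc n) \<and> ?P r \<and> (r - t) * \<Phi> r < 1 / real (Suc n)" for n
    using vanishing_times[OF \<Phi>_integrable \<Phi>_nonneg AP t, of "1 / real (Suc n)" "1 / real (Suc n)"] by auto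
  then obtain r where r: "\<And>n. t < r n" "\<And>n. r n < T" "\<And>n. r n < t + 1 / real (Suc n)" "\<And>n. good (r n)" "\<And>n. L.good (r n)"
    "\<And>n. e (r n) + \<beta> (r n) = c0" "\<And>n. (r n - t) * \<Phi> (r n) < 1 / real (Suc n)" by metis
  have r0: "0 \<le> r n" "r n \<le> T" for n using t r(1,2)[of n] by auto
  have l1: "(\<lambda>n. 1 / real (Suc n)) \<longlonglongrightarrow> 0" by (rule LIMSEQ_Suc[OF lim_1_over_n])
  have rt: "r \<longlonglongrightarrow> t"
  proof (rule tendsto_sandwich[OF _ _ tendsto_const])
    show "(\<lambda>n. t + 1 / real (Suc n)) \<longlonglongrightarrow> t" using tendsto_add[OF tendsto_const l1, of t] by simp
    show "\<forall>\<^sub>F n in sequentially. t \<le> r n" using r(1) by (intro always_eventually allI less_imp_le)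
    show "\<forall>\<^sub>F n in sequentially. r n \<le> t + 1 / real (Suc n)" using r(3) by (intro always_eventually allI less_imp_le)
  qed
  define \<delta> where "\<delta> n = 1 / real (Suc n) + (\<integral>\<sigma>. indicator {t<..r n} \<sigma> * \<kappa> \<sigma> \<partial>lborel) + \<bar>\<beta> (r n) - \<beta> t\<bar>" for n
  have \<beta>r: "(\<lambda>n. \<beta> (r n)) \<longlonglongrightarrow> \<beta> t"
    unfolding \<beta>_def by (rule lborel_primitive_continuous[OF L.diag_integrable rt])
  have "\<delta> \<longlonglongrightarrow> 0 + (\<integral>\<sigma>. indicator {t<..t} \<sigma> * \<kappa> \<sigma> \<partial>lborel) + \<bar>\<beta> t - \<beta> t\<bar>"
    unfolding \<delta>_def[abs_def]
    by (intro tendsto_add l1 tendsto_rabs tendsto_diff \<beta>r tendsto_const lborel_primitive_continuous[OF \<kappa>_integrable rt])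
  then have \<delta>0: "\<delta> \<longlonglongrightarrow> 0" by simp
  have \<delta>nn: "\<delta> n \<ge> 0" for n unfolding \<delta>_def using \<kappa>_nonneg
    by (intro add_nonneg_nonneg integral_nonneg_AE) auto
  \<comment> \<open>The expansion is frozen at the later of the two times: the distance r i - r j is
    then at most r i - t, and the bound on (r i - t) \<Phi> (r i) applies.\<close>
  have half: "(\<integral>x. (U1 (r j, x) - U1 (r i, x))\<^sup>2 \<partial>M) \<le> 2 * (\<delta> i + \<delta> j)" if "r j \<le> r i" for i j
  proof -
    note ex = e_expansion[OF r(4,4), of j i]
    have 1: "osc (r i) (r j) \<le> 1 / real (Suc i) + (\<integral>\<sigma>. indicator {t<..r i} \<sigma> * \<kappa> \<sigma> \<partial>lborel)"
    proof -
      have "osc (r i) (r j) \<le> \<bar>osc (r i) (r j)\<bar>" by simp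
      also have "\<dots> \<le> (r i - t) * \<Phi> (r i) + (\<integral>\<sigma>. indicator {t<..r i} \<sigma> * \<kappa> \<sigma> \<partial>lborel)"
        by (rule osc_bound[OF r(5) t(1) less_imp_le[OF r(1)] that])
      finally show ?thesis using less_imp_le[OF r(7)[of i]] by (meson add_right_mono order_trans)
    qed
    have 2: "0 \<le> 1 / real (Suc j) + (\<integral>\<sigma>. indicator {t<..r j} \<sigma> * \<kappa> \<sigma> \<partial>lborel)"
      using \<kappa>_nonneg by (intro add_nonneg_nonneg integral_nonneg_AE) auto
    show ?thesis unfolding \<delta>_def by (rule Cauchy_arith[OF ex r(6) r(6) 1 2])
  qed
  have sym: "(\<integral>x. (U1 (r j, x) - U1 (r i, x))\<^sup>2 \<partial>M) \<le> 2 * (\<delta> i + \<delta> j)" for i j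
  proof (cases "r j \<le> r i")
    case False
    then have "(\<integral>x. (U1 (r i, x) - U1 (r j, x))\<^sup>2 \<partial>M) \<le> 2 * (\<delta> j + \<delta> i)" by (intro half) simp
    then show ?thesis by (simp add: power2_commute add.commute)
  qed (rule half)
  have "\<exists>N. \<forall>i\<ge>N. \<forall>j\<ge>N. (\<integral>x. (U1 (r i, x) - U1 (r j, x))\<^sup>2 \<partial>M) < ep" if ep: "ep > 0" for ep
  proof -
    have "\<forall>\<^sub>F n in sequentially. \<delta> n < ep / 4" using \<delta>0 ep by (intro order_tendstoD(2)) auto
    then obtain N where N: "\<And>n. n \<ge> N \<Longrightarrow> \<delta> n < ep / 4" unfolding eventually_sequentially by blast
    show ?thesis
    proof (intro exI[of _ N] allI impI)
      fix i j assume "i \<ge> N" "j \<ge> N"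
      then have "2 * (\<delta> j + \<delta> i) < ep" using N[of i] N[of j] by simp
      then show "(\<integral>x. (U1 (r i, x) - U1 (r j, x))\<^sup>2 \<partial>M) < ep" by (rule le_less_trans[OF sym])
    qed
  qed
  from L2_complete[OF finite_MI U1_sec good_U1_integrable(2)[OF r(4)] this]
  obtain g where g: "g \<in> borel_measurable M" "integrable M (\<lambda>x. (g x)\<^sup>2)" "(\<lambda>n. \<integral>x. (U1 (r n, x) - g x)\<^sup>2 \<partial>M) \<longlonglongrightarrow> 0" by blast
  have en1: "(\<lambda>n. 1 / 2 * (\<integral>x. (U1 (r n, x))\<^sup>2 \<partial>M)) \<longlonglongrightarrow> 1 / 2 * (\<integral>x. (g x)\<^sup>2 \<partial>M)"
    by (intro tendsto_mult tendsto_const L2_norm_conv[OF U1_sec good_U1_integrable(2)[OF r(4)] g])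
  have en2: "1 / 2 * (\<integral>x. (U1 (r n, x))\<^sup>2 \<partial>M) = c0 - \<beta> (r n)" for n
    using r(6)[of n] unfolding e_def by (rule eq_diff_eq[THEN iffD2])
  have en3: "(\<lambda>n. c0 - \<beta> (r n)) \<longlonglongrightarrow> c0 - \<beta> t" by (intro tendsto_diff tendsto_const \<beta>r)
  have en: "1 / 2 * (\<integral>x. (g x)\<^sup>2 \<partial>M) = c0 - \<beta> t"
    by (rule LIMSEQ_unique[OF en1[unfolded en2] en3])
  have gi: "integrable M g"
  proof (rule Bochner_Integration.integrable_bound)
    show "integrable M (\<lambda>x. 1 + (g x)\<^sup>2)" using g(2) finite_MI[of a b] by (simp add: finite_measure.integrable_const)
    show "AE x in M. norm (g x) \<le> norm (1 + (g x)\<^sup>2)"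
    proof (rule AE_I2)
      fix x
      have "0 \<le> (\<bar>g x\<bar> - 1/2)\<^sup>2" by simp
      moreover have "(1 / 2 :: real)\<^sup>2 \<le> 1" by (simp add: power_divide)
      ultimately have "\<bar>g x\<bar> \<le> 1 + \<bar>g x\<bar>\<^sup>2" unfolding power2_diff by simp
      then show "norm (g x) \<le> norm (1 + (g x)\<^sup>2)" by simp
    qed
  qed (rule g(1))
  have d2: "integrable M (\<lambda>x. (U1 (r n, x) - g x)\<^sup>2)" for n
  proof (rule Bochner_Integration.integrable_bound)
    show "integrable M (\<lambda>x. 2 * (U1 (r n, x))\<^sup>2 + 2 * (g x)\<^sup>2)" using good_U1_integrable(2)[OF r(4)] g(2) by simp
    have "(u - w)\<^sup>2 \<le> 2 * u\<^sup>2 + 2 * w\<^sup>2" for u w :: real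
      using zero_le_power2[of "u + w"] by (simp add: power2_eq_square algebra_simps)
    then show "AE x in M. norm ((U1 (r n, x) - g x)\<^sup>2) \<le> norm (2 * (U1 (r n, x))\<^sup>2 + 2 * (g x)\<^sup>2)" by (intro AE_I2) simp
    show "(\<lambda>x. (U1 (r n, x) - g x)\<^sup>2) \<in> borel_measurable M" using U1_sec[of "r n"] g(1) by measurable
  qed
  have L1: "(\<lambda>n. \<integral>x. \<bar>U1 (r n, x) - g x\<bar> \<partial>M) \<longlonglongrightarrow> 0"
  proof (rule Lp_to_L1[OF finite_MI, of 2])
    show "(\<lambda>x. U1 (r n, x) - g x) \<in> borel_measurable M" for n using U1_sec[of "r n"] g(1) by measurable
    show "integrable M (\<lambda>x. \<bar>U1 (r n, x) - g x\<bar> powr 2)" for n using d2 by simp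
    show "(\<lambda>n. \<integral>x. \<bar>U1 (r n, x) - g x\<bar> powr 2 \<partial>M) \<longlonglongrightarrow> 0" using g(3) by simp
  qed simp
  have "has_weak_deriv {a<..<b} 1 (v t) g"
    unfolding has_weak_deriv_def
  proof (intro conjI allI impI locally_integrable_MI gi v_L2(2)[OF t(1)])
    fix \<phi> assume \<phi>: "test_fun {a<..<b} \<phi>"
    obtain B where B: "\<And>x. \<bar>\<phi> x\<bar> \<le> B" "B > 0" using test_fun_bounded[OF \<phi>] by blast
    obtain B' where B': "\<And>x. \<bar>deriv \<phi> x\<bar> \<le> B'" "B' > 0" using test_fun_bounded[OF test_fun_deriv[OF \<phi>]] by blast
    have \<phi>m: "\<phi> \<in> borel_measurable M" and \<phi>m': "deriv \<phi> \<in> borel_measurable M"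
      using continuous_integrable_MI[OF test_fun_continuous[OF \<phi>]] continuous_integrable_MI[OF test_fun_continuous[OF test_fun_deriv[OF \<phi>]]] by auto
    have lhs: "(\<lambda>n. \<integral>x. v (r n) x * deriv \<phi> x \<partial>M) \<longlonglongrightarrow> (\<integral>x. v t x * deriv \<phi> x \<partial>M)"
      by (rule L2_continuous_pairing(1)[OF L2 B'(2) _ \<phi>m' rt r0(1) t(1)]) (use B' in auto)
    have eqn: "(\<integral>x. v (r n) x * deriv \<phi> x \<partial>M) = - (\<integral>x. U1 (r n, x) * \<phi> x \<partial>M)" for n
    proof -
      obtain u where u: "ac_rep a b u (\<lambda>x. U1 (r n, x))" "AE x in M. v (r n) x = u x" using good_ac[OF r(4)] by blast
      have um: "u \<in> borel_measurable M" using continuous_integrable_MI[OF ac_rep_continuous[OF u(1)]] by auto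
      have "(\<integral>x. v (r n) x * deriv \<phi> x \<partial>M) = (\<integral>x. u x * deriv \<phi> x \<partial>M)"
      proof (rule integral_cong_AE)
        show "AE x in M. v (r n) x * deriv \<phi> x = u x * deriv \<phi> x" using u(2) by eventually_elim simp
      qed (use um \<phi>m' v_L2(1)[OF r0(1)] in measurable)
      then show ?thesis using ac_rep_has_weak_deriv[OF ab u(1)] \<phi> unfolding has_weak_deriv_def LINT_MI by simp
    qed
    have gphi: "integrable M (\<lambda>x. g x * \<phi> x)" by (rule AE_bounded_mult_integrable[OF gi \<phi>m _ B(2)]) (use B in auto)
    have uphi: "integrable M (\<lambda>x. U1 (r n, x) * \<phi> x)" for n
      by (rule AE_bounded_mult_integrable[OF good_U1_integrable(1)[OF r(4)] \<phi>m _ B(2)]) (use B in auto)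
    have "(\<lambda>n. B * (\<integral>x. \<bar>U1 (r n, x) - g x\<bar> \<partial>M)) \<longlonglongrightarrow> B * 0" by (intro tendsto_mult tendsto_const L1)
    then have BL: "(\<lambda>n. B * (\<integral>x. \<bar>U1 (r n, x) - g x\<bar> \<partial>M)) \<longlonglongrightarrow> 0" by simp
    have "(\<lambda>n. (\<integral>x. U1 (r n, x) * \<phi> x \<partial>M) - (\<integral>x. g x * \<phi> x \<partial>M)) \<longlonglongrightarrow> 0"
    proof (rule Lim_null_comparison[OF _ BL], intro always_eventually allI)
      fix n
      have di: "integrable M (\<lambda>x. U1 (r n, x) - g x)" using good_U1_integrable(1)[OF r(4)] gi by simp
      have di2: "integrable M (\<lambda>x. (U1 (r n, x) - g x) * \<phi> x)"
        by (rule AE_bounded_mult_integrable[OF di \<phi>m _ B(2)]) (use B in auto)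
      have "(\<integral>x. U1 (r n, x) * \<phi> x \<partial>M) - (\<integral>x. g x * \<phi> x \<partial>M) = (\<integral>x. (U1 (r n, x) - g x) * \<phi> x \<partial>M)"
        using gphi uphi by (simp add: left_diff_distrib)
      then have "norm ((\<integral>x. U1 (r n, x) * \<phi> x \<partial>M) - (\<integral>x. g x * \<phi> x \<partial>M)) \<le> (\<integral>x. \<bar>(U1 (r n, x) - g x) * \<phi> x\<bar> \<partial>M)"
        using integral_abs_bound[of M "\<lambda>x. (U1 (r n, x) - g x) * \<phi> x"] by simp
      also have "\<dots> \<le> (\<integral>x. B * \<bar>U1 (r n, x) - g x\<bar> \<partial>M)"
      proof (rule integral_mono)
        show "\<bar>(U1 (r n, x) - g x) * \<phi> x\<bar> \<le> B * \<bar>U1 (r n, x) - g x\<bar>" for x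
          using B(1)[of x] by (simp add: abs_mult mult.commute mult_right_mono)
      qed (use di di2 in auto)
      finally show "norm ((\<integral>x. U1 (r n, x) * \<phi> x \<partial>M) - (\<integral>x. g x * \<phi> x \<partial>M)) \<le> B * (\<integral>x. \<bar>U1 (r n, x) - g x\<bar> \<partial>M)" by simp
    qed
    then have "(\<lambda>n. \<integral>x. U1 (r n, x) * \<phi> x \<partial>M) \<longlonglongrightarrow> (\<integral>x. g x * \<phi> x \<partial>M)" by (rule LIM_zero_cancel)
    then have "(\<lambda>n. \<integral>x. v (r n) x * deriv \<phi> x \<partial>M) \<longlonglongrightarrow> - (\<integral>x. g x * \<phi> x \<partial>M)"
      unfolding eqn by (rule tendsto_minus)
    with lhs have "(\<integral>x. v t x * deriv \<phi> x \<partial>M) = - (\<integral>x. g x * \<phi> x \<partial>M)" by (rule LIMSEQ_unique)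
    then show "(LINT x:{a<..<b}|lebesgue. v t x * (deriv ^^ 1) \<phi> x) = (- 1) ^ 1 * (LINT x:{a<..<b}|lebesgue. g x * \<phi> x)"
      unfolding LINT_MI by simp
  qed
  with g(1,2) en show thesis by (intro that)
qed

lemma W_props:
  assumes t: "0 \<le> t" "t < T"
  shows "has_weak_deriv {a<..<b} 1 (v t) (W t)" "W t \<in> borel_measurable M" "integrable M (\<lambda>x. (W t x)\<^sup>2)" "integrable M (W t)"
    "1 / 2 * (\<integral>x. (W t x)\<^sup>2 \<partial>M) = c0 - \<beta> t"
proof -
  obtain g where g: "g \<in> borel_measurable M" "integrable M (\<lambda>x. (g x)\<^sup>2)" "has_weak_deriv {a<..<b} 1 (v t) g"
    "1 / 2 * (\<integral>x. (g x)\<^sup>2 \<partial>M) = c0 - \<beta> t" using H1_all[OF t] by blast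
  show w: "has_weak_deriv {a<..<b} 1 (v t) (W t)" by (rule wderiv_has[OF g(3)])
  then show m: "W t \<in> borel_measurable M"
    by (auto intro!: locally_integrable_measurable simp: has_weak_deriv_def)
  have ae: "AE x in M. W t x = g x" unfolding AE_MI using wderiv_AE[OF _ g(3)] by simp
  then have ae2: "AE x in M. (g x)\<^sup>2 = (W t x)\<^sup>2" by eventually_elim simp
  have m2: "(\<lambda>x. (W t x)\<^sup>2) \<in> borel_measurable M" using m by measurable
  show i2: "integrable M (\<lambda>x. (W t x)\<^sup>2)" by (rule integrable_cong_AE_imp[OF g(2) m2 ae2])
  have "(\<integral>x. (g x)\<^sup>2 \<partial>M) = (\<integral>x. (W t x)\<^sup>2 \<partial>M)" by (rule integral_cong_AE[OF _ m2 ae2]) (use g in auto)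
  then show "1 / 2 * (\<integral>x. (W t x)\<^sup>2 \<partial>M) = c0 - \<beta> t" using g(4) by simp
  have "integrable M (\<lambda>x. \<bar>W t x\<bar> powr 2)" using i2 by simp
  from finite_measure.integrable_of_powr[OF finite_MI _ m this] show "integrable M (W t)" by simp
qed

lemma vc_props:
  assumes t: "0 \<le> t" "t < T"
  shows "ac_rep a b (vc t) (W t)" "AE x in M. v t x = vc t x"
proof -
  obtain u where "ac_rep a b u (W t)" "AE x in M. v t x = u x"
    using weak_deriv_ac_rep[OF ab W_props(1)[OF t] v_L2(2)[OF t(1)] W_props(4)[OF t]] by blast
  then have "\<exists>u. ac_rep a b u (W t) \<and> (AE x in M. v t x = u x)" by blast
  from someI_ex[OF this] show "ac_rep a b (vc t) (W t)" "AE x in M. v t x = vc t x"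
    unfolding vrep_def by blast+
qed

text \<open>One constant for all t in [0, T), from a bound on c0 - \<beta> t. The extra 1 pays for
  the term l/2 in \<open>vc_Hoelder\<close>.\<close>

definition Hoe :: real where "Hoe = 1 + \<bar>c0\<bar> + (\<integral>\<sigma>. \<bar>L.b \<sigma> \<sigma>\<bar> \<partial>lborel)"

lemma Hoe_pos: "Hoe \<ge> 1"
  unfolding Hoe_def by (simp add: add_nonneg_nonneg integral_nonneg_AE)

lemma W2_bound: "0 \<le> t \<Longrightarrow> t < T \<Longrightarrow> 1 / 2 * (\<integral>x. (W t x)\<^sup>2 \<partial>M) \<le> Hoe - 1"
proof -
  assume t: "0 \<le> t" "t < T"
  have i: "integrable lborel (\<lambda>\<sigma>. \<bar>L.b \<sigma> \<sigma>\<bar>)" using L.diag_integrable by (rule integrable_abs)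
  have "\<bar>\<beta> t\<bar> \<le> (\<integral>\<sigma>. \<bar>indicator {0<..t} \<sigma> * L.b \<sigma> \<sigma>\<bar> \<partial>lborel)" unfolding \<beta>_def by (rule integral_abs_bound)
  also have "\<dots> \<le> (\<integral>\<sigma>. \<bar>L.b \<sigma> \<sigma>\<bar> \<partial>lborel)"
    using indicator_integrable_lborel[OF L.diag_integrable] i L.diag_integrable
    by (intro integral_mono integrable_abs) (auto split: split_indicator)
  finally show ?thesis using W_props(5)[OF t] by (simp add: Hoe_def)
qed

text \<open>With l the root of y - x, |W| \<le> 1/(2l) + l W^2 / 2. Integration over (x, y] gives
  l/2 plus at most l times the Dirichlet energy, so no root of the energy appears.\<close>

lemma vc_Hoelder:
  assumes t: "0 \<le> t" "t < T" and xy: "x \<in> {a..b}" "y \<in> {a..b}"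
  shows "\<bar>vc t y - vc t x\<bar> \<le> Hoe * sqrt \<bar>y - x\<bar>"
proof -
  have main: "\<bar>vc t y - vc t x\<bar> \<le> Hoe * sqrt (y - x)" if xy: "x \<in> {a..b}" "y \<in> {a..b}" "x < y" for x y
  proof -
    define l where "l = sqrt (y - x)"
    have l: "l > 0" "l\<^sup>2 = y - x" using xy by (auto simp: l_def)
    have W1: "integrable M (\<lambda>z. indicator {x<..y} z * W t z)" by (rule integrable_MI_indicator[OF W_props(4)[OF t]]) simp
    have W2: "integrable M (\<lambda>z. (W t z)\<^sup>2)" by (rule W_props(3)[OF t])
    have one: "integrable M (\<lambda>z. indicator {x<..y} z * (1 / (2 * l)))"
      by (rule integrable_MI_indicator) (simp_all add: finite_measure.integrable_const[OF finite_MI])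
    have "vc t y - vc t x = (\<integral>z. indicator {x<..y} z * W t z \<partial>M)"
      by (rule ac_rep_diff[OF vc_props(1)[OF t] xy(1,2)]) (use xy in simp)
    then have "\<bar>vc t y - vc t x\<bar> \<le> (\<integral>z. \<bar>indicator {x<..y} z * W t z\<bar> \<partial>M)" by (simp add: integral_abs_bound)
    also have "\<dots> \<le> (\<integral>z. indicator {x<..y} z * (1 / (2 * l)) + l / 2 * (W t z)\<^sup>2 \<partial>M)"
    proof (rule integral_mono)
      show "integrable M (\<lambda>z. \<bar>indicator {x<..y} z * W t z\<bar>)" using W1 by (rule integrable_abs)
      show "integrable M (\<lambda>z. indicator {x<..y} z * (1 / (2 * l)) + l / 2 * (W t z)\<^sup>2)" using one W2 by simp
      fix z
      have "0 \<le> (l * \<bar>W t z\<bar> - 1)\<^sup>2" by simp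
      then have "2 * (l * \<bar>W t z\<bar>) \<le> 1 + l\<^sup>2 * (W t z)\<^sup>2" by (simp add: power2_diff power_mult_distrib)
      then have "2 * l * \<bar>W t z\<bar> \<le> 2 * l * (1 / (2 * l) + l / 2 * (W t z)\<^sup>2)"
        using l(1) by (simp add: distrib_left power2_eq_square)
      then have "\<bar>W t z\<bar> \<le> 1 / (2 * l) + l / 2 * (W t z)\<^sup>2" using l(1) by (simp only: mult_le_cancel_left_pos[of "2 * l"])
      moreover have "0 \<le> l / 2 * (W t z)\<^sup>2" using l by simp
      ultimately show "\<bar>indicator {x<..y} z * W t z\<bar> \<le> indicator {x<..y} z * (1 / (2 * l)) + l / 2 * (W t z)\<^sup>2"
        by (auto simp: abs_mult split: split_indicator)
    qed
    also have "\<dots> = (\<integral>z. indicator {x<..y} z * (1 / (2 * l)) \<partial>M) + l * (1 / 2 * (\<integral>z. (W t z)\<^sup>2 \<partial>M))"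
      using one W2 by simp
    also have "(\<integral>z. indicator {x<..y} z * (1 / (2 * l)) \<partial>M) = (\<integral>z. indicator {x..y} z * (1 / (2 * l)) \<partial>M)"
    proof (rule integral_cong_AE)
      have "AE z in lebesgue. z \<noteq> x" by (intro AE_completion AE_lborel_singleton)
      then have "AE z in M. z \<noteq> x" unfolding AE_MI by eventually_elim simp
      then show "AE z in M. indicat_real {x<..y} z * (1 / (2 * l)) = indicat_real {x..y} z * (1 / (2 * l))"
        by eventually_elim (auto split: split_indicator)
      show "(\<lambda>z. indicat_real {x<..y} z * (1 / (2 * l))) \<in> borel_measurable M" "(\<lambda>z. indicat_real {x..y} z * (1 / (2 * l))) \<in> borel_measurable M"
        by (intro borel_measurable_MI; simp)+
    qed
    also have "(\<integral>z. indicator {x..y} z * (1 / (2 * l)) \<partial>M) = (1 / (2 * l)) * y - (1 / (2 * l)) * x"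
      using xy l(1) by (intro MI_FTC[where \<phi> = "\<lambda>z. (1 / (2 * l)) * z"]) (auto intro!: derivative_eq_intros)
    also have "\<dots> = l\<^sup>2 / (2 * l)" unfolding l(2) by (simp add: diff_divide_distrib)
    also have "\<dots> = l / 2" using l(1) by (simp add: power2_eq_square)
    also have "l / 2 + l * (1 / 2 * (\<integral>z. (W t z)\<^sup>2 \<partial>M)) \<le> l + l * (Hoe - 1)"
      using l(1) W2_bound[OF t] by (intro add_mono mult_left_mono) auto
    also have "\<dots> = Hoe * l" by (simp add: algebra_simps)
    finally show ?thesis by (simp add: l_def)
  qed
  show ?thesis
  proof (cases x y rule: linorder_cases)
    case less then show ?thesis using main[OF xy less] by simp
  next
    case greater
    then show ?thesis using main[OF xy(2,1) greater] by (simp add: abs_minus_commute)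
  qed simp
qed

text \<open>The L_1 distance tends to 0, and all slices share one Hoelder constant. A deviation
  \<epsilon> at one point would persist as \<epsilon>/2 on an interval of length l and make the L_1
  distance at least l \<epsilon>/2.\<close>

lemma vc_time_uniform:
  assumes X: "X \<longlonglongrightarrow> t" "\<And>n. X n \<in> {0..<T}" and t: "t \<in> {0..<T}" and ep: "\<epsilon> > 0"
  shows "\<forall>\<^sub>F n in sequentially. \<forall>x\<in>{a..b}. \<bar>vc (X n) x - vc t x\<bar> < \<epsilon>"
proof -
  \<comment> \<open>The first bound lets an interval of length l fit into [a, b] on one side of any
    point; the second makes the two Hoelder increments over l add up to at most
    \<epsilon>/2.\<close>
  define l where "l = min ((b - a) / 2) ((\<epsilon> / (4 * Hoe))\<^sup>2)"
  have H: "Hoe > 0" using Hoe_pos by simp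
  have l: "l > 0" "l \<le> (b - a) / 2" "sqrt l \<le> \<epsilon> / (4 * Hoe)"
  proof -
    show "l > 0" using ab ep H by (simp add: l_def)
    show "l \<le> (b - a) / 2" unfolding l_def by (rule min.cobounded1)
    have "sqrt l \<le> sqrt ((\<epsilon> / (4 * Hoe))\<^sup>2)" by (rule real_sqrt_le_mono) (simp add: l_def)
    then show "sqrt l \<le> \<epsilon> / (4 * Hoe)" using ep H by simp
  qed
  have HL: "2 * Hoe * sqrt l \<le> \<epsilon> / 2" using l(3) H by (simp add: field_simps)
  have "(\<lambda>n. \<integral>x. \<bar>v (X n) x - v t x\<bar> \<partial>M) \<longlonglongrightarrow> 0"
  proof (rule L2_continuous_pairing(2)[OF L2, of 1 "\<lambda>_. 0"])
    show "0 \<le> X n" for n using X(2)[of n] by simp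
    show "0 \<le> t" using t by simp
  qed (use X(1) in auto)
  then have "\<forall>\<^sub>F n in sequentially. (\<integral>x. \<bar>v (X n) x - v t x\<bar> \<partial>M) < \<epsilon> / 2 * l"
    using ep l(1) by (intro order_tendstoD(2)) auto
  then show ?thesis
  proof eventually_elim
    case (elim n)
    have tn: "0 \<le> X n" "X n < T" "0 \<le> t" "t < T" using X(2)[of n] t by auto
    let ?D = "\<lambda>x. vc (X n) x - vc t x"
    have Dc: "continuous_on {a..b} ?D"
      by (intro continuous_intros ac_rep_continuous[OF vc_props(1)] tn)
    have "(\<integral>x. \<bar>v (X n) x - v t x\<bar> \<partial>M) = (\<integral>x. \<bar>?D x\<bar> \<partial>M)"
    proof (rule integral_cong_AE)
      show "AE x in M. \<bar>v (X n) x - v t x\<bar> = \<bar>?D x\<bar>"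
        using vc_props(2)[OF tn(1,2)] vc_props(2)[OF tn(3,4)] by eventually_elim simp
      show "(\<lambda>x. \<bar>v (X n) x - v t x\<bar>) \<in> borel_measurable M" using v_L2(1)[OF tn(1)] v_L2(1)[OF tn(3)] by measurable
      show "(\<lambda>x. \<bar>?D x\<bar>) \<in> borel_measurable M" using continuous_integrable_MI[OF Dc] by auto
    qed
    then have sm: "(\<integral>x. \<bar>?D x\<bar> \<partial>M) < \<epsilon> / 2 * l" using elim by simp
    show "\<forall>x\<in>{a..b}. \<bar>?D x\<bar> < \<epsilon>"
    proof (rule ccontr)
      assume "\<not> ?thesis"
      then obtain x0 where x0: "x0 \<in> {a..b}" "\<bar>?D x0\<bar> \<ge> \<epsilon>" by force
      obtain y where y: "a \<le> y" "y + l \<le> b" "\<And>z. z \<in> {y..y+l} \<Longrightarrow> \<bar>z - x0\<bar> \<le> l"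
      proof (cases "x0 \<le> (a + b) / 2")
        case True
        then have "x0 + l \<le> b" using l(2) by (simp add: field_simps)
        then show thesis using x0 by (intro that[of x0]) auto
      next
        case False
        then have "a \<le> x0 - l" using l(2) by (simp add: field_simps)
        then show thesis using x0 by (intro that[of "x0 - l"]) auto
      qed
      have big: "\<bar>?D z\<bar> \<ge> \<epsilon> / 2" if z: "z \<in> {y..y+l}" for z
      proof -
        have zab: "z \<in> {a..b}" using z y by auto
        have sq: "sqrt \<bar>z - x0\<bar> \<le> sqrt l" using y(3)[OF z] by (rule real_sqrt_le_mono)
        have "\<bar>vc (X n) z - vc (X n) x0\<bar> \<le> Hoe * sqrt l" "\<bar>vc t z - vc t x0\<bar> \<le> Hoe * sqrt l"
          using H by (auto intro!: order_trans[OF vc_Hoelder[OF _ _ x0(1) zab] mult_left_mono[OF sq]] tn)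
        then show ?thesis using x0(2) HL by linarith
      qed
      have Di: "integrable M (\<lambda>x. \<bar>?D x\<bar>)" using continuous_integrable_MI[OF Dc] by simp
      have i1: "(\<integral>x. indicator {y..y+l} x * (\<epsilon> / 2) \<partial>M) = (\<epsilon> / 2) * (y + l) - (\<epsilon> / 2) * y"
        using y l(1) by (intro MI_FTC[where \<phi> = "\<lambda>z. (\<epsilon> / 2) * z"]) (auto intro!: derivative_eq_intros)
      have i2: "(\<integral>x. indicator {y..y+l} x * (\<epsilon> / 2) \<partial>M) \<le> (\<integral>x. \<bar>?D x\<bar> \<partial>M)"
      proof (rule integral_mono[OF _ Di])
        show "integrable M (\<lambda>x. indicator {y..y+l} x * (\<epsilon> / 2))"
          by (rule integrable_MI_indicator) (simp_all add: finite_measure.integrable_const[OF finite_MI])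
        show "indicator {y..y+l} x * (\<epsilon> / 2) \<le> \<bar>?D x\<bar>" for x using big[of x] by (auto split: split_indicator)
      qed
      have i3: "(\<epsilon> / 2) * (y + l) - (\<epsilon> / 2) * y = \<epsilon> / 2 * l" by (simp add: distrib_left)
      show False using leD[OF i2[unfolded i1 i3]] sm by (rule notE)
    qed
  qed
qed

text \<open>Uniform convergence in x along a sequence of times is combined with continuity of the
  limiting slice. The initial time is included, which lets positivity start there.\<close>

lemma vc_continuous: "continuous_on ({0..<T} \<times> {a..b}) (\<lambda>z. vc (fst z) (snd z))"
  unfolding continuous_on_sequentially comp_def
proof (intro ballI allI impI)
  fix Z :: "nat \<Rightarrow> real \<times> real" and z assume z: "z \<in> {0..<T} \<times> {a..b}" and Z: "(\<forall>n. Z n \<in> {0..<T} \<times> {a..b}) \<and> Z \<longlonglongrightarrow> z"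
  define X where "X n = fst (Z n)" for n
  define Y where "Y n = snd (Z n)" for n
  have Zl: "Z \<longlonglongrightarrow> z" using Z by blast
  have X: "X \<longlonglongrightarrow> fst z" "\<And>n. X n \<in> {0..<T}"
    using tendsto_fst[OF Zl] Z by (auto simp: X_def[abs_def] mem_Times_iff)
  have Y: "Y \<longlonglongrightarrow> snd z" "\<And>n. Y n \<in> {a..b}"
    using tendsto_snd[OF Zl] Z by (auto simp: Y_def[abs_def] mem_Times_iff)
  have z': "fst z \<in> {0..<T}" "snd z \<in> {a..b}" using z by (auto simp: mem_Times_iff)
  have "(\<lambda>n. vc (fst z) (Y n)) \<longlonglongrightarrow> vc (fst z) (snd z)"
    using ac_rep_continuous[OF vc_props(1), of "fst z"] z' Y unfolding continuous_on_sequentially comp_def by auto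
  moreover have "(\<lambda>n. vc (X n) (Y n) - vc (fst z) (Y n)) \<longlonglongrightarrow> 0"
  proof (rule LIMSEQ_I)
    fix r :: real assume "r > 0"
    from vc_time_uniform[OF X z'(1) this] obtain N where "\<And>n x. n \<ge> N \<Longrightarrow> x \<in> {a..b} \<Longrightarrow> \<bar>vc (X n) x - vc (fst z) x\<bar> < r"
      unfolding eventually_sequentially by blast
    then show "\<exists>no. \<forall>n\<ge>no. norm (vc (X n) (Y n) - vc (fst z) (Y n) - 0) < r" using Y(2) by auto
  qed
  ultimately have "(\<lambda>n. (vc (X n) (Y n) - vc (fst z) (Y n)) + vc (fst z) (Y n)) \<longlonglongrightarrow> 0 + vc (fst z) (snd z)"
    by (intro tendsto_add)
  then show "(\<lambda>n. vc (fst (Z n)) (snd (Z n))) \<longlonglongrightarrow> vc (fst z) (snd z)" by (simp add: X_def Y_def)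
qed

end

section \<open>Energy identity for positive functions\<close>

lemma C1_ac_rep:
  assumes f: "\<And>x. x \<in> {a..b} \<Longrightarrow> (f has_real_derivative f' x) (at x within {a..b})" and f': "continuous_on {a..b} f'"
  shows "ac_rep a b f f'"
  unfolding ac_rep_def
proof (intro conjI exI[of _ "f a"] ballI)
  show "integrable (MI a b) f'" by (rule continuous_integrable_MI[OF f'])
  fix x assume x: "x \<in> {a..b}"
  have "prim a b f' x = (\<integral>z. indicator {a..x} z * f' z \<partial>MI a b)" unfolding prim_def
    by (rule Bochner_Integration.integral_cong) (auto simp: space_MI split: split_indicator)
  also have "\<dots> = f x - f a" by (rule MI_FTC[OF f f']) (use x in auto)
  finally show "f x = f a + prim a b f' x" by simp
qed

lemma continuous_powr_integrable:
  assumes f: "continuous_on {a..b} (f :: real \<Rightarrow> real)" and p: "p > 0"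
  shows "integrable (MI a b) (\<lambda>x. \<bar>f x\<bar> powr p)"
proof -
  obtain B where B: "B > 0" "\<And>x. x \<in> {a..b} \<Longrightarrow> \<bar>f x\<bar> \<le> B" using continuous_bounded_Icc[OF f] by blast
  have m: "f \<in> borel_measurable (MI a b)" using continuous_integrable_MI[OF f] by auto
  show ?thesis
  proof (rule finite_measure.integrable_const_bound[OF finite_MI, of _ "B powr p"])
    show "AE x in MI a b. norm (\<bar>f x\<bar> powr p) \<le> B powr p"
      using B p by (intro AE_I2) (auto simp: space_MI intro!: powr_mono2)
    show "(\<lambda>x. \<bar>f x\<bar> powr p) \<in> borel_measurable (MI a b)" using m by measurable
  qed
qed

lemma space_pair_MI: "space (lborel \<Otimes>\<^sub>M MI a b) = UNIV \<times> {a<..<b}"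
  by (simp add: space_pair_measure space_MI)

lemma rect_measurable:
  fixes g :: "real \<times> real \<Rightarrow> real"
  assumes g: "continuous_on ({s..t} \<times> {a..b}) g"
  shows "(\<lambda>z. indicator {s..t} (fst z) * g z) \<in> borel_measurable (lborel \<Otimes>\<^sub>M MI a b)"
proof -
  have "closed ({s..t} \<times> {a..b})" by (intro closed_Times) auto
  then have "({s..t} \<times> {a..b}) \<in> sets borel" by (rule borel_closed)
  from borel_measurable_continuous_on_indicator[OF this g]
  have "(\<lambda>z. indicator ({s..t} \<times> {a..b}) z *\<^sub>R g z) \<in> borel_measurable borel" by simp
  from measurable_compose[OF id_lborel_MI_measurable this]
  have "(\<lambda>z. indicator ({s..t} \<times> {a..b}) z *\<^sub>R g z) \<in> borel_measurable (lborel \<Otimes>\<^sub>M MI a b)" .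
  then show ?thesis
    by (rule measurable_cong[THEN iffD1, rotated]) (auto simp: space_pair_MI indicator_def)
qed

text \<open>The function h stands for the finite part of the potential on (0, \<infinity>).
  Convexity is recorded as the tangent inequality, the form in which freezing at time r uses
  it.\<close>

locale gflow = flow +
  fixes h h1 h2 :: "real \<Rightarrow> real"
  assumes h1: "\<And>s. s > 0 \<Longrightarrow> (h has_real_derivative h1 s) (at s)"
    and h2: "\<And>s. s > 0 \<Longrightarrow> (h1 has_real_derivative h2 s) (at s)"
    and h2c: "continuous_on {0<..} h2"
    and tangent: "\<And>x y. x > 0 \<Longrightarrow> y > 0 \<Longrightarrow> h y - h x \<ge> h1 x * (y - x)"
begin

lemma hc: "continuous_on {0<..} h" and h1c: "continuous_on {0<..} h1"
  by (intro continuous_at_imp_continuous_on ballI DERIV_isCont[OF h1] DERIV_isCont[OF h2]; simp)+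

text \<open>The rectangle is closed so that continuity of v and compactness bound h, h' and h''
  along v.\<close>

definition Pos :: "real \<Rightarrow> real \<Rightarrow> bool" where
  "Pos s t \<longleftrightarrow> (\<forall>\<tau>\<in>{s..t}. \<forall>x\<in>{a..b}. vc \<tau> x > 0)"

text \<open>A real number that represents the energy under positivity (\<open>energy_eq\<close>); h
  is unspecified at arguments \<le> 0.\<close>

definition En :: "real \<Rightarrow> real" where
  "En t = 1 / 2 * (\<integral>x. (W t x)\<^sup>2 \<partial>M) + (\<integral>x. h (vc t x) \<partial>M)"

definition frc :: "real \<Rightarrow> real \<Rightarrow> real \<times> real \<Rightarrow> real" where
  "frc s t z = indicator {s<..<t} (fst z) * (U3 z - h2 (vc (fst z) (snd z)) * U1 z)"

lemma Pos_comp: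
  assumes "Pos s t" "0 \<le> s" "t < T" "continuous_on {0<..} (\<phi> :: real \<Rightarrow> real)"
  shows "continuous_on ({s..t} \<times> {a..b}) (\<lambda>z. \<phi> (vc (fst z) (snd z)))"
proof (rule continuous_on_compose2[OF assms(4)])
  show "continuous_on ({s..t} \<times> {a..b}) (\<lambda>z. vc (fst z) (snd z))"
    by (rule continuous_on_subset[OF vc_continuous]) (use assms(2,3) in auto)
  show "(\<lambda>z. vc (fst z) (snd z)) ` ({s..t} \<times> {a..b}) \<subseteq> {0<..}" using assms(1) by (auto simp: Pos_def)
qed

lemma Pos_bound:
  assumes "Pos s t" "0 \<le> s" "t < T" "continuous_on {0<..} (\<phi> :: real \<Rightarrow> real)"
  obtains B where "B > 0" "\<And>\<tau> x. \<tau> \<in> {s..t} \<Longrightarrow> x \<in> {a..b} \<Longrightarrow> \<bar>\<phi> (vc \<tau> x)\<bar> \<le> B"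
proof -
  have "compact ({s..t} \<times> {a..b})" by (intro compact_Times) auto
  from compact_continuous_image[OF Pos_comp[OF assms] this]
  have "bounded ((\<lambda>z. \<phi> (vc (fst z) (snd z))) ` ({s..t} \<times> {a..b}))" by (rule compact_imp_bounded)
  then obtain B where B: "B > 0" "\<forall>y\<in>(\<lambda>z. \<phi> (vc (fst z) (snd z))) ` ({s..t} \<times> {a..b}). norm y \<le> B"
    unfolding bounded_pos by blast
  have "\<bar>\<phi> (vc \<tau> x)\<bar> \<le> B" if "\<tau> \<in> {s..t}" "x \<in> {a..b}" for \<tau> x
  proof -
    have "\<phi> (vc \<tau> x) \<in> (\<lambda>z. \<phi> (vc (fst z) (snd z))) ` ({s..t} \<times> {a..b})"
      using that by (intro image_eqI[of _ _ "(\<tau>, x)"]) auto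
    with B(2) show ?thesis by fastforce
  qed
  with B(1) show thesis by (rule that)
qed

lemma slice_continuous:
  assumes "Pos s t" "0 \<le> s" "t < T" "continuous_on {0<..} (\<phi> :: real \<Rightarrow> real)" "\<tau> \<in> {s..t}"
  shows "continuous_on {a..b} (\<lambda>x. \<phi> (vc \<tau> x))"
proof (rule continuous_on_compose2[OF assms(4)])
  show "continuous_on {a..b} (vc \<tau>)" by (rule ac_rep_continuous[OF vc_props(1)]) (use assms in auto)
qed (use assms(1,5) in \<open>auto simp: Pos_def\<close>)

text \<open>At a good time v(r) is positive with a continuous derivative, so h'(v(r)) is
  continuously differentiable in x and may be inserted into the continuity equation.\<close>

lemma convex_test:
  assumes P: "Pos s t" "0 \<le> s" "t < T" and r: "good r" "r \<in> {s..t}" and x: "0 \<le> x" "x \<le> y" "y \<le> T"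
  defines "\<psi> \<equiv> \<lambda>x. h1 (vc r x)"
  shows "(\<integral>z. v y z * \<psi> z \<partial>M) - (\<integral>z. v x z * \<psi> z \<partial>M) = (\<integral>\<sigma>. indicator {x<..y} \<sigma> * (\<integral>z. K (\<sigma>, z) * (h2 (vc r z) * U1 (r, z)) \<partial>M) \<partial>lborel)"
proof -
  obtain u u1 u2 where u:
    "ac_rep a b u (\<lambda>x. U1 (r, x))" "AE x in M. v r x = u x"
    "AE x in M. U1 (r, x) = u1 x"
    "\<And>x. x \<in> {a..b} \<Longrightarrow> (u has_real_derivative u1 x) (at x within {a..b})" "continuous_on {a..b} u1"
    "\<And>x. x \<in> {a..b} \<Longrightarrow> (u1 has_real_derivative u2 x) (at x within {a..b})" "continuous_on {a..b} u2"
    "u1 a = 0" "u1 b = 0" "AE x in M. wderiv {a<..<b} 2 (v r) x = u2 x"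
    "wderiv {a<..<b} 2 (v r) \<in> sobolev 1 p {a<..<b}"
    "AE x in M. wderiv {a<..<b} 1 (wderiv {a<..<b} 2 (v r)) x = U3 (r, x)"
    by (rule goodE[OF r(1), OF that])
  have r0: "0 \<le> r" "r < T" using r P by auto
  note vcr = vc_props[OF r0]
  have "AE x in M. u x = vc r x" using u(2) vcr(2) by eventually_elim simp
  from continuous_eq_of_AE[OF ab ac_rep_continuous[OF u(1)] ac_rep_continuous[OF vcr(1)] this]
  have uv: "u x = vc r x" if "x \<in> {a..b}" for x using that .
  have dv: "(vc r has_real_derivative u1 x) (at x within {a..b})" if "x \<in> {a..b}" for x
    by (rule has_field_derivative_transform_within[OF u(4)[OF that], of 1]) (use uv that in auto)
  have pos: "vc r x > 0" if "x \<in> {a..b}" for x using P(1) r(2) that by (auto simp: Pos_def)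
  define \<psi>' where "\<psi>' x = h2 (vc r x) * u1 x" for x
  have d\<psi>: "(\<psi> has_real_derivative \<psi>' x) (at x within {a..b})" if "x \<in> {a..b}" for x
    unfolding \<psi>_def \<psi>'_def by (rule DERIV_chain2[OF h2[OF pos[OF that]] dv[OF that]])
  have c\<psi>': "continuous_on {a..b} \<psi>'"
    unfolding \<psi>'_def by (intro continuous_on_mult slice_continuous[OF P h2c r(2)] u(5))
  have c\<psi>: "continuous_on {a..b} \<psi>" unfolding \<psi>_def by (rule slice_continuous[OF P h1c r(2)])
  have w: "has_weak_deriv {a<..<b} 1 \<psi> \<psi>'" by (rule ac_rep_has_weak_deriv[OF ab C1_ac_rep[OF d\<psi> c\<psi>']])
  have s: "\<psi> \<in> sobolev 1 p {a<..<b}"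
    using pq by (intro sobolevI[OF _ _ _ _ w] borel_measurable_integrable continuous_integrable_MI continuous_powr_integrable c\<psi> c\<psi>') auto
  have ae: "AE z in M. wderiv {a<..<b} 1 \<psi> z = h2 (vc r z) * U1 (r, z)"
  proof -
    have "AE z in M. wderiv {a<..<b} 1 \<psi> z = \<psi>' z" unfolding AE_MI using wderiv_AE[OF _ w] by simp
    with u(3) show ?thesis by eventually_elim (simp add: \<psi>'_def)
  qed
  have "(\<integral>z. K (\<sigma>, z) * wderiv {a<..<b} 1 \<psi> z \<partial>M) = (\<integral>z. K (\<sigma>, z) * (h2 (vc r z) * U1 (r, z)) \<partial>M)" for \<sigma>
  proof -
    have "(LINT z:{a<..<b}|lebesgue. K (\<sigma>, z) * wderiv {a<..<b} 1 \<psi> z) = (LINT z:{a<..<b}|lebesgue. K (\<sigma>, z) * (h2 (vc r z) * U1 (r, z)))"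
      using ae unfolding AE_MI by (intro set_integral_lebesgue_cong_AE) (auto elim!: eventually_mono)
    then show ?thesis by (simp add: LINT_MI)
  qed
  then show ?thesis using ce[OF s x] by simp
qed

text \<open>The scheme of the Dirichlet part, with the tangent inequality in place of the square: it
  holds for either order of r and \<tau>, and \<open>chain_const\<close> merges the two cases. The
  potential energy is continuous in time by compactness, so the identity extends to the endpoints s
  and t.\<close>

lemma potential_identity:
  assumes P: "Pos s t" and st: "0 \<le> s" "s < t" "t < T"
  shows "integrable L.P (\<lambda>z. indicator {s<..<t} (fst z) * (h2 (vc (fst z) (snd z)) * U1 z) * K z)"
    and "integrable L.P (\<lambda>z. \<bar>indicator {s<..<t} (fst z) * (h2 (vc (fst z) (snd z)) * U1 z)\<bar> powr p)"
    and "(\<lambda>z. indicator {s<..<t} (fst z) * (h2 (vc (fst z) (snd z)) * U1 z)) \<in> borel_measurable L.P"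
    and "(\<integral>x. h (vc t x) \<partial>M) - (\<integral>x. h (vc s x) \<partial>M) = (\<integral>z. indicator {s<..<t} (fst z) * (h2 (vc (fst z) (snd z)) * U1 z) * K z \<partial>L.P)"
proof -
  note P' = P st(1,3)
  note [measurable] = U1(1) K(1)
  \<comment> \<open>The sign makes this the potential part of the force: \<open>chain_const\<close>
    expects the energy plus the integral of force times flux to be constant.\<close>
  define F2 where "F2 z = - (indicator {s<..<t} (fst z) * (h2 (vc (fst z) (snd z)) * U1 z))" for z
  have hm[measurable]: "(\<lambda>z. indicator {s..t} (fst z) * h2 (vc (fst z) (snd z))) \<in> borel_measurable L.P"
    by (rule rect_measurable[OF Pos_comp[OF P' h2c]])
  have F2m: "F2 \<in> borel_measurable L.P"
  proof -
    have "(\<lambda>z. - (indicator {s<..<t} (fst z) * ((indicator {s..t} (fst z) * h2 (vc (fst z) (snd z))) * U1 z))) \<in> borel_measurable L.P"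
      by measurable
    then show ?thesis by (rule measurable_cong[THEN iffD1, rotated]) (auto simp: F2_def split: split_indicator)
  qed
  obtain B where B: "B > 0" "\<And>\<tau> x. \<tau> \<in> {s..t} \<Longrightarrow> x \<in> {a..b} \<Longrightarrow> \<bar>h2 (vc \<tau> x)\<bar> \<le> B" by (rule Pos_bound[OF P' h2c, OF that])
  have F2p: "integrable L.P (\<lambda>z. \<bar>F2 z\<bar> powr p)"
  proof (rule Bochner_Integration.integrable_bound)
    show "integrable L.P (\<lambda>z. B powr p * \<bar>U1 z\<bar> powr p)" using U1(2) by simp
    show "(\<lambda>z. \<bar>F2 z\<bar> powr p) \<in> borel_measurable L.P" using F2m by measurable
    show "AE z in L.P. norm (\<bar>F2 z\<bar> powr p) \<le> norm (B powr p * \<bar>U1 z\<bar> powr p)"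
    proof (rule AE_I2)
      fix z assume "z \<in> space L.P"
      then have z: "snd z \<in> {a..b}" by (auto simp: space_pair_MI)
      have "\<bar>F2 z\<bar> \<le> B * \<bar>U1 z\<bar>"
        using B(2)[of "fst z" "snd z"] z B(1) by (auto simp: F2_def abs_mult intro!: mult_right_mono split: split_indicator)
      then have "\<bar>F2 z\<bar> powr p \<le> (B * \<bar>U1 z\<bar>) powr p" using pq by (intro powr_mono2) auto
      then show "norm (\<bar>F2 z\<bar> powr p) \<le> norm (B powr p * \<bar>U1 z\<bar> powr p)" using B(1) by (simp add: powr_mult)
    qed
  qed
  have F2s: "F2 (\<tau>, x) = 0" if "\<tau> \<notin> {s<..<t}" for \<tau> x using that by (simp add: F2_def)
  interpret G: Lpq M p q F2 "\<lambda>z. indicator {s<..<t} (fst z) * K z" s t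
    by (rule Lpq_of[OF F2m F2p F2s]) (use st in auto)
  have sub: "(\<lambda>z. \<bar>indicator {s<..<t} (fst z) * (h2 (vc (fst z) (snd z)) * U1 z)\<bar> powr p) = (\<lambda>z. \<bar>F2 z\<bar> powr p)"
    by (simp add: F2_def fun_eq_iff)
  show "integrable L.P (\<lambda>z. \<bar>indicator {s<..<t} (fst z) * (h2 (vc (fst z) (snd z)) * U1 z)\<bar> powr p)"
    unfolding sub by (rule F2p)
  have "(\<lambda>z. - F2 z) \<in> borel_measurable L.P" using F2m by measurable
  then show "(\<lambda>z. indicator {s<..<t} (fst z) * (h2 (vc (fst z) (snd z)) * U1 z)) \<in> borel_measurable L.P"
    by (simp add: F2_def)
  have dp: "(\<lambda>z. indicator {s<..<t} (fst z) * (h2 (vc (fst z) (snd z)) * U1 z) * K z) = (\<lambda>z. - (F2 z * (indicator {s<..<t} (fst z) * K z)))"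
    by (auto simp: F2_def fun_eq_iff split: split_indicator)
  show "integrable L.P (\<lambda>z. indicator {s<..<t} (fst z) * (h2 (vc (fst z) (snd z)) * U1 z) * K z)"
    unfolding dp using G.diag_product by simp
  \<comment> \<open>The cut-off makes this a measurable function on the whole line; h composed with
    \<open>vc\<close> is controlled on the rectangle only.\<close>
  define e2 where "e2 \<tau> = (\<integral>x. indicator {s..t} \<tau> * h (vc \<tau> x) \<partial>M)" for \<tau>
  have e2m: "e2 \<in> borel_measurable borel"
  proof -
    interpret sigma_finite_measure M by (rule sigma_finite_MI)
    have "(\<lambda>z. indicator {s..t} (fst z) * h (vc (fst z) (snd z))) \<in> borel_measurable L.P"
      by (rule rect_measurable[OF Pos_comp[OF P' hc]])
    then have "(\<lambda>\<tau>. \<integral>x. indicator {s..t} \<tau> * h (vc \<tau> x) \<partial>M) \<in> borel_measurable lborel"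
      by (intro sigma_finite_measure.borel_measurable_lebesgue_integral[OF sigma_finite_MI]) (simp add: case_prod_unfold)
    then show ?thesis by (simp add: e2_def[abs_def])
  qed
  have e2in: "e2 \<tau> = (\<integral>x. h (vc \<tau> x) \<partial>M)" if "\<tau> \<in> {s..t}" for \<tau> using that by (simp add: e2_def)
  have hi: "integrable M (\<lambda>x. h (vc \<tau> x))" if "\<tau> \<in> {s..t}" for \<tau>
    by (rule continuous_integrable_MI[OF slice_continuous[OF P' hc that]])
  \<comment> \<open>The tangent inequality at v(r), integrated in x. No order of r and \<tau> is
    imposed, which gives both inequalities for \<open>chain_const\<close>.\<close>
  have step: "e2 \<tau> - e2 r \<ge> (\<integral>x. v \<tau> x * h1 (vc r x) \<partial>M) - (\<integral>x. v r x * h1 (vc r x) \<partial>M)"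
    if r: "r \<in> {s..t}" "\<tau> \<in> {s..t}" for r \<tau>
  proof -
    have r0: "0 \<le> r" "r < T" "0 \<le> \<tau>" "\<tau> < T" using r st by auto
    have c: "continuous_on {a..b} (\<lambda>x. vc \<tau> x * h1 (vc r x))" "continuous_on {a..b} (\<lambda>x. vc r x * h1 (vc r x))"
      using r0 by (auto intro!: continuous_on_mult slice_continuous[OF P' h1c r(1)] ac_rep_continuous[OF vc_props(1)])
    have vv: "(\<integral>x. v \<rho> x * h1 (vc r x) \<partial>M) = (\<integral>x. vc \<rho> x * h1 (vc r x) \<partial>M)" if "0 \<le> \<rho>" "\<rho> < T" for \<rho>
    proof (rule integral_cong_AE)
      have hm: "(\<lambda>x. h1 (vc r x)) \<in> borel_measurable M"
        using continuous_integrable_MI[OF slice_continuous[OF P' h1c r(1)]] by auto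
      have "vc \<rho> \<in> borel_measurable M" using continuous_integrable_MI[OF ac_rep_continuous[OF vc_props(1)[OF that]]] by auto
      with hm show "(\<lambda>x. vc \<rho> x * h1 (vc r x)) \<in> borel_measurable M" by measurable
      show "(\<lambda>x. v \<rho> x * h1 (vc r x)) \<in> borel_measurable M" using v_L2(1)[OF that(1)] hm by measurable
      show "AE x in M. v \<rho> x * h1 (vc r x) = vc \<rho> x * h1 (vc r x)" using vc_props(2)[OF that] by eventually_elim simp
    qed
    have "(\<integral>x. vc \<tau> x * h1 (vc r x) \<partial>M) - (\<integral>x. vc r x * h1 (vc r x) \<partial>M) = (\<integral>x. h1 (vc r x) * (vc \<tau> x - vc r x) \<partial>M)"
      using c[THEN continuous_integrable_MI] by (simp add: right_diff_distrib mult.commute)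
    also have "\<dots> \<le> (\<integral>x. h (vc \<tau> x) - h (vc r x) \<partial>M)"
    proof (rule integral_mono)
      show "integrable M (\<lambda>x. h1 (vc r x) * (vc \<tau> x - vc r x))"
        using c[THEN continuous_integrable_MI] by (simp add: right_diff_distrib mult.commute)
      show "integrable M (\<lambda>x. h (vc \<tau> x) - h (vc r x))" using hi r by simp
      fix x assume "x \<in> space M"
      then show "h1 (vc r x) * (vc \<tau> x - vc r x) \<le> h (vc \<tau> x) - h (vc r x)"
        using P r by (intro tangent) (auto simp: Pos_def space_MI)
    qed
    also have "\<dots> = e2 \<tau> - e2 r" using hi r by (simp add: e2in)
    finally show ?thesis using vv r0 by simp
  qed
  have Gb: "(\<integral>\<sigma>. indicator {x<..y} \<sigma> * (\<integral>z. K (\<sigma>, z) * (h2 (vc r z) * U1 (r, z)) \<partial>M) \<partial>lborel) = - (\<integral>\<sigma>. indicator {x<..y} \<sigma> * G.b r \<sigma> \<partial>lborel)"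
    if "r \<in> {s<..<t}" "x \<in> {s<..<t}" "y \<in> {s<..<t}" for r x y
  proof -
    have "indicator {x<..y} \<sigma> * (\<integral>z. K (\<sigma>, z) * (h2 (vc r z) * U1 (r, z)) \<partial>M) = - (indicator {x<..y} \<sigma> * G.b r \<sigma>)" for \<sigma>
    proof (cases "\<sigma> \<in> {x<..y}")
      case True
      then have "\<sigma> \<in> {s<..<t}" using that by auto
      then have "G.b r \<sigma> = (\<integral>z. - (K (\<sigma>, z) * (h2 (vc r z) * U1 (r, z))) \<partial>M)"
        unfolding G.b_def using that(1) by (intro Bochner_Integration.integral_cong) (auto simp: F2_def)
      then show ?thesis by simp
    qed simp
    then show ?thesis by simp
  qed
  have "\<exists>c. AE \<tau> in lborel. \<tau> \<in> {s<..<t} \<longrightarrow> e2 \<tau> + (\<integral>\<sigma>. indicator {s<..\<tau>} \<sigma> * G.b \<sigma> \<sigma> \<partial>lborel) = c"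
  proof (rule G.chain_const[where R = good, OF _ _ _ e2m])
    show "AE r in lborel. r \<in> {s<..<t} \<longrightarrow> good r" using AE_good by eventually_elim (use st in auto)
    fix r \<tau> assume a: "good r" "good \<tau>" "r \<in> {s<..<t}" "\<tau> \<in> {s<..<t}"
    have a': "r \<in> {s..t}" "\<tau> \<in> {s..t}" "0 \<le> r" "r \<le> T" "0 \<le> \<tau>" "\<tau> \<le> T" using a st by auto
    show "- (\<integral>\<sigma>. indicator {r<..\<tau>} \<sigma> * G.b r \<sigma> \<partial>lborel) \<le> e2 \<tau> - e2 r" if "r < \<tau>"
      using step[OF a'(1,2)] convex_test[OF P' a(1) a'(1,3) less_imp_le[OF that] a'(6)] Gb[OF a(3) a(3) a(4)] by simp
    show "(\<integral>\<sigma>. indicator {\<tau><..r} \<sigma> * G.b r \<sigma> \<partial>lborel) \<le> e2 \<tau> - e2 r" if "\<tau> < r"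
      using step[OF a'(1,2)] convex_test[OF P' a(1) a'(1,5) less_imp_le[OF that] a'(4)] Gb[OF a(3) a(4) a(3)] by simp
  qed
  then obtain c where c: "AE \<tau> in lborel. \<tau> \<in> {s<..<t} \<longrightarrow> e2 \<tau> + (\<integral>\<sigma>. indicator {s<..\<tau>} \<sigma> * G.b \<sigma> \<sigma> \<partial>lborel) = c" by blast
  have e2c: "continuous_on {s..t} e2"
    unfolding continuous_on_sequentially comp_def
  proof (intro ballI allI impI)
    fix X \<tau> assume \<tau>: "\<tau> \<in> {s..t}" and X: "(\<forall>n. X n \<in> {s..t}) \<and> X \<longlonglongrightarrow> \<tau>"
    obtain Bh where Bh: "Bh > 0" "\<And>\<tau> x. \<tau> \<in> {s..t} \<Longrightarrow> x \<in> {a..b} \<Longrightarrow> \<bar>h (vc \<tau> x)\<bar> \<le> Bh" by (rule Pos_bound[OF P' hc, OF that])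
    have "(\<lambda>n. \<integral>x. h (vc (X n) x) \<partial>M) \<longlonglongrightarrow> (\<integral>x. h (vc \<tau> x) \<partial>M)"
    proof (rule integral_dominated_convergence[where w = "\<lambda>_. Bh"])
      show "integrable M (\<lambda>_. Bh)" by (rule finite_measure.integrable_const[OF finite_MI])
      show "AE x in M. (\<lambda>n. h (vc (X n) x)) \<longlonglongrightarrow> h (vc \<tau> x)"
      proof (rule AE_I2)
        fix x assume "x \<in> space M"
        then have x: "x \<in> {a..b}" by (auto simp: space_MI)
        have "(\<lambda>n. (X n, x)) \<longlonglongrightarrow> (\<tau>, x)" using X by (intro tendsto_Pair tendsto_const) auto
        then show "(\<lambda>n. h (vc (X n) x)) \<longlonglongrightarrow> h (vc \<tau> x)"
          using Pos_comp[OF P' hc, unfolded continuous_on_sequentially comp_def, rule_format, of "(\<tau>, x)" "\<lambda>n. (X n, x)"] X \<tau> x by simp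
      qed
      show "AE x in M. norm (h (vc (X n) x)) \<le> Bh" for n using Bh(2) X by (intro AE_I2) (auto simp: space_MI)
      show "(\<lambda>x. h (vc (X n) x)) \<in> borel_measurable M" for n using hi[of "X n"] X by auto
      show "(\<lambda>x. h (vc \<tau> x)) \<in> borel_measurable M" using hi[OF \<tau>] by auto
    qed
    then show "(\<lambda>n. e2 (X n)) \<longlonglongrightarrow> e2 \<tau>" using X \<tau> by (simp add: e2in)
  qed
  have gc: "continuous_on {s..t} (\<lambda>\<tau>. \<integral>\<sigma>. indicator {s<..\<tau>} \<sigma> * G.b \<sigma> \<sigma> \<partial>lborel)"
    unfolding continuous_on_sequentially comp_def using lborel_primitive_continuous[OF G.diag_integrable] by blast
  have all: "e2 \<tau> + (\<integral>\<sigma>. indicator {s<..\<tau>} \<sigma> * G.b \<sigma> \<sigma> \<partial>lborel) = c" if "\<tau> \<in> {s..t}" for \<tau>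
    by (rule continuous_eq_of_AE[OF st(2) continuous_on_add[OF e2c gc] continuous_on_const _ that])
       (use c in \<open>simp add: AE_lborel_MI\<close>)
  have "e2 t - e2 s = - (\<integral>\<sigma>. indicator {s<..t} \<sigma> * G.b \<sigma> \<sigma> \<partial>lborel)"
    using all[of s] all[of t] st by simp
  also have "(\<integral>\<sigma>. indicator {s<..t} \<sigma> * G.b \<sigma> \<sigma> \<partial>lborel) = (\<integral>\<sigma>. G.b \<sigma> \<sigma> \<partial>lborel)"
    by (intro Bochner_Integration.integral_cong) (auto simp: G.b_def F2s split: split_indicator)
  also have "\<dots> = (\<integral>z. F2 z * (indicator {s<..<t} (fst z) * K z) \<partial>L.P)"
    using L.P.integral_fst'[OF G.diag_product] by (simp add: G.b_def)
  finally show "(\<integral>x. h (vc t x) \<partial>M) - (\<integral>x. h (vc s x) \<partial>M) = (\<integral>z. indicator {s<..<t} (fst z) * (h2 (vc (fst z) (snd z)) * U1 z) * K z \<partial>L.P)"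
    unfolding dp using e2in[of s] e2in[of t] st by simp
qed

text \<open>The Dirichlet part comes from \<open>W_props\<close>, which holds at every time, the
  potential part from \<open>potential_identity\<close>; their integrands combine to the cut-off
  force times the flux.\<close>

lemma energy_identity:
  assumes P: "Pos s t" and st: "0 \<le> s" "s < t" "t < T"
  shows "frc s t \<in> borel_measurable L.P" "integrable L.P (\<lambda>z. \<bar>frc s t z\<bar> powr p)" "integrable L.P (\<lambda>z. frc s t z * K z)"
    "En t - En s = - (\<integral>z. frc s t z * K z \<partial>L.P)"
proof -
  note G = potential_identity[OF P st]
  note [measurable] = U3(1) K(1) G(3)
  have um: "(\<lambda>z. indicator {s<..<t} (fst z) * U3 z) \<in> borel_measurable L.P" by measurable
  have fe: "frc s t = (\<lambda>z. indicator {s<..<t} (fst z) * U3 z - indicator {s<..<t} (fst z) * (h2 (vc (fst z) (snd z)) * U1 z))"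
    by (auto simp: frc_def fun_eq_iff split: split_indicator)
  show fm: "frc s t \<in> borel_measurable L.P" unfolding fe by measurable
  show "integrable L.P (\<lambda>z. \<bar>frc s t z\<bar> powr p)"
  proof (rule Bochner_Integration.integrable_bound)
    show "integrable L.P (\<lambda>z. 2 powr p * (\<bar>U3 z\<bar> powr p + \<bar>indicator {s<..<t} (fst z) * (h2 (vc (fst z) (snd z)) * U1 z)\<bar> powr p))"
      using U3(2) G(2) by simp
    show "(\<lambda>z. \<bar>frc s t z\<bar> powr p) \<in> borel_measurable L.P" using fm by measurable
    show "AE z in L.P. norm (\<bar>frc s t z\<bar> powr p) \<le> norm (2 powr p * (\<bar>U3 z\<bar> powr p + \<bar>indicator {s<..<t} (fst z) * (h2 (vc (fst z) (snd z)) * U1 z)\<bar> powr p))"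
    proof (rule AE_I2)
      fix z
      let ?g = "indicator {s<..<t} (fst z) * (h2 (vc (fst z) (snd z)) * U1 z)"
      have "\<bar>frc s t z\<bar> powr p \<le> \<bar>U3 z - ?g\<bar> powr p"
        by (auto simp: fe split: split_indicator)
      also have "\<dots> \<le> 2 powr p * (\<bar>U3 z\<bar> powr p + \<bar>?g\<bar> powr p)" using pq by (intro powr_add_le) auto
      finally show "norm (\<bar>frc s t z\<bar> powr p) \<le> norm (2 powr p * (\<bar>U3 z\<bar> powr p + \<bar>?g\<bar> powr p))" by simp
    qed
  qed
  have i1: "integrable L.P (\<lambda>z. indicator {s<..<t} (fst z) * U3 z * K z)"
  proof (rule Bochner_Integration.integrable_bound[OF L.diag_product])
    show "(\<lambda>z. indicator {s<..<t} (fst z) * U3 z * K z) \<in> borel_measurable L.P" by measurable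
  qed (auto split: split_indicator)
  have fk: "(\<lambda>z. frc s t z * K z) = (\<lambda>z. indicator {s<..<t} (fst z) * U3 z * K z - indicator {s<..<t} (fst z) * (h2 (vc (fst z) (snd z)) * U1 z) * K z)"
    by (auto simp: fe fun_eq_iff left_diff_distrib)
  show "integrable L.P (\<lambda>z. frc s t z * K z)" unfolding fk using i1 G(1) by (rule Bochner_Integration.integrable_diff)
  have t0: "0 \<le> t" "s < T" using st by auto
  have "\<beta> t - \<beta> s = (\<integral>\<sigma>. indicator {s<..t} \<sigma> * L.b \<sigma> \<sigma> \<partial>lborel)"
    unfolding \<beta>_def using L.indicator_split_integral[OF L.diag_integrable st(1) less_imp_le[OF st(2)]] by simp
  also have "\<dots> = (\<integral>\<sigma>. indicator {s<..<t} \<sigma> * L.b \<sigma> \<sigma> \<partial>lborel)"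
  proof (rule integral_cong_AE)
    show "AE \<sigma> in lborel. indicat_real {s<..t} \<sigma> * L.b \<sigma> \<sigma> = indicat_real {s<..<t} \<sigma> * L.b \<sigma> \<sigma>"
      using AE_lborel_singleton[of t] by eventually_elim (auto split: split_indicator)
  qed (use borel_measurable_integrable[OF L.diag_integrable] in measurable)
  also have "\<dots> = (\<integral>\<sigma>. (\<integral>x. indicator {s<..<t} \<sigma> * U3 (\<sigma>, x) * K (\<sigma>, x) \<partial>M) \<partial>lborel)"
    unfolding L.b_def by (intro Bochner_Integration.integral_cong) (auto split: split_indicator)
  also have "\<dots> = (\<integral>z. indicator {s<..<t} (fst z) * U3 z * K z \<partial>L.P)"
    using L.P.integral_fst'[OF i1] by simp
  finally have b: "\<beta> t - \<beta> s = (\<integral>z. indicator {s<..<t} (fst z) * U3 z * K z \<partial>L.P)" .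
  have "En t - En s = - (\<beta> t - \<beta> s) + ((\<integral>x. h (vc t x) \<partial>M) - (\<integral>x. h (vc s x) \<partial>M))"
    unfolding En_def W_props(5)[OF t0(1) st(3)] W_props(5)[OF st(1) t0(2)] by simp
  also have "\<dots> = - (\<integral>z. frc s t z * K z \<partial>L.P)"
    unfolding b G(4) fk Bochner_Integration.integral_diff[OF i1 G(1)] by simp
  finally show "En t - En s = - (\<integral>z. frc s t z * K z \<partial>L.P)" .
qed

end

section \<open>Positivity from finite energy\<close>

text \<open>In one dimension an \<open>H\<^sup>1\<close> bound gives Hoelder continuity with exponent \<open>1/2\<close>, so near a
  small minimum \<open>\<mu>\<close> the potential is at least \<open>c / (2 \<mu>\<^sup>2 + 2 H\<^sup>2 \<bar>x - x\<^sub>0\<bar>)\<close>, whose integral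
  diverges logarithmically as \<open>\<mu>\<close> tends to \<open>0\<close>.\<close>

lemma potential_lower_bound:
  fixes G :: "real \<Rightarrow> ennreal"
  assumes ab: "a < b" and H: "H > 0" and c: "c > 0" and \<sigma>: "\<sigma> > 0" and C: "C \<ge> 0"
    and G: "\<And>s. 0 \<le> s \<Longrightarrow> s \<le> \<sigma> \<Longrightarrow> ennreal c / (ennreal s)\<^sup>2 \<le> G s" "\<And>s. s < 0 \<Longrightarrow> G s = \<infinity>"
  obtains \<delta> where "\<delta> > 0" "\<And>u x. \<lbrakk>\<And>x y. x \<in> {a..b} \<Longrightarrow> y \<in> {a..b} \<Longrightarrow> \<bar>u y - u x\<bar> \<le> H * sqrt \<bar>y - x\<bar>;
    (\<integral>\<^sup>+x. G (u x) \<partial>MI a b) \<le> ennreal C; x \<in> {a..b}\<rbrakk> \<Longrightarrow> \<delta> \<le> u x"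
proof -
  \<comment> \<open>An interval of this length fits into [a, b] on one side of any point, and the
    Hoelder bound lets u vary by at most \<sigma>/2 from the value at that point.\<close>
  define l where "l = min ((b - a) / 2) ((\<sigma> / (2 * H))\<^sup>2)"
  have l0: "l > 0" using ab H \<sigma> by (simp add: l_def)
  have lb: "l \<le> (b - a) / 2" unfolding l_def by (rule min.cobounded1)
  have "sqrt l \<le> sqrt ((\<sigma> / (2 * H))\<^sup>2)" by (rule real_sqrt_le_mono) (simp add: l_def)
  then have "sqrt l \<le> \<sigma> / (2 * H)" using \<sigma> H by simp
  then have Hl: "H * sqrt l \<le> \<sigma> / 2" using H by (simp add: field_simps)
  \<comment> \<open>Solves c / (2 H^2) ln \<theta> = C + 1, a value that the bound C on the integral
    excludes.\<close>
  define \<theta> where "\<theta> = exp (2 * H\<^sup>2 * (C + 1) / c)"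
  have \<theta>: "\<theta> > 0" by (simp add: \<theta>_def)
  \<comment> \<open>The second bound gives \<delta>^2 \<theta> \<le> H^2 l, so the logarithm below
    is at least ln \<theta>. The first keeps u below \<sigma> near x0, where the lower bound on G
    applies.\<close>
  define \<delta> where "\<delta> = min (\<sigma> / 2) (H * sqrt (l / \<theta>))"
  have \<delta>0: "\<delta> > 0" using \<sigma> H l0 \<theta> by (simp add: \<delta>_def)
  have \<delta>s: "\<delta> \<le> \<sigma> / 2" unfolding \<delta>_def by (rule min.cobounded1)
  have "\<delta>\<^sup>2 \<le> (H * sqrt (l / \<theta>))\<^sup>2" using \<delta>0 by (intro power_mono) (auto simp: \<delta>_def)
  also have "\<dots> = H\<^sup>2 * (l / \<theta>)" using l0 \<theta> by (simp add: power_mult_distrib)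
  finally have \<delta>2: "\<delta>\<^sup>2 * \<theta> \<le> H\<^sup>2 * l" using \<theta> by (simp add: field_simps)
  show thesis
  proof (rule that[OF \<delta>0])
    fix u :: "real \<Rightarrow> real" and x0
    assume u: "\<And>x y. x \<in> {a..b} \<Longrightarrow> y \<in> {a..b} \<Longrightarrow> \<bar>u y - u x\<bar> \<le> H * sqrt \<bar>y - x\<bar>"
      and bd: "(\<integral>\<^sup>+x. G (u x) \<partial>MI a b) \<le> ennreal C" and x0: "x0 \<in> {a..b}"
    show "\<delta> \<le> u x0"
    proof (rule ccontr)
      assume "\<not> \<delta> \<le> u x0"
      then have small: "u x0 < \<delta>" by simp
      \<comment> \<open>The sign s records on which side of x0 the interval [y, y + l] lies, so that
        |x - x0| is the linear function s (x - x0) there.\<close>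
      obtain s y :: real where sy: "s = 1 \<and> y = x0 \<or> s = -1 \<and> y = x0 - l" "a \<le> y" "y + l \<le> b"
      proof (cases "x0 \<le> (a + b) / 2")
        case True
        then show thesis using x0 lb by (intro that[of 1 x0]) (auto simp: field_simps)
      next
        case False
        then show thesis using x0 lb by (intro that[of "-1" "x0 - l"]) (auto simp: field_simps)
      qed
      \<comment> \<open>A lower bound for c / u^2, from u \<le> \<delta> + H sqrt |x - x0| and (x +
        y)^2 \<le> 2 x^2 + 2 y^2.\<close>
      define w where "w x = c / (2 * (\<delta>\<^sup>2 + H\<^sup>2 * (s * (x - x0))))" for x
      have d: "0 \<le> s * (x - x0)" "s * (x - x0) = \<bar>x - x0\<bar>" "\<bar>x - x0\<bar> \<le> l" if "x \<in> {y..y+l}" for x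
        using sy(1) that by auto
      have den: "\<delta>\<^sup>2 + H\<^sup>2 * (s * (x - x0)) > 0" if "x \<in> {y..y+l}" for x
        using \<delta>0 mult_nonneg_nonneg[OF zero_le_power2[of H] d(1)[OF that]] by (intro add_pos_nonneg) auto
      have Gw: "ennreal (w x) \<le> G (u x)" if x: "x \<in> {y..y+l}" for x
      proof (cases "u x < 0")
        case True
        then show ?thesis by (simp add: G(2))
      next
        case False
        have xab: "x \<in> {a..b}" using x sy by auto
        have "sqrt \<bar>x - x0\<bar> \<le> sqrt l" using d(3)[OF x] by (rule real_sqrt_le_mono)
        then have "H * sqrt \<bar>x - x0\<bar> \<le> \<sigma> / 2" using Hl H by (meson mult_left_mono order_trans less_imp_le)
        moreover have ux: "u x \<le> \<delta> + H * sqrt \<bar>x - x0\<bar>" using u[OF x0 xab] small by linarith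
        ultimately have us: "u x \<le> \<sigma>" using \<delta>s by linarith
        have Gu: "ennreal c / (ennreal (u x))\<^sup>2 \<le> G (u x)" using False us by (intro G(1)) auto
        show ?thesis
        proof (cases "u x = 0")
          case True
          then have "ennreal c / (ennreal (u x))\<^sup>2 = \<infinity>" using c by (simp add: divide_ennreal_def ennreal_mult_top)
          then show ?thesis using Gu by (simp add: top_unique)
        next
          case nz: False
          then have up: "u x > 0" using False by simp
          have "(u x)\<^sup>2 \<le> (\<delta> + H * sqrt \<bar>x - x0\<bar>)\<^sup>2" using ux up by (intro power_mono) auto
          also have "\<dots> \<le> 2 * \<delta>\<^sup>2 + 2 * (H * sqrt \<bar>x - x0\<bar>)\<^sup>2"
            using zero_le_power2[of "\<delta> - H * sqrt \<bar>x - x0\<bar>"] by (simp add: power2_sum power2_diff)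
          also have "(H * sqrt \<bar>x - x0\<bar>)\<^sup>2 = H\<^sup>2 * (s * (x - x0))" by (simp add: power_mult_distrib d(2)[OF x])
          finally have "(u x)\<^sup>2 \<le> 2 * (\<delta>\<^sup>2 + H\<^sup>2 * (s * (x - x0)))" by simp
          then have "w x \<le> c / (u x)\<^sup>2" unfolding w_def using c up by (intro divide_left_mono mult_pos_pos) (auto simp: den[OF x])
          then have "ennreal (w x) \<le> ennreal (c / (u x)\<^sup>2)" by (rule ennreal_leI)
          also have "\<dots> = ennreal c / (ennreal (u x))\<^sup>2" using c up by (simp add: divide_ennreal ennreal_power)
          finally show ?thesis using Gu by (rule order_trans)
        qed
      qed
      define F where "F x = s * (c / (2 * H\<^sup>2)) * ln (\<delta>\<^sup>2 + H\<^sup>2 * (s * (x - x0)))" for x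
      have ss: "s * s = 1" using sy(1) by auto
      have "(\<integral>\<^sup>+x. ennreal (w x) * indicator {y..y+l} x \<partial>lborel) = ennreal (F (y + l) - F y)"
      proof (rule nn_integral_FTC_Icc)
        show "w \<in> borel_measurable borel" unfolding w_def[abs_def] by measurable
        show "y \<le> y + l" using l0 by simp
        fix x assume x: "x \<in> {y..y+l}"
        show "0 \<le> w x" unfolding w_def using c den[OF x] by simp
        have "(F has_real_derivative s * (c / (2 * H\<^sup>2)) * (1 / (\<delta>\<^sup>2 + H\<^sup>2 * (s * (x - x0))) * (H\<^sup>2 * s))) (at x)"
          unfolding F_def[abs_def] using den[OF x] by (auto intro!: derivative_eq_intros)
        moreover have "s * (c / (2 * H\<^sup>2)) * (1 / (\<delta>\<^sup>2 + H\<^sup>2 * (s * (x - x0))) * (H\<^sup>2 * s)) = w x"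
        proof -
          have "s * (c / (2 * H\<^sup>2)) * (1 / D * (H\<^sup>2 * s)) = (s * s) * (c / (2 * D))" for D
            using H by (simp add: field_simps)
          then show ?thesis by (simp add: ss w_def)
        qed
        ultimately show "(F has_real_derivative w x) (at x)" by simp
      qed
      also have "F (y + l) - F y = c / (2 * H\<^sup>2) * (ln (\<delta>\<^sup>2 + H\<^sup>2 * l) - ln (\<delta>\<^sup>2))"
        using sy(1) by (auto simp: F_def algebra_simps)
      also have "\<dots> = c / (2 * H\<^sup>2) * ln ((\<delta>\<^sup>2 + H\<^sup>2 * l) / \<delta>\<^sup>2)"
        using \<delta>0 add_pos_nonneg[of "\<delta>\<^sup>2" "H\<^sup>2 * l"] l0 by (simp add: ln_div)
      finally have val: "(\<integral>\<^sup>+x. ennreal (w x) * indicator {y..y+l} x \<partial>lborel) = ennreal (c / (2 * H\<^sup>2) * ln ((\<delta>\<^sup>2 + H\<^sup>2 * l) / \<delta>\<^sup>2))" .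
      have "\<theta> \<le> (\<delta>\<^sup>2 + H\<^sup>2 * l) / \<delta>\<^sup>2"
      proof -
        have "\<theta> * \<delta>\<^sup>2 \<le> \<delta>\<^sup>2 + H\<^sup>2 * l" using \<delta>2 by (simp add: mult.commute add_increasing)
        then show ?thesis using \<delta>0 by (simp add: pos_le_divide_eq)
      qed
      then have "ln \<theta> \<le> ln ((\<delta>\<^sup>2 + H\<^sup>2 * l) / \<delta>\<^sup>2)" using \<theta> by (subst ln_le_cancel_iff) auto
      then have "c / (2 * H\<^sup>2) * ln \<theta> \<le> c / (2 * H\<^sup>2) * ln ((\<delta>\<^sup>2 + H\<^sup>2 * l) / \<delta>\<^sup>2)" using c by (intro mult_left_mono) auto
      moreover have "c / (2 * H\<^sup>2) * ln \<theta> = C + 1" using c H by (simp add: \<theta>_def)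
      ultimately have "ennreal (C + 1) \<le> (\<integral>\<^sup>+x. ennreal (w x) * indicator {y..y+l} x \<partial>lborel)"
        unfolding val by (intro ennreal_leI) simp
      also have "\<dots> \<le> (\<integral>\<^sup>+x. indicator {a<..<b} x * G (u x) \<partial>lborel)"
      proof (rule nn_integral_mono_AE)
        show "AE x in lborel. ennreal (w x) * indicator {y..y+l} x \<le> indicator {a<..<b} x * G (u x)"
          using AE_lborel_singleton[of a] AE_lborel_singleton[of b]
        proof eventually_elim
          case (elim x)
          show ?case
          proof (cases "x \<in> {y..y+l}")
            case True
            then have "x \<in> {a<..<b}" using sy elim by auto
            then show ?thesis using True Gw by simp
          qed simp
        qed
      qed
      also have "\<dots> \<le> ennreal C" using bd by (simp add: nn_integral_MI_lborel)
      finally show False using C by simp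
    qed
  qed
qed

section \<open>Young's inequality weighted by the mobility\<close>

lemma Young_mobility:
  fixes \<alpha> \<mu> k f :: real
  assumes \<alpha>: "\<alpha> > 0" and \<mu>: "\<mu> > 0"
  shows "f * k \<le> \<alpha> / (\<alpha> + 1) * (\<bar>k\<bar> powr ((\<alpha> + 1) / \<alpha>) / \<mu> powr (1 / \<alpha>)) + 1 / (\<alpha> + 1) * (\<mu> * \<bar>f\<bar> powr (\<alpha> + 1))"
proof -
  let ?p = "\<alpha> + 1" and ?q = "(\<alpha> + 1) / \<alpha>"
  have pq: "?p > 1" "?q > 1" "1 / ?p + 1 / ?q = 1" using \<alpha> by (auto simp: field_simps)
  \<comment> \<open>Splitting f k into e |f| and |k| / e with this weight turns the p-th power into
    \<mu> |f|^p and the q-th into |k|^q / \<mu>^(1/\<alpha>), because q / p = 1 / \<alpha>.\<close>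
  define e where "e = \<mu> powr (1 / ?p)"
  have e: "e > 0" using \<mu> by (simp add: e_def)
  have ep: "e powr ?p = \<mu>" using \<mu> \<alpha> by (simp add: e_def powr_powr)
  have eq: "e powr ?q = \<mu> powr (1 / \<alpha>)" using \<alpha> by (simp add: e_def powr_powr)
  have "f * k \<le> \<bar>f\<bar> * \<bar>k\<bar>" using abs_ge_self[of "f * k"] by (simp add: abs_mult)
  also have "\<dots> = (e * \<bar>f\<bar>) * (\<bar>k\<bar> / e)" using e by simp
  also have "\<dots> \<le> (e * \<bar>f\<bar>) powr ?p / ?p + (\<bar>k\<bar> / e) powr ?q / ?q"
    using e pq by (intro Youngs_inequality) auto
  also have "(e * \<bar>f\<bar>) powr ?p = \<mu> * \<bar>f\<bar> powr ?p" using e by (simp add: powr_mult ep)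
  also have "(\<bar>k\<bar> / e) powr ?q = \<bar>k\<bar> powr ?q / \<mu> powr (1 / \<alpha>)" using e by (simp add: powr_divide eq)
  finally show ?thesis by (simp add: mult.commute)
qed

text \<open>The deficit is nonnegative as a function of f, so a zero is a minimum, and the vanishing
  derivative there is the relation between k and f. The case f = 0 is treated apart, since no
  neighbourhood of 0 avoids the sign change of f. The converse is a computation with powers.\<close>

lemma Young_mobility_eq:
  fixes \<alpha> \<mu> k f :: real
  assumes \<alpha>: "\<alpha> > 0" and \<mu>: "\<mu> > 0"
  shows "\<alpha> / (\<alpha> + 1) * (\<bar>k\<bar> powr ((\<alpha> + 1) / \<alpha>) / \<mu> powr (1 / \<alpha>)) + 1 / (\<alpha> + 1) * (\<mu> * \<bar>f\<bar> powr (\<alpha> + 1)) - f * k = 0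
    \<longleftrightarrow> k = \<mu> * Psi \<alpha> f" (is "?g f = 0 \<longleftrightarrow> _")
proof
  assume k: "k = \<mu> * Psi \<alpha> f"
  show "?g f = 0"
  proof (cases "f = 0")
    case True
    then show ?thesis using k \<alpha> by (simp add: Psi_def)
  next
    case False
    have P: "\<bar>Psi \<alpha> f\<bar> = \<bar>f\<bar> powr \<alpha>" using False by (simp add: Psi_def abs_mult powr_diff)
    have fP: "f * Psi \<alpha> f = \<bar>f\<bar> powr (\<alpha> + 1)"
    proof -
      have "f * Psi \<alpha> f = \<bar>f\<bar> powr (\<alpha> - 1) * (\<bar>f\<bar> * \<bar>f\<bar>)" by (simp add: Psi_def)
      also have "\<dots> = \<bar>f\<bar> powr (\<alpha> - 1) * \<bar>f\<bar> powr 2" using False by (simp add: powr_numeral power2_eq_square)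
      also have "\<dots> = \<bar>f\<bar> powr (\<alpha> + 1)" unfolding powr_add[symmetric] by (simp add: add.commute)
      finally show ?thesis .
    qed
    have "\<bar>k\<bar> powr ((\<alpha> + 1) / \<alpha>) = \<mu> powr ((\<alpha> + 1) / \<alpha>) * \<bar>f\<bar> powr (\<alpha> + 1)"
      using k \<mu> \<alpha> by (simp add: abs_mult P powr_mult powr_powr)
    also have "\<mu> powr ((\<alpha> + 1) / \<alpha>) = \<mu> powr (1 / \<alpha>) * \<mu>"
    proof -
      have "(\<alpha> + 1) / \<alpha> = 1 / \<alpha> + 1" using \<alpha> by (simp add: field_simps)
      then show ?thesis using \<mu> by (simp add: powr_add)
    qed
    finally have "\<bar>k\<bar> powr ((\<alpha> + 1) / \<alpha>) / \<mu> powr (1 / \<alpha>) = \<mu> * \<bar>f\<bar> powr (\<alpha> + 1)" using \<mu> by simp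
    moreover have "f * k = \<mu> * \<bar>f\<bar> powr (\<alpha> + 1)" using k fP by (simp add: mult.left_commute)
    moreover have "\<alpha> / (\<alpha> + 1) * X + 1 / (\<alpha> + 1) * X = X" for X
    proof -
      have "\<alpha> / (\<alpha> + 1) + 1 / (\<alpha> + 1) = 1" using \<alpha> by (simp add: add_divide_distrib[symmetric])
      then show ?thesis by (metis distrib_right mult_1)
    qed
    ultimately show ?thesis by simp
  qed
next
  assume g: "?g f = 0"
  show "k = \<mu> * Psi \<alpha> f"
  proof (cases "f = 0")
    case True
    then have "\<alpha> / (\<alpha> + 1) * (\<bar>k\<bar> powr ((\<alpha> + 1) / \<alpha>) / \<mu> powr (1 / \<alpha>)) = 0" using g \<alpha> by simp
    then have "k = 0" using \<alpha> \<mu> by simp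
    then show ?thesis using True by (simp add: Psi_def)
  next
    case False
    define c where "c = \<alpha> / (\<alpha> + 1) * (\<bar>k\<bar> powr ((\<alpha> + 1) / \<alpha>) / \<mu> powr (1 / \<alpha>))"
    \<comment> \<open>For y closer to f than |f| one has s y = |y|, which removes the absolute value
      from the power to be differentiated.\<close>
    define s where "s = sgn f"
    have s: "s * f = \<bar>f\<bar>" "\<bar>s\<bar> = 1" using False by (auto simp: s_def abs_sgn mult.commute)
    let ?F = "\<lambda>y. c + 1 / (\<alpha> + 1) * (\<mu> * (s * y) powr (\<alpha> + 1)) - y * k"
    have pos: "s * f > 0" using s False by simp
    have D: "(?F has_real_derivative 1 / (\<alpha> + 1) * (\<mu> * ((\<alpha> + 1) * (s * f) powr (\<alpha> + 1 - 1) * s)) - k) (at f)"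
      using pos by (auto intro!: derivative_eq_intros)
    have "1 / (\<alpha> + 1) * (\<mu> * ((\<alpha> + 1) * (s * f) powr (\<alpha> + 1 - 1) * s)) - k = 0"
    proof (rule DERIV_local_min[OF D])
      show "0 < \<bar>f\<bar>" using False by simp
      show "\<forall>y. \<bar>f - y\<bar> < \<bar>f\<bar> \<longrightarrow> ?F f \<le> ?F y"
      proof (intro allI impI)
        fix y assume y: "\<bar>f - y\<bar> < \<bar>f\<bar>"
        have sy: "s * y = \<bar>y\<bar>" using y False by (cases "f > 0") (auto simp: s_def sgn_if abs_if split: if_splits)
        have "0 \<le> ?g y" using Young_mobility[OF \<alpha> \<mu>, of y k] by simp
        moreover have "?F f = ?g f" "?F y = ?g y" by (simp_all add: c_def s(1) sy)
        ultimately show "?F f \<le> ?F y" using g by simp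
      qed
    qed
    then have "k = \<mu> * (\<bar>f\<bar> powr \<alpha> * s)" using \<alpha> by (simp add: s(1))
    also have "\<bar>f\<bar> powr \<alpha> * s = Psi \<alpha> f"
      using False by (simp add: Psi_def s_def powr_diff sgn_div_norm divide_inverse)
    finally show ?thesis .
  qed
qed

section \<open>Uniqueness of the flux\<close>

text \<open>Rational points suffice by continuity of the primitive; their countability lets
  exceptional sets of times be united in \<open>weak_flux_unique\<close>.\<close>

lemma AE_zero_of_prim:
  assumes ab: "a < b" and f: "integrable (MI a b) f" and z: "\<And>c. c \<in> \<rat> \<Longrightarrow> prim a b f c = 0"
  shows "AE x in MI a b. f x = 0"
proof -
  have z': "prim a b f c = 0" for c
    using continuous_constant_on_closure[OF prim_continuous[OF f], of \<rat> 0 c] z by (simp add: Rats_closure_real)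
  have "AE x in lebesgue. indicator {a<..<b} x * f x = 0"
  proof (rule AE_zero_of_rays)
    show "integrable lebesgue (\<lambda>x. indicator {a<..<b} x * f x)"
      using f by (simp add: set_integrable_MI[symmetric] set_integrable_def)
    fix x
    have "(LINT y|lebesgue. indicator {x<..} y * (indicator {a<..<b} y * f y)) = (LINT y:{a<..<b}|lebesgue. indicator {x<..} y * f y)"
      unfolding set_lebesgue_integral_def by (intro Bochner_Integration.integral_cong) auto
    also have "\<dots> = (\<integral>y. f y - indicator {..x} y * f y \<partial>MI a b)"
      unfolding LINT_MI by (intro Bochner_Integration.integral_cong) (auto split: split_indicator)
    also have "\<dots> = integral\<^sup>L (MI a b) f - prim a b f x"
      unfolding prim_def by (intro Bochner_Integration.integral_diff f integrable_MI_indicator) auto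
    finally show "(LINT y|lebesgue. indicator {x<..} y * (indicator {a<..<b} y * f y)) = 0"
      using z' prim_right[of a b f] by simp
  qed
  then show ?thesis unfolding AE_MI by eventually_elim auto
qed

text \<open>A test function that need not vanish at the right end. Pairing a flux with its
  derivative, the indicator of a ray, gives the primitive of the flux at c.\<close>

lemma ray_prim_sobolev:
  assumes ab: "a < b" and p: "p \<ge> 1"
  shows "prim a b (indicator {..c}) \<in> sobolev 1 p {a<..<b}"
    and "AE x in MI a b. wderiv {a<..<b} 1 (prim a b (indicator {..c})) x = indicator {..c} x"
proof -
  have i: "integrable (MI a b) (indicat_real {..c})"
    using integrable_MI_indicator[of a b "\<lambda>_. 1" "{..c}"] finite_measure.integrable_const[OF finite_MI, of a b 1] by simp
  have ac: "ac_rep a b (prim a b (indicator {..c})) (indicat_real {..c})"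
    unfolding ac_rep_def by (intro conjI i exI[of _ 0]) simp
  have w: "has_weak_deriv {a<..<b} 1 (prim a b (indicator {..c})) (indicat_real {..c})" by (rule ac_rep_has_weak_deriv[OF ab ac])
  have "(\<lambda>x. \<bar>indicat_real {..c} x\<bar> powr p) = indicat_real {..c}" using p by (auto simp: fun_eq_iff split: split_indicator)
  then have ip: "integrable (MI a b) (\<lambda>x. \<bar>indicat_real {..c} x\<bar> powr p)" using i by simp
  note cont = ac_rep_continuous[OF ac]
  show "prim a b (indicator {..c}) \<in> sobolev 1 p {a<..<b}"
    using p by (intro sobolevI[OF _ _ _ ip w] continuous_powr_integrable cont borel_measurable_integrable[OF i]
      borel_measurable_integrable[OF continuous_integrable_MI[OF cont]]) auto
  show "AE x in MI a b. wderiv {a<..<b} 1 (prim a b (indicator {..c})) x = indicator {..c} x"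
    unfolding AE_MI using wderiv_AE[OF _ w] by simp
qed

lemma integral_MI_cong_AE:
  assumes "AE x in MI a b. f x = g x"
  shows "(\<integral>x. f x \<partial>MI a b) = (\<integral>x. (g x :: real) \<partial>MI a b)"
  unfolding LINT_MI[symmetric] by (rule set_integral_lebesgue_cong_AE) (use assms in \<open>simp add: AE_MI\<close>)

text \<open>Tests vanishing on the boundary would fix a flux only up to a function of time; the
  wider class of tests, which encodes zero flux through the boundary, removes this freedom. Testing
  with primitives of ray indicators shows that the primitive of the difference vanishes at each
  rational c for almost every t, with one null set for all c.\<close>

lemma weak_flux_unique:
  fixes p q :: real and K J :: "real \<times> real \<Rightarrow> real"
  assumes ab: "a < b" and pq: "1 < p" "1 < q" "1 / p + 1 / q = 1"
    and vt: "\<And>T. T > 0 \<Longrightarrow> AE t in MI 0 T. vt t \<in> dual_space (sobolev 1 p {a<..<b}) N"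
    and k: "weak_continuity_eq p {a<..<b} vt k" and j: "weak_continuity_eq p {a<..<b} vt j"
    and K: "K \<in> borel_measurable (lborel \<Otimes>\<^sub>M MI a b)" "integrable (lborel \<Otimes>\<^sub>M MI a b) (\<lambda>z. \<bar>K z\<bar> powr q)"
      "\<And>t x. t \<notin> {0<..<r} \<Longrightarrow> K (t, x) = 0" "AE t in lborel. t \<in> {0<..<r} \<longrightarrow> (AE x in MI a b. K (t, x) = k t x)"
    and J: "J \<in> borel_measurable (lborel \<Otimes>\<^sub>M MI a b)" "integrable (lborel \<Otimes>\<^sub>M MI a b) (\<lambda>z. \<bar>J z\<bar> powr q)"
      "\<And>t x. t \<notin> {0<..<r} \<Longrightarrow> J (t, x) = 0" "AE t in lborel. t \<in> {0<..<r} \<longrightarrow> (AE x in MI a b. J (t, x) = j t x)"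
  shows "AE t in lborel. t \<in> {0<..<r} \<longrightarrow> (AE x in MI a b. k t x = j t x)"
proof -
  interpret P: pair_sigma_finite lborel "MI a b" by (rule pair_lborel[OF sigma_finite_MI])
  have K3: "\<forall>t x. t \<notin> {0<..<r} \<longrightarrow> K (t, x) = 0" and J3: "\<forall>t x. t \<notin> {0<..<r} \<longrightarrow> J (t, x) = 0" using K(3) J(3) by blast+
  note KK = K(1,2) K3 K(4) and JJ = J(1,2) J3 J(4)
  have pair: "set_integrable lebesgue {0<..<r} (\<lambda>t. (\<integral>x. K (t, x) * wderiv {a<..<b} 1 \<psi> x \<partial>MI a b) * \<eta> t)"
    "(LINT t:{0<..<r}|lebesgue. (\<integral>x. K (t, x) * wderiv {a<..<b} 1 \<psi> x \<partial>MI a b) * \<eta> t) = (LINT t:{0<..}|lebesgue. \<eta> t * vt t \<psi>)"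
    "locally_integrable {0<..<r} (\<lambda>t. \<integral>x. K (t, x) * wderiv {a<..<b} 1 \<psi> x \<partial>MI a b)"
    if \<psi>: "\<psi> \<in> sobolev 1 p {a<..<b}" and \<eta>: "test_fun {0<..<r} \<eta>" and k: "weak_continuity_eq p {a<..<b} vt k"
      and K: "K \<in> borel_measurable (lborel \<Otimes>\<^sub>M MI a b)" "integrable (lborel \<Otimes>\<^sub>M MI a b) (\<lambda>z. \<bar>K z\<bar> powr q)"
      "\<forall>t x. t \<notin> {0<..<r} \<longrightarrow> K (t, x) = 0" "AE t in lborel. t \<in> {0<..<r} \<longrightarrow> (AE x in MI a b. K (t, x) = k t x)"
    for \<psi> \<eta> k and K :: "real \<times> real \<Rightarrow> real"
  proof -
    let ?w = "wderiv {a<..<b} 1 \<psi>" and ?y = "\<lambda>t. \<integral>x. K (t, x) * wderiv {a<..<b} 1 \<psi> x \<partial>MI a b"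
    have w: "?w \<in> borel_measurable (MI a b)" "integrable (MI a b) (\<lambda>x. \<bar>?w x\<bar> powr p)"
      using sobolev_wderiv[OF \<psi>, of 1] by auto
    have il: "integrable lborel ?y" by (rule joint_pairing(1)[OF pq K(1,2) _ w, of r]) (use K(3) in blast)
    then have iL: "integrable lebesgue ?y" by (subst integrable_completion) auto
    show li: "locally_integrable {0<..<r} ?y"
      unfolding locally_integrable_def set_integrable_def 
      by (intro allI impI integrable_mult_indicator[OF _ iL]) (auto intro!: sets_completionI_sets borel_compact)
    show "set_integrable lebesgue {0<..<r} (\<lambda>t. ?y t * \<eta> t)" by (rule test_fun_mult_integrable[OF _ li \<eta>]) simp
    have p0: "p > 0" using pq by simp
    have \<eta>0: "\<eta> t = 0" if "t \<notin> {0<..<r}" for t using \<eta> that unfolding test_fun_def by blast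
    have "(LINT t:{0<..}|lebesgue. \<eta> t * vt t \<psi>) = (LINT t:{0<..}|lebesgue. \<eta> t * (\<integral>x. k t x * ?w x \<partial>MI a b))"
      by (rule weak_eq_product(1)[OF p0 vt k \<psi> test_fun_mono[OF \<eta>]]) auto
    also have "\<dots> = (LINT t:{0<..<r}|lebesgue. ?y t * \<eta> t)"
      unfolding set_lebesgue_integral_def
    proof (rule integral_lebesgue_cong_AE)
      show "AE t in lebesgue. indicat_real {0<..} t *\<^sub>R (\<eta> t * (\<integral>x. k t x * ?w x \<partial>MI a b)) = indicat_real {0<..<r} t *\<^sub>R (?y t * \<eta> t)"
        using AE_completion[OF K(4)]
      proof eventually_elim
        case (elim t)
        show ?case
        proof (cases "t \<in> {0<..<r}")
          case True
          then have "AE x in MI a b. k t x * ?w x = K (t, x) * ?w x" using elim by (auto elim: eventually_mono)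
          from integral_MI_cong_AE[OF this] show ?thesis using True by simp
        next
          case False
          then show ?thesis by (simp add: \<eta>0)
        qed
      qed
    qed
    finally show "(LINT t:{0<..<r}|lebesgue. ?y t * \<eta> t) = (LINT t:{0<..}|lebesgue. \<eta> t * vt t \<psi>)" by simp
  qed
  have joint: "integrable (lborel \<Otimes>\<^sub>M MI a b) K"
    if "K \<in> borel_measurable (lborel \<Otimes>\<^sub>M MI a b)" "integrable (lborel \<Otimes>\<^sub>M MI a b) (\<lambda>z. \<bar>K z\<bar> powr q)"
      "\<forall>t x. t \<notin> {0<..<r} \<longrightarrow> K (t, x) = 0" for K :: "real \<times> real \<Rightarrow> real"
    using joint_pairing(2)[OF pq that(1,2), of r "\<lambda>_. 1"] that(3) finite_measure.integrable_const[OF finite_MI, of a b 1] by simp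
  note KJ = P.AE_integrable_fst'[OF joint[OF KK(1-3)]] P.AE_integrable_fst'[OF joint[OF JJ(1-3)]]
  have c0: "AE t in lborel. t \<in> {0<..<r} \<longrightarrow> prim a b (\<lambda>x. K (t, x) - J (t, x)) c = 0" for c
  proof -
    have p1: "p \<ge> 1" using pq by simp
    note S = ray_prim_sobolev[OF ab p1, of c]
    let ?w = "wderiv {a<..<b} 1 (prim a b (indicator {..c}))"
    let ?y = "\<lambda>K t. \<integral>x. (K :: real \<times> real \<Rightarrow> real) (t, x) * ?w x \<partial>MI a b"
    \<comment> \<open>The interval from 1 to 0 is empty, so this is the zero function, a test
      function whatever r is. It instantiates a conclusion that does not mention \<eta>.\<close>
    have \<eta>: "test_fun {0<..<r} (bump 0 1 0)" by (rule test_fun_bump) simp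
    then have li: "locally_integrable {0<..<r} (?y K)" "locally_integrable {0<..<r} (?y J)"
      using pair(3)[OF S(1) \<eta> k KK] pair(3)[OF S(1) \<eta> j JJ] by blast+
    have "AE t in lebesgue. t \<in> {0<..<r} \<longrightarrow> 1 * ?y K t + (-1) * ?y J t = 0"
    proof (rule fundamental_lemma)
      show "locally_integrable {0<..<r} (\<lambda>t. 1 * ?y K t + (-1) * ?y J t)" by (rule locally_integrable_lincomb[OF li])
      fix \<eta> :: "real \<Rightarrow> real" assume \<eta>: "test_fun {0<..<r} \<eta>"
      note a = pair[OF S(1) \<eta> k KK] and b = pair[OF S(1) \<eta> j JJ]
      have "(LINT t:{0<..<r}|lebesgue. (1 * ?y K t + (-1) * ?y J t) * \<eta> t) = (LINT t:{0<..<r}|lebesgue. ?y K t * \<eta> t - ?y J t * \<eta> t)"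
        by (simp add: left_diff_distrib)
      also have "\<dots> = 0" using set_integral_diff(2)[OF a(1) b(1)] a(2) b(2) by simp
      finally show "(LINT t:{0<..<r}|lebesgue. (1 * ?y K t + (-1) * ?y J t) * \<eta> t) = 0" .
    qed simp
    then have "AE t in lborel. t \<in> {0<..<r} \<longrightarrow> ?y K t - ?y J t = 0" by (simp add: AE_completion_iff)
    with KJ show ?thesis
    proof eventually_elim
      case (elim t)
      have y: "?y F t = prim a b (\<lambda>x. F (t, x)) c" for F
        unfolding prim_def[of a b "\<lambda>x. F (t, x)"] by (rule integral_MI_cong_AE) (use S(2) in \<open>eventually_elim, simp add: mult.commute\<close>)
      have "prim a b (\<lambda>x. K (t, x) - J (t, x)) c = prim a b (\<lambda>x. K (t, x)) c - prim a b (\<lambda>x. J (t, x)) c"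
        unfolding prim_def right_diff_distrib
        by (intro Bochner_Integration.integral_diff integrable_MI_indicator elim) auto
      then show ?case using elim(3) unfolding y by simp
    qed
  qed
  have "AE t in lborel. \<forall>c\<in>\<rat>. t \<in> {0<..<r} \<longrightarrow> prim a b (\<lambda>x. K (t, x) - J (t, x)) c = 0"
    using c0 by (subst AE_ball_countable) (auto simp: countable_rat)
  with KJ K(4) J(4) show ?thesis
  proof eventually_elim
    case (elim t)
    show ?case
    proof
      assume t: "t \<in> {0<..<r}"
      have "AE x in MI a b. K (t, x) - J (t, x) = 0"
        by (rule AE_zero_of_prim[OF ab Bochner_Integration.integrable_diff]) (use elim t in auto)
      moreover have "AE x in MI a b. K (t, x) = k t x" "AE x in MI a b. J (t, x) = j t x" using elim t by blast+
      ultimately show "AE x in MI a b. k t x = j t x" by eventually_elim simp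
    qed
  qed
qed

lemma weak_continuity_eq_cong:
  assumes k: "weak_continuity_eq p {a<..<b} vt k"
    and eq: "AE t in lebesgue. t > 0 \<longrightarrow> (AE x in MI a b. k t x = j t x)"
  shows "weak_continuity_eq p {a<..<b} vt j"
  unfolding weak_continuity_eq_def
proof (intro ballI)
  let ?S = "{a<..<b}"
  have ae0: "AE t in lebesgue. t \<noteq> (0::real)" by (intro AE_completion AE_lborel_singleton)
  have I: "{0::real..} \<inter> space lebesgue \<in> sets lebesgue" by simp
  fix \<phi> assume \<phi>: "\<phi> \<in> time_test p ?S"
  let ?w = "\<lambda>t. wderiv ?S 1 (\<phi> t)"
  have k1: "AE t in lebesgue_on {0..}. set_integrable lebesgue ?S (\<lambda>x. k t x * ?w t x)"
    and k2: "set_integrable lebesgue {0..} (\<lambda>t. LINT x:?S|lebesgue. \<bar>k t x * ?w t x\<bar>)"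
    and k3: "(LINT t:{0..}|lebesgue. vt t (\<phi> t)) - (LINT t:{0..}|lebesgue. LINT x:?S|lebesgue. k t x * ?w t x) = 0"
    using k \<phi> unfolding weak_continuity_eq_def by blast+
  have cong: "integrable lebesgue g" if f: "integrable lebesgue f" and ae: "AE x in lebesgue. f x = g x" for f g :: "real \<Rightarrow> real"
    by (rule integrable_cong_AE_imp[OF f borel_measurable_lebesgue_cong_AE[OF borel_measurable_integrable[OF f] ae]]) (use ae in eventually_elim, simp)
  have E: "AE t in lebesgue. t \<in> {0..} \<longrightarrow> (AE x in lebesgue. x \<in> ?S \<longrightarrow> k t x * ?w t x = j t x * ?w t x)"
    using eq ae0
  proof eventually_elim
    case (elim t)
    show ?case
    proof
      assume "t \<in> {0..}"
      then have "AE x in lebesgue. x \<in> ?S \<longrightarrow> k t x = j t x" using elim by (simp add: AE_MI)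
      then show "AE x in lebesgue. x \<in> ?S \<longrightarrow> k t x * ?w t x = j t x * ?w t x" by eventually_elim simp
    qed
  qed
  have "AE t in lebesgue. t \<in> {0..} \<longrightarrow> set_integrable lebesgue ?S (\<lambda>x. k t x * ?w t x)"
    using k1 unfolding AE_restrict_space_iff[OF I] .
  with E have "AE t in lebesgue. t \<in> {0..} \<longrightarrow> set_integrable lebesgue ?S (\<lambda>x. j t x * ?w t x)"
  proof eventually_elim
    case (elim t)
    show ?case
    proof
      assume t: "t \<in> {0..}"
      then have i: "integrable lebesgue (\<lambda>x. indicat_real ?S x *\<^sub>R (k t x * ?w t x))" using elim by (simp add: set_integrable_def)
      have "AE x in lebesgue. x \<in> ?S \<longrightarrow> k t x * ?w t x = j t x * ?w t x" using elim t by blast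
      then have "AE x in lebesgue. indicat_real ?S x *\<^sub>R (k t x * ?w t x) = indicat_real ?S x *\<^sub>R (j t x * ?w t x)"
        by eventually_elim (auto split: split_indicator)
      from cong[OF i this] show "set_integrable lebesgue ?S (\<lambda>x. j t x * ?w t x)" by (simp add: set_integrable_def)
    qed
  qed
  then have j1: "AE t in lebesgue_on {0..}. set_integrable lebesgue ?S (\<lambda>x. j t x * ?w t x)"
    unfolding AE_restrict_space_iff[OF I] .
  have "AE t in lebesgue. indicat_real {0..} t *\<^sub>R (LINT x:?S|lebesgue. \<bar>k t x * ?w t x\<bar>) = indicat_real {0..} t *\<^sub>R (LINT x:?S|lebesgue. \<bar>j t x * ?w t x\<bar>)"
    using E
  proof eventually_elim
    case (elim t)
    have "(LINT x:?S|lebesgue. \<bar>k t x * ?w t x\<bar>) = (LINT x:?S|lebesgue. \<bar>j t x * ?w t x\<bar>)" if "t \<in> {0..}"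
      by (rule set_integral_lebesgue_cong_AE) (use elim that in \<open>auto elim: eventually_mono\<close>)
    then show ?case by (auto split: split_indicator)
  qed
  from cong[OF k2[unfolded set_integrable_def] this]
  have j2: "set_integrable lebesgue {0..} (\<lambda>t. LINT x:?S|lebesgue. \<bar>j t x * ?w t x\<bar>)" by (simp add: set_integrable_def)
  have "(LINT t:{0..}|lebesgue. LINT x:?S|lebesgue. k t x * ?w t x) = (LINT t:{0..}|lebesgue. LINT x:?S|lebesgue. j t x * ?w t x)"
  proof (rule set_integral_lebesgue_cong_AE)
    show "AE t in lebesgue. t \<in> {0..} \<longrightarrow> (LINT x:?S|lebesgue. k t x * ?w t x) = (LINT x:?S|lebesgue. j t x * ?w t x)"
      using E by eventually_elim (auto intro: set_integral_lebesgue_cong_AE)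
  qed
  with k3 j1 j2
  show "(AE t in lebesgue_on {0..}. set_integrable lebesgue ?S (\<lambda>x. j t x * ?w t x)) \<and>
    set_integrable lebesgue {0..} (\<lambda>t. LINT x:?S|lebesgue. \<bar>j t x * ?w t x\<bar>) \<and>
    (LINT t:{0..}|lebesgue. vt t (\<phi> t)) - (LINT t:{0..}|lebesgue. LINT x:?S|lebesgue. j t x * ?w t x) = 0" by simp
qed

text \<open>Take the first time r at which some value is at most \<delta>/2; it exists by
  compactness. Before r all values are positive, hence at least \<delta> by the step, and by
  continuity the values at r are at least \<delta> too.\<close>

lemma continuation:
  fixes f :: "real \<Rightarrow> real \<Rightarrow> real"
  assumes f: "continuous_on ({s..t} \<times> {a..b}) (\<lambda>z. f (fst z) (snd z))" and \<delta>: "\<delta> > 0"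
    and step: "\<And>r x. r \<in> {s..t} \<Longrightarrow> (\<And>\<rho> y. \<rho> \<in> {s..r} \<Longrightarrow> y \<in> {a..b} \<Longrightarrow> f \<rho> y > 0) \<Longrightarrow> x \<in> {a..b} \<Longrightarrow> f r x \<ge> \<delta>"
    and base: "\<And>x. x \<in> {a..b} \<Longrightarrow> f s x \<ge> \<delta>"
    and \<tau>: "\<tau> \<in> {s..t}" "x \<in> {a..b}"
  shows "f \<tau> x > 0"
proof (rule ccontr)
  assume neg: "\<not> f \<tau> x > 0"
  let ?R = "{s..t} \<times> {a..b}"
  define S where "S = fst ` {z \<in> ?R. f (fst z) (snd z) \<le> \<delta> / 2}"
  have cR: "compact ?R" by (intro compact_Times) auto
  have "compact (?R \<inter> (\<lambda>z. f (fst z) (snd z)) -` {..\<delta> / 2})"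
    using closedin_compact[OF cR continuous_closedin_preimage[OF f closed_atMost]] .
  also have "?R \<inter> (\<lambda>z. f (fst z) (snd z)) -` {..\<delta> / 2} = {z \<in> ?R. f (fst z) (snd z) \<le> \<delta> / 2}" by auto
  finally have "compact {z \<in> ?R. f (fst z) (snd z) \<le> \<delta> / 2}" .
  then have cS: "compact S" unfolding S_def by (intro compact_continuous_image continuous_on_fst continuous_on_id) simp
  have "\<tau> \<in> S" unfolding S_def using \<tau> neg \<delta> by (intro image_eqI[of _ _ "(\<tau>, x)"]) auto
  then have "S \<noteq> {}" by blast
  then obtain r where r: "r \<in> S" "\<And>\<rho>. \<rho> \<in> S \<Longrightarrow> r \<le> \<rho>" using compact_attains_inf[OF cS] by blast
  then obtain y where y: "r \<in> {s..t}" "y \<in> {a..b}" "f r y \<le> \<delta> / 2" by (auto simp: S_def)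
  have big: "f \<rho> x > \<delta> / 2" if "\<rho> \<in> {s..<r}" "x \<in> {a..b}" for \<rho> x
  proof (rule ccontr)
    assume "\<not> ?thesis"
    then have "\<rho> \<in> S" unfolding S_def using that y(1) by (intro image_eqI[of _ _ "(\<rho>, x)"]) auto
    then show False using r(2) that by force
  qed
  have ge: "f \<rho> x \<ge> \<delta>" if \<rho>: "\<rho> \<in> {s..<r}" "x \<in> {a..b}" for \<rho> x
  proof (rule step[OF _ _ \<rho>(2)])
    show "\<rho> \<in> {s..t}" using \<rho> y by auto
    fix \<rho>' y assume "\<rho>' \<in> {s..\<rho>}" "y \<in> {a..b}"
    then have "f \<rho>' y > \<delta> / 2" using \<rho> by (intro big) auto
    then show "f \<rho>' y > 0" using \<delta> by simp
  qed
  have "f r y \<ge> \<delta>"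
  proof (cases "r = s")
    case True
    then show ?thesis using base y by simp
  next
    case False
    then have sr: "s < r" using y by simp
    have "continuous_on {s..r} (\<lambda>\<rho>. f \<rho> y)"
    proof -
      have c: "continuous_on {s..r} (\<lambda>\<rho>. (\<rho>, y))" by (intro continuous_intros)
      have "(\<lambda>\<rho>. (\<rho>, y)) ` {s..r} \<subseteq> ?R" using y by auto
      from continuous_on_compose2[OF f c this] show ?thesis by simp
    qed
    then show ?thesis using continuous_ge_on_closure[of "{s..<r}" "\<lambda>\<rho>. f \<rho> y" r \<delta>] ge y(2) sr by simp
  qed
  then show False using y(3) \<delta> by simp
qed

section \<open>Energy balance\<close>

lemma AE_iff_cong:
  assumes "AE x in N. P x \<longleftrightarrow> Q x" shows "(AE x in N. P x) \<longleftrightarrow> (AE x in N. Q x)"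
proof
  show "AE x in N. Q x" if "AE x in N. P x" using that assms by eventually_elim blast
  show "AE x in N. P x" if "AE x in N. Q x" using that assms by eventually_elim blast
qed

locale tfe = gflow +
  fixes \<alpha> c \<sigma> :: real and m :: "real \<Rightarrow> real" and H :: "real \<Rightarrow> ennreal" and k :: "real \<Rightarrow> real \<Rightarrow> real"
  assumes \<alpha>: "\<alpha> > 0" and pa: "p = \<alpha> + 1" and qa: "q = (\<alpha> + 1) / \<alpha>"
    and m: "continuous_on UNIV m" "\<And>s. s > 0 \<Longrightarrow> m s > 0"
    and H: "\<And>s. s > 0 \<Longrightarrow> H s = ennreal (h s)" "\<And>s. s > 0 \<Longrightarrow> h s \<ge> 0" "\<And>s. s > 0 \<Longrightarrow> dd H s = h2 s"
    and low: "c > 0" "\<sigma> > 0" "\<And>s. 0 \<le> s \<Longrightarrow> s \<le> \<sigma> \<Longrightarrow> ennreal c / (ennreal s)\<^sup>2 \<le> H s" "\<And>s. s < 0 \<Longrightarrow> H s = \<infinity>"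
    and kK: "AE t in lborel. t \<in> {0<..<T} \<longrightarrow> (AE x in MI a b. K (t, x) = k t x)"
begin

abbreviation "\<Omega> \<equiv> {a<..<b}"

definition J :: "real \<Rightarrow> real \<Rightarrow> real" where
  "J t x = m (v t x) * Psi \<alpha> (force \<Omega> H v t x)"

text \<open>Jointly measurable counterpart of \<open>J\<close>, restricted to (s, t) through
  \<open>frc\<close>; \<open>J\<close> itself is built from derivatives chosen slice by
  slice.\<close>

definition Jr :: "real \<Rightarrow> real \<Rightarrow> real \<times> real \<Rightarrow> real" where
  "Jr s t z = m (vc (fst z) (snd z)) * Psi \<alpha> (frc s t z)"

definition A :: "real \<Rightarrow> real \<Rightarrow> real \<times> real \<Rightarrow> real" where
  "A s t z = indicator {s<..<t} (fst z) * (\<bar>K z\<bar> powr q / m (vc (fst z) (snd z)) powr (1 / \<alpha>))"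

definition B :: "real \<Rightarrow> real \<Rightarrow> real \<times> real \<Rightarrow> real" where
  "B s t z = m (vc (fst z) (snd z)) * \<bar>frc s t z\<bar> powr p"

text \<open>The deficit in the weighted Young inequality for force times flux. Its integral is the
  excess in the dissipation inequality.\<close>

definition gap :: "real \<Rightarrow> real \<Rightarrow> real \<times> real \<Rightarrow> real" where
  "gap s t z = \<alpha> / (\<alpha> + 1) * A s t z + 1 / (\<alpha> + 1) * B s t z - frc s t z * K z"

lemma energy_eq:
  assumes t: "0 \<le> t" "t < T" and P: "Pos t t"
  shows "energy \<Omega> H (v t) = ennreal (En t)" "En t \<ge> 0"
proof -
  have pos: "vc t x > 0" if "x \<in> {a..b}" for x using P that by (simp add: Pos_def)
  have hi: "integrable M (\<lambda>x. h (vc t x))"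
    by (rule continuous_integrable_MI[OF slice_continuous[OF P t hc]]) simp
  have i: "integrable M (\<lambda>x. 1 / 2 * (W t x)\<^sup>2 + h (vc t x))" using W_props(3)[OF t] hi by simp
  have nn: "AE x in M. 0 \<le> 1 / 2 * (W t x)\<^sup>2 + h (vc t x)"
    using pos H(2) by (intro AE_I2) (auto simp: space_MI intro!: add_nonneg_nonneg)
  have En: "En t = (\<integral>x. 1 / 2 * (W t x)\<^sup>2 + h (vc t x) \<partial>M)"
    unfolding En_def using W_props(3)[OF t] hi by simp
  have "energy \<Omega> H (v t) = (\<integral>\<^sup>+x. ennreal (1 / 2 * \<bar>W t x\<bar>\<^sup>2) + H (v t x) \<partial>M)"
    unfolding energy_def using W_props(1)[OF t] by (auto simp: nn_MI)
  also have "\<dots> = (\<integral>\<^sup>+x. ennreal (1 / 2 * (W t x)\<^sup>2 + h (vc t x)) \<partial>M)"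
  proof (rule nn_integral_cong_AE)
    show "AE x in M. ennreal (1 / 2 * \<bar>W t x\<bar>\<^sup>2) + H (v t x) = ennreal (1 / 2 * (W t x)\<^sup>2 + h (vc t x))"
      using vc_props(2)[OF t] AE_space
    proof eventually_elim
      case (elim x)
      then have "vc t x > 0" by (intro pos) (auto simp: space_MI)
      then show ?case using elim(1) H(1,2) by (simp add: ennreal_plus)
    qed
  qed
  also have "\<dots> = ennreal (En t)" unfolding En by (rule nn_integral_eq_integral[OF i nn])
  finally show "energy \<Omega> H (v t) = ennreal (En t)" .
  show "En t \<ge> 0" unfolding En by (rule integral_nonneg_AE[OF nn])
qed

text \<open>The bound \<delta> depends on C and, through \<open>Hoe\<close>, on the horizon T, but
  not on t. This uniformity is what \<open>continuation\<close> needs.\<close>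

lemma energy_lower:
  assumes C: "C \<ge> 0"
  obtains \<delta> where "\<delta> > 0" "\<And>t x. \<lbrakk>0 \<le> t; t < T; energy \<Omega> H (v t) \<le> ennreal C; x \<in> {a..b}\<rbrakk> \<Longrightarrow> \<delta> \<le> vc t x"
proof -
  have H0: "Hoe > 0" using Hoe_pos by simp
  show thesis
  proof (rule potential_lower_bound[OF ab H0 low(1,2) C, of H])
    show "ennreal c / (ennreal s)\<^sup>2 \<le> H s" if "0 \<le> s" "s \<le> \<sigma>" for s using that by (rule low(3))
    show "H s = \<infinity>" if "s < 0" for s using that by (rule low(4))
    fix \<delta> assume \<delta>: "\<delta> > 0" "\<And>u x. \<lbrakk>\<And>x y. x \<in> {a..b} \<Longrightarrow> y \<in> {a..b} \<Longrightarrow> \<bar>u y - u x\<bar> \<le> Hoe * sqrt \<bar>y - x\<bar>;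
      (\<integral>\<^sup>+x. H (u x) \<partial>M) \<le> ennreal C; x \<in> {a..b}\<rbrakk> \<Longrightarrow> \<delta> \<le> u x"
    show thesis
  proof (rule that[OF \<delta>(1)])
    fix t x assume t: "0 \<le> t" "t < T" and e: "energy \<Omega> H (v t) \<le> ennreal C" and x: "x \<in> {a..b}"
    have "(\<integral>\<^sup>+x. H (vc t x) \<partial>M) \<le> (\<integral>\<^sup>+x. ennreal (1 / 2 * \<bar>W t x\<bar>\<^sup>2) + H (v t x) \<partial>M)"
    proof (rule nn_integral_mono_AE)
      show "AE x in M. H (vc t x) \<le> ennreal (1 / 2 * \<bar>W t x\<bar>\<^sup>2) + H (v t x)"
        using vc_props(2)[OF t] by eventually_elim simp
    qed
    also have "\<dots> = energy \<Omega> H (v t)"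
      unfolding energy_def using W_props(1)[OF t] by (auto simp: nn_MI)
    also note e
    finally show "\<delta> \<le> vc t x" by (intro \<delta>(2)[OF vc_Hoelder[OF t] _ x])
  qed
  qed
qed

text \<open>The dissipations are iterated integrals of slices. The endpoints s and t are null, and
  almost every slice agrees with one of the jointly measurable F, to which Tonelli applies.\<close>

lemma dissipation_joint:
  assumes F: "integrable L.P F" "\<And>z. z \<in> space L.P \<Longrightarrow> F z \<ge> 0" "\<And>\<tau> x. \<tau> \<notin> {s<..<t} \<Longrightarrow> F (\<tau>, x) = 0"
    and X: "AE \<tau> in lborel. \<tau> \<in> {s<..<t} \<longrightarrow> (AE x in M. X \<tau> x = ennreal (F (\<tau>, x)))"
  shows "(\<integral>\<^sup>+\<tau>\<in>{s..t}. (\<integral>\<^sup>+x\<in>\<Omega>. X \<tau> x \<partial>lebesgue) \<partial>lebesgue) = ennreal (\<integral>z. F z \<partial>L.P)"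
proof -
  have Fm: "(\<lambda>z. ennreal (F z)) \<in> borel_measurable L.P" using F(1) by measurable
  have "(\<integral>\<^sup>+\<tau>\<in>{s..t}. (\<integral>\<^sup>+x\<in>\<Omega>. X \<tau> x \<partial>lebesgue) \<partial>lebesgue) = (\<integral>\<^sup>+\<tau>. (\<integral>\<^sup>+x. ennreal (F (\<tau>, x)) \<partial>M) \<partial>lebesgue)"
  proof (rule nn_integral_cong_AE)
    show "AE \<tau> in lebesgue. (\<integral>\<^sup>+x\<in>\<Omega>. X \<tau> x \<partial>lebesgue) * indicator {s..t} \<tau> = (\<integral>\<^sup>+x. ennreal (F (\<tau>, x)) \<partial>M)"
      using AE_completion[OF X] AE_completion[OF AE_lborel_singleton[of s]] AE_completion[OF AE_lborel_singleton[of t]]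
    proof eventually_elim
      case (elim \<tau>)
      show ?case
      proof (cases "\<tau> \<in> {s<..<t}")
        case True
        then have "AE x in M. X \<tau> x = ennreal (F (\<tau>, x))" using elim by blast
        from nn_integral_cong_AE[OF this] show ?thesis using True by (simp add: nn_MI)
      next
        case False
        then have "\<tau> \<notin> {s..t}" using elim by auto
        then show ?thesis using F(3)[OF False] by simp
      qed
    qed
  qed
  also have "\<dots> = (\<integral>\<^sup>+\<tau>. (\<integral>\<^sup>+x. ennreal (F (\<tau>, x)) \<partial>M) \<partial>lborel)" by (rule nn_integral_completion)
  also have "\<dots> = (\<integral>\<^sup>+z. ennreal (F z) \<partial>L.P)" using sigma_finite_measure.nn_integral_fst[OF sigma_finite_MI Fm] by simp
  also have "\<dots> = ennreal (\<integral>z. F z \<partial>L.P)" by (rule nn_integral_eq_integral[OF F(1)]) (use F(2) in \<open>intro AE_I2\<close>)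
  finally show ?thesis .
qed

text \<open>The comparison of \<open>frc\<close> with \<open>force\<close> is conditional because
  \<open>dd H\<close> is tied to h2 at positive arguments only.\<close>

lemma slices:
  assumes "0 \<le> s" "t < T"
  shows "AE \<tau> in lborel. \<tau> \<in> {s<..<t} \<longrightarrow> (AE x in M. K (\<tau>, x) = k \<tau> x \<and> vc \<tau> x = v \<tau> x \<and>
    (vc \<tau> x > 0 \<longrightarrow> frc s t (\<tau>, x) = force \<Omega> H v \<tau> x))"
  using AE_good kK
proof eventually_elim
  case (elim \<tau>)
  show ?case
  proof
    assume \<tau>: "\<tau> \<in> {s<..<t}"
    then have \<tau>': "\<tau> \<in> {0<..<T}" "0 \<le> \<tau>" "\<tau> < T" using assms by auto
    have g: "good \<tau>" using elim \<tau>' by blast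
    have "AE x in M. U1 (\<tau>, x) = W \<tau> x" "AE x in M. U3 (\<tau>, x) = wderiv \<Omega> 3 (v \<tau>) x" using g by (auto simp: good_def)
    moreover have "AE x in M. K (\<tau>, x) = k \<tau> x" using elim \<tau>' by blast
    ultimately show "AE x in M. K (\<tau>, x) = k \<tau> x \<and> vc \<tau> x = v \<tau> x \<and> (vc \<tau> x > 0 \<longrightarrow> frc s t (\<tau>, x) = force \<Omega> H v \<tau> x)"
      using vc_props(2)[OF \<tau>'(2,3)] by eventually_elim (use \<tau> H(3) in \<open>simp add: frc_def force_def\<close>)
  qed
qed

section \<open>Energy balance on an interval of positivity\<close>

context
  fixes s t assumes P: "Pos s t" and st: "0 \<le> s" "s < t" "t < T"
begin

lemma pos_slice: "\<tau> \<in> {s..t} \<Longrightarrow> x \<in> {a..b} \<Longrightarrow> vc \<tau> x > 0"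
  using P by (simp add: Pos_def)

text \<open>Compactness bounds g along v on the rectangle, and F vanishes where this composition is
  uncontrolled.\<close>

lemma rect_comp:
  assumes g: "continuous_on {0<..} (g :: real \<Rightarrow> real)" and F: "F \<in> borel_measurable L.P"
    "\<And>\<tau> x. \<tau> \<notin> {s<..<t} \<Longrightarrow> F (\<tau>, x) = 0"
  shows "(\<lambda>z. g (vc (fst z) (snd z)) * F z) \<in> borel_measurable L.P"
    "\<And>r. integrable L.P (\<lambda>z. \<bar>F z\<bar> powr r) \<Longrightarrow> r > 0 \<Longrightarrow> integrable L.P (\<lambda>z. \<bar>g (vc (fst z) (snd z)) * F z\<bar> powr r)"
proof -
  note [measurable] = F(1)
  have [measurable]: "(\<lambda>z. indicator {s..t} (fst z) * g (vc (fst z) (snd z))) \<in> borel_measurable L.P"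
    by (rule rect_measurable[OF Pos_comp[OF P st(1,3) g]])
  have eq: "(\<lambda>z. (indicator {s..t} (fst z) * g (vc (fst z) (snd z))) * F z) = (\<lambda>z. g (vc (fst z) (snd z)) * F z)"
    using F(2) by (auto simp: fun_eq_iff split: split_indicator)
  have "(\<lambda>z. (indicator {s..t} (fst z) * g (vc (fst z) (snd z))) * F z) \<in> borel_measurable L.P" by measurable
  then show meas: "(\<lambda>z. g (vc (fst z) (snd z)) * F z) \<in> borel_measurable L.P" unfolding eq .
  fix r :: real assume i: "integrable L.P (\<lambda>z. \<bar>F z\<bar> powr r)" and r: "r > 0"
  obtain C where C: "C > 0" "\<And>\<tau> x. \<tau> \<in> {s..t} \<Longrightarrow> x \<in> {a..b} \<Longrightarrow> \<bar>g (vc \<tau> x)\<bar> \<le> C" by (rule Pos_bound[OF P st(1,3) g, OF that])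
  show "integrable L.P (\<lambda>z. \<bar>g (vc (fst z) (snd z)) * F z\<bar> powr r)"
  proof (rule Bochner_Integration.integrable_bound)
    show "integrable L.P (\<lambda>z. C powr r * \<bar>F z\<bar> powr r)" using i by simp
    show "(\<lambda>z. \<bar>g (vc (fst z) (snd z)) * F z\<bar> powr r) \<in> borel_measurable L.P" using meas by measurable
    show "AE z in L.P. norm (\<bar>g (vc (fst z) (snd z)) * F z\<bar> powr r) \<le> norm (C powr r * \<bar>F z\<bar> powr r)"
    proof (rule AE_I2)
      fix z assume "z \<in> space L.P"
      then have z: "snd z \<in> {a..b}" by (auto simp: space_pair_MI)
      have "\<bar>g (vc (fst z) (snd z)) * F z\<bar> \<le> C * \<bar>F z\<bar>"
      proof (cases "fst z \<in> {s<..<t}")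
        case True
        then show ?thesis using C(2)[of "fst z" "snd z"] z by (auto simp: abs_mult intro!: mult_right_mono)
      next
        case False
        then show ?thesis using F(2)[of "fst z" "snd z"] by simp
      qed
      then have "\<bar>g (vc (fst z) (snd z)) * F z\<bar> powr r \<le> (C * \<bar>F z\<bar>) powr r" using r by (intro powr_mono2) auto
      then show "norm (\<bar>g (vc (fst z) (snd z)) * F z\<bar> powr r) \<le> norm (C powr r * \<bar>F z\<bar> powr r)" using C(1) by (simp add: powr_mult)
    qed
  qed
qed

lemma mc: "continuous_on {0<..} m" "continuous_on {0<..} (\<lambda>s. 1 / m s powr (1 / \<alpha>))"
proof -
  show c: "continuous_on {0<..} m" by (rule continuous_on_subset[OF m(1)]) simp
  have "m s \<noteq> 0" if "s \<in> {0<..}" for s using m(2)[of s] that by simp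
  then show "continuous_on {0<..} (\<lambda>s. 1 / m s powr (1 / \<alpha>))" by (auto intro!: continuous_intros c)
qed

lemma frc_out: "\<tau> \<notin> {s<..<t} \<Longrightarrow> frc s t (\<tau>, x) = 0"
  by (simp add: frc_def)

lemma A_props: "integrable L.P (A s t)" "z \<in> space L.P \<Longrightarrow> A s t z \<ge> 0"
proof -
  note [measurable] = K(1)
  have q0: "q > 0" using pq by simp
  have i: "integrable L.P (\<lambda>z. indicator {s<..<t} (fst z) * \<bar>K z\<bar> powr q)"
  proof (rule Bochner_Integration.integrable_bound[OF K(2)])
    show "(\<lambda>z. indicator {s<..<t} (fst z) * \<bar>K z\<bar> powr q) \<in> borel_measurable L.P" by measurable
  qed (auto split: split_indicator)
  then have i': "integrable L.P (\<lambda>z. \<bar>indicator {s<..<t} (fst z) * \<bar>K z\<bar> powr q\<bar> powr 1)" by (simp add: abs_mult)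
  note rc = rect_comp[OF mc(2) borel_measurable_integrable[OF i]]
  have eq: "A s t = (\<lambda>z. 1 / m (vc (fst z) (snd z)) powr (1 / \<alpha>) * (indicator {s<..<t} (fst z) * \<bar>K z\<bar> powr q))"
    by (auto simp: A_def fun_eq_iff)
  show nn: "A s t z \<ge> 0" for z unfolding A_def by simp
  have "integrable L.P (\<lambda>z. \<bar>A s t z\<bar> powr 1)" unfolding eq by (rule rc(2)[OF _ i']) auto
  then show "integrable L.P (A s t)" using nn by simp
qed

lemma B_props: "integrable L.P (B s t)" "z \<in> space L.P \<Longrightarrow> B s t z \<ge> 0"
proof -
  note E = energy_identity[OF P st]
  have p0: "p > 0" using pq by simp
  have i': "integrable L.P (\<lambda>z. \<bar>\<bar>frc s t z\<bar> powr p\<bar> powr 1)" using E(2) by simp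
  have z0: "\<bar>frc s t (\<tau>, x)\<bar> powr p = 0" if "\<tau> \<notin> {s<..<t}" for \<tau> x using frc_out[OF that] p0 by simp
  have i: "integrable L.P (\<lambda>z. \<bar>B s t z\<bar> powr 1)" unfolding B_def
    by (rule rect_comp(2)[OF mc(1) borel_measurable_integrable[OF E(2)] z0 i']) auto
  have m': "B s t \<in> borel_measurable L.P" unfolding B_def[abs_def]
    by (rule rect_comp(1)[OF mc(1) borel_measurable_integrable[OF E(2)] z0])
  show "integrable L.P (B s t)" by (rule Bochner_Integration.integrable_bound[OF i m']) simp
  show "B s t z \<ge> 0" if "z \<in> space L.P"
  proof (cases "fst z \<in> {s<..<t}")
    case True
    then have "m (vc (fst z) (snd z)) > 0" using that by (intro m(2) pos_slice) (auto simp: space_pair_MI)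
    then show ?thesis by (simp add: B_def)
  next
    case False
    then show ?thesis using frc_out[OF False, of "snd z"] p0 by (simp add: B_def)
  qed
qed

text \<open>Since \<alpha> q = p, the q-th power of |\<Psi>(f)| is |f|^p. This gives the flux of the
  thin-film equation the integrability that uniqueness of fluxes asks for.\<close>

lemma Jr_props: "Jr s t \<in> borel_measurable L.P" "integrable L.P (\<lambda>z. \<bar>Jr s t z\<bar> powr q)" "\<tau> \<notin> {s<..<t} \<Longrightarrow> Jr s t (\<tau>, x) = 0"
proof -
  note E = energy_identity[OF P st]
  note [measurable] = E(1)
  have q0: "q > 0" using pq by simp
  have Pm: "(\<lambda>z. Psi \<alpha> (frc s t z)) \<in> borel_measurable L.P" unfolding Psi_def by measurable
  have "\<bar>Psi \<alpha> y\<bar> powr q = \<bar>y\<bar> powr p" for y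
  proof (cases "y = 0")
    case False
    have "\<bar>Psi \<alpha> y\<bar> = \<bar>y\<bar> powr \<alpha>" using False by (simp add: Psi_def abs_mult powr_diff)
    then show ?thesis using \<alpha> by (simp add: powr_powr pa qa)
  qed (use pq in \<open>simp add: Psi_def\<close>)
  then have i: "integrable L.P (\<lambda>z. \<bar>Psi \<alpha> (frc s t z)\<bar> powr q)" using E(2) by simp
  have z0: "Psi \<alpha> (frc s t (\<tau>, x)) = 0" if "\<tau> \<notin> {s<..<t}" for \<tau> x using frc_out[OF that] by (simp add: Psi_def)
  show "Jr s t \<in> borel_measurable L.P" unfolding Jr_def[abs_def] by (rule rect_comp(1)[OF mc(1) Pm z0])
  show "integrable L.P (\<lambda>z. \<bar>Jr s t z\<bar> powr q)" unfolding Jr_def by (rule rect_comp(2)[OF mc(1) Pm z0 i q0])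
  show "Jr s t (\<tau>, x) = 0" if "\<tau> \<notin> {s<..<t}" using z0[OF that] by (simp add: Jr_def)
qed

lemma Jr_J: "AE \<tau> in lborel. \<tau> \<in> {s<..<t} \<longrightarrow> (AE x in M. Jr s t (\<tau>, x) = J \<tau> x)"
  using slices[OF st(1,3)]
proof eventually_elim
  case (elim \<tau>)
  show ?case
  proof
    assume \<tau>: "\<tau> \<in> {s<..<t}"
    then have "AE x in M. K (\<tau>, x) = k \<tau> x \<and> vc \<tau> x = v \<tau> x \<and> (vc \<tau> x > 0 \<longrightarrow> frc s t (\<tau>, x) = force \<Omega> H v \<tau> x)" using elim by blast
    then show "AE x in M. Jr s t (\<tau>, x) = J \<tau> x"
      using AE_space
    proof eventually_elim
      case (elim x)
      then have "vc \<tau> x > 0" using \<tau> by (intro pos_slice) (auto simp: space_MI)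
      then show ?case using elim by (simp add: Jr_def J_def)
    qed
  qed
qed

lemma flux_dissipation_eq: "flux_dissipation \<Omega> \<alpha> m v k s t = ennreal (\<integral>z. A s t z \<partial>L.P)"
  unfolding flux_dissipation_def
proof (rule dissipation_joint[OF A_props])
  show "A s t (\<tau>, x) = 0" if "\<tau> \<notin> {s<..<t}" for \<tau> x using that by (simp add: A_def)
  show "AE \<tau> in lborel. \<tau> \<in> {s<..<t} \<longrightarrow> (AE x in M. ennreal (\<bar>k \<tau> x\<bar> powr ((\<alpha> + 1) / \<alpha>)) / ennreal (m (v \<tau> x) powr (1 / \<alpha>)) = ennreal (A s t (\<tau>, x)))"
    using slices[OF st(1,3)]
  proof eventually_elim
    case (elim \<tau>)
    show ?case
    proof
      assume \<tau>: "\<tau> \<in> {s<..<t}"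
      then have "AE x in M. K (\<tau>, x) = k \<tau> x \<and> vc \<tau> x = v \<tau> x \<and> (vc \<tau> x > 0 \<longrightarrow> frc s t (\<tau>, x) = force \<Omega> H v \<tau> x)" using elim by blast
      then show "AE x in M. ennreal (\<bar>k \<tau> x\<bar> powr ((\<alpha> + 1) / \<alpha>)) / ennreal (m (v \<tau> x) powr (1 / \<alpha>)) = ennreal (A s t (\<tau>, x))"
        using AE_space
      proof eventually_elim
        case (elim x)
        then have "m (vc \<tau> x) > 0" using \<tau> by (intro m(2) pos_slice) (auto simp: space_MI)
        then show ?case using elim \<tau> unfolding A_def by (simp add: qa divide_ennreal)
      qed
    qed
  qed
qed

lemma force_dissipation_eq: "force_dissipation \<Omega> \<alpha> m H v s t = ennreal (\<integral>z. B s t z \<partial>L.P)"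
  unfolding force_dissipation_def
proof (rule dissipation_joint[OF B_props])
  show "B s t (\<tau>, x) = 0" if "\<tau> \<notin> {s<..<t}" for \<tau> x using frc_out[OF that] pq by (simp add: B_def)
  show "AE \<tau> in lborel. \<tau> \<in> {s<..<t} \<longrightarrow> (AE x in M. ennreal (m (v \<tau> x) * \<bar>force \<Omega> H v \<tau> x\<bar> powr (\<alpha> + 1)) = ennreal (B s t (\<tau>, x)))"
    using slices[OF st(1,3)]
  proof eventually_elim
    case (elim \<tau>)
    show ?case
    proof
      assume \<tau>: "\<tau> \<in> {s<..<t}"
      then have "AE x in M. K (\<tau>, x) = k \<tau> x \<and> vc \<tau> x = v \<tau> x \<and> (vc \<tau> x > 0 \<longrightarrow> frc s t (\<tau>, x) = force \<Omega> H v \<tau> x)" using elim by blast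
      then show "AE x in M. ennreal (m (v \<tau> x) * \<bar>force \<Omega> H v \<tau> x\<bar> powr (\<alpha> + 1)) = ennreal (B s t (\<tau>, x))"
        using AE_space
      proof eventually_elim
        case (elim x)
        then have "vc \<tau> x > 0" using \<tau> by (intro pos_slice) (auto simp: space_MI)
        then show ?case using elim unfolding B_def by (simp add: pa)
      qed
    qed
  qed
qed

lemma gap_props:
  assumes z: "z \<in> space L.P"
  shows "gap s t z \<ge> 0" "gap s t z = 0 \<longleftrightarrow> (fst z \<in> {s<..<t} \<longrightarrow> K z = Jr s t z)"
proof -
  have "gap s t z \<ge> 0 \<and> (gap s t z = 0 \<longleftrightarrow> (fst z \<in> {s<..<t} \<longrightarrow> K z = Jr s t z))"
  proof (cases "fst z \<in> {s<..<t}")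
    case True
    then have \<mu>: "m (vc (fst z) (snd z)) > 0" using z by (intro m(2) pos_slice) (auto simp: space_pair_MI)
    have g: "gap s t z = \<alpha> / (\<alpha> + 1) * (\<bar>K z\<bar> powr ((\<alpha> + 1) / \<alpha>) / m (vc (fst z) (snd z)) powr (1 / \<alpha>))
      + 1 / (\<alpha> + 1) * (m (vc (fst z) (snd z)) * \<bar>frc s t z\<bar> powr (\<alpha> + 1)) - frc s t z * K z"
      using True unfolding gap_def A_def B_def by (simp add: pa qa)
    show ?thesis unfolding g using Young_mobility[OF \<alpha> \<mu>, of "frc s t z" "K z"] Young_mobility_eq[OF \<alpha> \<mu>, of "K z" "frc s t z"] True
      by (auto simp: Jr_def)
  next
    case False
    then have "gap s t z = 0" using frc_out[OF False, of "snd z"] pq by (simp add: gap_def A_def B_def)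
    then show ?thesis using False by auto
  qed
  then show "gap s t z \<ge> 0" "gap s t z = 0 \<longleftrightarrow> (fst z \<in> {s<..<t} \<longrightarrow> K z = Jr s t z)" by blast+
qed

lemma gap_integrable: "integrable L.P (gap s t)"
  unfolding gap_def[abs_def]
  by (intro Bochner_Integration.integrable_diff Bochner_Integration.integrable_add integrable_mult_right A_props(1) B_props(1) energy_identity(3)[OF P st])

text \<open>A nonnegative integrand with integral 0 vanishes almost everywhere, and
  \<open>slices\<close> translates equality of the joint versions into equality of k and J.\<close>

lemma gap_zero: "(\<integral>z. gap s t z \<partial>L.P) = 0 \<longleftrightarrow> (AE \<tau> in lborel. \<tau> \<in> {s<..<t} \<longrightarrow> (AE x in M. k \<tau> x = J \<tau> x))"
proof -
  have "(\<integral>z. gap s t z \<partial>L.P) = 0 \<longleftrightarrow> (AE z in L.P. gap s t z = 0)"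
    by (rule integral_nonneg_eq_0_iff_AE[OF gap_integrable]) (use gap_props(1) in \<open>intro AE_I2\<close>)
  also have "\<dots> \<longleftrightarrow> (AE \<tau> in lborel. AE x in M. gap s t (\<tau>, x) = 0)"
  proof -
    have [measurable]: "gap s t \<in> borel_measurable L.P" by (rule borel_measurable_integrable[OF gap_integrable])
    have "{z \<in> space L.P. gap s t z = 0} \<in> sets L.P" by measurable
    then show ?thesis using L.P.AE_pair_iff[of "\<lambda>\<tau> x. gap s t (\<tau>, x) = 0"] by simp
  qed
  also have "\<dots> \<longleftrightarrow> (AE \<tau> in lborel. \<tau> \<in> {s<..<t} \<longrightarrow> (AE x in M. k \<tau> x = J \<tau> x))"
  proof (rule AE_iff_cong)
    show "AE \<tau> in lborel. (AE x in M. gap s t (\<tau>, x) = 0) \<longleftrightarrow> (\<tau> \<in> {s<..<t} \<longrightarrow> (AE x in M. k \<tau> x = J \<tau> x))"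
      using slices[OF st(1,3)] Jr_J
    proof eventually_elim
      case (elim \<tau>)
      have g: "gap s t (\<tau>, x) = 0 \<longleftrightarrow> (\<tau> \<in> {s<..<t} \<longrightarrow> K (\<tau>, x) = Jr s t (\<tau>, x))" if "x \<in> space M" for x
        using gap_props(2)[of "(\<tau>, x)"] that by (simp add: space_pair_measure)
      have "(AE x in M. gap s t (\<tau>, x) = 0) \<longleftrightarrow> (AE x in M. \<tau> \<in> {s<..<t} \<longrightarrow> K (\<tau>, x) = Jr s t (\<tau>, x))"
        by (rule AE_cong) (rule g)
      also have "\<dots> \<longleftrightarrow> (\<tau> \<in> {s<..<t} \<longrightarrow> (AE x in M. k \<tau> x = J \<tau> x))"
      proof (cases "\<tau> \<in> {s<..<t}")
        case True
        then have 1: "AE x in M. K (\<tau>, x) = k \<tau> x \<and> vc \<tau> x = v \<tau> x \<and> (vc \<tau> x > 0 \<longrightarrow> frc s t (\<tau>, x) = force \<Omega> H v \<tau> x)"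
          and 2: "AE x in M. Jr s t (\<tau>, x) = J \<tau> x" using elim by blast+
        have "(AE x in M. K (\<tau>, x) = Jr s t (\<tau>, x)) \<longleftrightarrow> (AE x in M. k \<tau> x = J \<tau> x)"
          by (rule AE_iff_cong) (use 1 2 in \<open>eventually_elim, simp\<close>)
        then show ?thesis using True by simp
      qed auto
      finally show ?case .
    qed
  qed
  finally show ?thesis .
qed

text \<open>Written additively because energies and dissipations take values in [0, \<infinity>].
  Under positivity all terms are finite, so the identity transfers from the reals.\<close>

lemma energy_balance:
  "energy \<Omega> H (v t) + ennreal (\<alpha> / (\<alpha> + 1)) * flux_dissipation \<Omega> \<alpha> m v k s t
    + ennreal (1 / (\<alpha> + 1)) * force_dissipation \<Omega> \<alpha> m H v s t
   = energy \<Omega> H (v s) + ennreal (\<integral>z. gap s t z \<partial>L.P)"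
proof -
  have Pt: "Pos t t" and Ps: "Pos s s" using P st by (auto simp: Pos_def)
  have t0: "0 \<le> t" and s1: "s < T" using st by auto
  note et = energy_eq[OF t0 st(3) Pt] and es = energy_eq[OF st(1) s1 Ps]
  have A0: "0 \<le> (\<integral>z. A s t z \<partial>L.P)" by (rule integral_nonneg_AE) (use A_props(2) in \<open>intro AE_I2\<close>)
  have B0: "0 \<le> (\<integral>z. B s t z \<partial>L.P)" by (rule integral_nonneg_AE) (use B_props(2) in \<open>intro AE_I2\<close>)
  have g0: "0 \<le> (\<integral>z. gap s t z \<partial>L.P)" by (rule integral_nonneg_AE) (use gap_props(1) in \<open>intro AE_I2\<close>)
  have c: "0 \<le> \<alpha> / (\<alpha> + 1)" "0 \<le> 1 / (\<alpha> + 1)" using \<alpha> by auto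
  have "(\<integral>z. gap s t z \<partial>L.P) = \<alpha> / (\<alpha> + 1) * (\<integral>z. A s t z \<partial>L.P) + 1 / (\<alpha> + 1) * (\<integral>z. B s t z \<partial>L.P) - (\<integral>z. frc s t z * K z \<partial>L.P)"
    unfolding gap_def[abs_def]
    by (simp only: Bochner_Integration.integral_diff Bochner_Integration.integral_add integrable_mult_right Bochner_Integration.integrable_add
      integral_mult_right_zero A_props(1) B_props(1) energy_identity(3)[OF P st])
  then have "En t + \<alpha> / (\<alpha> + 1) * (\<integral>z. A s t z \<partial>L.P) + 1 / (\<alpha> + 1) * (\<integral>z. B s t z \<partial>L.P) = En s + (\<integral>z. gap s t z \<partial>L.P)"
    using energy_identity(4)[OF P st] by simp
  then show ?thesis
    unfolding et(1) es(1) flux_dissipation_eq force_dissipation_eq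
    using et(2) es(2) A0 B0 g0 c by (simp only: ennreal_mult[symmetric] ennreal_plus[symmetric] mult_nonneg_nonneg add_nonneg_nonneg)
qed

end

end

section \<open>Propagation of positivity\<close>

text \<open>The left-hand side of the dissipation inequality. It decreases in s
  (\<open>energy_budget_antimono\<close>), so a bound for the budget from s to t also serves for
  every later starting time r.\<close>

definition energy_budget ::
  "real set \<Rightarrow> real \<Rightarrow> (real \<Rightarrow> real) \<Rightarrow> (real \<Rightarrow> ennreal) \<Rightarrow> (real \<Rightarrow> real \<Rightarrow> real) \<Rightarrow> (real \<Rightarrow> real \<Rightarrow> real) \<Rightarrow> real \<Rightarrow> real \<Rightarrow> ennreal" where
  "energy_budget S \<alpha> m H v k s t = energy S H (v t) + ennreal (\<alpha> / (\<alpha> + 1)) * flux_dissipation S \<alpha> m v k s t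
    + ennreal (1 / (\<alpha> + 1)) * force_dissipation S \<alpha> m H v s t"

lemma energy_budget_antimono:
  assumes "s \<le> r" shows "energy_budget S \<alpha> m H v k r t \<le> energy_budget S \<alpha> m H v k s t"
proof -
  have "flux_dissipation S \<alpha> m v k r t \<le> flux_dissipation S \<alpha> m v k s t"
    "force_dissipation S \<alpha> m H v r t \<le> force_dissipation S \<alpha> m H v s t"
    unfolding flux_dissipation_def force_dissipation_def
    by (rule nn_integral_mono, rule mult_left_mono, use assms in \<open>auto split: split_indicator\<close>)+
  then show ?thesis unfolding energy_budget_def by (intro add_mono mult_left_mono) auto
qed

context tfe
begin

abbreviation "EB \<equiv> energy_budget \<Omega> \<alpha> m H v k"

lemma budget_balance:
  assumes "Pos s t" "0 \<le> s" "s < t" "t < T"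
  shows "EB s t = energy \<Omega> H (v s) + ennreal (\<integral>z. gap s t z \<partial>L.P)"
  unfolding energy_budget_def by (rule energy_balance[OF assms])

lemma gap_integral_nonneg:
  assumes "Pos s t" "0 \<le> s" "s < t" "t < T" shows "0 \<le> (\<integral>z. gap s t z \<partial>L.P)"
  by (rule integral_nonneg_AE) (use gap_props(1)[OF assms] in \<open>intro AE_I2\<close>)

lemma Pos_backward:
  assumes st: "0 \<le> s" "s < t" "t < T" and fin: "EB s t < \<infinity>"
  shows "Pos s t"
proof -
  obtain C where C: "C \<ge> 0" "EB s t = ennreal C" using fin by (cases "EB s t") auto
  obtain \<delta> where \<delta>: "\<delta> > 0" "\<And>t x. \<lbrakk>0 \<le> t; t < T; energy \<Omega> H (v t) \<le> ennreal C; x \<in> {a..b}\<rbrakk> \<Longrightarrow> \<delta> \<le> vc t x"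
    by (rule energy_lower[OF C(1), OF that])
  have et: "energy \<Omega> H (v t) \<le> ennreal C"
    unfolding C(2)[symmetric] energy_budget_def add.assoc by simp
  have base: "\<delta> \<le> vc t x" if "x \<in> {a..b}" for x using st that et by (intro \<delta>(2)) auto
  \<comment> \<open>\<open>continuation\<close> moves forward in time, so it is applied to the
    time-reversed function on [-t, -s].\<close>
  have cont: "continuous_on ({-t..-s} \<times> {a..b}) (\<lambda>z. vc (- fst z) (snd z))"
  proof -
    have c: "continuous_on ({-t..-s} \<times> {a..b}) (\<lambda>z. (- fst z, snd z))" by (intro continuous_intros)
    have "(\<lambda>z. (- fst z, snd z)) ` ({-t..-s} \<times> {a..b}) \<subseteq> {0..<T} \<times> {a..b}" using st by auto
    from continuous_on_compose2[OF vc_continuous c this] show ?thesis by simp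
  qed
  have "vc (- \<tau>) x > 0" if \<tau>: "\<tau> \<in> {-t..-s}" "x \<in> {a..b}" for \<tau> x
  proof (rule continuation[OF cont \<delta>(1) _ _ \<tau>])
    show "\<delta> \<le> vc (- (- t)) x" if "x \<in> {a..b}" for x using base[OF that] by simp
    fix r x assume r: "r \<in> {-t..-s}" and pos: "\<And>\<rho> y. \<rho> \<in> {-t..r} \<Longrightarrow> y \<in> {a..b} \<Longrightarrow> vc (- \<rho>) y > 0" and x: "x \<in> {a..b}"
    show "\<delta> \<le> vc (- r) x"
    \<comment> \<open>The balance is stated for intervals of positive length; at the starting time
      the base estimate is used instead.\<close>
    proof (cases "- r = t")
      case True
      then show ?thesis using base x by simp
    next
      case False
      then have r': "0 \<le> - r" "- r < t" "- r < T" "s \<le> - r" using r st by auto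
      have P: "Pos (- r) t" unfolding Pos_def
      proof (intro ballI)
        fix \<rho> y assume "\<rho> \<in> {- r..t}" "y \<in> {a..b}"
        then show "vc \<rho> y > 0" using pos[of "- \<rho>" y] by simp
      qed
      have "energy \<Omega> H (v (- r)) \<le> EB (- r) t" unfolding budget_balance[OF P r'(1,2) st(3)] by simp
      also have "\<dots> \<le> ennreal C" unfolding C(2)[symmetric] by (rule energy_budget_antimono[OF r'(4)])
      finally show ?thesis by (rule \<delta>(2)[OF r'(1,3) _ x])
    qed
  qed
  note pos = this
  show ?thesis unfolding Pos_def
  proof (intro ballI)
    fix \<tau> x assume "\<tau> \<in> {s..t}" "x \<in> {a..b}"
    then show "vc \<tau> x > 0" using pos[of "- \<tau>" x] by simp
  qed
qed

lemma budget_ge: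
  assumes st: "0 \<le> s" "s < t" "t < T" shows "energy \<Omega> H (v s) \<le> EB s t"
proof (cases "EB s t < \<infinity>")
  case True
  show ?thesis unfolding budget_balance[OF Pos_backward[OF st True] st] by simp
next
  case False
  then show ?thesis by (simp add: not_less top_unique)
qed

text \<open>The budget equals a finite energy, hence is finite and forces positivity. Finiteness
  also allows cancellation in [0, \<infinity>], which isolates the integral of the gap.\<close>

lemma flux_eq_of_budget_eq:
  assumes st: "0 \<le> s" "s < t" "t < T" and eq: "EB s t = energy \<Omega> H (v s)" and fin: "energy \<Omega> H (v s) < \<infinity>"
  shows "AE \<tau> in lborel. \<tau> \<in> {s<..<t} \<longrightarrow> (AE x in M. k \<tau> x = J \<tau> x)"
proof -
  have P: "Pos s t" by (rule Pos_backward[OF st]) (unfold eq, rule fin)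
  have "energy \<Omega> H (v s) + ennreal (\<integral>z. gap s t z \<partial>L.P) = energy \<Omega> H (v s) + 0"
    using budget_balance[OF P st] eq by simp
  then have "ennreal (\<integral>z. gap s t z \<partial>L.P) = 0" using fin by (auto simp: ennreal_add_left_cancel)
  then have "(\<integral>z. gap s t z \<partial>L.P) = 0" using gap_integral_nonneg[OF P st] by (simp add: ennreal_eq_0_iff)
  then show ?thesis using gap_zero[OF P st] by blast
qed

lemma budget_eq_of_flux_eq:
  assumes P: "Pos s t" and st: "0 \<le> s" "s < t" "t < T"
    and kJ: "AE \<tau> in lborel. \<tau> \<in> {s<..<t} \<longrightarrow> (AE x in M. k \<tau> x = J \<tau> x)"
  shows "EB s t = energy \<Omega> H (v s)"
  using budget_balance[OF P st] gap_zero[OF P st] kJ by simp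

section \<open>Forward propagation for weak solutions\<close>

lemma weak_solution_flux:
  assumes P: "Pos 0 r" and r: "0 < r" "r < T"
    and vt: "\<And>T. T > 0 \<Longrightarrow> AE t in MI 0 T. vt t \<in> dual_space (sobolev 1 p \<Omega>) N"
    and k: "weak_continuity_eq p \<Omega> vt k" and J: "weak_continuity_eq p \<Omega> vt J"
  shows "AE \<tau> in lborel. \<tau> \<in> {0<..<r} \<longrightarrow> (AE x in M. k \<tau> x = J \<tau> x)"
proof -
  note Jp = Jr_props[OF P order_refl r]
  note [measurable] = K(1)
  have q0: "q > 0" using pq by simp
  have Km: "(\<lambda>z. indicator {0<..<r} (fst z) * K z) \<in> borel_measurable L.P" by measurable
  have Ki: "integrable L.P (\<lambda>z. \<bar>indicator {0<..<r} (fst z) * K z\<bar> powr q)"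
  proof (rule Bochner_Integration.integrable_bound[OF K(2)])
    show "(\<lambda>z. \<bar>indicator {0<..<r} (fst z) * K z\<bar> powr q) \<in> borel_measurable L.P" by measurable
    show "AE z in L.P. norm (\<bar>indicator {0<..<r} (fst z) * K z\<bar> powr q) \<le> norm (\<bar>K z\<bar> powr q)"
      by (intro AE_I2) (auto split: split_indicator)
  qed
  have K0: "indicator {0<..<r} (fst (t, x)) * K (t, x) = 0" if "t \<notin> {0<..<r}" for t x using that by simp
  have Kk: "AE t in lborel. t \<in> {0<..<r} \<longrightarrow> (AE x in M. indicator {0<..<r} (fst (t, x)) * K (t, x) = k t x)"
    using kK by eventually_elim (use r in auto)
  show ?thesis
    by (rule weak_flux_unique[OF ab pq vt k J Km Ki K0 Kk Jp(1,2) Jp(3) Jr_J[OF P order_refl r]])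
qed

text \<open>L_q integrability of J, and with it the identification of k and J, is available on
  intervals of positivity. It is therefore derived anew on (0, r) inside
  \<open>continuation\<close>, where it makes the energy at r at most the initial one and so
  restores the bound \<delta>.\<close>

lemma Pos_forward:
  assumes t: "0 < t" "t < T" and fin: "energy \<Omega> H (v 0) < \<infinity>"
    and vt: "\<And>T. T > 0 \<Longrightarrow> AE t in MI 0 T. vt t \<in> dual_space (sobolev 1 p \<Omega>) N"
    and k: "weak_continuity_eq p \<Omega> vt k" and J: "weak_continuity_eq p \<Omega> vt J"
  shows "Pos 0 t"
proof -
  obtain C where C: "C \<ge> 0" "energy \<Omega> H (v 0) = ennreal C" using fin by (cases "energy \<Omega> H (v 0)") auto
  obtain \<delta> where \<delta>: "\<delta> > 0" "\<And>t x. \<lbrakk>0 \<le> t; t < T; energy \<Omega> H (v t) \<le> ennreal C; x \<in> {a..b}\<rbrakk> \<Longrightarrow> \<delta> \<le> vc t x"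
    by (rule energy_lower[OF C(1), OF that])
  have base: "\<delta> \<le> vc 0 x" if "x \<in> {a..b}" for x using t that C(2) by (intro \<delta>(2)) auto
  have cont: "continuous_on ({0..t} \<times> {a..b}) (\<lambda>z. vc (fst z) (snd z))"
    by (rule continuous_on_subset[OF vc_continuous]) (use t in auto)
  show ?thesis unfolding Pos_def
  proof (intro ballI)
    fix \<tau> x assume \<tau>: "\<tau> \<in> {0..t}" "x \<in> {a..b}"
    show "vc \<tau> x > 0"
    proof (rule continuation[OF cont \<delta>(1) _ base \<tau>])
      fix r x assume r: "r \<in> {0..t}" and pos: "\<And>\<rho> y. \<rho> \<in> {0..r} \<Longrightarrow> y \<in> {a..b} \<Longrightarrow> vc \<rho> y > 0" and x: "x \<in> {a..b}"
      show "\<delta> \<le> vc r x"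
      proof (cases "r = 0")
        case True
        then show ?thesis using base x by simp
      next
        case False
        then have r': "0 < r" "0 \<le> r" "r < T" using r t by auto
        have P: "Pos 0 r" using pos by (auto simp: Pos_def)
        have "energy \<Omega> H (v r) \<le> EB 0 r" unfolding energy_budget_def add.assoc by simp
        also have "\<dots> = ennreal C" unfolding C(2)[symmetric]
          by (rule budget_eq_of_flux_eq[OF P order_refl r'(1,3) weak_solution_flux[OF P r'(1,3) vt k J]])
        finally show ?thesis by (rule \<delta>(2)[OF r'(2,3) _ x])
      qed
    qed
  qed
qed

end

section \<open>The main result\<close>

lemma strongly_measurable_AE_mem: "strongly_measurable I X N u \<Longrightarrow> AE t in lebesgue_on I. u t \<in> X"
  unfolding strongly_measurable_def by (auto elim: eventually_mono)

text \<open>By Tonelli: the L_p norm of a derivative at time t is at most the Sobolev norm of v t,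
  whose p-th power is integrable in time by the Bochner condition.\<close>

lemma bochner_wderiv_joint:
  assumes p: "p \<ge> 1" and X: "X \<subseteq> sobolev n p {a<..<b}" and j: "j \<le> n"
    and v: "v \<in> bochner_Lp p {0<..<T} X (sobolev_norm n p {a<..<b})"
  obtains U where "U \<in> borel_measurable (lborel \<Otimes>\<^sub>M MI a b)" "integrable (lborel \<Otimes>\<^sub>M MI a b) (\<lambda>z. \<bar>U z\<bar> powr p)"
    "\<And>t x. t \<notin> {0<..<T} \<Longrightarrow> U (t, x) = 0"
    "AE t in lborel. t \<in> {0<..<T} \<longrightarrow> (AE x in MI a b. U (t, x) = wderiv {a<..<b} j (v t) x)"
proof -
  let ?N = "sobolev_norm n p {a<..<b}" and ?M = "MI a b" and ?w = "\<lambda>t. wderiv {a<..<b} j (v t)"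
  have sm: "strongly_measurable {0<..<T} X ?N v" and Ni: "integrable (MI 0 T) (\<lambda>t. ?N (v t) powr p)"
    using v by (auto simp: bochner_Lp_def)
  obtain U where U: "U \<in> borel_measurable (lborel \<Otimes>\<^sub>M ?M)"
    "AE t in lborel. t \<in> {0<..<T} \<longrightarrow> (AE x in ?M. U (t, x) = ?w t x)"
    by (rule joint_wderiv_measurable[OF p X j sm, OF that])
  note [measurable] = U(1)
  define V where "V z = indicator {0<..<T} (fst z) * U z" for z
  have Vm[measurable]: "V \<in> borel_measurable (lborel \<Otimes>\<^sub>M ?M)" unfolding V_def[abs_def] by measurable
  have "AE t in lborel. t \<in> {0<..<T} \<longrightarrow> v t \<in> X"
    using strongly_measurable_AE_mem[OF sm] unfolding AE_lborel_MI .
  with U(2) have le: "AE t in lborel. (\<integral>\<^sup>+x. ennreal (\<bar>V (t, x)\<bar> powr p) \<partial>?M) \<le> indicator {0<..<T} t * ennreal (?N (v t) powr p)"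
  proof eventually_elim
    case (elim t)
    show ?case
    proof (cases "t \<in> {0<..<T}")
      case True
      then have s: "v t \<in> sobolev n p {a<..<b}" and ae: "AE x in ?M. U (t, x) = ?w t x" using elim X by blast+
      have "(\<integral>\<^sup>+x. ennreal (\<bar>V (t, x)\<bar> powr p) \<partial>?M) = (\<integral>\<^sup>+x. ennreal (\<bar>?w t x\<bar> powr p) \<partial>?M)"
        by (rule nn_integral_cong_AE) (use ae in \<open>eventually_elim, use True in \<open>simp add: V_def\<close>\<close>)
      also have "\<dots> = ennreal (\<integral>x. \<bar>?w t x\<bar> powr p \<partial>?M)"
        by (rule nn_integral_eq_integral[OF sobolev_wderiv(3)[OF s j]]) simp
      also have "\<dots> \<le> ennreal (?N (v t) powr p)" using p j by (intro ennreal_leI sobolev_norm_wderiv_le) auto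
      finally show ?thesis using True by simp
    qed (use p in \<open>simp add: V_def\<close>)
  qed
  have Vi: "integrable (lborel \<Otimes>\<^sub>M ?M) (\<lambda>z. \<bar>V z\<bar> powr p)"
  proof (rule integrableI_bounded)
    have m: "(\<lambda>z. ennreal (\<bar>V z\<bar> powr p)) \<in> borel_measurable (lborel \<Otimes>\<^sub>M ?M)" by measurable
    have "(\<integral>\<^sup>+z. ennreal (norm (\<bar>V z\<bar> powr p)) \<partial>(lborel \<Otimes>\<^sub>M ?M)) = (\<integral>\<^sup>+t. (\<integral>\<^sup>+x. ennreal (\<bar>V (t, x)\<bar> powr p) \<partial>?M) \<partial>lborel)"
      using sigma_finite_measure.nn_integral_fst[OF sigma_finite_MI m] by simp
    also have "\<dots> \<le> (\<integral>\<^sup>+t. indicator {0<..<T} t * ennreal (?N (v t) powr p) \<partial>lborel)" by (rule nn_integral_mono_AE[OF le])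
    also have "\<dots> = (\<integral>\<^sup>+t. ennreal (?N (v t) powr p) \<partial>MI 0 T)" by (simp add: nn_integral_MI_lborel)
    also have "\<dots> < \<infinity>" using Ni unfolding integrable_iff_bounded by simp
    finally show "(\<integral>\<^sup>+z. ennreal (norm (\<bar>V z\<bar> powr p)) \<partial>(lborel \<Otimes>\<^sub>M ?M)) < \<infinity>" .
  qed measurable
  show thesis
  proof (rule that[OF Vm Vi])
    show "V (t, x) = 0" if "t \<notin> {0<..<T}" for t x using that by (simp add: V_def)
    show "AE t in lborel. t \<in> {0<..<T} \<longrightarrow> (AE x in ?M. V (t, x) = ?w t x)"
      using U(2) by eventually_elim (auto simp: V_def)
  qed
qed

lemma mobility_continuous: assumes "mobility m" shows "continuous_on UNIV m"
proof (rule continuous_at_imp_continuous_on, intro ballI)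
  fix s
  obtain r L where r: "r > 0" "L-lipschitz_on (cball s r) m" using assms unfolding mobility_def by blast
  have "s \<in> interior (cball s r)" using r(1) by (simp add: interior_cball)
  then show "isCont m s" by (rule continuous_on_interior[OF lipschitz_on_continuous_on[OF r(2)]])
qed

lemma C2_on_posE:
  assumes "C2_on_pos H" and conv: "convex_on {0<..} (\<lambda>s. enn2real (H s))"
  defines "h \<equiv> \<lambda>s. enn2real (H s)"
  shows "s > 0 \<Longrightarrow> H s = ennreal (h s)" "s > 0 \<Longrightarrow> (h has_real_derivative deriv h s) (at s)"
    "s > 0 \<Longrightarrow> (deriv h has_real_derivative dd H s) (at s)" "continuous_on {0<..} (dd H)"
    "s > 0 \<Longrightarrow> r > 0 \<Longrightarrow> h r - h s \<ge> deriv h s * (r - s)"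
proof -
  have C: "\<And>s. s > 0 \<Longrightarrow> H s < \<infinity>" "\<And>s. s > 0 \<Longrightarrow> h differentiable (at s)"
    "\<And>s. s > 0 \<Longrightarrow> deriv h differentiable (at s)" "continuous_on {0<..} (deriv (deriv h))"
    using assms(1) unfolding C2_on_pos_def Let_def h_def by blast+
  show "s > 0 \<Longrightarrow> H s = ennreal (h s)" using C(1) by (simp add: h_def)
  show d: "(h has_real_derivative deriv h s) (at s)" if "s > 0" for s
    using C(2)[OF that] by (simp add: DERIV_deriv_iff_real_differentiable)
  show "(deriv h has_real_derivative dd H s) (at s)" if "s > 0"
    using C(3)[OF that] unfolding dd_def h_def[symmetric] by (simp add: DERIV_deriv_iff_real_differentiable)
  show "continuous_on {0<..} (dd H)" using C(4) unfolding dd_def h_def[symmetric] .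
  show "h r - h s \<ge> deriv h s * (r - s)" if "s > 0" "r > 0"
  proof (rule convex_on_imp_above_tangent[of "{0<..}"])
    show "convex_on {0<..} h" using conv unfolding h_def .
    show "(h has_real_derivative deriv h s) (at s within {0<..})" by (rule has_field_derivative_at_within[OF d[OF that(1)]])
  qed (use that in \<open>auto simp: interior_open\<close>)
qed

theorem proposition2p12:
  fixes a b \<alpha> \<sigma> :: real
    and \<Omega> :: "real set"
    and m :: "real \<Rightarrow> real"
    and G G\<sigma> :: "real \<Rightarrow> ennreal"
    and v k :: "real \<Rightarrow> real \<Rightarrow> real"
    and vt :: "real \<Rightarrow> (real \<Rightarrow> real) \<Rightarrow> real"
  assumes "a < b" and "\<Omega> = {a<..<b}"
    and "\<alpha> > 0" and "0 < \<sigma>" and "\<sigma> < 1"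
    and "mobility m" and "potential G" and "modified_potential \<sigma> G G\<sigma>"
    and "v \<in> bochner_Lp_loc (\<alpha> + 1) (sobolev3_B (\<alpha> + 1) \<Omega>) (sobolev_norm 3 (\<alpha> + 1) \<Omega>)"
    and "k \<in> Lp_loc_time ((\<alpha> + 1) / \<alpha>) \<Omega>"
    and "vt \<in> bochner_Lp_loc ((\<alpha> + 1) / \<alpha>)
               (dual_space (sobolev 1 (\<alpha> + 1) \<Omega>) (sobolev_norm 1 (\<alpha> + 1) \<Omega>))
               (dual_norm (sobolev 1 (\<alpha> + 1) \<Omega>) (sobolev_norm 1 (\<alpha> + 1) \<Omega>))"
    and "has_weak_time_deriv (\<alpha> + 1) \<Omega> v vt"
    and "L2_continuous \<Omega> v"
    and "weak_continuity_eq (\<alpha> + 1) \<Omega> vt k"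
  shows "(\<forall>s t. 0 \<le> s \<and> s < t \<longrightarrow>
            energy \<Omega> G\<sigma> (v t)
            + ennreal (\<alpha> / (\<alpha> + 1)) * flux_dissipation \<Omega> \<alpha> m v k s t
            + ennreal (1 / (\<alpha> + 1)) * force_dissipation \<Omega> \<alpha> m G\<sigma> v s t
            \<ge> energy \<Omega> G\<sigma> (v s)) \<and>
         (energy \<Omega> G\<sigma> (v 0) < \<infinity> \<longrightarrow>
            ((\<forall>s t. 0 \<le> s \<and> s < t \<longrightarrow>
                energy \<Omega> G\<sigma> (v t)
                + ennreal (\<alpha> / (\<alpha> + 1)) * flux_dissipation \<Omega> \<alpha> m v k s t
                + ennreal (1 / (\<alpha> + 1)) * force_dissipation \<Omega> \<alpha> m G\<sigma> v s t
                = energy \<Omega> G\<sigma> (v s))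
             \<longleftrightarrow> weak_solution_mtfe \<Omega> \<alpha> m G\<sigma> v vt))"
proof -
  let ?p = "\<alpha> + 1" and ?q = "(\<alpha> + 1) / \<alpha>"
  define h where "h s = enn2real (G\<sigma> s)" for s
  note ab = assms(1) and \<Omega> = assms(2) and \<alpha> = assms(3)
  note v = assms(9)[unfolded \<Omega>] and k = assms(10)[unfolded \<Omega>] and vtB = assms(11)[unfolded \<Omega>]
    and wt = assms(12)[unfolded \<Omega>] and L2 = assms(13)[unfolded \<Omega>] and ce = assms(14)[unfolded \<Omega>]
  have pq: "1 < ?p" "1 < ?q" "1 / ?p + 1 / ?q = 1" using \<alpha> by (auto simp: field_simps)
  have G: "C2_on_pos G\<sigma>" "convex_on {0<..} (\<lambda>s. enn2real (G\<sigma> s))" "\<And>s. s < 0 \<Longrightarrow> G\<sigma> s = \<infinity>"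
    using assms(8) unfolding modified_potential_def by blast+
  obtain c where c: "c > 0" "\<And>s. 0 \<le> s \<Longrightarrow> s \<le> \<sigma> \<Longrightarrow> ennreal c / (ennreal s)\<^sup>2 \<le> G\<sigma> s"
    using assms(8) unfolding modified_potential_def by blast
  note H = C2_on_posE[OF G(1,2), folded h_def[abs_def]]
  have m: "continuous_on UNIV m" "\<And>s. s > 0 \<Longrightarrow> m s > 0"
    using mobility_continuous[OF assms(6)] assms(6) unfolding mobility_def by blast+
  have vt: "AE t in MI 0 T. vt t \<in> dual_space (sobolev 1 ?p {a<..<b}) (sobolev_norm 1 ?p {a<..<b})" if "T > 0" for T
    using vtB that unfolding bochner_Lp_loc_def bochner_Lp_def by (blast intro: strongly_measurable_AE_mem)
  \<comment> \<open>Joint representatives are built for each horizon T separately and need not be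
    compatible: the conclusions drawn from the locale do not mention them.\<close>
  have tfe: "\<exists>U1 U3 K. tfe a b ?p ?q T v U1 U3 K h (deriv h) (dd G\<sigma>) \<alpha> c \<sigma> m G\<sigma> k" if T: "T > 0" for T
  proof -
    have p1: "?p \<ge> 1" using \<alpha> by simp
    have X: "sobolev3_B ?p {a<..<b} \<subseteq> sobolev 3 ?p {a<..<b}" by (auto simp: sobolev3_B_def)
    have vT: "v \<in> bochner_Lp ?p {0<..<T} (sobolev3_B ?p {a<..<b}) (sobolev_norm 3 ?p {a<..<b})"
      using v T unfolding bochner_Lp_loc_def by blast
    obtain U1 where U1: "U1 \<in> borel_measurable (lborel \<Otimes>\<^sub>M MI a b)" "integrable (lborel \<Otimes>\<^sub>M MI a b) (\<lambda>z. \<bar>U1 z\<bar> powr ?p)"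
      "\<And>t x. t \<notin> {0<..<T} \<Longrightarrow> U1 (t, x) = 0"
      "AE t in lborel. t \<in> {0<..<T} \<longrightarrow> (AE x in MI a b. U1 (t, x) = wderiv {a<..<b} 1 (v t) x)"
      by (rule bochner_wderiv_joint[OF p1 X _ vT, of 1]) auto
    obtain U3 where U3: "U3 \<in> borel_measurable (lborel \<Otimes>\<^sub>M MI a b)" "integrable (lborel \<Otimes>\<^sub>M MI a b) (\<lambda>z. \<bar>U3 z\<bar> powr ?p)"
      "\<And>t x. t \<notin> {0<..<T} \<Longrightarrow> U3 (t, x) = 0"
      "AE t in lborel. t \<in> {0<..<T} \<longrightarrow> (AE x in MI a b. U3 (t, x) = wderiv {a<..<b} 3 (v t) x)"
      by (rule bochner_wderiv_joint[OF p1 X _ vT, of 3]) auto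
    obtain K where K: "K \<in> borel_measurable (lborel \<Otimes>\<^sub>M MI a b)" "integrable (lborel \<Otimes>\<^sub>M MI a b) (\<lambda>z. \<bar>K z\<bar> powr ?q)"
      "AE t in lborel. t \<in> {0<..<T} \<longrightarrow> (AE x in MI a b. K (t, x) = k t x)" "\<And>t x. t \<notin> {0<..<T} \<Longrightarrow> K (t, x) = 0"
      by (rule Lp_loc_time_joint[OF k T, OF that])
    have "AE t in lborel. t \<in> {0<..<T} \<longrightarrow> v t \<in> sobolev3_B ?p {a<..<b}"
      using vT strongly_measurable_AE_mem unfolding bochner_Lp_def AE_lborel_MI[symmetric] by blast
    with U1(4) U3(4) have vB: "AE t in lborel. t \<in> {0<..<T} \<longrightarrow> v t \<in> sobolev3_B ?p {a<..<b} \<and>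
      (AE x in MI a b. U1 (t, x) = wderiv {a<..<b} 1 (v t) x) \<and> (AE x in MI a b. U3 (t, x) = wderiv {a<..<b} 3 (v t) x)"
      by eventually_elim blast
    have "flow a b ?p ?q T v U1 U3 K"
    proof (rule flow.intro[OF ab T pq L2 U1(1,2) U1(3) U3(1,2) U3(3) K(1,2) K(4) vB])
      fix \<psi> s t assume "\<psi> \<in> sobolev 1 ?p {a<..<b}" "0 \<le> s" "s \<le> t" "t \<le> T"
      then show "(\<integral>x. v t x * \<psi> x \<partial>MI a b) - (\<integral>x. v s x * \<psi> x \<partial>MI a b)
        = (\<integral>\<tau>. indicator {s<..t} \<tau> * (\<integral>x. K (\<tau>, x) * wderiv {a<..<b} 1 \<psi> x \<partial>MI a b) \<partial>lborel)"
        using continuity_eq_integrated[OF ab pq k vt wt L2 ce K(1,2,3) K(4), of \<psi> s t] T by blast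
    qed
    then have "gflow a b ?p ?q T v U1 U3 K h (deriv h) (dd G\<sigma>)"
      by (rule gflow.intro) (unfold_locales, use H(2-5) in \<open>auto simp: h_def[symmetric]\<close>)
    then have "tfe a b ?p ?q T v U1 U3 K h (deriv h) (dd G\<sigma>) \<alpha> c \<sigma> m G\<sigma> k"
      by (rule tfe.intro) (unfold_locales, use \<alpha> m H(1) c assms(4) G(3) K(3) in \<open>auto simp: h_def\<close>)
    then show ?thesis by blast
  qed
  note EB = energy_budget_def[of \<Omega> \<alpha> m G\<sigma> v k, symmetric]
  show ?thesis unfolding EB
  proof (intro conjI impI allI)
    fix s t :: real assume st: "0 \<le> s \<and> s < t"
    \<comment> \<open>The flow is controlled on [0, T) only, so a horizon beyond t is taken.\<close>
    then have T: "t + 1 > 0" by simp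
    obtain U1 U3 K where "tfe a b ?p ?q (t + 1) v U1 U3 K h (deriv h) (dd G\<sigma>) \<alpha> c \<sigma> m G\<sigma> k" using tfe[OF T] by blast
    from tfe.budget_ge[OF this, of s t] show "energy_budget \<Omega> \<alpha> m G\<sigma> v k s t \<ge> energy \<Omega> G\<sigma> (v s)" using st by (simp add: \<Omega>)
  next
    assume fin: "energy \<Omega> G\<sigma> (v 0) < \<infinity>"
    let ?J = "\<lambda>t x. m (v t x) * Psi \<alpha> (force {a<..<b} G\<sigma> v t x)"
    show "(\<forall>s t. 0 \<le> s \<and> s < t \<longrightarrow> energy_budget \<Omega> \<alpha> m G\<sigma> v k s t = energy \<Omega> G\<sigma> (v s)) \<longleftrightarrow> weak_solution_mtfe \<Omega> \<alpha> m G\<sigma> v vt"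
    proof
      assume eq: "\<forall>s t. 0 \<le> s \<and> s < t \<longrightarrow> energy_budget \<Omega> \<alpha> m G\<sigma> v k s t = energy \<Omega> G\<sigma> (v s)"
      \<comment> \<open>The energy equality from 0 to T is used here, since the energy at 0 is known
        to be finite.\<close>
      have "AE t in MI 0 T. AE x in MI a b. k t x = ?J t x" if "T > 0" for T
      proof -
        have T1: "T + 1 > 0" using that by simp
        obtain U1 U3 K where I: "tfe a b ?p ?q (T + 1) v U1 U3 K h (deriv h) (dd G\<sigma>) \<alpha> c \<sigma> m G\<sigma> k" using tfe[OF T1] by blast
        show ?thesis unfolding AE_lborel_MI[of _ 0 T]
          using tfe.flux_eq_of_budget_eq[OF I order_refl that] eq fin that unfolding tfe.J_def[OF I] \<Omega> by simp
      qed
      then have "AE t in lebesgue. t > 0 \<longrightarrow> (AE x in MI a b. k t x = ?J t x)" by (rule AE_pos_of_AE_Ioo)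
      from weak_continuity_eq_cong[OF ce this] show "weak_solution_mtfe \<Omega> \<alpha> m G\<sigma> v vt"
        unfolding weak_solution_mtfe_def \<Omega> .
    next
      assume "weak_solution_mtfe \<Omega> \<alpha> m G\<sigma> v vt"
      then have J: "weak_continuity_eq ?p {a<..<b} vt ?J" unfolding weak_solution_mtfe_def \<Omega> .
      show "\<forall>s t. 0 \<le> s \<and> s < t \<longrightarrow> energy_budget \<Omega> \<alpha> m G\<sigma> v k s t = energy \<Omega> G\<sigma> (v s)"
      proof (intro allI impI)
        fix s t :: real assume st: "0 \<le> s \<and> s < t"
        then have T: "t + 1 > 0" "0 < t" by auto
        obtain U1 U3 K where "tfe a b ?p ?q (t + 1) v U1 U3 K h (deriv h) (dd G\<sigma>) \<alpha> c \<sigma> m G\<sigma> k" using tfe[OF T(1)] by blast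
        then interpret I: tfe a b ?p ?q "t + 1" v U1 U3 K h "deriv h" "dd G\<sigma>" \<alpha> c \<sigma> m G\<sigma> k .
        have J': "weak_continuity_eq ?p {a<..<b} vt I.J" using J by (simp add: I.J_def[abs_def])
        \<comment> \<open>Positivity and the identity of the fluxes are gained from time 0 on, where
          the energy is finite, and then restricted to the interval from s to t.\<close>
        have P: "I.Pos 0 t" by (rule I.Pos_forward[OF T(2) _ _ vt ce J']) (use fin \<Omega> in auto)
        have "AE \<tau> in lborel. \<tau> \<in> {0<..<t} \<longrightarrow> (AE x in MI a b. k \<tau> x = I.J \<tau> x)"
          by (rule I.weak_solution_flux[OF P T(2) _ vt ce J']) auto
        then have "AE \<tau> in lborel. \<tau> \<in> {s<..<t} \<longrightarrow> (AE x in MI a b. k \<tau> x = I.J \<tau> x)"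
          by eventually_elim (use st in auto)
        moreover have "I.Pos s t" using P st by (auto simp: I.Pos_def)
        ultimately have "energy_budget {a<..<b} \<alpha> m G\<sigma> v k s t = energy {a<..<b} G\<sigma> (v s)"
          using st by (intro I.budget_eq_of_flux_eq) auto
        then show "energy_budget \<Omega> \<alpha> m G\<sigma> v k s t = energy \<Omega> G\<sigma> (v s)" unfolding \<Omega> .
      qed
    qed
  qed
qed

end
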